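(* Let $\mathcal P,\mathcal Q$ be nonempty families of probability measures on $(\Omega_1,\mathcal A_1)$ and $(\Omega_2,\mathcal A_2)$, $P_0\otimes Q_0\in\mathcal P\otimes\mathcal Q$, and let $(n_1)_n,(n_2)_n\subset\mathbb N$ satisfy $n_1+n_2=n$ for all $n$ and $\lim_{n\to\infty}\frac{n_2}n=d\in(0,1)$. Let $H_d$ be the Hilbert space $T(P_0\otimes Q_0,\mathcal P\otimes\mathcal Q)$ with the scalar product $$\langle g_1\circ\pi_1+g_2\circ\pi_2,\ h_1\circ\pi_1+h_2\circ\pi_2\rangle_d=(1-d)\int g_1h_1\,dP_0+d\int g_2h_2\,dQ_0$$ ($g_1,h_1\in T(P_0,\mathcal P)$, $g_2,h_2\in T(Q_0,\mathcal Q)$). For each $g\in T(P_0\otimes Q_0,\mathcal P\otimes\mathcal Q)$ let $P_{n,g}:=P_{1/\sqrt n}^{n_1}\otimes Q_{1/\sqrt n}^{n_2}$, where $t\mapsto P_t\otimes Q_t$, $t\in\mathbb R$, is an $L_2(P_0\otimes Q_0)$-differentiable curve of product measures in $\mathcal M_1(\Omega_1,\mathcal A_1)\otimes\mathcal M_1(\Omega_2,\mathcal A_2)$ with tangent $g$, passing through $P_0\otimes Q_0$ at $t=0$ (one such curve being fixed for each $g$). Then the sequence of experiments $$E_{d,n}=\bigl(\Omega_1^{n_1}\times\Omega_2^{n_2},\ \mathcal A_1^{n_1}\otimes\mathcal A_2^{n_2},\ \{P_{n,g}:g\in T(P_0\otimes Q_0,\mathcal P\otimes\mathcal Q)\}\bigr)$$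 converges weakly to a Gaussian shift experiment $E_d=(\Omega,\mathcal A,\{P_h:h\in H_d\})$ on $H_d$, and is therefore locally asymptotically normal.
   Context: $\mathcal M_1(\Omega,\mathcal A)$ is the set of probability measures on $(\Omega,\mathcal A)$, and for families $\mathcal P,\mathcal Q$, $\mathcal P\otimes\mathcal Q=\{P\otimes Q:P\in\mathcal P,Q\in\mathcal Q\}$. $dP/dQ$ denotes the density quotient (a $[0,\infty]$-valued measurable $L$ with $P(A)=\int_AL\,dQ+P(A\cap\{L=\infty\})$, $Q(L<\infty)=1$). A curve $t\mapsto R_t$ defined on a neighbourhood of $0$ is $L_2(R_0)$-differentiable with tangent $g\in L_2(R_0)$ if $\|2((dR_t/dR_0)^{1/2}-1)-tg\|_{L_2(R_0)}=o(|t|)$ and $R_t(dR_t/dR_0=\infty)=o(t^2)$ as $t\to0$. The tangent cone $K(R,\mathcal R)$ of a family $\mathcal R$ at $R\in\mathcal R$ is the set of tangents of all such curves in $\mathcal R$ with $R_0=R$; the tangent space $T(R,\mathcal R)$ is the $L_2(R)$-closure of its linear span. Each $g\in T(P_0\otimes Q_0,\mathcal P\otimes\mathcal Q)$ has a unique representation $g=g_1\circ\pi_1+g_2\circ\pi_2$ with $g_1\in T(P_0,\mathcal P)$, $g_2\in T(Q_0,\mathcal Q)$. Curves as required always exist: e.g. $\frac{dP_t}{dP_0}=(1+\frac12tg_1)^2/\int(1+\frac12tg_1)^2dP_0$ and analogously for $Q_t$ with $g_2$. For a Hilbert space $H$, a standard Gaussian process is a linear map $L:H\to L_2(P_0)$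 on a probability space $(\Omega,\mathcal A,P_0)$ with $\mathcal L(L(h)\mid P_0)=N(0,\|h\|^2)$ for all $h$. An experiment $(\Omega,\mathcal A,\{P_h:h\in H\})$ is a Gaussian shift on $H$ if $\frac{dP_h}{dP_0}=\exp(L(h)-\frac12\|h\|^2)$ for all $h\in H$ with a standard Gaussian process $L:H\to L_2(P_0)$. A sequence of experiments $(\Omega_n,\mathcal A_n,\{P_{n,h}:h\in\Theta\})$ converges weakly to $(\Omega,\mathcal A,\{P_h:h\in\Theta\})$ if $\mathcal L((dP_{n,h}/dP_{n,s})_{h\in Z}\mid P_{n,s})\to\mathcal L((dP_h/dP_s)_{h\in Z}\mid P_s)$ weakly for all finite $Z\subset\Theta$ and all $s\in\Theta$. A sequence of experiments indexed by a Hilbert space $H$ is called locally asymptotically normal if it converges weakly to a Gaussian shift on $H$. *)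

theory Defs
  imports "HOL-Probability.Probability"
begin

section \<open>Density quotients and square integrable functions\<close>

definition is_density_quotient :: "'a measure \<Rightarrow> 'a measure \<Rightarrow> ('a \<Rightarrow> ennreal) \<Rightarrow> bool" where
  "is_density_quotient P Q L \<longleftrightarrow>
     L \<in> borel_measurable Q \<and>
     (\<forall>A\<in>sets Q. emeasure P A =
        (\<integral>\<^sup>+x. L x * indicator A x \<partial>Q) + emeasure P (A \<inter> {x \<in> space Q. L x = \<infinity>})) \<and>
     emeasure Q {x \<in> space Q. L x < \<infinity>} = 1"

text \<open>A version of the density quotient.  For probability measures on the same measurable space one
  exists by the Lebesgue decomposition, and it is unique up to null sets of both measures, so
  nothing below depends on the choice.\<close>

definition density_quotient :: "'a measure \<Rightarrow> 'a measure \<Rightarrow> 'a \<Rightarrow> ennreal" where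
  "density_quotient P Q = (SOME L. is_density_quotient P Q L)"

definition L2 :: "'a measure \<Rightarrow> ('a \<Rightarrow> real) set" where
  "L2 M = {f \<in> borel_measurable M. integrable M (\<lambda>x. (f x)\<^sup>2)}"

definition L2_norm :: "'a measure \<Rightarrow> ('a \<Rightarrow> real) \<Rightarrow> real" where
  "L2_norm M f = sqrt (\<integral>x. (f x)\<^sup>2 \<partial>M)"

text \<open>The element of the Hilbert space of square integrable functions represented by \<open>f\<close>.\<close>

definition L2_class :: "'a measure \<Rightarrow> ('a \<Rightarrow> real) \<Rightarrow> ('a \<Rightarrow> real) set" where
  "L2_class M f = {g \<in> L2 M. AE x in M. g x = f x}"

section \<open>Tangents\<close>

text \<open>\<open>\<rho>\<close> is total, but only its values near \<open>0\<close> matter, so this covers curves that are defined on a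
  neighbourhood of \<open>0\<close> only.  The first density quotient is finite almost surely with respect to
  \<open>\<rho> 0\<close>, so \<open>enn2real\<close> is harmless.\<close>

definition L2_differentiable :: "(real \<Rightarrow> 'a measure) \<Rightarrow> ('a \<Rightarrow> real) \<Rightarrow> bool" where
  "L2_differentiable \<rho> g \<longleftrightarrow>
     g \<in> L2 (\<rho> 0) \<and>
     (\<lambda>t. L2_norm (\<rho> 0) (\<lambda>x. 2 * (sqrt (enn2real (density_quotient (\<rho> t) (\<rho> 0) x)) - 1) - t * g x))
       \<in> o[at 0](\<lambda>t. \<bar>t\<bar>) \<and>
     (\<lambda>t. measure (\<rho> t) {x \<in> space (\<rho> 0). density_quotient (\<rho> t) (\<rho> 0) x = \<infinity>})
       \<in> o[at 0](\<lambda>t. t\<^sup>2)"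

text \<open>Tangent cone and tangent space are sets of functions, saturated under almost sure equality;
  the passage to classes happens in the Hilbert space below.\<close>

definition tangent_cone :: "'a measure \<Rightarrow> 'a measure set \<Rightarrow> ('a \<Rightarrow> real) set" where
  "tangent_cone R \<R> =
     {g. \<exists>\<rho>. \<rho> 0 = R \<and> (\<forall>\<^sub>F t in nhds 0. \<rho> t \<in> \<R>) \<and> L2_differentiable \<rho> g}"

definition linear_span :: "('a \<Rightarrow> real) set \<Rightarrow> ('a \<Rightarrow> real) set" where
  "linear_span K = {(\<lambda>x. \<Sum>g\<in>F. c g * g x) | F c. finite F \<and> F \<subseteq> K}"

definition tangent_space :: "'a measure \<Rightarrow> 'a measure set \<Rightarrow> ('a \<Rightarrow> real) set" where
  "tangent_space R \<R> =
     {g \<in> L2 R. \<forall>\<epsilon>>0. \<exists>h\<in>linear_span (tangent_cone R \<R>). L2_norm R (\<lambda>x. g x - h x) < \<epsilon>}"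

definition prod_family :: "'a measure set \<Rightarrow> 'b measure set \<Rightarrow> ('a \<times> 'b) measure set" where
  "prod_family \<P> \<Q> = {P \<Otimes>\<^sub>M Q | P Q. P \<in> \<P> \<and> Q \<in> \<Q>}"

section \<open>Hilbert spaces on an explicit carrier\<close>

record 'h hilbert =
  hcarrier :: "'h set"
  hzero :: 'h
  hadd :: "'h \<Rightarrow> 'h \<Rightarrow> 'h"
  hscale :: "real \<Rightarrow> 'h \<Rightarrow> 'h"
  hinner :: "'h \<Rightarrow> 'h \<Rightarrow> real"

definition hnorm :: "'h hilbert \<Rightarrow> 'h \<Rightarrow> real" where
  "hnorm H x = sqrt (hinner H x x)"

definition hdist :: "'h hilbert \<Rightarrow> 'h \<Rightarrow> 'h \<Rightarrow> real" where
  "hdist H x y = hnorm H (hadd H x (hscale H (-1) y))"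

locale hilbert_space =
  fixes H :: "'h hilbert"
  assumes zero_closed: "hzero H \<in> hcarrier H"
    and add_closed: "\<lbrakk>x \<in> hcarrier H; y \<in> hcarrier H\<rbrakk> \<Longrightarrow> hadd H x y \<in> hcarrier H"
    and scale_closed: "x \<in> hcarrier H \<Longrightarrow> hscale H a x \<in> hcarrier H"
    and add_assoc: "\<lbrakk>x \<in> hcarrier H; y \<in> hcarrier H; z \<in> hcarrier H\<rbrakk>
      \<Longrightarrow> hadd H (hadd H x y) z = hadd H x (hadd H y z)"
    and add_commute: "\<lbrakk>x \<in> hcarrier H; y \<in> hcarrier H\<rbrakk> \<Longrightarrow> hadd H x y = hadd H y x"
    and add_zero: "x \<in> hcarrier H \<Longrightarrow> hadd H x (hzero H) = x"
    and add_inverse: "x \<in> hcarrier H \<Longrightarrow> hadd H x (hscale H (-1) x) = hzero H"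
    and scale_add_right: "\<lbrakk>x \<in> hcarrier H; y \<in> hcarrier H\<rbrakk>
      \<Longrightarrow> hscale H a (hadd H x y) = hadd H (hscale H a x) (hscale H a y)"
    and scale_add_left: "x \<in> hcarrier H
      \<Longrightarrow> hscale H (a + b) x = hadd H (hscale H a x) (hscale H b x)"
    and scale_scale: "x \<in> hcarrier H \<Longrightarrow> hscale H a (hscale H b x) = hscale H (a * b) x"
    and scale_one: "x \<in> hcarrier H \<Longrightarrow> hscale H 1 x = x"
    and inner_commute: "\<lbrakk>x \<in> hcarrier H; y \<in> hcarrier H\<rbrakk> \<Longrightarrow> hinner H x y = hinner H y x"
    and inner_add_left: "\<lbrakk>x \<in> hcarrier H; y \<in> hcarrier H; z \<in> hcarrier H\<rbrakk>
      \<Longrightarrow> hinner H (hadd H x y) z = hinner H x z + hinner H y z"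
    and inner_scale_left: "\<lbrakk>x \<in> hcarrier H; y \<in> hcarrier H\<rbrakk>
      \<Longrightarrow> hinner H (hscale H a x) y = a * hinner H x y"
    and inner_ge_zero: "x \<in> hcarrier H \<Longrightarrow> 0 \<le> hinner H x x"
    and inner_eq_zero: "\<lbrakk>x \<in> hcarrier H; hinner H x x = 0\<rbrakk> \<Longrightarrow> x = hzero H"
    and cauchy_complete: "\<lbrakk>\<And>n. X n \<in> hcarrier H;
        \<And>\<epsilon>. \<epsilon> > 0 \<Longrightarrow> \<exists>N. \<forall>m\<ge>N. \<forall>n\<ge>N. hdist H (X m) (X n) < \<epsilon>\<rbrakk>
      \<Longrightarrow> \<exists>x\<in>hcarrier H. (\<lambda>n::nat. hdist H (X n) x) \<longlonglongrightarrow> 0"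

text \<open>The tangent space of the product family at \<open>P\<^sub>0 \<otimes> Q\<^sub>0\<close>, with elements taken as classes modulo
  almost sure equality, and with the weighted scalar product.  The components \<open>g\<^sub>1\<close>, \<open>g\<^sub>2\<close> of a
  tangent are unique up to null sets, so the description determines exactly one real number.\<close>

definition weighted_tangent_space ::
  "'a measure \<Rightarrow> 'b measure \<Rightarrow> 'a measure set \<Rightarrow> 'b measure set \<Rightarrow> real
     \<Rightarrow> ('a \<times> 'b \<Rightarrow> real) set hilbert" where
  "weighted_tangent_space P0 Q0 \<P> \<Q> d =
     (let R = P0 \<Otimes>\<^sub>M Q0 in
      \<lparr> hcarrier = L2_class R ` tangent_space R (prod_family \<P> \<Q>),
        hzero = L2_class R (\<lambda>x. 0),
        hadd = (\<lambda>G H. \<Union>g\<in>G. \<Union>h\<in>H. L2_class R (\<lambda>x. g x + h x)),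
        hscale = (\<lambda>a G. \<Union>g\<in>G. L2_class R (\<lambda>x. a * g x)),
        hinner = (\<lambda>G H. THE r. \<exists>g1 \<in> tangent_space P0 \<P>. \<exists>h1 \<in> tangent_space P0 \<P>.
          \<exists>g2 \<in> tangent_space Q0 \<Q>. \<exists>h2 \<in> tangent_space Q0 \<Q>.
            (\<lambda>x. g1 (fst x) + g2 (snd x)) \<in> G \<and>
            (\<lambda>x. h1 (fst x) + h2 (snd x)) \<in> H \<and>
            r = (1 - d) * (\<integral>x. g1 x * h1 x \<partial>P0) + d * (\<integral>y. g2 y * h2 y \<partial>Q0)) \<rparr>)"

section \<open>Experiments, weak convergence and Gaussian shifts\<close>

definition is_experiment :: "'w measure \<Rightarrow> 'h set \<Rightarrow> ('h \<Rightarrow> 'w measure) \<Rightarrow> bool" where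
  "is_experiment M \<Theta> P \<longleftrightarrow> (\<forall>\<theta>\<in>\<Theta>. P \<theta> \<in> space (prob_algebra M))"

definition weakly_convergent_to :: "'x topology \<Rightarrow> (nat \<Rightarrow> 'x measure) \<Rightarrow> 'x measure \<Rightarrow> bool" where
  "weakly_convergent_to X \<mu> \<nu> \<longleftrightarrow>
     (\<forall>f. continuous_map X euclideanreal f \<and> bounded (f ` topspace X) \<longrightarrow>
        (\<lambda>n. \<integral>x. f x \<partial>\<mu> n) \<longlonglongrightarrow> (\<integral>x. f x \<partial>\<nu>))"

definition likelihood_law :: "('h \<Rightarrow> 'w measure) \<Rightarrow> 'h set \<Rightarrow> 'h \<Rightarrow> ('h \<Rightarrow> ennreal) measure" where
  "likelihood_law P Z s =
     distr (P s) (\<Pi>\<^sub>M h\<in>Z. borel) (\<lambda>x. \<lambda>h\<in>Z. density_quotient (P h) (P s) x)"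

definition experiments_converge_weakly ::
  "'h set \<Rightarrow> (nat \<Rightarrow> 'h \<Rightarrow> 'w measure) \<Rightarrow> ('h \<Rightarrow> 'v measure) \<Rightarrow> bool" where
  "experiments_converge_weakly \<Theta> E P \<longleftrightarrow>
     (\<forall>Z s. finite Z \<and> Z \<subseteq> \<Theta> \<and> s \<in> \<Theta> \<longrightarrow>
        weakly_convergent_to (product_topology (\<lambda>h. euclidean) Z)
          (\<lambda>n. likelihood_law (E n) Z s) (likelihood_law P Z s))"

text \<open>The centred normal law with standard deviation \<open>\<sigma>\<close>, including the point mass for \<open>\<sigma> = 0\<close>.\<close>

definition centred_normal :: "real \<Rightarrow> real measure" where
  "centred_normal \<sigma> =
     (if \<sigma> = 0 then return borel 0 else density lborel (\<lambda>x. ennreal (normal_density 0 \<sigma> x)))"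

definition standard_gaussian_process ::
  "'h hilbert \<Rightarrow> 'w measure \<Rightarrow> ('h \<Rightarrow> 'w \<Rightarrow> real) \<Rightarrow> bool" where
  "standard_gaussian_process H M L \<longleftrightarrow>
     prob_space M \<and>
     (\<forall>h\<in>hcarrier H. L h \<in> L2 M) \<and>
     (\<forall>h\<in>hcarrier H. \<forall>k\<in>hcarrier H. AE x in M. L (hadd H h k) x = L h x + L k x) \<and>
     (\<forall>a. \<forall>h\<in>hcarrier H. AE x in M. L (hscale H a h) x = a * L h x) \<and>
     (\<forall>h\<in>hcarrier H. distr M borel (L h) = centred_normal (hnorm H h))"

definition gaussian_shift :: "'h hilbert \<Rightarrow> 'w measure \<Rightarrow> ('h \<Rightarrow> 'w measure) \<Rightarrow> bool" where
  "gaussian_shift H M P \<longleftrightarrow>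
     hilbert_space H \<and> is_experiment M (hcarrier H) P \<and>
     (\<exists>L. standard_gaussian_process H (P (hzero H)) L \<and>
        (\<forall>h\<in>hcarrier H. is_density_quotient (P h) (P (hzero H))
           (\<lambda>x. ennreal (exp (L h x - (hnorm H h)\<^sup>2 / 2)))))"

text \<open>A type cannot be quantified existentially, so the limit experiment lives on the path space
  \<open>'h \<Rightarrow> real\<close>.  This loses nothing: the image of a Gaussian shift on any sample space under
  \<open>\<omega> \<mapsto> (L h \<omega>)\<^sub>h\<close> is a Gaussian shift on path space with the same likelihood laws.\<close>

definition locally_asymptotically_normal ::
  "'h hilbert \<Rightarrow> (nat \<Rightarrow> 'w measure) \<Rightarrow> (nat \<Rightarrow> 'h \<Rightarrow> 'w measure) \<Rightarrow> bool" where
  "locally_asymptotically_normal H M E \<longleftrightarrow>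
     hilbert_space H \<and> (\<forall>n. is_experiment (M n) (hcarrier H) (E n)) \<and>
     (\<exists>(W :: ('h \<Rightarrow> real) measure) P.
        gaussian_shift H W P \<and> experiments_converge_weakly (hcarrier H) E P)"

definition two_sample :: "'a measure \<Rightarrow> 'b measure \<Rightarrow> nat \<Rightarrow> nat \<Rightarrow> ((nat \<Rightarrow> 'a) \<times> (nat \<Rightarrow> 'b)) measure"
  where
  "two_sample P Q k m = (\<Pi>\<^sub>M i\<in>{..<k}. P) \<Otimes>\<^sub>M (\<Pi>\<^sub>M j\<in>{..<m}. Q)"

end

(* Under P_{n,s} the likelihood ratios are products over independent observations, so the joint
   characteristic function of finitely many log-likelihood ratios is a product of an n1-th and an
   n2-th power of one-observation integrals.  Differentiability in quadratic mean gives each of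
   these integrals the expansion 1 + c/n + o(1/n); hence the powers converge to
   exp((1 - d) c1 + d c2), which is the characteristic function of the log-likelihood ratios of a
   Gaussian shift with the weighted scalar product.  The multivariate Levy theorem turns this into
   weak convergence.  The Gaussian shift lives on path space, where Kolmogorov's extension theorem
   yields a centred Gaussian process with covariance the scalar product.  Components of a product
   curve are differentiable because integrating out one coordinate of the root density is a
   contraction of L2. *)

theory Submission
  imports Defs
begin

text \<open>Likelihood ratios may vanish or be infinite, and the base product need not dominate the
  alternatives, so logarithms are taken only on an event \<open>good\<close>. Contiguity comes out
  of the main computation: the integrals over \<open>good\<close> factorise, and at \<tau> = 0 their
  limit is 1, so the probability of \<open>good\<close> tends to 1. The Taylor polynomial of one
  observation is written through the masses of the squared root densities. These differ from 1 by
  o(1/n) because the singular parts are small, which disposes of the linear terms and leaves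
  quadratic forms in the tangents. The remainder has the form m^2 min(1, m), which square
  integrability alone controls. On the Gaussian side complex exponential moments are carried along:
  the real part of an exponent performs the change of measure to P_s, its imaginary part gives the
  characteristic function there. Integrating out one coordinate of a product of root densities
  leaves a factor k, the mean of the other root density. Tangents have mean zero, and this bounds 1
  - k by the norm of the remainder; so the contraction yields differentiability of the
  component.\<close>

section \<open>The multivariate Levy continuity theorem\<close>

text \<open>By second countability an open set of the finite product topology is a countable union
  of boxes with basis sides, hence lies in the product sigma-algebra. The general factor type serves
  real coordinates and \<open>ennreal\<close> likelihood ratios alike.\<close>

lemma borel_measurable_PiM_continuous_map:
  fixes f :: "('i \<Rightarrow> 'b::second_countable_topology) \<Rightarrow> real"
  assumes I: "finite I" and f: "continuous_map (product_topology (\<lambda>_. euclidean) I) euclideanreal f"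
  shows "f \<in> borel_measurable (\<Pi>\<^sub>M i\<in>I. borel)"
proof (rule borel_measurableI)
  fix S :: "real set" assume "open S"
  let ?X = "product_topology (\<lambda>_. euclidean :: 'b topology) I"
  let ?U = "{x \<in> topspace ?X. f x \<in> S}"
  have U: "openin ?X ?U" using f \<open>open S\<close> by (auto simp: continuous_map_def)
  obtain B :: "'b set set" where B: "countable B" "topological_basis B"
    using ex_countable_basis by auto
  let ?C = "{b \<in> PiE I (\<lambda>_. B). PiE I b \<subseteq> ?U}"
  have "countable (PiE I (\<lambda>_. B))" using I B by (intro countable_PiE) auto
  then have cC: "countable ?C" by (rule countable_subset[rotated]) auto
  have "?U = (\<Union>b\<in>?C. PiE I b)"
  proof (intro equalityI subsetI)
    fix x assume x: "x \<in> ?U"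
    then have xext: "x \<in> extensional I" by (auto simp: PiE_def)
    have "\<exists>V. finite {i \<in> I. V i \<noteq> topspace euclidean} \<and> (\<forall>i\<in>I. openin euclidean (V i)) \<and>
        x \<in> PiE I V \<and> PiE I V \<subseteq> ?U"
      using U x unfolding openin_product_topology_alt by (elim conjE bspec)
    then obtain V where V: "\<And>i. i \<in> I \<Longrightarrow> open (V i)" "x \<in> PiE I V" "PiE I V \<subseteq> ?U"
      by (elim exE conjE) (auto simp del: topspace_product_topology)
    have "\<exists>W. W \<in> B \<and> x i \<in> W \<and> W \<subseteq> V i" if "i \<in> I" for i
      using topological_basisE[OF B(2) V(1)[OF that], of "x i"] V(2) that by (metis PiE_mem)
    then obtain W where W: "\<And>i. i \<in> I \<Longrightarrow> W i \<in> B \<and> x i \<in> W i \<and> W i \<subseteq> V i" by metis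
    have eq: "PiE I (restrict W I) = PiE I W" by (rule PiE_cong) auto
    have "PiE I W \<subseteq> PiE I V" using W by (intro PiE_mono) blast
    then have sub: "PiE I (restrict W I) \<subseteq> ?U" unfolding eq using V(3) by (rule order_trans)
    have "restrict W I \<in> PiE I (\<lambda>_. B)" using W by simp
    with sub have "restrict W I \<in> ?C" by (intro CollectI conjI)
    moreover have "x \<in> PiE I (restrict W I)" using W xext by (simp add: PiE_iff)
    ultimately show "x \<in> (\<Union>b\<in>?C. PiE I b)" by (rule UN_I[where a = "restrict W I"])
  next
    fix x assume "x \<in> (\<Union>b\<in>?C. PiE I b)"
    then obtain b where "b \<in> ?C" "x \<in> PiE I b" by (rule UN_E)
    then have "PiE I b \<subseteq> ?U" "x \<in> PiE I b" by simp_all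
    then show "x \<in> ?U" by (rule subsetD)
  qed
  also have "\<dots> \<in> sets (\<Pi>\<^sub>M i\<in>I. borel)"
  proof (rule sets.countable_UN'[OF cC], rule image_subsetI)
    fix b assume "b \<in> ?C"
    then have "b \<in> PiE I (\<lambda>_. B)" by simp
    then show "PiE I b \<in> sets (\<Pi>\<^sub>M i\<in>I. borel)"
      by (intro sets_PiM_I_finite I borel_open topological_basis_open[OF B(2)]) (rule PiE_mem)
  qed
  finally have "?U \<in> sets (\<Pi>\<^sub>M i\<in>I. borel)" .
  moreover have "f -` S \<inter> space (\<Pi>\<^sub>M i\<in>I. borel) = ?U" by (auto simp: space_PiM)
  ultimately show "f -` S \<inter> space (\<Pi>\<^sub>M i\<in>I. borel) \<in> sets (\<Pi>\<^sub>M i\<in>I. borel)" by simp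
qed

section \<open>Approximation by trigonometric polynomials with a global bound\<close>

text \<open>Finite sums of characters in the coordinates from \<open>I\<close>: their integrals are
  finite combinations of values of the characteristic function. The inductive form makes every
  closure property a two-case induction.\<close>

inductive trig_poly :: "'i set \<Rightarrow> (('i \<Rightarrow> real) \<Rightarrow> complex) \<Rightarrow> bool" for I where
  trig_poly_exp: "trig_poly I (\<lambda>x. c * iexp (\<Sum>i\<in>I. \<tau> i * x i))"
| trig_poly_add: "trig_poly I f \<Longrightarrow> trig_poly I g \<Longrightarrow> trig_poly I (\<lambda>x. f x + g x)"

lemma trig_poly_const: "trig_poly I (\<lambda>_. c)"
  using trig_poly_exp[of I c "\<lambda>_. 0"] by simp

lemma trig_poly_mult:
  assumes "trig_poly I f" "trig_poly I g"
  shows "trig_poly I (\<lambda>x. f x * g x)"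
  using assms(1)
proof induction
  case (trig_poly_exp c \<tau>)
  show ?case using assms(2)
  proof induction
    case (trig_poly_exp c' \<tau>')
    have "(\<lambda>x. c * iexp (\<Sum>i\<in>I. \<tau> i * x i) * (c' * iexp (\<Sum>i\<in>I. \<tau>' i * x i)))
       = (\<lambda>x. (c * c') * iexp (\<Sum>i\<in>I. (\<tau> i + \<tau>' i) * x i))"
      by (simp add: fun_eq_iff distrib_right sum.distrib distrib_left exp_add)
    then show ?case using trig_poly.trig_poly_exp[of I "c * c'" "\<lambda>i. \<tau> i + \<tau>' i"] by simp
  next
    case (trig_poly_add f g)
    then show ?case using trig_poly.trig_poly_add by (simp add: distrib_left)
  qed
next
  case (trig_poly_add f g)
  then show ?case using trig_poly.trig_poly_add by (simp add: distrib_right)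
qed

lemma trig_poly_bounded: "trig_poly I f \<Longrightarrow> \<exists>B. \<forall>x. norm (f x) \<le> B"
proof (induction rule: trig_poly.induct)
  case (trig_poly_exp c \<tau>)
  then show ?case by (intro exI[of _ "norm c"]) (simp add: norm_mult)
next
  case (trig_poly_add f g)
  then obtain B C where "\<forall>x. norm (f x) \<le> B" "\<forall>x. norm (g x) \<le> C" by auto
  then show ?case by (intro exI[of _ "B + C"]) (meson add_mono norm_triangle_le)
qed

lemma trig_poly_continuous: "trig_poly I f \<Longrightarrow> continuous_on UNIV f"
proof (induction rule: trig_poly.induct)
  case (trig_poly_exp c \<tau>)
  show ?case by (intro continuous_intros) auto
qed (intro continuous_intros)

lemma trig_poly_restrict: "trig_poly I f \<Longrightarrow> f (restrict x I) = f x"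
  by (induction rule: trig_poly.induct) auto

lemma trig_poly_measurable:
  "trig_poly I f \<Longrightarrow> (\<And>i. i \<in> I \<Longrightarrow> (\<lambda>w. X w i) \<in> borel_measurable M) \<Longrightarrow>
    (\<lambda>w. f (X w)) \<in> borel_measurable M"
  by (induction rule: trig_poly.induct) (auto intro!: borel_measurable_sum)

text \<open>This permits truncating an approximant without leaving the class: the truncation map is
  itself replaced by a real polynomial.\<close>

lemma trig_poly_polynomial:
  assumes "real_polynomial_function r" "trig_poly I (\<lambda>x. complex_of_real (p x))"
  shows "trig_poly I (\<lambda>x. complex_of_real (r (p x)))"
  using assms(1)
proof induction
  case (linear f)
  then have "f y = y * f 1" for y :: real using real_bounded_linear by (metis mult.left_neutral)
  then have "(\<lambda>x. complex_of_real (f (p x))) = (\<lambda>x. complex_of_real (p x) * complex_of_real (f 1))"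
    by (metis of_real_mult)
  then show ?case using trig_poly_mult[OF assms(2) trig_poly_const] by simp
next
  case (const c)
  show ?case by (rule trig_poly_const)
next
  case (add f g)
  then show ?case using trig_poly_add by simp
next
  case (mult f g)
  then show ?case using trig_poly_mult by simp
qed

lemma trig_poly_separates:
  assumes "finite I" "i \<in> I" "x i \<noteq> y i"
  shows "\<exists>f. trig_poly I (\<lambda>x. complex_of_real (f x)) \<and> f x \<noteq> f y"
proof -
  \<comment> \<open>This scale makes the argument of the sine 1 at \<open>x\<close> and 0 at
    \<open>y\<close>; sin 1 is positive because 1 < pi.\<close>
  define t where "t = 1 / (x i - y i)"
  define f :: "('a \<Rightarrow> real) \<Rightarrow> real" where "f z = sin (t * (z i - y i))" for z
  have t: "t * (x i - y i) = 1" using assms by (simp add: t_def)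
  have s: "(\<Sum>j\<in>I. (if j = i then a else 0) * z j) = a * z i" for a and z :: "'a \<Rightarrow> real"
    using assms by (simp add: if_distrib[of "\<lambda>u. u * _"] cong: if_cong)
  have "complex_of_real (f z) = (- \<i> / 2 * exp (- (\<i> * (t * y i)))) * iexp (\<Sum>j\<in>I. (if j = i then t else 0) * z j)
     + (\<i> / 2 * exp (\<i> * (t * y i))) * iexp (\<Sum>j\<in>I. (if j = i then - t else 0) * z j)" for z
    unfolding s f_def sin_of_real[symmetric] sin_exp_eq
    by (simp add: exp_add[symmetric] algebra_simps divide_simps)
  then have "trig_poly I (\<lambda>x. complex_of_real (f x))"
    using trig_poly_add[OF trig_poly_exp[of I "- \<i> / 2 * exp (- (\<i> * (t * y i)))" "\<lambda>j. if j = i then t else 0"]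
       trig_poly_exp[of I "\<i> / 2 * exp (\<i> * (t * y i))" "\<lambda>j. if j = i then - t else 0"]] by simp
  moreover have "f x \<noteq> f y" using t sin_gt_zero[of 1] pi_gt3 by (simp add: f_def)
  ultimately show ?thesis by blast
qed

text \<open>Uniform approximation holds only on the box, so a bound on the whole space has to be
  arranged separately: the Stone-Weierstrass approximant \<open>p\<close> is composed with a
  polynomial close to truncation at \<open>C\<close>. The global bound is what later controls the
  integrals off the box.\<close>

lemma trig_poly_approx_nat:
  fixes F :: "(nat \<Rightarrow> real) \<Rightarrow> real"
  assumes I: "finite I" and F: "continuous_map (product_topology (\<lambda>_. euclideanreal) I) euclideanreal F"
    and C: "\<And>x. x \<in> extensional I \<Longrightarrow> \<bar>F x\<bar> \<le> C" and e: "e > 0"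
  obtains q where "trig_poly I (\<lambda>x. complex_of_real (q x))" "\<And>x. \<bar>q x\<bar> \<le> C + e"
    "\<And>x. x \<in> PiE I (\<lambda>_. {-m..m}) \<Longrightarrow> \<bar>q x - F x\<bar> \<le> 2 * e"
proof -
  let ?K = "PiE I (\<lambda>_. {-m..m})"
  \<comment> \<open>The box over \<open>I\<close> is a full product over \<open>nat\<close> with
    singleton factors outside \<open>I\<close>, so compactness follows from Tychonoff.\<close>
  have Keq: "?K = PiE UNIV (\<lambda>i. if i \<in> I then {-m..m} else {undefined})"
    by (auto simp: PiE_def extensional_def Pi_def split: if_splits)
  have "compactin (product_topology (\<lambda>_. euclidean) UNIV) ?K"
    unfolding Keq compactin_PiE by auto
  then have K: "compact ?K" by (simp add: euclidean_product_topology)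
  have "continuous_map (top_of_set ?K) (product_topology (\<lambda>_. euclideanreal) I) (\<lambda>x. x)"
    unfolding continuous_map_componentwise
    by (auto simp: PiE_def intro: continuous_on_subset[OF continuous_on_product_coordinates])
  from continuous_map_compose[OF this F] have FK: "continuous_on ?K F"
    by (simp add: o_def)
  interpret function_ring_on "{f. trig_poly I (\<lambda>x. complex_of_real (f x))}" ?K
  proof
    fix f assume "f \<in> {f. trig_poly I (\<lambda>x. complex_of_real (f x))}"
    then have "continuous_on UNIV (\<lambda>x. complex_of_real (f x))" by (auto dest: trig_poly_continuous)
    then have "continuous_on UNIV (\<lambda>x. Re (complex_of_real (f x)))" by (rule continuous_on_Re)
    then show "continuous_on ?K f" by (auto intro: continuous_on_subset)
  next
    fix x y assume "x \<in> ?K" "y \<in> ?K" "x \<noteq> y"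
    then obtain i where "i \<in> I" "x i \<noteq> y i" by (metis PiE_ext)
    then show "\<exists>f\<in>{f. trig_poly I (\<lambda>x. complex_of_real (f x))}. f x \<noteq> f y"
      using trig_poly_separates[OF I] by auto
  qed (use K trig_poly_add trig_poly_mult trig_poly_const in auto)
  from Stone_Weierstrass_basic[OF FK e] obtain p where p: "trig_poly I (\<lambda>x. complex_of_real (p x))"
    "\<And>x. x \<in> ?K \<Longrightarrow> \<bar>F x - p x\<bar> < e" by auto
  obtain B where B: "\<And>x. \<bar>p x\<bar> \<le> B" using trig_poly_bounded[OF p(1)] by auto
  \<comment> \<open>Truncation to [-C, C]. On the box \<open>F\<close> takes values there, so
    truncating \<open>p\<close> does not move it away from \<open>F\<close>; and since
    \<open>p\<close> has its range in [-B, B], it is enough to approximate \<open>cl\<close> on that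
    interval.\<close>
  define cl where "cl y = max (- C) (min C y)" for y :: real
  have C0: "C \<ge> 0" using C[of "\<lambda>_. undefined"] by (auto simp: extensional_def)
  have "continuous_on {-B..B} cl" unfolding cl_def by (intro continuous_intros)
  from Stone_Weierstrass_real_polynomial_function[OF compact_Icc this e] obtain r where
    r: "real_polynomial_function r" "\<And>y. y \<in> {-B..B} \<Longrightarrow> \<bar>cl y - r y\<bar> < e" by metis
  have r': "\<bar>cl (p x) - r (p x)\<bar> < e" for x using r(2)[of "p x"] B[of x] by (auto simp: abs_le_iff)
  show ?thesis
  proof
    show "trig_poly I (\<lambda>x. complex_of_real (r (p x)))" by (rule trig_poly_polynomial[OF r(1) p(1)])
    show "\<bar>r (p x)\<bar> \<le> C + e" for x
      using r'[of x] C0 by (auto simp: cl_def max_def min_def split: if_splits)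
    show "\<bar>r (p x) - F x\<bar> \<le> 2 * e" if "x \<in> ?K" for x
      using r'[of x] p(2)[OF that] C[of x] that
      by (auto simp: cl_def max_def min_def PiE_def abs_le_iff abs_less_iff split: if_splits)
  qed
qed


lemma trig_poly_reindex:
  assumes e: "bij_betw e J I" and p: "trig_poly J p"
  shows "trig_poly I (\<lambda>x. p (\<lambda>j\<in>J. x (e j)))"
  using p
proof induction
  case (trig_poly_exp c \<tau>)
  have "(\<Sum>j\<in>J. \<tau> j * (\<lambda>j\<in>J. x (e j)) j) = (\<Sum>i\<in>I. \<tau> (inv_into J e i) * x i)" for x :: "'b \<Rightarrow> real"
  proof -
    have "(\<Sum>i\<in>I. \<tau> (inv_into J e i) * x i) = (\<Sum>j\<in>J. \<tau> (inv_into J e (e j)) * x (e j))"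
      by (rule sum.reindex_bij_betw[OF e, symmetric])
    also have "\<dots> = (\<Sum>j\<in>J. \<tau> j * (\<lambda>j\<in>J. x (e j)) j)"
      using e by (intro sum.cong refl) (simp add: bij_betw_inv_into_left)
    finally show ?thesis by simp
  qed
  then show ?case using trig_poly.trig_poly_exp[of I c "\<lambda>i. \<tau> (inv_into J e i)"] by simp
qed (rule trig_poly.trig_poly_add)

text \<open>Stone--Weierstrass needs a topological type, and functions carry one only on a countable index
  type; hence the detour over \<open>nat\<close>.\<close>

lemma trig_poly_approx:
  fixes F :: "('i \<Rightarrow> real) \<Rightarrow> real"
  assumes I: "finite I" and F: "continuous_map (product_topology (\<lambda>_. euclideanreal) I) euclideanreal F"
    and C: "\<And>x. x \<in> extensional I \<Longrightarrow> \<bar>F x\<bar> \<le> C" and e: "e > 0"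
  obtains q where "trig_poly I (\<lambda>x. complex_of_real (q x))" "\<And>x. \<bar>q x\<bar> \<le> C + e"
    "\<And>x. x \<in> PiE I (\<lambda>_. {-m..m}) \<Longrightarrow> \<bar>q x - F x\<bar> \<le> 2 * e"
proof -
  let ?J = "{0..<card I}"
  obtain b where b: "bij_betw b ?J I" using ex_bij_betw_nat_finite[OF I] by blast
  let ?b' = "inv_into ?J b"
  have b': "?b' i \<in> ?J" "b (?b' i) = i" if "i \<in> I" for i
    using that b inv_into_into[of i b ?J] f_inv_into_f[of i b ?J] by (auto simp: bij_betw_def)
  have "continuous_map (product_topology (\<lambda>_. euclideanreal) ?J) (product_topology (\<lambda>_. euclideanreal) I)
      (\<lambda>y. \<lambda>i\<in>I. y (?b' i))"
    unfolding continuous_map_componentwise using b'(1)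
    by (auto intro!: continuous_map_product_projection)
  from continuous_map_compose[OF this F]
  have "continuous_map (product_topology (\<lambda>_. euclideanreal) ?J) euclideanreal (\<lambda>y. F (\<lambda>i\<in>I. y (?b' i)))"
    by (simp add: o_def)
  from trig_poly_approx_nat[OF _ this _ e, of C m] C obtain q where
    q: "trig_poly ?J (\<lambda>x. complex_of_real (q x))" "\<And>x. \<bar>q x\<bar> \<le> C + e"
    "\<And>x. x \<in> PiE ?J (\<lambda>_. {-m..m}) \<Longrightarrow> \<bar>q x - F (\<lambda>i\<in>I. x (?b' i))\<bar> \<le> 2 * e" by auto
  show ?thesis
  proof
    show "trig_poly I (\<lambda>x. complex_of_real (q (\<lambda>j\<in>?J. x (b j))))" by (rule trig_poly_reindex[OF b q(1)])
    show "\<bar>q (\<lambda>j\<in>?J. x (b j))\<bar> \<le> C + e" for x by (rule q(2))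
    fix x assume x: "x \<in> PiE I (\<lambda>_. {-m..m})"
    have "(\<lambda>j\<in>?J. x (b j)) \<in> PiE ?J (\<lambda>_. {-m..m})"
      using x bij_betwE[OF b] by (auto simp: PiE_iff)
    moreover have "(\<lambda>i\<in>I. (\<lambda>j\<in>?J. x (b j)) (?b' i)) = x"
      using x b' by (auto simp: fun_eq_iff PiE_iff extensional_def)
    ultimately show "\<bar>q (\<lambda>j\<in>?J. x (b j)) - F x\<bar> \<le> 2 * e" using q(3) by metis
  qed
qed

section \<open>Tightness, continuity and uniqueness\<close>

text \<open>The integrands differ by at most \<open>e\<close> off \<open>A\<close> and by at most
  \<open>B + B'\<close> on \<open>A\<close>. With e = 0 this compares functions that agree off a
  small event.\<close>

lemma integral_diff_off_event:
  fixes f g :: "'w \<Rightarrow> real"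
  assumes "prob_space M" and [measurable]: "f \<in> borel_measurable M" "g \<in> borel_measurable M" "A \<in> sets M"
    and f: "\<And>w. w \<in> space M \<Longrightarrow> \<bar>f w\<bar> \<le> B" and g: "\<And>w. w \<in> space M \<Longrightarrow> \<bar>g w\<bar> \<le> B'"
    and fg: "\<And>w. w \<in> space M \<Longrightarrow> w \<notin> A \<Longrightarrow> \<bar>f w - g w\<bar> \<le> e"
    and e: "0 \<le> e"
  shows "\<bar>(\<integral>w. f w \<partial>M) - (\<integral>w. g w \<partial>M)\<bar> \<le> e + (B + B') * measure M A"
proof -
  interpret prob_space M by fact
  \<comment> \<open>A probability space has a point, which forces the sum of the two bounds to be
    nonnegative.\<close>
  have BB: "0 \<le> B + B'" using not_empty f g by (metis abs_ge_zero add_nonneg_nonneg ex_in_conv order_trans)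
  have i: "integrable M f" "integrable M g"
    by (rule integrable_const_bound[where B=B], use f in auto) (rule integrable_const_bound[where B=B'], use g in auto)
  have "\<bar>(\<integral>w. f w \<partial>M) - (\<integral>w. g w \<partial>M)\<bar> = \<bar>\<integral>w. f w - g w \<partial>M\<bar>" using i by simp
  also have "\<dots> \<le> (\<integral>w. \<bar>f w - g w\<bar> \<partial>M)" by (rule integral_abs_bound)
  also have "\<dots> \<le> (\<integral>w. e + (B + B') * indicator A w \<partial>M)"
  proof (rule integral_mono)
    show "integrable M (\<lambda>w. \<bar>f w - g w\<bar>)" using i by simp
    show "integrable M (\<lambda>w. e + (B + B') * indicator A w)"
      by (intro Bochner_Integration.integrable_add integrable_mult_right integrable_real_indicator)
        (auto simp: less_top[symmetric])
    fix w assume w: "w \<in> space M"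
    show "\<bar>f w - g w\<bar> \<le> e + (B + B') * indicator A w"
      using f[OF w] g[OF w] fg[OF w] e by (auto simp: indicator_def)
  qed
  also have "\<dots> = e + (B + B') * measure M A"
    by (subst Bochner_Integration.integral_add) (auto simp: prob_space less_top[symmetric] intro!: integrable_real_indicator)
  finally show ?thesis .
qed

text \<open>Weak convergence of the one-dimensional laws, tested on one ramp function with small
  integral under the limit law, bounds the tails of all late members of the sequence and of the
  limit at a common level.\<close>

lemma levy_tight:
  fixes X :: "nat \<Rightarrow> 'w \<Rightarrow> real" and Y :: "'v \<Rightarrow> real"
  assumes M: "\<And>n. prob_space (M n)" and N: "prob_space N"
    and X[measurable]: "\<And>n. X n \<in> borel_measurable (M n)" and Y[measurable]: "Y \<in> borel_measurable N"
    and char: "\<And>t. (\<lambda>n. \<integral>w. iexp (t * X n w) \<partial>M n) \<longlonglongrightarrow> (\<integral>w. iexp (t * Y w) \<partial>N)"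
    and e: "e > 0"
  shows "\<exists>m. (\<forall>\<^sub>F n in sequentially. measure (M n) {w \<in> space (M n). \<bar>X n w\<bar> > m} < e)
      \<and> measure N {w \<in> space N. \<bar>Y w\<bar> > m} < e"
proof -
  interpret N: prob_space N by fact
  \<comment> \<open>The ramp rises from 0 at |x| = m to 1 at |x| = m + 1; hence the level
    \<open>real k + 1\<close> below.\<close>
  define \<phi> where "\<phi> m x = min 1 (max 0 (\<bar>x\<bar> - m))" for m x :: real
  have \<phi>c: "isCont (\<phi> m) x" for m x unfolding \<phi>_def by (intro continuous_intros)
  then have [measurable]: "\<phi> m \<in> borel_measurable borel" for m
    by (intro borel_measurable_continuous_onI continuous_at_imp_continuous_on) auto
  have \<phi>b: "norm (\<phi> m x) \<le> 1" for m x by (auto simp: \<phi>_def)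
  have "(\<lambda>k. \<integral>w. \<phi> (real k) (Y w) \<partial>N) \<longlonglongrightarrow> (\<integral>w. 0 \<partial>N)"
  proof (rule integral_dominated_convergence[where w = "\<lambda>_. 1"])
    show "AE w in N. (\<lambda>k. \<phi> (real k) (Y w)) \<longlonglongrightarrow> 0"
    proof (intro AE_I2 tendsto_eventually)
      fix w
      show "\<forall>\<^sub>F k in sequentially. \<phi> (real k) (Y w) = 0"
        using eventually_ge_at_top[of "nat \<lceil>\<bar>Y w\<bar>\<rceil>"]
        by eventually_elim (auto simp: \<phi>_def)
    qed
  qed (use \<phi>b in auto)
  then have "\<forall>\<^sub>F k in sequentially. (\<integral>w. \<phi> (real k) (Y w) \<partial>N) < e"
    using e by (intro order_tendstoD) auto
  then obtain k where k: "(\<integral>w. \<phi> (real k) (Y w) \<partial>N) < e" by (auto dest: eventually_happens)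
  have rd: "real_distribution (distr (M n) borel (X n))" for n
    using prob_space.real_distribution_distr[OF M X] .
  have rdN: "real_distribution (distr N borel Y)" using N.real_distribution_distr[OF Y] .
  have "weak_conv_m (\<lambda>n. distr (M n) borel (X n)) (distr N borel Y)"
    by (rule levy_continuity[OF rd rdN]) (use char in \<open>simp add: char_def integral_distr\<close>)
  from weak_conv_imp_integral_bdd_continuous_conv[OF rd rdN this \<phi>c \<phi>b]
  have "(\<lambda>n. \<integral>w. \<phi> (real k) (X n w) \<partial>M n) \<longlonglongrightarrow> (\<integral>w. \<phi> (real k) (Y w) \<partial>N)"
    by (simp add: integral_distr)
  then have ev: "\<forall>\<^sub>F n in sequentially. (\<integral>w. \<phi> (real k) (X n w) \<partial>M n) < e"
    using k by (intro order_tendstoD) auto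
  have le: "measure Q {w \<in> space Q. \<bar>Z w\<bar> > real k + 1} \<le> (\<integral>w. \<phi> (real k) (Z w) \<partial>Q)"
    if "prob_space Q" and [measurable]: "Z \<in> borel_measurable Q" for Q :: "'u measure" and Z
  proof -
    interpret Q: prob_space Q by fact
    have "measure Q {w \<in> space Q. \<bar>Z w\<bar> > real k + 1} = (\<integral>w. indicator {w \<in> space Q. \<bar>Z w\<bar> > real k + 1} w \<partial>Q)"
      by simp
    also have "\<dots> \<le> (\<integral>w. \<phi> (real k) (Z w) \<partial>Q)"
    proof (rule integral_mono)
      show "integrable Q (\<lambda>w. \<phi> (real k) (Z w))" using \<phi>b by (auto intro!: Q.integrable_const_bound[where B=1])
      show "integrable Q (indicat_real {w \<in> space Q. \<bar>Z w\<bar> > real k + 1})"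
        by (intro integrable_real_indicator) (auto simp: less_top[symmetric])
    qed (auto simp: indicator_def \<phi>_def)
    finally show ?thesis .
  qed
  show ?thesis
  proof (intro exI[of _ "real k + 1"] conjI)
    show "\<forall>\<^sub>F n in sequentially. measure (M n) {w \<in> space (M n). \<bar>X n w\<bar> > real k + 1} < e"
      using ev by eventually_elim (use le[OF M X] order.strict_trans1 in blast)
    show "measure N {w \<in> space N. \<bar>Y w\<bar> > real k + 1} < e"
      using le[OF N Y] k by simp
  qed
qed

lemma trig_poly_integral_tendsto:
  assumes p: "trig_poly I p"
    and M: "\<And>n. prob_space (M n)" and N: "prob_space N"
    and X: "\<And>n i. i \<in> I \<Longrightarrow> (\<lambda>w. X n w i) \<in> borel_measurable (M n)"
    and Y: "\<And>i. i \<in> I \<Longrightarrow> (\<lambda>w. Y w i) \<in> borel_measurable N"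
    and char: "\<And>\<tau>. (\<lambda>n. \<integral>w. iexp (\<Sum>i\<in>I. \<tau> i * X n w i) \<partial>M n) \<longlonglongrightarrow> (\<integral>w. iexp (\<Sum>i\<in>I. \<tau> i * Y w i) \<partial>N)"
  shows "(\<lambda>n. \<integral>w. p (X n w) \<partial>M n) \<longlonglongrightarrow> (\<integral>w. p (Y w) \<partial>N)"
  using p
proof induction
  case (trig_poly_exp c \<tau>)
  show ?case using tendsto_mult_left[OF char, of c] by simp
next
  case (trig_poly_add f g)
  have i: "integrable Q (\<lambda>w. h (Z w))" if h: "trig_poly I h" and Q: "prob_space Q"
    and Z: "\<And>i. i \<in> I \<Longrightarrow> (\<lambda>w. Z w i) \<in> borel_measurable Q" for h Z and Q :: "'u measure"
  proof -
    obtain B where "\<And>x. norm (h x) \<le> B" using trig_poly_bounded[OF h] by blast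
    then show ?thesis
      by (intro finite_measure.integrable_const_bound[OF prob_space.finite_measure[OF Q], where B = B]
        trig_poly_measurable[OF h Z] AE_I2)
  qed
  have "(\<integral>w. f (X n w) + g (X n w) \<partial>M n) = (\<integral>w. f (X n w) \<partial>M n) + (\<integral>w. g (X n w) \<partial>M n)" for n
    by (intro Bochner_Integration.integral_add i trig_poly_add M X)
  moreover have "(\<integral>w. f (Y w) + g (Y w) \<partial>N) = (\<integral>w. f (Y w) \<partial>N) + (\<integral>w. g (Y w) \<partial>N)"
    by (intro Bochner_Integration.integral_add i trig_poly_add N Y)
  ultimately show ?case using tendsto_add[OF trig_poly_add.IH] by simp
qed

text \<open>Tightness of each coordinate confines the late laws and the limit, up to a small mass,
  to one box. There \<open>F\<close> is uniformly close to a trigonometric polynomial, whose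
  integrals converge by hypothesis; elsewhere both functions are bounded and the mass is
  small.\<close>

theorem multivariate_levy_continuity:
  fixes X :: "nat \<Rightarrow> 'w \<Rightarrow> 'i \<Rightarrow> real" and Y :: "'v \<Rightarrow> 'i \<Rightarrow> real"
  assumes I: "finite I" and M: "\<And>n. prob_space (M n)" and N: "prob_space N"
    and X: "\<And>n i. i \<in> I \<Longrightarrow> (\<lambda>w. X n w i) \<in> borel_measurable (M n)"
    and Y: "\<And>i. i \<in> I \<Longrightarrow> (\<lambda>w. Y w i) \<in> borel_measurable N"
    and char: "\<And>\<tau>. (\<lambda>n. \<integral>w. iexp (\<Sum>i\<in>I. \<tau> i * X n w i) \<partial>M n) \<longlonglongrightarrow> (\<integral>w. iexp (\<Sum>i\<in>I. \<tau> i * Y w i) \<partial>N)"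
    and F: "continuous_map (product_topology (\<lambda>_. euclideanreal) I) euclideanreal F"
    and C: "\<And>x. x \<in> extensional I \<Longrightarrow> \<bar>F x\<bar> \<le> C"
  shows "(\<lambda>n. \<integral>w. F (restrict (X n w) I) \<partial>M n) \<longlonglongrightarrow> (\<integral>w. F (restrict (Y w) I) \<partial>N)"
proof (rule LIMSEQ_I)
  fix r :: real assume r: "r > 0"
  have C0: "C \<ge> 0" using C[of "\<lambda>_. undefined"] by (auto simp: extensional_def)
  \<comment> \<open>The total error is 2 (2 e + (2 C + e) e) + e, which for e \<le> 1 is at most e
    (10 + 10 C). The summand r in the denominator gives both e \<le> 1 and the strict inequality
    \<open>er\<close>.\<close>
  define e where "e = r / (10 + 10 * C + r)"
  have den: "10 + 10 * C + r > 0" using r C0 by simp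
  have e: "e > 0" "e \<le> 1" using r C0 by (auto simp: e_def field_simps)
  have er: "e * (10 + 10 * C) < r"
  proof -
    have "e * (10 + 10 * C + r) = r" using den by (simp add: e_def)
    moreover have "e * r > 0" using e r by simp
    ultimately show ?thesis by (simp add: distrib_left)
  qed
  \<comment> \<open>The union bound over the coordinates costs a factor \<open>card I\<close>; the
    added 1 covers the empty index set, as does the 0 inserted into the maximum
    \<open>m'\<close>.\<close>
  define e' where "e' = e / (1 + card I)"
  have e': "e' > 0" using e by (simp add: e'_def)
  have ce: "card I * e' \<le> e" using e by (simp add: e'_def field_simps)
  have "\<exists>m. (\<forall>\<^sub>F n in sequentially. measure (M n) {w \<in> space (M n). \<bar>X n w i\<bar> > m} < e')
      \<and> measure N {w \<in> space N. \<bar>Y w i\<bar> > m} < e'" if i: "i \<in> I" for i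
  proof (rule levy_tight[OF M N X[OF i] Y[OF i] _ e'])
    fix t :: real
    have s: "(\<Sum>j\<in>I. (if j = i then t else 0) * z j) = t * z i" for z :: "'i \<Rightarrow> real"
      using I i by (simp add: if_distrib[of "\<lambda>u. u * _"] cong: if_cong)
    show "(\<lambda>n. \<integral>w. iexp (t * X n w i) \<partial>M n) \<longlonglongrightarrow> (\<integral>w. iexp (t * Y w i) \<partial>N)"
      using char[of "\<lambda>j. if j = i then t else 0"] unfolding s .
  qed
  then have "\<exists>m. \<forall>i\<in>I. (\<forall>\<^sub>F n in sequentially. measure (M n) {w \<in> space (M n). \<bar>X n w i\<bar> > m i} < e')
      \<and> measure N {w \<in> space N. \<bar>Y w i\<bar> > m i} < e'" by (intro bchoice ballI)
  then obtain m where m: "\<And>i. i \<in> I \<Longrightarrow> \<forall>\<^sub>F n in sequentially. measure (M n) {w \<in> space (M n). \<bar>X n w i\<bar> > m i} < e'"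
    "\<And>i. i \<in> I \<Longrightarrow> measure N {w \<in> space N. \<bar>Y w i\<bar> > m i} < e'" by blast
  define m' where "m' = Max (insert 0 (m ` I))"
  have m': "m i \<le> m'" if "i \<in> I" for i unfolding m'_def using I that by (intro Max_ge) auto
  obtain q where q: "trig_poly I (\<lambda>x. complex_of_real (q x))" "\<And>x. \<bar>q x\<bar> \<le> C + e"
    "\<And>x. x \<in> PiE I (\<lambda>_. {-m'..m'}) \<Longrightarrow> \<bar>q x - F x\<bar> \<le> 2 * e"
    using trig_poly_approx[OF I F C e(1), of m'] by blast
  have qr: "q (restrict x I) = q x" for x using trig_poly_restrict[OF q(1)] by simp
  have Fm: "F \<in> borel_measurable (\<Pi>\<^sub>M i\<in>I. borel)" by (rule borel_measurable_PiM_continuous_map[OF I F])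
  have approx: "\<bar>(\<integral>w. F (restrict (Z w) I) \<partial>Q) - (\<integral>w. q (Z w) \<partial>Q)\<bar> \<le> 2 * e + (C + (C + e)) * e"
    if Q: "prob_space Q" and Z: "\<And>i. i \<in> I \<Longrightarrow> (\<lambda>w. Z w i) \<in> borel_measurable Q"
      and sm: "\<And>i. i \<in> I \<Longrightarrow> measure Q {w \<in> space Q. \<bar>Z w i\<bar> > m i} < e'"
    for Q :: "'u measure" and Z
  proof -
    interpret Q: prob_space Q by fact
    define A where "A = (\<Union>i\<in>I. {w \<in> space Q. \<bar>Z w i\<bar> > m i})"
    have As: "A \<in> sets Q" unfolding A_def using Z I by (intro sets.finite_UN) auto
    have "measure Q A \<le> (\<Sum>i\<in>I. measure Q {w \<in> space Q. \<bar>Z w i\<bar> > m i})"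
      unfolding A_def using Z I by (intro Q.finite_measure_subadditive_finite) auto
    also have "\<dots> \<le> card I * e'" using sm by (intro sum_bounded_above) (auto intro: less_imp_le)
    finally have A: "measure Q A \<le> e" using ce by simp
    have Zm: "(\<lambda>w. restrict (Z w) I) \<in> measurable Q (\<Pi>\<^sub>M i\<in>I. borel)"
      using Z by (intro measurable_restrict) auto
    have "\<bar>(\<integral>w. F (restrict (Z w) I) \<partial>Q) - (\<integral>w. q (Z w) \<partial>Q)\<bar> \<le> 2 * e + (C + (C + e)) * measure Q A"
    proof (rule integral_diff_off_event[OF Q _ _ As])
      show "(\<lambda>w. F (restrict (Z w) I)) \<in> borel_measurable Q" using measurable_compose[OF Zm Fm] .
      have "(\<lambda>w. Re (complex_of_real (q (Z w)))) \<in> borel_measurable Q"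
        by (rule measurable_compose[OF trig_poly_measurable[OF q(1)] borel_measurable_Re]) (rule Z)
      then show "(\<lambda>w. q (Z w)) \<in> borel_measurable Q" by simp
      show "\<bar>F (restrict (Z w) I)\<bar> \<le> C" for w by (intro C) auto
      show "\<bar>q (Z w)\<bar> \<le> C + e" for w by (rule q)
      show "\<bar>F (restrict (Z w) I) - q (Z w)\<bar> \<le> 2 * e" if "w \<in> space Q" "w \<notin> A" for w
      proof -
        have "restrict (Z w) I \<in> PiE I (\<lambda>_. {-m'..m'})"
          using that m' by (fastforce simp: A_def not_less abs_le_iff)
        from q(3)[OF this] show ?thesis by (simp add: qr abs_minus_commute)
      qed
    qed (use e in auto)
    also have "\<dots> \<le> 2 * e + (C + (C + e)) * e" using A C0 e by (intro add_mono mult_left_mono) auto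
    finally show ?thesis .
  qed
  have "(\<lambda>n. \<integral>w. complex_of_real (q (X n w)) \<partial>M n) \<longlonglongrightarrow> (\<integral>w. complex_of_real (q (Y w)) \<partial>N)"
    by (rule trig_poly_integral_tendsto[OF q(1) M N X Y char])
  then have "(\<lambda>n. \<integral>w. q (X n w) \<partial>M n) \<longlonglongrightarrow> (\<integral>w. q (Y w) \<partial>N)"
    by (simp add: tendsto_of_real_iff)
  then have ev1: "\<forall>\<^sub>F n in sequentially. \<bar>(\<integral>w. q (X n w) \<partial>M n) - (\<integral>w. q (Y w) \<partial>N)\<bar> < e"
    using e(1) by (auto dest!: tendstoD simp: dist_real_def)
  have ev2: "\<forall>\<^sub>F n in sequentially. \<forall>i\<in>I. measure (M n) {w \<in> space (M n). \<bar>X n w i\<bar> > m i} < e'"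
    using m(1) I by (simp add: eventually_ball_finite)
  have "\<forall>\<^sub>F n in sequentially. norm ((\<integral>w. F (restrict (X n w) I) \<partial>M n) - (\<integral>w. F (restrict (Y w) I) \<partial>N)) < r"
    using ev1 ev2
  proof eventually_elim
    case (elim n)
    have "\<bar>(\<integral>w. F (restrict (X n w) I) \<partial>M n) - (\<integral>w. q (X n w) \<partial>M n)\<bar> \<le> 2 * e + (C + (C + e)) * e"
      using elim by (intro approx M X) auto
    moreover have "\<bar>(\<integral>w. F (restrict (Y w) I) \<partial>N) - (\<integral>w. q (Y w) \<partial>N)\<bar> \<le> 2 * e + (C + (C + e)) * e"
      by (intro approx N Y m)
    moreover have "2 * (2 * e + (C + (C + e)) * e) + e \<le> e * (10 + 10 * C)"
    proof -
      have "e * e \<le> e * 1" using e by (intro mult_left_mono) auto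
      moreover have "0 \<le> e * C" using e C0 by simp
      moreover have "2 * (2 * e + (C + (C + e)) * e) + e = 5 * e + 4 * (e * C) + 2 * (e * e)"
        "e * (10 + 10 * C) = 10 * e + 10 * (e * C)" by (simp_all add: algebra_simps)
      ultimately show ?thesis using e by linarith
    qed
    ultimately show ?case using elim(1) er by (simp add: abs_le_iff abs_less_iff)
  qed
  then show "\<exists>no. \<forall>n\<ge>no. norm ((\<integral>w. F (restrict (X n w) I) \<partial>M n) - (\<integral>w. F (restrict (Y w) I) \<partial>N)) < r"
    by (simp add: eventually_sequentially)
qed

text \<open>Applied to a constant sequence, the continuity theorem makes all integrals of bounded
  continuous functions agree. Indicators of lower orthants are limits of such functions, and the
  orthants form an intersection-stable generator of the product sigma-algebra.\<close>

theorem multivariate_levy_uniqueness: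
  fixes \<mu> \<nu> :: "('i \<Rightarrow> real) measure"
  assumes I: "finite I" and P: "prob_space \<mu>" "prob_space \<nu>"
    and s: "sets \<mu> = sets (\<Pi>\<^sub>M i\<in>I. borel)" "sets \<nu> = sets (\<Pi>\<^sub>M i\<in>I. borel)"
    and char: "\<And>\<tau>. (\<integral>x. iexp (\<Sum>i\<in>I. \<tau> i * x i) \<partial>\<mu>) = (\<integral>x. iexp (\<Sum>i\<in>I. \<tau> i * x i) \<partial>\<nu>)"
  shows "\<mu> = \<nu>"
proof -
  interpret \<mu>: prob_space \<mu> by fact
  interpret \<nu>: prob_space \<nu> by fact
  have sp: "space \<mu> = PiE I (\<lambda>_. UNIV)" "space \<nu> = PiE I (\<lambda>_. UNIV)"
    using s by (auto dest!: sets_eq_imp_space_eq simp: space_PiM)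
  have comp: "(\<lambda>x. x i) \<in> borel_measurable \<mu>" "(\<lambda>x. x i) \<in> borel_measurable \<nu>" if "i \<in> I" for i
    using that s by (simp_all cong: measurable_cong_sets)
  have eqF: "(\<integral>x. F x \<partial>\<mu>) = (\<integral>x. F x \<partial>\<nu>)"
    if F: "continuous_map (product_topology (\<lambda>_. euclideanreal) I) euclideanreal F"
      and C: "\<And>x. x \<in> extensional I \<Longrightarrow> \<bar>F x\<bar> \<le> C" for F C
  proof -
    have "(\<lambda>n::nat. \<integral>x. F (restrict x I) \<partial>\<mu>) \<longlonglongrightarrow> (\<integral>x. F (restrict x I) \<partial>\<nu>)"
      by (rule multivariate_levy_continuity[OF I P _ _ _ F C]) (use comp char in auto)
    then have "(\<integral>x. F (restrict x I) \<partial>\<mu>) = (\<integral>x. F (restrict x I) \<partial>\<nu>)" by (simp add: LIMSEQ_const_iff)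
    moreover have "(\<integral>x. F (restrict x I) \<partial>\<mu>) = (\<integral>x. F x \<partial>\<mu>)" "(\<integral>x. F (restrict x I) \<partial>\<nu>) = (\<integral>x. F x \<partial>\<nu>)"
      by (intro Bochner_Integration.integral_cong; auto simp: sp)+
    ultimately show ?thesis by simp
  qed
  have box: "measure \<mu> (PiE I (\<lambda>i. {..a i})) = measure \<nu> (PiE I (\<lambda>i. {..a i}))" for a
  proof -
    \<comment> \<open>For k > 0 this is 1 for y \<le> 0 and 0 for y \<ge> 1/k, so the products
      \<open>F k\<close> tend pointwise to the indicator of the orthant.\<close>
    define \<phi> where "\<phi> k y = max 0 (min 1 (1 - real k * y))" for k :: nat and y :: real
    define F where "F k x = (\<Prod>i\<in>I. \<phi> k (x i - a i))" for k and x :: "'i \<Rightarrow> real"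
    have \<phi>: "0 \<le> \<phi> k y" "\<phi> k y \<le> 1" for k y by (auto simp: \<phi>_def)
    have Fb: "\<bar>F k x\<bar> \<le> 1" for k x
      unfolding F_def abs_prod using \<phi> by (intro prod_le_1) auto
    have Fc: "continuous_map (product_topology (\<lambda>_. euclideanreal) I) euclideanreal (F k)" for k
      unfolding F_def \<phi>_def
      by (intro continuous_map_prod I continuous_map_real_max continuous_map_real_min continuous_map_diff
        continuous_map_real_mult continuous_map_product_projection) auto
    have lim: "(\<lambda>k. F k x) \<longlonglongrightarrow> indicator (PiE I (\<lambda>i. {..a i})) x" if "x \<in> PiE I (\<lambda>_. UNIV)" for x
    proof -
      have "(\<lambda>k. \<phi> k (x i - a i)) \<longlonglongrightarrow> indicator {..a i} (x i)" for i
      proof (cases "x i \<le> a i")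
        case True
        then have "\<phi> k (x i - a i) = 1" for k
          by (auto simp: \<phi>_def max_def min_def mult_nonneg_nonpos)
        then show ?thesis using True by simp
      next
        case False
        then obtain K :: nat where K: "1 < real K * (x i - a i)" using reals_Archimedean3[of "x i - a i"] by auto
        have "\<forall>\<^sub>F k in sequentially. \<phi> k (x i - a i) = 0"
          using eventually_ge_at_top[of K]
        proof eventually_elim
          case (elim k)
          then have "real K * (x i - a i) \<le> real k * (x i - a i)" using False by (intro mult_right_mono) auto
          then show ?case using K by (auto simp: \<phi>_def)
        qed
        then show ?thesis using False by (simp add: tendsto_eventually)
      qed
      then have "(\<lambda>k. F k x) \<longlonglongrightarrow> (\<Prod>i\<in>I. indicator {..a i} (x i))" unfolding F_def by (rule tendsto_prod)
      also have "(\<Prod>i\<in>I. indicator {..a i} (x i)) = (indicator (PiE I (\<lambda>i. {..a i})) x :: real)"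
        using that I by (auto simp: indicator_def PiE_iff prod_zero_iff)
      finally show ?thesis .
    qed
    have Fm: "F k \<in> borel_measurable (\<Pi>\<^sub>M i\<in>I. borel)" for k by (rule borel_measurable_PiM_continuous_map[OF I Fc])
    have bs: "PiE I (\<lambda>i. {..a i}) \<in> sets (\<Pi>\<^sub>M i\<in>I. borel)" using I by (intro sets_PiM_I_finite) auto
    have L: "(\<lambda>k. \<integral>x. F k x \<partial>Q) \<longlonglongrightarrow> measure Q (PiE I (\<lambda>i. {..a i}))"
      if Q: "prob_space Q" "sets Q = sets (\<Pi>\<^sub>M i\<in>I. borel)" "space Q = PiE I (\<lambda>_. UNIV)" for Q
    proof -
      interpret Q: prob_space Q by fact
      have "(\<lambda>k. \<integral>x. F k x \<partial>Q) \<longlonglongrightarrow> (\<integral>x. indicator (PiE I (\<lambda>i. {..a i})) x \<partial>Q)"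
      proof (rule integral_dominated_convergence[where w="\<lambda>_. 1"])
        show "AE x in Q. (\<lambda>k. F k x) \<longlonglongrightarrow> indicator (PiE I (\<lambda>i. {..a i})) x" using lim Q by auto
        show "F k \<in> borel_measurable Q" for k using Fm Q by (simp cong: measurable_cong_sets)
        show "indicat_real (PiE I (\<lambda>i. {..a i})) \<in> borel_measurable Q"
          using bs Q by (intro borel_measurable_indicator) auto
      qed (use Fb in auto)
      moreover have "PiE I (\<lambda>i. {..a i}) \<inter> space Q = PiE I (\<lambda>i. {..a i})" using Q(3) by auto
      ultimately show ?thesis using bs Q(2) by simp
    qed
    show ?thesis
      using LIMSEQ_unique[OF L[OF P(1) s(1) sp(1)]] L[OF P(2) s(2) sp(2)] eqF[OF Fc Fb] by simp
  qed
  \<comment> \<open>Countably many half-lines cover the line, which lets boxes of half-lines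
    generate the product sigma-algebra.\<close>
  have cover: "\<exists>S\<subseteq>range atMost. countable S \<and> (UNIV :: real set) = \<Union>S"
  proof (intro exI[of _ "range (\<lambda>n::nat. {..real n})"] conjI)
    show "UNIV = (\<Union>n::nat. {..real n})" using real_arch_simple by auto
  qed auto
  let ?P = "{{f \<in> PiE I (\<lambda>_. UNIV :: real set). \<forall>i\<in>j. f i \<in> A i} | A j. j \<in> {I} \<and> A \<in> Pi j (\<lambda>_. range atMost)}"
  let ?G = "range (\<lambda>a. PiE I (\<lambda>i. {..a i :: real}))"
  have "?P = ?G"
  proof (intro equalityI subsetI)
    fix x assume "x \<in> ?P"
    then obtain A where A: "x = {f \<in> PiE I (\<lambda>_. UNIV :: real set). \<forall>i\<in>I. f i \<in> A i}" "A \<in> Pi I (\<lambda>_. range atMost)" by blast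
    then have "\<forall>i\<in>I. \<exists>a. A i = {..a}" by blast
    then obtain a where "\<And>i. i \<in> I \<Longrightarrow> A i = {..a i}" by metis
    then have "x = PiE I (\<lambda>i. {..a i})" using A(1) by (auto simp: PiE_def Pi_def extensional_def)
    then show "x \<in> ?G" by blast
  next
    fix x assume "x \<in> ?G"
    then obtain a where "x = PiE I (\<lambda>i. {..a i})" by blast
    then have "x = {f \<in> PiE I (\<lambda>_. UNIV :: real set). \<forall>i\<in>I. f i \<in> {..a i}}"
      by (auto simp: PiE_def extensional_def)
    then show "x \<in> ?P" by (intro CollectI exI[of _ "\<lambda>i. {..a i}"] exI[of _ I] conjI) auto
  qed
  note PG = this
  have "sets (\<Pi>\<^sub>M i\<in>I. borel) = sets (sigma (PiE I (\<lambda>_. UNIV)) ?P)"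
    unfolding borel_eq_atMost by (rule sets_PiM_sigma) (use cover I in auto)
  also have "\<dots> = sigma_sets (PiE I (\<lambda>_. UNIV)) ?G"
    unfolding PG by (rule sets_measure_of) (auto simp: PiE_iff)
  finally have gen: "sets (\<Pi>\<^sub>M i\<in>I. borel) = sigma_sets (PiE I (\<lambda>_. UNIV :: real set)) ?G" .
  show ?thesis
  proof (rule measure_eqI_generator_eq[where E = ?G and \<Omega> = "PiE I (\<lambda>_. UNIV)" and A = "\<lambda>n. PiE I (\<lambda>_. {..real n})"])
    show "Int_stable ?G"
    proof (rule Int_stableI_image)
      fix a b :: "'i \<Rightarrow> real"
      show "\<exists>c\<in>UNIV. PiE I (\<lambda>i. {..a i}) \<inter> PiE I (\<lambda>i. {..b i}) = PiE I (\<lambda>i. {..c i})"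
        by (intro bexI[of _ "\<lambda>i. min (a i) (b i)"]) (auto simp: PiE_iff)
    qed
    show "emeasure \<mu> X = emeasure \<nu> X" if "X \<in> ?G" for X
      using that box by (auto simp: \<mu>.emeasure_eq_measure \<nu>.emeasure_eq_measure)
    show "(\<Union>n. PiE I (\<lambda>_. {..real n})) = PiE I (\<lambda>_. UNIV)"
    proof (intro equalityI subsetI)
      fix x :: "'i \<Rightarrow> real" assume x: "x \<in> PiE I (\<lambda>_. UNIV)"
      obtain n :: nat where "Max (insert 0 (x ` I)) \<le> real n" using real_arch_simple by blast
      then have "x i \<le> real n" if "i \<in> I" for i using I that by simp
      then show "x \<in> (\<Union>n. PiE I (\<lambda>_. {..real n}))" using x by (auto simp: PiE_iff)
    qed auto
  qed (use s gen \<mu>.emeasure_finite in \<open>auto simp: PiE_iff\<close>)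
qed

section \<open>Gaussian processes with a given covariance\<close>

text \<open>Completing the square moves the real part of \<open>z\<close> into a translation of
  Lebesgue measure; what remains is the characteristic function at the imaginary part. The argument
  is complex because a real tilt and a Fourier variable will occur in one exponent.\<close>

lemma std_normal_complex_exp:
  fixes z :: complex
  shows "integrable std_normal_distribution (\<lambda>x. exp (z * complex_of_real x))"
    and "(\<integral>x. exp (z * complex_of_real x) \<partial>std_normal_distribution) = exp (z\<^sup>2 / 2)"
proof -
  define a b where "a = Re z" and "b = Im z"
  have z: "z = Complex a b" by (simp add: a_def b_def)
  define g where "g x = std_normal_density x *\<^sub>R exp (z * complex_of_real x)" for x
  interpret real_distribution std_normal_distribution by (rule real_dist_normal_dist)
  \<comment> \<open>At a + x the real part \<open>a\<close> of the exponent cancels against the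
    cross term of the square; up to a constant only exp (i b x) is left beside the density.\<close>
  have shift: "g (a + 1 * x) = exp (complex_of_real (a\<^sup>2 / 2) + \<i> * (b * a)) * (std_normal_density x *\<^sub>R iexp (b * x))" for x
  proof -
    have "complex_of_real (exp (- (a + x)\<^sup>2 / 2)) * exp (z * complex_of_real (a + x))
        = exp (complex_of_real (a\<^sup>2 / 2) + \<i> * (b * a)) * (complex_of_real (exp (- x\<^sup>2 / 2)) * iexp (b * x))"
      unfolding exp_of_real[symmetric] exp_add[symmetric]
      by (rule arg_cong[where f = exp]) (simp add: z complex_eq_iff power2_eq_square field_simps)
    then show ?thesis
      by (simp add: g_def std_normal_density_def scaleR_conv_of_real)
  qed
  have i1: "integrable lborel (\<lambda>x. std_normal_density x *\<^sub>R iexp (b * x))"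
    using integrable_iexp[of "\<lambda>x. b * x"] by (simp add: integrable_density)
  have i2: "(\<integral>x. std_normal_density x *\<^sub>R iexp (b * x) \<partial>lborel) = complex_of_real (exp (- (b\<^sup>2) / 2))"
    using char_std_normal_distribution by (simp add: char_def integral_density fun_eq_iff)
  have [measurable]: "g \<in> borel_measurable borel" unfolding g_def by measurable
  have "integrable lborel (\<lambda>x. g (a + 1 * x))" unfolding shift by (rule integrable_mult_right, rule i1)
  then have "integrable lborel g" using lborel_integrable_real_affine_iff[of 1 g a] by simp
  then show "integrable std_normal_distribution (\<lambda>x. exp (z * complex_of_real x))"
    by (simp add: integrable_density g_def[abs_def])
  have "(\<integral>x. exp (z * complex_of_real x) \<partial>std_normal_distribution) = (\<integral>x. g x \<partial>lborel)"
    by (simp add: integral_density g_def)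
  also have "\<dots> = (\<integral>x. g (a + 1 * x) \<partial>lborel)" using lborel_integral_real_affine[of 1 g a] by simp
  also have "\<dots> = exp (complex_of_real (a\<^sup>2 / 2) + \<i> * (b * a)) * complex_of_real (exp (- (b\<^sup>2) / 2))"
    unfolding shift by (simp only: integral_mult_right_zero i2)
  also have "\<dots> = exp (z\<^sup>2 / 2)"
    unfolding exp_of_real[symmetric] exp_add[symmetric]
    by (rule arg_cong[where f = exp]) (simp add: z complex_eq_iff power2_eq_square field_simps)
  finally show "(\<integral>x. exp (z * complex_of_real x) \<partial>std_normal_distribution) = exp (z\<^sup>2 / 2)" .
qed

lemma PiM_std_normal_complex_exp:
  fixes z :: "nat \<Rightarrow> complex"
  shows "integrable (\<Pi>\<^sub>M j\<in>{..<k}. std_normal_distribution) (\<lambda>x. exp (\<Sum>j<k. z j * complex_of_real (x j)))"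
    and "(\<integral>x. exp (\<Sum>j<k. z j * complex_of_real (x j)) \<partial>(\<Pi>\<^sub>M j\<in>{..<k}. std_normal_distribution))
        = exp ((\<Sum>j<k. (z j)\<^sup>2) / 2)"
proof -
  interpret real_distribution std_normal_distribution by (rule real_dist_normal_dist)
  interpret product_sigma_finite "\<lambda>_::nat. std_normal_distribution" ..
  note p = product_integrable_prod[of "{..<k}" "\<lambda>j x. exp (z j * complex_of_real x)"]
    product_integral_prod[of "{..<k}" "\<lambda>j x. exp (z j * complex_of_real x)"]
  show "integrable (\<Pi>\<^sub>M j\<in>{..<k}. std_normal_distribution) (\<lambda>x. exp (\<Sum>j<k. z j * complex_of_real (x j)))"
    using p(1) std_normal_complex_exp(1) by (simp add: exp_sum)
  show "(\<integral>x. exp (\<Sum>j<k. z j * complex_of_real (x j)) \<partial>(\<Pi>\<^sub>M j\<in>{..<k}. std_normal_distribution))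
        = exp ((\<Sum>j<k. (z j)\<^sup>2) / 2)"
    using p(2) std_normal_complex_exp by (simp add: exp_sum sum_divide_distrib)
qed

section \<open>Factorisation of positive semidefinite kernels\<close>

definition psd_kernel :: "'i set \<Rightarrow> ('i \<Rightarrow> 'i \<Rightarrow> real) \<Rightarrow> bool" where
  "psd_kernel I K \<longleftrightarrow> (\<forall>x\<in>I. \<forall>y\<in>I. K x y = K y x) \<and>
     (\<forall>J c. finite J \<longrightarrow> J \<subseteq> I \<longrightarrow> 0 \<le> (\<Sum>x\<in>J. \<Sum>y\<in>J. c x * c y * K x y))"

lemma psd_kernel_subset: "psd_kernel I K \<Longrightarrow> J \<subseteq> I \<Longrightarrow> psd_kernel J K"
  unfolding psd_kernel_def by blast

text \<open>Cholesky factorisation: peel off one index and pass to the Schur complement.\<close>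

lemma psd_kernel_factorization:
  assumes "finite J" "psd_kernel J K"
  shows "\<exists>(k::nat) a. \<forall>x\<in>J. \<forall>y\<in>J. K x y = (\<Sum>j<k. a x j * a y j)"
  using assms
proof (induction J arbitrary: K)
  case (insert h J)
  have sym: "K x y = K y x" if "x \<in> insert h J" "y \<in> insert h J" for x y
    using insert.prems that unfolding psd_kernel_def by blast
  have pos: "0 \<le> (\<Sum>x\<in>insert h J. \<Sum>y\<in>insert h J. c x * c y * K x y)" for c
    using insert.prems insert.hyps(1) unfolding psd_kernel_def by blast
  \<comment> \<open>The quadratic form as a polynomial in the coefficient \<open>t\<close> of the
    new index; each case below draws its conclusion from one well chosen \<open>t\<close>.\<close>
  have expand: "(\<Sum>x\<in>insert h J. \<Sum>y\<in>insert h J. (c(h := t)) x * (c(h := t)) y * K x y)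
     = t\<^sup>2 * K h h + 2 * t * (\<Sum>x\<in>J. c x * K h x) + (\<Sum>x\<in>J. \<Sum>y\<in>J. c x * c y * K x y)" for c t
  proof -
    have n: "x \<noteq> h" if "x \<in> J" for x using that insert.hyps by auto
    have "(\<Sum>x\<in>insert h J. \<Sum>y\<in>insert h J. (c(h := t)) x * (c(h := t)) y * K x y)
      = t * t * K h h + (\<Sum>y\<in>J. t * c y * K h y) + (\<Sum>x\<in>J. c x * t * K x h + (\<Sum>y\<in>J. c x * c y * K x y))"
      using insert.hyps n by (simp cong: sum.cong)
    also have "(\<Sum>x\<in>J. c x * t * K x h + (\<Sum>y\<in>J. c x * c y * K x y))
      = (\<Sum>x\<in>J. t * c x * K h x) + (\<Sum>x\<in>J. \<Sum>y\<in>J. c x * c y * K x y)"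
      unfolding sum.distrib[symmetric] using sym by (intro sum.cong refl) (simp add: mult_ac)
    finally show ?thesis
      by (simp add: power2_eq_square sum_distrib_left mult.assoc)
  qed
  have hh: "0 \<le> K h h"
    using pos[of "(\<lambda>_. 0)(h := 1)"] unfolding expand by simp
  show ?case
  proof (cases "K h h = 0")
    case True
    have zero: "K h y = 0" if y: "y \<in> J" for y
    proof (rule ccontr)
      assume ne: "K h y \<noteq> 0"
      define c where "c = (\<lambda>x. if x = y then 1 else 0 :: real)"
      have s1: "(\<Sum>x\<in>J. c x * K h x) = K h y"
        using y insert.hyps(1) by (simp add: c_def if_distrib[of "\<lambda>u. u * _"] cong: if_cong)
      \<comment> \<open>With K h h = 0 the form is affine in \<open>t\<close>, and this
        \<open>t\<close> would give it the value -1.\<close>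
      define t where "t = - ((\<Sum>x\<in>J. \<Sum>y\<in>J. c x * c y * K x y) + 1) / (2 * K h y)"
      have "0 \<le> 2 * t * K h y + (\<Sum>x\<in>J. \<Sum>y\<in>J. c x * c y * K x y)"
        using pos[of "c(h := t)"] unfolding expand s1 True by simp
      moreover have "2 * t * K h y = - ((\<Sum>x\<in>J. \<Sum>y\<in>J. c x * c y * K x y) + 1)"
        using ne by (simp add: t_def)
      ultimately show False by simp
    qed
    from insert.IH[OF psd_kernel_subset[OF insert.prems]] obtain k :: nat and a where
      a: "\<forall>x\<in>J. \<forall>y\<in>J. K x y = (\<Sum>j<k. a x j * a y j)" by blast
    show ?thesis
    proof (intro exI ballI)
      fix x y assume "x \<in> insert h J" "y \<in> insert h J"
      then show "K x y = (\<Sum>j<k. (a(h := \<lambda>_. 0)) x j * (a(h := \<lambda>_. 0)) y j)"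
        using True zero a sym[of x h] by auto
    qed
  next
    case False
    then have p: "K h h > 0" using hh by simp
    define K' where "K' x y = K x y - K h x * K h y / K h h" for x y
    have "psd_kernel J K'"
      unfolding psd_kernel_def
    proof (intro conjI ballI allI impI)
      fix x y assume "x \<in> J" "y \<in> J"
      then show "K' x y = K' y x" using sym[of x y] by (simp add: K'_def)
    next
      fix J' and c :: "_ \<Rightarrow> real" assume J': "finite J'" "J' \<subseteq> J"
      define c' where "c' x = (if x \<in> J' then c x else 0)" for x
      define S where "S = (\<Sum>x\<in>J. c' x * K h x)"
      have "(\<Sum>x\<in>J'. \<Sum>y\<in>J'. c x * c y * K' x y) = (\<Sum>x\<in>J. \<Sum>y\<in>J. c' x * c' y * K' x y)"
      proof -
        have "(\<Sum>x\<in>J. \<Sum>y\<in>J. c' x * c' y * K' x y) = (\<Sum>x\<in>J'. \<Sum>y\<in>J. c' x * c' y * K' x y)"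
          using J' insert.hyps(1) by (intro sum.mono_neutral_right) (auto simp: c'_def)
        also have "\<dots> = (\<Sum>x\<in>J'. \<Sum>y\<in>J'. c' x * c' y * K' x y)"
          using J' insert.hyps(1) by (intro sum.cong refl sum.mono_neutral_right) (auto simp: c'_def)
        also have "\<dots> = (\<Sum>x\<in>J'. \<Sum>y\<in>J'. c x * c y * K' x y)" by (simp add: c'_def)
        finally show ?thesis by simp
      qed
      also have "\<dots> = (\<Sum>x\<in>J. \<Sum>y\<in>J. c' x * c' y * K x y) - (\<Sum>x\<in>J. \<Sum>y\<in>J. (c' x * K h x) * (c' y * K h y)) / K h h"
        by (simp add: K'_def right_diff_distrib sum_subtractf sum_divide_distrib mult_ac)
      also have "(\<Sum>x\<in>J. \<Sum>y\<in>J. (c' x * K h x) * (c' y * K h y)) = S * S"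
        by (simp add: S_def sum_product)
      \<comment> \<open>The value -S / K h h of \<open>t\<close> minimises the form, and the minimum
        is the form of the Schur complement.\<close>
      also have "(\<Sum>x\<in>J. \<Sum>y\<in>J. c' x * c' y * K x y) - S * S / K h h
         = (- S / K h h)\<^sup>2 * K h h + 2 * (- S / K h h) * S + (\<Sum>x\<in>J. \<Sum>y\<in>J. c' x * c' y * K x y)"
        using p by (simp add: power2_eq_square field_simps)
      also have "\<dots> \<ge> 0"
        using pos[of "c'(h := - S / K h h)"] unfolding expand S_def by simp
      finally show "0 \<le> (\<Sum>x\<in>J'. \<Sum>y\<in>J'. c x * c y * K' x y)" .
    qed
    from insert.IH[OF this] obtain k :: nat and a where
      a: "\<forall>x\<in>J. \<forall>y\<in>J. K' x y = (\<Sum>j<k. a x j * a y j)" by blast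
    \<comment> \<open>Column \<open>k\<close> reproduces the subtracted rank-one term; in the
      earlier columns the row of \<open>h\<close> is zero.\<close>
    define b where "b x j = (if j = k then K h x / sqrt (K h h) else if x = h then 0 else a x j)" for x j
    have sq: "u / sqrt (K h h) * (v / sqrt (K h h)) = u * v / K h h" for u v
      using p by (simp add: field_simps)
    show ?thesis
    proof (intro exI ballI)
      fix x y assume xy: "x \<in> insert h J" "y \<in> insert h J"
      have "(\<Sum>j<k. b x j * b y j) = (if x = h \<or> y = h then 0 else K' x y)"
        using xy a by (auto simp: b_def intro!: sum.cong)
      then show "K x y = (\<Sum>j<Suc k. b x j * b y j)"
        using xy p sym[of x h] by (auto simp: b_def sq K'_def)
    qed
  qed
qed simp

section \<open>Gaussian laws and Kolmogorov extension\<close>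

text \<open>A degenerate covariance has no density, so the law is pinned down by its complex
  exponential moments. The choice operator makes it a function of \<open>K\<close> and
  \<open>J\<close>, as a projective family requires.\<close>

definition gaussian_fidi :: "('i \<Rightarrow> 'i \<Rightarrow> real) \<Rightarrow> 'i set \<Rightarrow> ('i \<Rightarrow> real) measure" where
  "gaussian_fidi K J = (SOME \<mu>. prob_space \<mu> \<and> sets \<mu> = sets (\<Pi>\<^sub>M i\<in>J. borel) \<and>
     (\<forall>z. integrable \<mu> (\<lambda>x. exp (\<Sum>i\<in>J. z i * complex_of_real (x i))) \<and>
       (\<integral>x. exp (\<Sum>i\<in>J. z i * complex_of_real (x i)) \<partial>\<mu>) =
         exp ((\<Sum>x\<in>J. \<Sum>y\<in>J. z x * z y * complex_of_real (K x y)) / 2)))"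

text \<open>A factorisation of \<open>K\<close> turns independent standard normals into a vector
  with covariance \<open>K\<close>; its exponential moments are those of the normals at the
  transformed arguments.\<close>

lemma gaussian_fidi:
  assumes "finite J" "psd_kernel J K"
  shows "prob_space (gaussian_fidi K J)" "sets (gaussian_fidi K J) = sets (\<Pi>\<^sub>M i\<in>J. borel)"
    "integrable (gaussian_fidi K J) (\<lambda>x. exp (\<Sum>i\<in>J. z i * complex_of_real (x i)))"
    "(\<integral>x. exp (\<Sum>i\<in>J. z i * complex_of_real (x i)) \<partial>gaussian_fidi K J) =
         exp ((\<Sum>x\<in>J. \<Sum>y\<in>J. z x * z y * complex_of_real (K x y)) / 2)"
proof -
  from psd_kernel_factorization[OF assms] obtain k :: nat and a where
    a: "\<And>x y. x \<in> J \<Longrightarrow> y \<in> J \<Longrightarrow> K x y = (\<Sum>j<k. a x j * a y j)" by metis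
  let ?N = "\<Pi>\<^sub>M j\<in>{..<k}. std_normal_distribution"
  let ?T = "\<lambda>x. \<lambda>i\<in>J. \<Sum>j<k. a i j * x j"
  interpret std: real_distribution std_normal_distribution by (rule real_dist_normal_dist)
  have N: "prob_space ?N" by (intro prob_space_PiM std.prob_space_axioms)
  have T: "?T \<in> measurable ?N (\<Pi>\<^sub>M i\<in>J. borel)"
    by (intro measurable_restrict borel_measurable_sum) auto
  let ?\<mu> = "distr ?N (\<Pi>\<^sub>M i\<in>J. borel) ?T"
  have lin: "(\<Sum>i\<in>J. z i * complex_of_real (?T x i)) = (\<Sum>j<k. (\<Sum>i\<in>J. z i * complex_of_real (a i j)) * complex_of_real (x j))"
    for z x
    by (simp add: sum_distrib_left sum_distrib_right mult.assoc) (rule sum.swap)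
  have quad: "(\<Sum>j<k. (\<Sum>i\<in>J. z i * complex_of_real (a i j))\<^sup>2) = (\<Sum>x\<in>J. \<Sum>y\<in>J. z x * z y * complex_of_real (K x y))" for z
  proof -
    have "(\<Sum>j<k. (\<Sum>i\<in>J. z i * complex_of_real (a i j))\<^sup>2)
       = (\<Sum>j<k. \<Sum>x\<in>J. \<Sum>y\<in>J. z x * z y * (a x j * a y j))"
      by (simp add: power2_eq_square sum_product mult_ac)
    also have "\<dots> = (\<Sum>x\<in>J. \<Sum>y\<in>J. \<Sum>j<k. z x * z y * (a x j * a y j))"
      by (subst sum.swap) (intro sum.cong refl sum.swap)
    also have "\<dots> = (\<Sum>x\<in>J. \<Sum>y\<in>J. z x * z y * complex_of_real (K x y))"
      using a by (intro sum.cong refl) (simp add: sum_distrib_left)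
    finally show ?thesis .
  qed
  have m: "(\<lambda>x. exp (\<Sum>i\<in>J. z i * complex_of_real (x i))) \<in> borel_measurable (\<Pi>\<^sub>M i\<in>J. borel)" for z :: "_ \<Rightarrow> complex"
    by measurable
  have "prob_space ?\<mu> \<and> sets ?\<mu> = sets (\<Pi>\<^sub>M i\<in>J. borel) \<and>
     (\<forall>z. integrable ?\<mu> (\<lambda>x. exp (\<Sum>i\<in>J. z i * complex_of_real (x i))) \<and>
       (\<integral>x. exp (\<Sum>i\<in>J. z i * complex_of_real (x i)) \<partial>?\<mu>) =
         exp ((\<Sum>x\<in>J. \<Sum>y\<in>J. z x * z y * complex_of_real (K x y)) / 2))"
  proof (intro conjI allI)
    show "prob_space ?\<mu>" by (rule prob_space.prob_space_distr[OF N T])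
    fix z
    show "integrable ?\<mu> (\<lambda>x. exp (\<Sum>i\<in>J. z i * complex_of_real (x i)))"
      by (subst integrable_distr_eq[OF T m]) (simp only: lin PiM_std_normal_complex_exp)
    show "(\<integral>x. exp (\<Sum>i\<in>J. z i * complex_of_real (x i)) \<partial>?\<mu>) =
         exp ((\<Sum>x\<in>J. \<Sum>y\<in>J. z x * z y * complex_of_real (K x y)) / 2)"
      by (subst integral_distr[OF T m]) (simp only: lin PiM_std_normal_complex_exp quad)
  qed simp
  from someI[where P = "\<lambda>\<mu>. prob_space \<mu> \<and> sets \<mu> = sets (\<Pi>\<^sub>M i\<in>J. borel) \<and>
     (\<forall>z. integrable \<mu> (\<lambda>x. exp (\<Sum>i\<in>J. z i * complex_of_real (x i))) \<and>
       (\<integral>x. exp (\<Sum>i\<in>J. z i * complex_of_real (x i)) \<partial>\<mu>) =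
         exp ((\<Sum>x\<in>J. \<Sum>y\<in>J. z x * z y * complex_of_real (K x y)) / 2))", OF this, folded gaussian_fidi_def]
  show "prob_space (gaussian_fidi K J)" "sets (gaussian_fidi K J) = sets (\<Pi>\<^sub>M i\<in>J. borel)"
    "integrable (gaussian_fidi K J) (\<lambda>x. exp (\<Sum>i\<in>J. z i * complex_of_real (x i)))"
    "(\<integral>x. exp (\<Sum>i\<in>J. z i * complex_of_real (x i)) \<partial>gaussian_fidi K J) =
         exp ((\<Sum>x\<in>J. \<Sum>y\<in>J. z x * z y * complex_of_real (K x y)) / 2)" by auto
qed

text \<open>A linear functional of the coordinates in \<open>J\<close> is one of those in
  \<open>H\<close> with zero coefficients added, so both laws have the same characteristic function
  and the uniqueness theorem applies.\<close>

lemma gaussian_fidi_consistent: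
  assumes K: "psd_kernel I K" and H: "J \<subseteq> H" "finite H" "H \<subseteq> I"
  shows "gaussian_fidi K J = distr (gaussian_fidi K H) (\<Pi>\<^sub>M i\<in>J. borel) (\<lambda>x. restrict x J)"
proof -
  have J: "finite J" "psd_kernel J K" "psd_kernel H K"
    using H psd_kernel_subset[OF K] finite_subset by auto
  note GJ = gaussian_fidi[OF J(1,2)] and GH = gaussian_fidi[OF H(2) J(3)]
  have r: "(\<lambda>x. restrict x J) \<in> measurable (gaussian_fidi K H) (\<Pi>\<^sub>M i\<in>J. borel)"
    using measurable_restrict_subset[OF H(1)] GH(2) by (simp cong: measurable_cong_sets)
  interpret H: prob_space "gaussian_fidi K H" by (rule GH(1))
  show ?thesis
  proof (rule multivariate_levy_uniqueness[OF J(1) GJ(1) H.prob_space_distr[OF r] GJ(2)])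
    fix \<tau> :: "'a \<Rightarrow> real"
    define z where "z i = (if i \<in> J then \<i> * complex_of_real (\<tau> i) else 0)" for i
    have i1: "iexp (\<Sum>i\<in>J. \<tau> i * x i) = exp (\<Sum>i\<in>J. z i * complex_of_real (x i))" for x
      by (rule arg_cong[where f = exp]) (simp add: z_def sum_distrib_left mult.assoc)
    have i2: "(\<Sum>i\<in>J. z i * complex_of_real (x i)) = (\<Sum>i\<in>H. z i * complex_of_real (x i))" for x
      using H by (intro sum.mono_neutral_left) (auto simp: z_def)
    have q: "(\<Sum>x\<in>H. \<Sum>y\<in>H. z x * z y * complex_of_real (K x y)) = (\<Sum>x\<in>J. \<Sum>y\<in>J. z x * z y * complex_of_real (K x y))"
    proof -
      have "(\<Sum>x\<in>H. \<Sum>y\<in>H. z x * z y * complex_of_real (K x y)) = (\<Sum>x\<in>J. \<Sum>y\<in>H. z x * z y * complex_of_real (K x y))"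
        using H by (intro sum.mono_neutral_right) (auto simp: z_def)
      also have "\<dots> = (\<Sum>x\<in>J. \<Sum>y\<in>J. z x * z y * complex_of_real (K x y))"
        using H by (intro sum.cong refl sum.mono_neutral_right) (auto simp: z_def)
      finally show ?thesis .
    qed
    have "(\<integral>x. iexp (\<Sum>i\<in>J. \<tau> i * x i) \<partial>distr (gaussian_fidi K H) (\<Pi>\<^sub>M i\<in>J. borel) (\<lambda>x. restrict x J))
      = (\<integral>x. iexp (\<Sum>i\<in>J. \<tau> i * restrict x J i) \<partial>gaussian_fidi K H)"
      by (rule integral_distr[OF r]) measurable
    also have "\<dots> = (\<integral>x. exp (\<Sum>i\<in>H. z i * complex_of_real (x i)) \<partial>gaussian_fidi K H)"
      unfolding i1 by (intro Bochner_Integration.integral_cong refl) (simp add: i2[symmetric])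
    also have "\<dots> = (\<integral>x. iexp (\<Sum>i\<in>J. \<tau> i * x i) \<partial>gaussian_fidi K J)"
      unfolding i1 GJ(4) GH(4) q ..
    finally show "(\<integral>x. iexp (\<Sum>i\<in>J. \<tau> i * x i) \<partial>gaussian_fidi K J) =
      (\<integral>x. iexp (\<Sum>i\<in>J. \<tau> i * x i) \<partial>distr (gaussian_fidi K H) (\<Pi>\<^sub>M i\<in>J. borel) (\<lambda>x. restrict x J))" ..
  qed simp
qed

text \<open>Coordinates are addressed through a map \<open>f\<close> on an auxiliary index set that
  need not be injective: an exponent may mention the same coordinate several times without a case
  distinction.\<close>

theorem gaussian_process_exists:
  assumes K: "psd_kernel I K"
  obtains W :: "('i \<Rightarrow> real) measure" where "prob_space W" "sets W = sets (\<Pi>\<^sub>M i\<in>I. borel)"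
    "\<And>A f z. finite (A :: 'k set) \<Longrightarrow> f ` A \<subseteq> I \<Longrightarrow> integrable W (\<lambda>x. exp (\<Sum>a\<in>A. z a * complex_of_real (x (f a))))"
    "\<And>A f z. finite (A :: 'k set) \<Longrightarrow> f ` A \<subseteq> I \<Longrightarrow> (\<integral>x. exp (\<Sum>a\<in>A. z a * complex_of_real (x (f a))) \<partial>W)
       = exp ((\<Sum>a\<in>A. \<Sum>b\<in>A. z a * z b * complex_of_real (K (f a) (f b))) / 2)"
proof -
  have psd: "psd_kernel J K" if "J \<subseteq> I" for J using psd_kernel_subset[OF K that] .
  interpret polish_projective I "gaussian_fidi K"
    by (intro polish_projective.intro projective_family.intro)
      (erule (2) gaussian_fidi_consistent[OF K], blast intro: gaussian_fidi(1) psd)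
  have r: "(\<lambda>x. restrict x J) \<in> measurable lim (\<Pi>\<^sub>M i\<in>J. borel)" if "J \<subseteq> I" for J
    using measurable_restrict_subset[OF that] by (simp cong: measurable_cong_sets)
  have d: "distr lim (\<Pi>\<^sub>M i\<in>J. borel) (\<lambda>x. restrict x J) = gaussian_fidi K J" if J: "J \<subseteq> I" "finite J" for J
  proof (rule measure_eqI)
    show "sets (distr lim (\<Pi>\<^sub>M i\<in>J. borel) (\<lambda>x. restrict x J)) = sets (gaussian_fidi K J)"
      using gaussian_fidi(2)[OF J(2) psd[OF J(1)]] by simp
    fix X assume "X \<in> sets (distr lim (\<Pi>\<^sub>M i\<in>J. borel) (\<lambda>x. restrict x J))"
    then have X: "X \<in> sets (\<Pi>\<^sub>M i\<in>J. borel)" by simp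
    show "emeasure (distr lim (\<Pi>\<^sub>M i\<in>J. borel) (\<lambda>x. restrict x J)) X = emeasure (gaussian_fidi K J) X"
      using emeasure_lim_emb[OF J X] by (simp add: emeasure_distr[OF r[OF J(1)] X] prod_emb_def space_PiM)
  qed
  have main: "integrable lim (\<lambda>x. exp (\<Sum>a\<in>A. z a * complex_of_real (x (f a)))) \<and>
      (\<integral>x. exp (\<Sum>a\<in>A. z a * complex_of_real (x (f a))) \<partial>lim)
       = exp ((\<Sum>a\<in>A. \<Sum>b\<in>A. z a * z b * complex_of_real (K (f a) (f b))) / 2)"
    if A: "finite A" "f ` A \<subseteq> I" for A :: "'k set" and f z
  proof -
    let ?J = "f ` A"
    \<comment> \<open>Coefficients that fall on the same coordinate are added up over the fibre of
      \<open>f\<close>.\<close>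
    define z' where "z' i = (\<Sum>a\<in>{a\<in>A. f a = i}. z a)" for i
    have J: "?J \<subseteq> I" "finite ?J" using A by auto
    have eq: "(\<Sum>a\<in>A. z a * g (f a)) = (\<Sum>i\<in>?J. z' i * g i)" for g :: "'i \<Rightarrow> complex"
    proof -
      have "(\<Sum>a\<in>A. z a * g (f a)) = (\<Sum>i\<in>?J. \<Sum>a\<in>{a\<in>A. f a = i}. z a * g (f a))"
        using sum.group[OF A(1) J(2), of f "\<lambda>a. z a * g (f a)"] by simp
      also have "\<dots> = (\<Sum>i\<in>?J. z' i * g i)"
        by (intro sum.cong refl) (auto simp: z'_def sum_distrib_right intro!: sum.cong)
      finally show ?thesis .
    qed
    have q: "(\<Sum>a\<in>A. \<Sum>b\<in>A. z a * z b * complex_of_real (K (f a) (f b))) =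
        (\<Sum>x\<in>?J. \<Sum>y\<in>?J. z' x * z' y * complex_of_real (K x y))"
    proof -
      have "(\<Sum>a\<in>A. \<Sum>b\<in>A. z a * z b * complex_of_real (K (f a) (f b)))
        = (\<Sum>a\<in>A. z a * (\<Sum>b\<in>A. z b * complex_of_real (K (f a) (f b))))"
        by (simp add: sum_distrib_left mult.assoc)
      also have "\<dots> = (\<Sum>x\<in>?J. z' x * (\<Sum>y\<in>?J. z' y * complex_of_real (K x y)))"
        unfolding eq[of "\<lambda>y. complex_of_real (K _ y)"] by (rule eq)
      finally show ?thesis by (simp add: sum_distrib_left mult.assoc)
    qed
    note G = gaussian_fidi(3,4)[OF J(2) psd[OF J(1)], of z', folded d[OF J]]
    have m: "(\<lambda>x. exp (\<Sum>i\<in>?J. z' i * complex_of_real (x i))) \<in> borel_measurable (\<Pi>\<^sub>M i\<in>?J. borel)"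
      by measurable
    have e: "exp (\<Sum>a\<in>A. z a * complex_of_real (x (f a))) = exp (\<Sum>i\<in>?J. z' i * complex_of_real (restrict x ?J i))" for x
      by (subst eq[of "\<lambda>i. complex_of_real (x i)"]) simp
    show ?thesis
      using G unfolding integrable_distr_eq[OF r[OF J(1)] m] integral_distr[OF r[OF J(1)] m] e q by simp
  qed
  show ?thesis
    by (rule that[of lim]) (use main P.prob_space_axioms in auto)
qed

section \<open>Density quotients\<close>

text \<open>\<open>S\<close> carries the part of \<open>P\<close> that is absolutely continuous with
  respect to \<open>Q\<close>, with real density \<open>p\<close>; the rest of \<open>P\<close> is
  singular because \<open>S\<close> has full \<open>Q\<close>-measure. This is the density quotient
  with the value infinity encoded by a set, a form that passes easily to products.\<close>

definition density_on :: "'a measure \<Rightarrow> 'a measure \<Rightarrow> ('a \<Rightarrow> real) \<Rightarrow> 'a set \<Rightarrow> bool" where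
  "density_on P Q p S \<longleftrightarrow> p \<in> borel_measurable Q \<and> (\<forall>x. 0 \<le> p x) \<and> S \<in> sets Q \<and> sets P = sets Q \<and>
     (AE x in Q. x \<in> S) \<and> density P (indicator S) = density Q (\<lambda>x. ennreal (p x))"

lemma density_on_emeasure:
  assumes d: "density_on P Q p S" and A: "A \<in> sets Q"
  shows "emeasure P (A \<inter> S) = (\<integral>\<^sup>+x. ennreal (p x) * indicator A x \<partial>Q)"
proof -
  have s: "sets P = sets Q" "S \<in> sets P" and [measurable]: "p \<in> borel_measurable Q"
    and e: "density P (indicator S) = density Q (\<lambda>x. ennreal (p x))"
    using d by (auto simp: density_on_def)
  have "emeasure P (A \<inter> S) = emeasure (density P (indicator S)) A"
    using A s by (subst emeasure_density) (auto simp: indicator_inter_arith[symmetric] Int_commute mult.commute)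
  also have "\<dots> = (\<integral>\<^sup>+x. ennreal (p x) * indicator A x \<partial>Q)"
    unfolding e using A by (subst emeasure_density) auto
  finally show ?thesis .
qed

lemma density_on_integrable:
  assumes d: "density_on P Q p S" and P: "prob_space P"
  shows "integrable Q p" "(\<integral>x. p x \<partial>Q) = measure P S" "(\<integral>x. p x \<partial>Q) \<le> 1"
proof -
  interpret P: prob_space P by fact
  have s: "sets P = sets Q" "S \<in> sets P" "p \<in> borel_measurable Q" "\<And>x. 0 \<le> p x"
    using d by (auto simp: density_on_def)
  have "space Q \<inter> S = S" using sets.sets_into_space[OF s(2)] sets_eq_imp_space_eq[OF s(1)] by auto
  then have "ennreal (measure P S) = (\<integral>\<^sup>+x. ennreal (p x) * indicator (space Q) x \<partial>Q)"
    using density_on_emeasure[OF d sets.top] by (simp add: P.emeasure_eq_measure)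
  also have "\<dots> = (\<integral>\<^sup>+x. ennreal (p x) \<partial>Q)" by (intro nn_integral_cong) auto
  finally have e: "(\<integral>\<^sup>+x. ennreal (p x) \<partial>Q) = ennreal (measure P S)" ..
  show i: "integrable Q p" using e s by (intro integrableI_nonneg) auto
  show "(\<integral>x. p x \<partial>Q) = measure P S"
    using e s by (subst integral_eq_nn_integral) auto
  then show "(\<integral>x. p x \<partial>Q) \<le> 1" by simp
qed

lemma density_on_integral:
  fixes f :: "'a \<Rightarrow> 'b::{banach, second_countable_topology}"
  assumes d: "density_on P Q p S" and f: "f \<in> borel_measurable Q"
  shows "(\<integral>x. indicator S x *\<^sub>R f x \<partial>P) = (\<integral>x. p x *\<^sub>R f x \<partial>Q)"
proof -
  have s: "sets P = sets Q" "S \<in> sets P" and p: "p \<in> borel_measurable Q" "\<And>x. 0 \<le> p x"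
    and e: "density P (indicator S) = density Q (\<lambda>x. ennreal (p x))"
    using d by (auto simp: density_on_def)
  have fP: "f \<in> borel_measurable P" using f s(1) by (simp cong: measurable_cong_sets)
  have "(\<integral>x. indicator S x *\<^sub>R f x \<partial>P) = (\<integral>x. f x \<partial>density P (\<lambda>x. ennreal (indicator S x)))"
    using s by (intro integral_density[symmetric] fP) auto
  also have "\<dots> = (\<integral>x. f x \<partial>density Q (\<lambda>x. ennreal (p x)))" unfolding e[symmetric] by (simp add: ennreal_indicator)
  also have "\<dots> = (\<integral>x. p x *\<^sub>R f x \<partial>Q)" using p f by (intro integral_density) auto
  finally show ?thesis .
qed

text \<open>The sets \<open>S\<close> and \<open>S'\<close> may differ, but both have full
  \<open>Q\<close>-measure; computing in two ways the mass that \<open>P\<close> gives to their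
  common part identifies the densities.\<close>

lemma density_on_unique:
  assumes Q: "prob_space Q" and d: "density_on P Q p S" and d': "density_on P Q p' S'"
  shows "AE x in Q. p x = p' x"
proof -
  interpret prob_space Q by fact
  have s: "S \<in> sets Q" "S' \<in> sets Q" "p \<in> borel_measurable Q" "p' \<in> borel_measurable Q" "\<And>x. 0 \<le> p x" "\<And>x. 0 \<le> p' x"
    and ae: "AE x in Q. x \<in> S \<and> x \<in> S'"
    using d d' by (auto simp: density_on_def)
  have "density Q (\<lambda>x. ennreal (p x)) = density Q (\<lambda>x. ennreal (p' x))"
  proof (rule measure_eqI)
    fix A assume "A \<in> sets (density Q (\<lambda>x. ennreal (p x)))"
    then have A: "A \<in> sets Q" by simp
    have "emeasure (density Q (\<lambda>x. ennreal (p x))) A = (\<integral>\<^sup>+x. ennreal (p x) * indicator A x \<partial>Q)"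
      using A s by (simp add: emeasure_density)
    also have "\<dots> = (\<integral>\<^sup>+x. ennreal (p x) * indicator (A \<inter> S') x \<partial>Q)"
      by (rule nn_integral_cong_AE) (use ae in \<open>eventually_elim, auto simp: indicator_def\<close>)
    also have "\<dots> = emeasure P (A \<inter> S' \<inter> S)" using A s by (intro density_on_emeasure[OF d, symmetric]) auto
    also have "\<dots> = emeasure P (A \<inter> S \<inter> S')" by (simp add: Int_ac)
    also have "\<dots> = (\<integral>\<^sup>+x. ennreal (p' x) * indicator (A \<inter> S) x \<partial>Q)" using A s by (intro density_on_emeasure[OF d']) auto
    also have "\<dots> = (\<integral>\<^sup>+x. ennreal (p' x) * indicator A x \<partial>Q)"
      by (rule nn_integral_cong_AE) (use ae in \<open>eventually_elim, auto simp: indicator_def\<close>)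
    also have "\<dots> = emeasure (density Q (\<lambda>x. ennreal (p' x))) A"
      using A s by (simp add: emeasure_density)
    finally show "emeasure (density Q (\<lambda>x. ennreal (p x))) A = emeasure (density Q (\<lambda>x. ennreal (p' x))) A" .
  qed simp
  then have "AE x in Q. ennreal (p x) = ennreal (p' x)" using s by (subst (asm) density_unique_iff) auto
  then show ?thesis by eventually_elim (use s(5,6) in simp)
qed

text \<open>Both measures have densities \<open>f\<close> and \<open>g\<close> with respect to P +
  Q. The quotient f / g works where \<open>g\<close> is not 0, and that set has full
  \<open>Q\<close>-measure.\<close>

lemma Lebesgue_decomposition:
  assumes P: "prob_space P" and Q: "prob_space Q" and s: "sets P = sets Q"
  obtains p S where "density_on P Q p S"
proof -
  interpret P: prob_space P by fact
  interpret Q: prob_space Q by fact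
  have sp: "space P = space Q" using s by (rule sets_eq_imp_space_eq)
  define \<mu> where "\<mu> = measure_of (space Q) (sets Q) (\<lambda>A. emeasure P A + emeasure Q A)"
  have s\<mu>: "sets \<mu> = sets Q" "space \<mu> = space Q" by (simp_all add: \<mu>_def sets.space_closed)
  have e\<mu>: "emeasure \<mu> A = emeasure P A + emeasure Q A" if "A \<in> sets Q" for A
    unfolding \<mu>_def
  proof (rule emeasure_measure_of_sigma[OF sets.sigma_algebra_axioms _ _ that])
    show "positive (sets Q) (\<lambda>A. emeasure P A + emeasure Q A)" by (simp add: positive_def)
    show "countably_additive (sets Q) (\<lambda>A. emeasure P A + emeasure Q A)"
    proof (rule countably_additiveI)
      fix A :: "nat \<Rightarrow> 'a set" assume A: "range A \<subseteq> sets Q" "disjoint_family A"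
      then show "(\<Sum>i. emeasure P (A i) + emeasure Q (A i)) = emeasure P (\<Union>i. A i) + emeasure Q (\<Union>i. A i)"
        using s by (simp add: suminf_add[symmetric] suminf_emeasure)
    qed
  qed
  interpret \<mu>: finite_measure \<mu>
  proof (rule finite_measureI)
    have "emeasure P (space Q) = 1" using P.emeasure_space_1 sp by simp
    then show "emeasure \<mu> (space \<mu>) \<noteq> \<infinity>" using e\<mu>[OF sets.top] Q.emeasure_space_1 s\<mu> by simp
  qed
  have ac: "absolutely_continuous \<mu> P" "absolutely_continuous \<mu> Q"
    using s s\<mu> e\<mu> by (auto simp: absolutely_continuous_def null_sets_def)
  define f g where "f = RN_deriv \<mu> P" and "g = RN_deriv \<mu> Q"
  have fm[measurable]: "f \<in> borel_measurable \<mu>" "g \<in> borel_measurable \<mu>" by (simp_all add: f_def g_def)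
  have df: "density \<mu> f = P" "density \<mu> g = Q"
    unfolding f_def g_def using ac s s\<mu> by (auto intro!: \<mu>.density_RN_deriv)
  have fin: "AE x in \<mu>. f x \<noteq> \<infinity>" "AE x in \<mu>. g x \<noteq> \<infinity>"
    unfolding f_def g_def
    by (rule \<mu>.RN_deriv_finite[OF P.sigma_finite_measure_axioms ac(1)], simp add: s s\<mu>)
      (rule \<mu>.RN_deriv_finite[OF Q.sigma_finite_measure_axioms ac(2)], simp add: s\<mu>)
  define S where "S = {x \<in> space Q. g x \<noteq> 0}"
  have fQ[measurable]: "f \<in> borel_measurable Q" "g \<in> borel_measurable Q"
    using fm s\<mu>(1) by (simp_all cong: measurable_cong_sets)
  have SQ[measurable]: "S \<in> sets Q" unfolding S_def by measurable
  then have S\<mu>: "S \<in> sets \<mu>" using s\<mu> by simp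
  \<comment> \<open>Where \<open>g\<close> vanishes the quotient is 0 or infinity;
    \<open>enn2real\<close> turns both into 0, so \<open>p\<close> vanishes there.\<close>
  define p where "p x = enn2real (f x / g x)" for x
  have pm: "p \<in> borel_measurable Q" unfolding p_def by measurable
  then have p\<mu>: "p \<in> borel_measurable \<mu>" using s\<mu>(1) by (simp cong: measurable_cong_sets)
  have "AE x in density \<mu> g. x \<in> S"
    using S\<mu> by (subst AE_density) (auto simp: S_def s\<mu> intro!: AE_I2)
  then have aeS: "AE x in Q. x \<in> S" unfolding df .
  have "density P (indicator S) = density (density \<mu> f) (indicator S)" by (simp add: df)
  also have "\<dots> = density \<mu> (\<lambda>x. f x * indicator S x)" using S\<mu> by (intro density_density_eq) auto
  also have "\<dots> = density \<mu> (\<lambda>x. g x * ennreal (p x))"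
  proof (rule density_cong)
    show "AE x in \<mu>. f x * indicator S x = g x * ennreal (p x)"
      using fin AE_space
    proof (eventually_elim, goal_cases)
      case (1 x)
      show ?case
      proof (cases "g x = 0")
        case True
        have "p x = 0"
        proof (cases "f x = 0")
          case False
          then show ?thesis using True 1 by (simp add: p_def ennreal_divide_zero)
        qed (simp add: p_def)
        then show ?thesis using True by (simp add: S_def)
      next
        case False
        obtain u v where uv: "f x = ennreal u" "u \<ge> 0" "g x = ennreal v" "v \<ge> 0"
          using 1 by (metis ennreal_cases infinity_ennreal_def)
        then have v: "v > 0" using False by (metis ennreal_0 order_le_less)
        have "p x = u / v" using uv v by (simp add: p_def divide_ennreal)
        then have "g x * ennreal (p x) = f x" using uv v by (simp add: ennreal_mult[symmetric])
        moreover have "x \<in> space \<mu> \<Longrightarrow> x \<in> S" using False by (simp add: S_def s\<mu>)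
        ultimately show ?thesis using 1 by simp
      qed
    qed
  qed (use S\<mu> p\<mu> in auto)
  also have "\<dots> = density (density \<mu> g) (\<lambda>x. ennreal (p x))"
    using p\<mu> by (intro density_density_eq[symmetric]) auto
  also have "\<dots> = density Q (\<lambda>x. ennreal (p x))" by (simp add: df)
  finally have "density_on P Q p S"
    using pm SQ aeS s unfolding density_on_def by (auto simp: p_def)
  then show ?thesis by (rule that)
qed

lemma density_on_imp_is_density_quotient:
  assumes P: "prob_space P" and Q: "prob_space Q" and d: "density_on P Q p S"
  shows "is_density_quotient P Q (\<lambda>x. if x \<in> S then ennreal (p x) else \<infinity>)"
proof -
  interpret Q: prob_space Q by fact
  interpret P: prob_space P by fact
  have s: "sets P = sets Q" and [measurable]: "S \<in> sets Q" "p \<in> borel_measurable Q" and ae: "AE x in Q. x \<in> S"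
    using d by (auto simp: density_on_def)
  show ?thesis unfolding is_density_quotient_def
  proof (intro conjI ballI)
    show "(\<lambda>x. if x \<in> S then ennreal (p x) else \<infinity>) \<in> borel_measurable Q" by measurable
    fix A assume A: "A \<in> sets Q"
    have "A \<subseteq> space Q" using sets.sets_into_space[OF A] .
    then have "emeasure P A = emeasure P (A \<inter> S) + emeasure P (A \<inter> {x \<in> space Q. (if x \<in> S then ennreal (p x) else \<infinity>) = \<infinity>})"
      using A s by (subst plus_emeasure) (auto intro!: arg_cong[where f = "emeasure P"])
    also have "emeasure P (A \<inter> S) = (\<integral>\<^sup>+x. (if x \<in> S then ennreal (p x) else \<infinity>) * indicator A x \<partial>Q)"
      unfolding density_on_emeasure[OF d A] using ae by (intro nn_integral_cong_AE) (auto elim!: eventually_mono)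
    finally show "emeasure P A = (\<integral>\<^sup>+x. (if x \<in> S then ennreal (p x) else \<infinity>) * indicator A x \<partial>Q)
       + emeasure P (A \<inter> {x \<in> space Q. (if x \<in> S then ennreal (p x) else \<infinity>) = \<infinity>})" .
  next
    have "AE x in Q. (if x \<in> S then ennreal (p x) else \<infinity>) < \<infinity>" using ae by eventually_elim simp
    then show "emeasure Q {x \<in> space Q. (if x \<in> S then ennreal (p x) else \<infinity>) < \<infinity>} = 1"
      by (intro Q.emeasure_eq_1_AE) auto
  qed
qed

lemma is_density_quotient_imp_density_on:
  assumes P: "prob_space P" and Q: "prob_space Q" and s: "sets P = sets Q" and L: "is_density_quotient P Q L"
  shows "density_on P Q (\<lambda>x. enn2real (L x)) {x \<in> space Q. L x < \<infinity>}" "AE x in Q. L x < \<infinity>"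
proof -
  interpret Q: prob_space Q by fact
  interpret P: prob_space P by fact
  have Lm[measurable]: "L \<in> borel_measurable Q"
    and e: "\<And>A. A \<in> sets Q \<Longrightarrow> emeasure P A = (\<integral>\<^sup>+x. L x * indicator A x \<partial>Q) + emeasure P (A \<inter> {x \<in> space Q. L x = \<infinity>})"
    and 1: "emeasure Q {x \<in> space Q. L x < \<infinity>} = 1"
    using L by (auto simp: is_density_quotient_def)
  show ae: "AE x in Q. L x < \<infinity>"
    using 1 by (subst Q.AE_iff_emeasure_eq_1) auto
  let ?S = "{x \<in> space Q. L x < \<infinity>}"
  have S: "?S \<in> sets Q" by measurable
  have "density P (indicator ?S) = density Q (\<lambda>x. ennreal (enn2real (L x)))"
  proof (rule measure_eqI)
    fix A assume "A \<in> sets (density P (indicator ?S))"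
    then have A: "A \<in> sets Q" using s by simp
    have "emeasure (density P (indicator ?S)) A = emeasure P (A \<inter> ?S)"
      using A S s by (subst emeasure_density) (auto simp: indicator_inter_arith[symmetric] Int_commute mult.commute)
    also have "\<dots> = (\<integral>\<^sup>+x. L x * indicator (A \<inter> ?S) x \<partial>Q) + emeasure P (A \<inter> ?S \<inter> {x \<in> space Q. L x = \<infinity>})"
      using A S by (intro e) auto
    also have "A \<inter> ?S \<inter> {x \<in> space Q. L x = \<infinity>} = {}" by auto
    also have "(\<integral>\<^sup>+x. L x * indicator (A \<inter> ?S) x \<partial>Q) = (\<integral>\<^sup>+x. ennreal (enn2real (L x)) * indicator A x \<partial>Q)"
      by (rule nn_integral_cong_AE)
        (use ae AE_space in \<open>eventually_elim, auto simp: indicator_def less_top[symmetric]\<close>)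
    also have "(\<integral>\<^sup>+x. ennreal (enn2real (L x)) * indicator A x \<partial>Q) + emeasure P {} = emeasure (density Q (\<lambda>x. ennreal (enn2real (L x)))) A"
      using A by (simp add: emeasure_density)
    finally show "emeasure (density P (indicator ?S)) A = emeasure (density Q (\<lambda>x. ennreal (enn2real (L x)))) A" .
  qed (simp add: s)
  then show "density_on P Q (\<lambda>x. enn2real (L x)) ?S"
    unfolding density_on_def using S s ae by (auto simp: AE_conj_iff)
qed

lemma density_quotient:
  assumes "prob_space P" "prob_space Q" "sets P = sets Q"
  shows "is_density_quotient P Q (density_quotient P Q)"
proof -
  obtain p S where "density_on P Q p S" using Lebesgue_decomposition[OF assms] .
  from density_on_imp_is_density_quotient[OF assms(1,2) this] show ?thesis
    unfolding density_quotient_def by (rule someI[of "is_density_quotient P Q"])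
qed

lemma density_on_density_quotient:
  assumes "prob_space P" "prob_space Q" "sets P = sets Q"
  shows "density_on P Q (\<lambda>x. enn2real (density_quotient P Q x)) {x \<in> space Q. density_quotient P Q x < \<infinity>}"
    "AE x in Q. density_quotient P Q x < \<infinity>"
  by (rule is_density_quotient_imp_density_on[OF assms density_quotient[OF assms]])+

text \<open>Chain rule through \<open>R\<close>: on \<open>T\<close> the measure \<open>Q\<close>
  itself has a density with respect to \<open>R\<close>, so the quotient is a ratio of densities.
  Off \<open>T\<close> the measure \<open>Q\<close> is singular to \<open>R\<close>, and densities
  relative to \<open>R\<close> give no information.\<close>

lemma density_quotient_chain:
  assumes P: "prob_space P" and Q: "prob_space Q" and R: "prob_space R"
    and p: "density_on P R p S" and q: "density_on Q R q T"
  shows "AE x in Q. x \<in> T \<longrightarrow> x \<in> S \<and> q x > 0 \<and> density_quotient P Q x = ennreal (p x / q x)"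
proof -
  interpret P: prob_space P by fact
  interpret Q: prob_space Q by fact
  interpret R: prob_space R by fact
  have s: "sets P = sets R" "sets Q = sets R" "sets P = sets Q"
    and [measurable]: "S \<in> sets R" "T \<in> sets R" "p \<in> borel_measurable R" "q \<in> borel_measurable R"
    and nn: "\<And>x. 0 \<le> p x" "\<And>x. 0 \<le> q x" and aeR: "AE x in R. x \<in> S" "AE x in R. x \<in> T"
    and eq: "density Q (indicator T) = density R (\<lambda>x. ennreal (q x))"
    using p q by (auto simp: density_on_def)
  define L where "L = density_quotient P Q"
  define U where "U = {x \<in> space Q. L x < \<infinity>}"
  have LU: "density_on P Q (\<lambda>x. enn2real (L x)) U" and aeL: "AE x in Q. L x < \<infinity>"
    unfolding L_def U_def using density_on_density_quotient[OF P Q s(3)] by auto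
  then have UQ[measurable]: "U \<in> sets R" and Lm[measurable]: "(\<lambda>x. enn2real (L x)) \<in> borel_measurable R"
    using s(2) by (auto simp: density_on_def cong: measurable_cong_sets)
  have "AE x in density R (\<lambda>x. ennreal (q x)). x \<in> S \<and> q x > 0"
    using aeR nn by (subst AE_density) (auto elim!: eventually_mono simp: order_less_le)
  then have "AE x in density Q (indicator T). x \<in> S \<and> q x > 0" unfolding eq .
  then have ae1: "AE x in Q. x \<in> T \<longrightarrow> x \<in> S \<and> q x > 0"
    using s by (subst (asm) AE_density) (auto elim!: eventually_mono)
  \<comment> \<open>On the points where both quotients relative to \<open>R\<close> and the one
    relative to \<open>Q\<close> are finite and \<open>q\<close> is positive, the two candidates are
    densities of the same measure; \<open>Q\<close>-almost every point of \<open>T\<close> lies in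
    \<open>B\<close>.\<close>
  define B where "B = {x \<in> space R. x \<in> S \<and> x \<in> T \<and> q x > 0 \<and> x \<in> U}"
  have B: "B \<in> sets R" unfolding B_def by measurable
  have BQ: "B \<in> sets Q" using B s by simp
  have mQ: "(\<lambda>x. enn2real (L x)) \<in> borel_measurable Q" "p \<in> borel_measurable Q" "q \<in> borel_measurable Q" "T \<in> sets Q"
    using s(2) by (simp_all cong: measurable_cong_sets)
  have mB: "(\<lambda>x. ennreal (p x / q x) * indicator B x) \<in> borel_measurable Q" using BQ mQ by auto
  have "density Q (\<lambda>x. ennreal (enn2real (L x)) * indicator B x) = density Q (\<lambda>x. ennreal (p x / q x) * indicator B x)"
  proof (rule measure_eqI)
    fix A assume "A \<in> sets (density Q (\<lambda>x. ennreal (enn2real (L x)) * indicator B x))"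
    then have A: "A \<in> sets Q" "A \<in> sets R" using s by auto
    have AB: "A \<inter> B \<in> sets Q" "A \<inter> B \<in> sets R" using A B s by auto
    have "emeasure (density Q (\<lambda>x. ennreal (enn2real (L x)) * indicator B x)) A
      = (\<integral>\<^sup>+x. ennreal (enn2real (L x)) * indicator (A \<inter> B) x \<partial>Q)"
      using A BQ mQ by (subst emeasure_density) (auto intro!: nn_integral_cong simp: indicator_def)
    also have "\<dots> = emeasure P (A \<inter> B \<inter> U)" by (rule density_on_emeasure[OF LU AB(1), symmetric])
    also have "A \<inter> B \<inter> U = A \<inter> B \<inter> S" by (auto simp: B_def)
    also have "emeasure P (A \<inter> B \<inter> S) = (\<integral>\<^sup>+x. ennreal (p x) * indicator (A \<inter> B) x \<partial>R)"
      by (rule density_on_emeasure[OF p AB(2)])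
    also have "\<dots> = (\<integral>\<^sup>+x. ennreal (q x) * (ennreal (p x / q x) * indicator (A \<inter> B) x) \<partial>R)"
    proof (intro nn_integral_cong)
      fix x
      show "ennreal (p x) * indicator (A \<inter> B) x = ennreal (q x) * (ennreal (p x / q x) * indicator (A \<inter> B) x)"
        using nn[of x] by (auto simp: indicator_def B_def ennreal_mult[symmetric])
    qed
    also have "\<dots> = (\<integral>\<^sup>+x. ennreal (p x / q x) * indicator (A \<inter> B) x \<partial>density R (\<lambda>x. ennreal (q x)))"
      using AB by (subst nn_integral_density) auto
    also have "\<dots> = (\<integral>\<^sup>+x. indicator T x * (ennreal (p x / q x) * indicator (A \<inter> B) x) \<partial>Q)"
      unfolding eq[symmetric] using AB mQ by (subst nn_integral_density) auto
    also have "\<dots> = emeasure (density Q (\<lambda>x. ennreal (p x / q x) * indicator B x)) A"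
      unfolding emeasure_density[OF mB A(1)] by (intro nn_integral_cong) (auto simp: indicator_def B_def)
    finally show "emeasure (density Q (\<lambda>x. ennreal (enn2real (L x)) * indicator B x)) A
      = emeasure (density Q (\<lambda>x. ennreal (p x / q x) * indicator B x)) A" .
  qed simp
  then have "AE x in Q. ennreal (enn2real (L x)) * indicator B x = ennreal (p x / q x) * indicator B x"
    using BQ mQ by (subst (asm) Q.density_unique_iff) auto
  with ae1 aeL AE_space show ?thesis
  proof eventually_elim
    case (elim x)
    show ?case
    proof
      assume T: "x \<in> T"
      with elim have x: "x \<in> B" using sets_eq_imp_space_eq[OF s(2)] by (auto simp: B_def U_def)
      then have "L x = ennreal (p x / q x)" using elim by (auto simp: less_top)
      then show "x \<in> S \<and> q x > 0 \<and> density_quotient P Q x = ennreal (p x / q x)" using T elim by (simp add: L_def)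
    qed
  qed
qed

lemma finite_measure_density:
  assumes f: "f \<in> borel_measurable M" and fin: "(\<integral>\<^sup>+x. f x \<partial>M) < \<infinity>"
  shows "finite_measure (density M f)"
proof (rule finite_measureI)
  have "emeasure (density M f) (space M) = (\<integral>\<^sup>+x. f x * indicator (space M) x \<partial>M)"
    using f by (simp add: emeasure_density)
  also have "\<dots> = (\<integral>\<^sup>+x. f x \<partial>M)" by (intro nn_integral_cong) auto
  finally show "emeasure (density M f) (space (density M f)) \<noteq> \<infinity>" using fin by simp
qed

section \<open>Density quotients of product measures\<close>

lemma density_on_pair:
  assumes P: "prob_space P1" "prob_space P2" and Q: "prob_space Q1" "prob_space Q2"
    and d: "density_on P1 Q1 p1 S1" "density_on P2 Q2 p2 S2"
  shows "density_on (P1 \<Otimes>\<^sub>M P2) (Q1 \<Otimes>\<^sub>M Q2) (\<lambda>x. p1 (fst x) * p2 (snd x)) (S1 \<times> S2)"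
proof -
  interpret P2: prob_space P2 by fact
  interpret Q1: prob_space Q1 by fact
  interpret Q2: prob_space Q2 by fact
  interpret Q: pair_prob_space Q1 Q2 ..
  have s: "sets P1 = sets Q1" "sets P2 = sets Q2"
    and [measurable]: "S1 \<in> sets Q1" "S2 \<in> sets Q2" "p1 \<in> borel_measurable Q1" "p2 \<in> borel_measurable Q2"
    and nn: "\<And>x. 0 \<le> p1 x" "\<And>x. 0 \<le> p2 x" and ae: "AE x in Q1. x \<in> S1" "AE x in Q2. x \<in> S2"
    and e: "density P1 (indicator S1) = density Q1 (\<lambda>x. ennreal (p1 x))" "density P2 (indicator S2) = density Q2 (\<lambda>x. ennreal (p2 x))"
    using d by (auto simp: density_on_def)
  have SP: "S1 \<in> sets P1" "S2 \<in> sets P2" using s by auto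
  have sf: "sigma_finite_measure (density P2 (indicator S2))"
    using SP by (intro finite_measure.sigma_finite_measure finite_measure_density) (auto simp: P2.emeasure_eq_measure)
  have "density (P1 \<Otimes>\<^sub>M P2) (indicator (S1 \<times> S2)) = density (P1 \<Otimes>\<^sub>M P2) (\<lambda>(x,y). indicator S1 x * indicator S2 y)"
    by (intro arg_cong2[where f = density] refl ext) (auto simp: indicator_def)
  also have "\<dots> = density P1 (indicator S1) \<Otimes>\<^sub>M density P2 (indicator S2)"
    using SP sf by (intro pair_measure_density[symmetric]) (auto simp: P2.sigma_finite_measure_axioms)
  also have "\<dots> = density Q1 (\<lambda>x. ennreal (p1 x)) \<Otimes>\<^sub>M density Q2 (\<lambda>x. ennreal (p2 x))" unfolding e ..
  also have "\<dots> = density (Q1 \<Otimes>\<^sub>M Q2) (\<lambda>(x,y). ennreal (p1 x) * ennreal (p2 y))"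
    using sf e by (intro pair_measure_density) (auto simp: Q2.sigma_finite_measure_axioms)
  also have "\<dots> = density (Q1 \<Otimes>\<^sub>M Q2) (\<lambda>x. ennreal (p1 (fst x) * p2 (snd x)))"
    using nn by (intro arg_cong2[where f = density] refl ext) (auto simp: ennreal_mult)
  finally have "density (P1 \<Otimes>\<^sub>M P2) (indicator (S1 \<times> S2)) = density (Q1 \<Otimes>\<^sub>M Q2) (\<lambda>x. ennreal (p1 (fst x) * p2 (snd x)))" .
  moreover have "AE x in Q1 \<Otimes>\<^sub>M Q2. x \<in> S1 \<times> S2"
    using ae by (auto simp: AE_conj_iff mem_Times_iff intro!: Q.AE_pair_measure)
  ultimately show ?thesis
    using s nn unfolding density_on_def by (auto cong: sets_pair_measure_cong)
qed

text \<open>Finite rather than unit mass is assumed because the lemma is applied to an indicator and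
  to a density that may have lost mass to a singular part; finiteness keeps the density measure
  sigma-finite.\<close>

lemma density_PiM:
  assumes I: "finite I" and M: "prob_space M" and f[measurable]: "f \<in> borel_measurable M"
    and fin: "(\<integral>\<^sup>+x. f x \<partial>M) < \<infinity>"
  shows "density (\<Pi>\<^sub>M i\<in>I. M) (\<lambda>x. \<Prod>i\<in>I. f (x i)) = (\<Pi>\<^sub>M i\<in>I. density M f)"
proof -
  interpret M: prob_space M by fact
  interpret M: product_sigma_finite "\<lambda>_. M" ..
  have fm: "finite_measure (density M f)"
    using fin by (intro finite_measure_density) auto
  interpret D: product_sigma_finite "\<lambda>_. density M f"
    using finite_measure.sigma_finite_measure[OF fm] by (simp add: product_sigma_finite_def)
  show ?thesis
  proof (rule D.PiM_eqI[OF I])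
    show "sets (density (\<Pi>\<^sub>M i\<in>I. M) (\<lambda>x. \<Prod>i\<in>I. f (x i))) = sets (\<Pi>\<^sub>M i\<in>I. density M f)"
      by (simp cong: sets_PiM_cong)
    fix A assume "\<And>i. i \<in> I \<Longrightarrow> A i \<in> sets (density M f)"
    then have A[measurable]: "\<And>i. i \<in> I \<Longrightarrow> A i \<in> sets M" by simp
    have "emeasure (density (\<Pi>\<^sub>M i\<in>I. M) (\<lambda>x. \<Prod>i\<in>I. f (x i))) (Pi\<^sub>E I A)
      = (\<integral>\<^sup>+x. (\<Prod>i\<in>I. f (x i)) * indicator (Pi\<^sub>E I A) x \<partial>(\<Pi>\<^sub>M i\<in>I. M))"
      using I by (intro emeasure_density) (auto intro!: borel_measurable_prod_ennreal measurable_compose[OF _ f])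
    also have "\<dots> = (\<integral>\<^sup>+x. (\<Prod>i\<in>I. f (x i) * indicator (A i) (x i)) \<partial>(\<Pi>\<^sub>M i\<in>I. M))"
    proof (intro nn_integral_cong)
      fix x assume "x \<in> space (\<Pi>\<^sub>M i\<in>I. M)"
      then have "indicator (Pi\<^sub>E I A) x = (\<Prod>i\<in>I. indicator (A i) (x i) :: ennreal)"
        using I by (auto simp: indicator_def PiE_iff space_PiM prod_zero_iff)
      then show "(\<Prod>i\<in>I. f (x i)) * indicator (Pi\<^sub>E I A) x = (\<Prod>i\<in>I. f (x i) * indicator (A i) (x i))"
        by (simp add: prod.distrib)
    qed
    also have "\<dots> = (\<Prod>i\<in>I. \<integral>\<^sup>+x. f x * indicator (A i) x \<partial>M)"
      using I by (intro M.product_nn_integral_prod) auto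
    also have "\<dots> = (\<Prod>i\<in>I. emeasure (density M f) (A i))"
      using A by (intro prod.cong refl) (simp add: emeasure_density)
    finally show "emeasure (density (\<Pi>\<^sub>M i\<in>I. M) (\<lambda>x. \<Prod>i\<in>I. f (x i))) (Pi\<^sub>E I A) = (\<Prod>i\<in>I. emeasure (density M f) (A i))" .
  qed
qed

lemma density_on_PiM:
  assumes I: "finite I" and P: "prob_space P" and Q: "prob_space Q" and d: "density_on P Q p S"
  shows "density_on (\<Pi>\<^sub>M i\<in>I. P) (\<Pi>\<^sub>M i\<in>I. Q) (\<lambda>x. \<Prod>i\<in>I. p (x i)) (PiE I (\<lambda>_. S))"
proof -
  interpret P: prob_space P by fact
  interpret Q: prob_space Q by fact
  interpret QI: product_prob_space "\<lambda>_. Q" I ..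
  have s: "sets P = sets Q" and S[measurable]: "S \<in> sets Q" and p[measurable]: "p \<in> borel_measurable Q"
    and nn: "\<And>x. 0 \<le> p x" and ae: "AE x in Q. x \<in> S"
    and e: "density P (indicator S) = density Q (\<lambda>x. ennreal (p x))"
    using d by (auto simp: density_on_def)
  have SP: "S \<in> sets P" using s by simp
  have f1: "(\<integral>\<^sup>+x. indicator S x \<partial>P) < \<infinity>" using SP by (simp add: P.emeasure_eq_measure)
  have "(\<integral>\<^sup>+x. ennreal (p x) \<partial>Q) = (\<integral>\<^sup>+x. ennreal (p x) * indicator (space Q) x \<partial>Q)"
    by (intro nn_integral_cong) auto
  also have "\<dots> = emeasure P (space Q \<inter> S)" by (rule density_on_emeasure[OF d, symmetric]) simp
  finally have f2: "(\<integral>\<^sup>+x. ennreal (p x) \<partial>Q) < \<infinity>" by (simp add: P.emeasure_eq_measure)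
  have "density (\<Pi>\<^sub>M i\<in>I. P) (indicator (PiE I (\<lambda>_. S))) = density (\<Pi>\<^sub>M i\<in>I. P) (\<lambda>x. \<Prod>i\<in>I. indicator S (x i))"
  proof (rule density_cong)
    show "AE x in \<Pi>\<^sub>M i\<in>I. P. indicator (PiE I (\<lambda>_. S)) x = (\<Prod>i\<in>I. indicator S (x i) :: ennreal)"
      using I by (intro AE_I2) (auto simp: indicator_def PiE_iff space_PiM prod_zero_iff)
  qed (use I SP in \<open>auto intro!: borel_measurable_prod_ennreal\<close>)
  also have "\<dots> = (\<Pi>\<^sub>M i\<in>I. density P (indicator S))" using SP f1 by (intro density_PiM I P) auto
  also have "\<dots> = (\<Pi>\<^sub>M i\<in>I. density Q (\<lambda>x. ennreal (p x)))" unfolding e ..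
  also have "\<dots> = density (\<Pi>\<^sub>M i\<in>I. Q) (\<lambda>x. \<Prod>i\<in>I. ennreal (p (x i)))" using f2 by (intro density_PiM[symmetric] I Q) auto
  also have "\<dots> = density (\<Pi>\<^sub>M i\<in>I. Q) (\<lambda>x. ennreal (\<Prod>i\<in>I. p (x i)))" using nn by (simp add: prod_ennreal)
  finally have "density (\<Pi>\<^sub>M i\<in>I. P) (indicator (PiE I (\<lambda>_. S))) = density (\<Pi>\<^sub>M i\<in>I. Q) (\<lambda>x. ennreal (\<Prod>i\<in>I. p (x i)))" .
  moreover have "AE x in \<Pi>\<^sub>M i\<in>I. Q. x \<in> PiE I (\<lambda>_. S)"
  proof -
    have "AE x in \<Pi>\<^sub>M i\<in>I. Q. \<forall>i\<in>I. x i \<in> S"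
      using I ae by (intro AE_finite_allI AE_PiM_component QI.prob_space) auto
    then show ?thesis using AE_space by eventually_elim (auto simp: space_PiM PiE_iff)
  qed
  ultimately show ?thesis
    unfolding density_on_def using s I nn by (auto intro!: prod_nonneg sets_PiM_I_finite cong: sets_PiM_cong)
qed

section \<open>Square integrable functions\<close>

lemma L2_measurable: "f \<in> L2 M \<Longrightarrow> f \<in> borel_measurable M"
  and L2_integrable_sq: "f \<in> L2 M \<Longrightarrow> integrable M (\<lambda>x. (f x)\<^sup>2)"
  by (simp_all add: L2_def)

lemma L2_I: "f \<in> borel_measurable M \<Longrightarrow> integrable M (\<lambda>x. (f x)\<^sup>2) \<Longrightarrow> f \<in> L2 M"
  by (simp add: L2_def)

lemma L2_cong_AE:
  assumes "f \<in> L2 M" "g \<in> borel_measurable M" "AE x in M. g x = f x"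
  shows "g \<in> L2 M"
proof (rule L2_I)
  show "integrable M (\<lambda>x. (g x)\<^sup>2)"
    by (rule Bochner_Integration.integrable_cong_AE[THEN iffD1, OF _ _ _ L2_integrable_sq[OF assms(1)]])
      (use assms L2_measurable[OF assms(1)] in \<open>auto elim: eventually_mono\<close>)
qed fact

lemma L2_mult_integrable:
  assumes f: "f \<in> L2 M" and g: "g \<in> L2 M"
  shows "integrable M (\<lambda>x. f x * g x)"
proof (rule Bochner_Integration.integrable_bound)
  show "integrable M (\<lambda>x. (f x)\<^sup>2 + (g x)\<^sup>2)" using f g by (simp add: L2_def)
  show "(\<lambda>x. f x * g x) \<in> borel_measurable M" using f g by (auto simp: L2_def)
  show "AE x in M. norm (f x * g x) \<le> norm ((f x)\<^sup>2 + (g x)\<^sup>2)"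
  proof (rule AE_I2)
    fix x
    have "0 \<le> (\<bar>f x\<bar> - \<bar>g x\<bar>)\<^sup>2" by simp
    then have "2 * (\<bar>f x\<bar> * \<bar>g x\<bar>) \<le> (f x)\<^sup>2 + (g x)\<^sup>2" by (simp add: power2_diff)
    moreover have "0 \<le> \<bar>f x\<bar> * \<bar>g x\<bar>" by simp
    ultimately have "\<bar>f x\<bar> * \<bar>g x\<bar> \<le> (f x)\<^sup>2 + (g x)\<^sup>2" by linarith
    then show "norm (f x * g x) \<le> norm ((f x)\<^sup>2 + (g x)\<^sup>2)"
      by (simp add: abs_mult)
  qed
qed

lemma L2_scale: "f \<in> L2 M \<Longrightarrow> (\<lambda>x. c * f x) \<in> L2 M"
  by (auto simp: L2_def power_mult_distrib)

lemma L2_add: "f \<in> L2 M \<Longrightarrow> g \<in> L2 M \<Longrightarrow> (\<lambda>x. f x + g x) \<in> L2 M"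
  using L2_mult_integrable[of f M g] by (auto simp: L2_def power2_sum mult.assoc)

lemma L2_uminus: "f \<in> L2 M \<Longrightarrow> (\<lambda>x. - f x) \<in> L2 M"
  using L2_scale[of f M "-1"] by simp

lemma L2_diff: "f \<in> L2 M \<Longrightarrow> g \<in> L2 M \<Longrightarrow> (\<lambda>x. f x - g x) \<in> L2 M"
  using L2_add[OF _ L2_uminus, of f M g] by simp

lemma L2_zero: "(\<lambda>x. 0) \<in> L2 M"
  by (simp add: L2_def)

lemma L2_sum: "(\<And>i. i \<in> I \<Longrightarrow> f i \<in> L2 M) \<Longrightarrow> (\<lambda>x. \<Sum>i\<in>I. f i x) \<in> L2 M"
  by (induction I rule: infinite_finite_induct) (auto intro: L2_zero L2_add)

lemma L2_abs: "f \<in> L2 M \<Longrightarrow> (\<lambda>x. \<bar>f x\<bar>) \<in> L2 M"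
  by (auto simp: L2_def)

lemma (in finite_measure) L2_const: "(\<lambda>x. c) \<in> L2 M"
  by (simp add: L2_def)

lemma (in finite_measure) L2_integrable: "f \<in> L2 M \<Longrightarrow> integrable M f"
  using L2_mult_integrable[of f M "\<lambda>_. 1"] L2_const by simp

lemma L2_norm_nonneg: "0 \<le> L2_norm M f"
  by (simp add: L2_norm_def)

lemma L2_norm_sq: "(L2_norm M f)\<^sup>2 = (\<integral>x. (f x)\<^sup>2 \<partial>M)"
  by (simp add: L2_norm_def)

lemma L2_norm_cong_AE:
  assumes "AE x in M. f x = g x" "f \<in> borel_measurable M" "g \<in> borel_measurable M"
  shows "L2_norm M f = L2_norm M g"
  unfolding L2_norm_def
  by (intro arg_cong[where f = sqrt] integral_cong_AE) (use assms in \<open>auto elim: eventually_mono\<close>)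

lemma L2_norm_zero: "L2_norm M (\<lambda>x. 0) = 0"
  by (simp add: L2_norm_def)

lemma L2_norm_scale: "L2_norm M (\<lambda>x. c * f x) = \<bar>c\<bar> * L2_norm M f"
  by (simp add: L2_norm_def power_mult_distrib real_sqrt_mult)

lemma L2_norm_diff_commute: "L2_norm M (\<lambda>x. f x - g x) = L2_norm M (\<lambda>x. g x - f x)"
  by (simp add: L2_norm_def power2_commute)

lemma L2_norm_eq_0_AE:
  assumes "f \<in> L2 M" "L2_norm M f = 0"
  shows "AE x in M. f x = 0"
proof -
  have "(\<integral>x. (f x)\<^sup>2 \<partial>M) = 0" using assms(2) L2_norm_sq[of M f] by simp
  then have "AE x in M. (f x)\<^sup>2 = 0"
    using integral_nonneg_eq_0_iff_AE[OF L2_integrable_sq[OF assms(1)]] by simp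
  then show ?thesis by simp
qed

lemma L2_Cauchy_Schwarz:
  assumes f: "f \<in> L2 M" and g: "g \<in> L2 M"
  shows "\<bar>\<integral>x. f x * g x \<partial>M\<bar> \<le> L2_norm M f * L2_norm M g"
proof -
  define A B C where "A = (\<integral>x. (f x)\<^sup>2 \<partial>M)" and "B = (\<integral>x. f x * g x \<partial>M)" and "C = (\<integral>x. (g x)\<^sup>2 \<partial>M)"
  have i: "integrable M (\<lambda>x. (f x)\<^sup>2)" "integrable M (\<lambda>x. (g x)\<^sup>2)" "integrable M (\<lambda>x. f x * g x)"
    using f g L2_mult_integrable by (auto simp: L2_def)
  \<comment> \<open>The integral of a square is a nonnegative quadratic form in (s, t); suitable
    values yield the discriminant inequality.\<close>
  have pos: "0 \<le> s\<^sup>2 * A - 2 * s * t * B + t\<^sup>2 * C" for s t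
  proof -
    have "0 \<le> (\<integral>x. (s * f x - t * g x)\<^sup>2 \<partial>M)" by simp
    also have "(\<lambda>x. (s * f x - t * g x)\<^sup>2) = (\<lambda>x. s\<^sup>2 * (f x)\<^sup>2 - 2 * s * t * (f x * g x) + t\<^sup>2 * (g x)\<^sup>2)"
      by (simp add: fun_eq_iff power2_eq_square algebra_simps)
    also have "(\<integral>x. s\<^sup>2 * (f x)\<^sup>2 - 2 * s * t * (f x * g x) + t\<^sup>2 * (g x)\<^sup>2 \<partial>M) = s\<^sup>2 * A - 2 * s * t * B + t\<^sup>2 * C"
      using i by (simp add: A_def B_def C_def)
    finally show ?thesis .
  qed
  have A0: "A \<ge> 0" "C \<ge> 0" by (simp_all add: A_def C_def)
  have "B\<^sup>2 \<le> A * C"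
  proof (cases "C = 0")
    case True
    have "B = 0"
    proof (rule ccontr)
      assume "B \<noteq> 0"
      \<comment> \<open>With C = 0 and B not 0 these values would make the form equal to -1.\<close>
      then show False using pos[of 1 "(A + 1) / (2 * B)"] True by (simp add: field_simps)
    qed
    then show ?thesis using A0 by simp
  next
    case False
    then have "C > 0" using A0 by simp
    moreover have "0 \<le> C\<^sup>2 * A - 2 * C * B * B + B\<^sup>2 * C" using pos[of C B] .
    then have "0 \<le> C * (A * C - B\<^sup>2)" by (simp add: power2_eq_square algebra_simps)
    ultimately show ?thesis by (simp add: zero_le_mult_iff)
  qed
  then have "sqrt (B\<^sup>2) \<le> sqrt (A * C)" by (rule real_sqrt_le_mono)
  then show ?thesis by (simp add: real_sqrt_mult L2_norm_def A_def B_def C_def)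
qed

lemma L2_norm_triangle:
  assumes f: "f \<in> L2 M" and g: "g \<in> L2 M"
  shows "L2_norm M (\<lambda>x. f x + g x) \<le> L2_norm M f + L2_norm M g"
proof (rule power2_le_imp_le)
  have "(L2_norm M (\<lambda>x. f x + g x))\<^sup>2 = (\<integral>x. (f x)\<^sup>2 + (g x)\<^sup>2 + 2 * (f x * g x) \<partial>M)"
    unfolding L2_norm_sq by (simp add: power2_sum mult.assoc)
  also have "\<dots> = (L2_norm M f)\<^sup>2 + (L2_norm M g)\<^sup>2 + 2 * (\<integral>x. f x * g x \<partial>M)"
    unfolding L2_norm_sq using f g L2_mult_integrable[OF f g] by (simp add: L2_def)
  also have "\<dots> \<le> (L2_norm M f)\<^sup>2 + (L2_norm M g)\<^sup>2 + 2 * (L2_norm M f * L2_norm M g)"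
    using L2_Cauchy_Schwarz[OF f g] by simp
  finally show "(L2_norm M (\<lambda>x. f x + g x))\<^sup>2 \<le> (L2_norm M f + L2_norm M g)\<^sup>2"
    by (simp add: power2_sum)
qed (simp add: L2_norm_nonneg)

lemma L2_norm_triangle_diff:
  assumes "f \<in> L2 M" "g \<in> L2 M" "h \<in> L2 M"
  shows "L2_norm M (\<lambda>x. f x - h x) \<le> L2_norm M (\<lambda>x. f x - g x) + L2_norm M (\<lambda>x. g x - h x)"
  using L2_norm_triangle[OF L2_diff[OF assms(1,2)] L2_diff[OF assms(2,3)]] by simp

lemma L2_norm_reverse_triangle:
  assumes f: "f \<in> L2 M" and g: "g \<in> L2 M"
  shows "\<bar>L2_norm M f - L2_norm M g\<bar> \<le> L2_norm M (\<lambda>x. f x - g x)"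
  using L2_norm_triangle[OF L2_diff[OF f g] g] L2_norm_triangle[OF L2_diff[OF g f] f]
    L2_norm_diff_commute[of M f g] by simp

lemma L2_norm_triangle_minus:
  assumes "f \<in> L2 M" "g \<in> L2 M"
  shows "L2_norm M (\<lambda>x. f x - g x) \<le> L2_norm M f + L2_norm M g"
  using L2_norm_triangle[OF assms(1) L2_uminus[OF assms(2)]] L2_norm_scale[of M "-1" g] by simp

lemma L2_norm_sum:
  assumes "\<And>i. i \<in> I \<Longrightarrow> f i \<in> L2 M"
  shows "L2_norm M (\<lambda>x. \<Sum>i\<in>I. f i x) \<le> (\<Sum>i\<in>I. L2_norm M (f i))"
  using assms
proof (induction I rule: infinite_finite_induct)
  case (insert i I)
  have "L2_norm M (\<lambda>x. f i x + (\<Sum>i\<in>I. f i x)) \<le> L2_norm M (f i) + L2_norm M (\<lambda>x. \<Sum>i\<in>I. f i x)"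
    using insert.prems by (intro L2_norm_triangle L2_sum) auto
  then show ?case using insert by simp
qed (auto simp: L2_norm_zero)

lemma (in prob_space) L2_norm_const: "L2_norm M (\<lambda>x. c) = \<bar>c\<bar>"
  by (simp add: L2_norm_def prob_space)

lemma (in prob_space) L2_norm_ge_integral:
  assumes "f \<in> L2 M"
  shows "\<bar>\<integral>x. f x \<partial>M\<bar> \<le> L2_norm M f"
  using L2_Cauchy_Schwarz[OF assms L2_const[of 1]] by (simp add: L2_norm_const)

lemma L2_norm_tendsto:
  assumes f: "\<And>n. f n \<in> L2 M" and g: "g \<in> L2 M"
    and lim: "((\<lambda>n. L2_norm M (\<lambda>x. f n x - g x)) \<longlongrightarrow> 0) F"
  shows "((\<lambda>n. L2_norm M (f n)) \<longlongrightarrow> L2_norm M g) F"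
proof (rule LIM_zero_cancel, rule Lim_null_comparison[OF _ lim])
  show "\<forall>\<^sub>F n in F. norm (L2_norm M (f n) - L2_norm M g) \<le> L2_norm M (\<lambda>x. f n x - g x)"
    using L2_norm_reverse_triangle[OF f g] by (intro always_eventually) simp
qed

text \<open>Riesz-Fischer: along a subsequence with steps below 2^(-k) the increments are absolutely
  summable almost everywhere, so a pointwise limit exists, and Fatou's lemma bounds the distance to
  it by the Cauchy distances.\<close>

theorem (in prob_space) L2_complete:
  assumes f: "\<And>n::nat. f n \<in> L2 M"
    and Cauchy: "\<And>e. e > 0 \<Longrightarrow> \<exists>N. \<forall>m\<ge>N. \<forall>n\<ge>N. L2_norm M (\<lambda>x. f m x - f n x) < e"
  obtains g where "g \<in> L2 M" "(\<lambda>n. L2_norm M (\<lambda>x. f n x - g x)) \<longlonglongrightarrow> 0"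
proof -
  note fm[measurable] = L2_measurable[OF f]
  have "\<exists>N. \<forall>k::nat. (\<forall>m\<ge>N k. \<forall>n\<ge>N k. L2_norm M (\<lambda>x. f m x - f n x) < (1/2)^k) \<and> N k < N (Suc k)"
  proof (rule dependent_nat_choice)
    show "\<exists>N. \<forall>m\<ge>N. \<forall>n\<ge>N. L2_norm M (\<lambda>x. f m x - f n x) < (1/2)^0" using Cauchy[of 1] by simp
    fix N k
    obtain N' where "\<forall>m\<ge>N'. \<forall>n\<ge>N'. L2_norm M (\<lambda>x. f m x - f n x) < (1/2)^Suc k"
      using Cauchy[of "(1/2)^Suc k"] by auto
    then show "\<exists>N'. (\<forall>m\<ge>N'. \<forall>n\<ge>N'. L2_norm M (\<lambda>x. f m x - f n x) < (1/2)^Suc k) \<and> N < N'"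
      by (intro exI[of _ "max N' (Suc N)"]) auto
  qed
  then obtain N where N: "\<And>k m n. m \<ge> N k \<Longrightarrow> n \<ge> N k \<Longrightarrow> L2_norm M (\<lambda>x. f m x - f n x) < (1/2)^k"
    and Nmono: "\<And>k. N k < N (Suc k)" by blast
  define h where "h k x = f (N (Suc k)) x - f (N k) x" for k x
  have hL: "h k \<in> L2 M" for k unfolding h_def using f by (intro L2_diff)
  have hm[measurable]: "h k \<in> borel_measurable M" for k using L2_measurable[OF hL] .
  have h1: "(\<integral>\<^sup>+x. ennreal \<bar>h k x\<bar> \<partial>M) \<le> ennreal ((1/2)^k)" for k
  proof -
    have "(\<integral>\<^sup>+x. ennreal \<bar>h k x\<bar> \<partial>M) = ennreal (\<integral>x. \<bar>h k x\<bar> \<partial>M)"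
      using L2_integrable[OF hL] by (intro nn_integral_eq_integral) auto
    also have "(\<integral>x. \<bar>h k x\<bar> \<partial>M) \<le> L2_norm M (\<lambda>x. \<bar>h k x\<bar>)"
      using L2_norm_ge_integral[OF L2_abs[OF hL]] by (rule order_trans[OF abs_ge_self])
    also have "L2_norm M (\<lambda>x. \<bar>h k x\<bar>) = L2_norm M (h k)" by (simp add: L2_norm_def)
    also have "\<dots> \<le> (1/2)^k" unfolding h_def using N[of k "N (Suc k)" "N k"] Nmono[of k] by simp
    finally show ?thesis by (simp add: ennreal_leI)
  qed
  have "(\<integral>\<^sup>+x. (\<Sum>k. ennreal \<bar>h k x\<bar>) \<partial>M) = (\<Sum>k. \<integral>\<^sup>+x. ennreal \<bar>h k x\<bar> \<partial>M)"
    by (rule nn_integral_suminf) measurable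
  also have "\<dots> \<le> (\<Sum>k. ennreal ((1/2)^k))" by (intro suminf_le h1) auto
  also have "\<dots> = ennreal (\<Sum>k. (1/2)^k)" by (intro suminf_ennreal2) (auto intro: summable_geometric)
  finally have fin: "(\<integral>\<^sup>+x. (\<Sum>k. ennreal \<bar>h k x\<bar>) \<partial>M) \<noteq> \<infinity>"
    by (metis ennreal_less_top infinity_ennreal_def leD)
  have "AE x in M. (\<Sum>k. ennreal \<bar>h k x\<bar>) \<noteq> \<infinity>" by (rule nn_integral_PInf_AE[OF _ fin]) measurable
  then have conv: "AE x in M. convergent (\<lambda>k. f (N k) x)"
  proof eventually_elim
    case (elim x)
    have "summable (\<lambda>k. \<bar>h k x\<bar>)" using elim by (intro summable_suminf_not_top) (auto simp: top_ennreal_def[symmetric])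
    then have "summable (\<lambda>k. h k x)" by (rule summable_rabs_cancel)
    then have "convergent (\<lambda>n. \<Sum>k<n. h k x)" by (simp add: summable_iff_convergent)
    moreover have "(\<Sum>k<n. h k x) = f (N n) x - f (N 0) x" for n
      unfolding h_def by (rule sum_lessThan_telescope)
    ultimately have "convergent (\<lambda>n. f (N n) x - f (N 0) x)" by simp
    then show ?case by (simp add: convergent_diff_const_right_iff)
  qed
  define g where "g x = lim (\<lambda>k. f (N k) x)" for x
  have gm[measurable]: "g \<in> borel_measurable M" unfolding g_def by measurable
  have lim: "AE x in M. (\<lambda>k. f (N k) x) \<longlonglongrightarrow> g x"
    using conv by eventually_elim (simp add: g_def convergent_LIMSEQ_iff)
  have Fatou: "(\<integral>\<^sup>+x. ennreal ((f n x - g x)\<^sup>2) \<partial>M) \<le> ennreal (e\<^sup>2)"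
    if e: "\<And>k. k \<ge> K \<Longrightarrow> L2_norm M (\<lambda>x. f n x - f (N k) x) \<le> e" for n e K
  proof -
    have "(\<integral>\<^sup>+x. ennreal ((f n x - g x)\<^sup>2) \<partial>M) = (\<integral>\<^sup>+x. liminf (\<lambda>k. ennreal ((f n x - f (N k) x)\<^sup>2)) \<partial>M)"
    proof (rule nn_integral_cong_AE)
      show "AE x in M. ennreal ((f n x - g x)\<^sup>2) = liminf (\<lambda>k. ennreal ((f n x - f (N k) x)\<^sup>2))"
        using lim
      proof eventually_elim
        case (elim x)
        have "(\<lambda>k. ennreal ((f n x - f (N k) x)\<^sup>2)) \<longlonglongrightarrow> ennreal ((f n x - g x)\<^sup>2)"
          using elim by (intro tendsto_ennrealI tendsto_intros)
        then show ?case by (intro lim_imp_Liminf[symmetric]) simp_all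
      qed
    qed
    also have "\<dots> \<le> liminf (\<lambda>k. \<integral>\<^sup>+x. ennreal ((f n x - f (N k) x)\<^sup>2) \<partial>M)"
      by (rule nn_integral_liminf) measurable
    also have "\<dots> \<le> ennreal (e\<^sup>2)"
    proof (rule Liminf_le)
      show "\<forall>\<^sub>F k in sequentially. (\<integral>\<^sup>+x. ennreal ((f n x - f (N k) x)\<^sup>2) \<partial>M) \<le> ennreal (e\<^sup>2)"
        using eventually_ge_at_top[of K]
      proof eventually_elim
      case (elim k)
      have "(\<integral>\<^sup>+x. ennreal ((f n x - f (N k) x)\<^sup>2) \<partial>M) = ennreal (\<integral>x. (f n x - f (N k) x)\<^sup>2 \<partial>M)"
        using L2_integrable_sq[OF L2_diff[OF f f]] by (intro nn_integral_eq_integral) auto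
      also have "\<dots> \<le> ennreal (e\<^sup>2)"
        unfolding L2_norm_sq[symmetric] using e[OF elim] by (intro ennreal_leI power_mono L2_norm_nonneg)
      finally show ?case .
      qed
    qed simp
    finally show ?thesis .
  qed
  have dL: "(\<lambda>x. f n x - g x) \<in> L2 M \<and> L2_norm M (\<lambda>x. f n x - g x) \<le> e"
    if e: "\<And>k. k \<ge> K \<Longrightarrow> L2_norm M (\<lambda>x. f n x - f (N k) x) \<le> e" "0 \<le> e" for n e K
  proof
    have le: "(\<integral>\<^sup>+x. ennreal ((f n x - g x)\<^sup>2) \<partial>M) \<le> ennreal (e\<^sup>2)" using Fatou[OF e(1)] .
    then have i: "integrable M (\<lambda>x. (f n x - g x)\<^sup>2)"
      by (intro integrableI_nonneg) (auto intro: order_le_less_trans)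
    then show "(\<lambda>x. f n x - g x) \<in> L2 M" by (intro L2_I) auto
    have "ennreal (\<integral>x. (f n x - g x)\<^sup>2 \<partial>M) \<le> ennreal (e\<^sup>2)"
      using le nn_integral_eq_integral[OF i] by simp
    then have "(L2_norm M (\<lambda>x. f n x - g x))\<^sup>2 \<le> e\<^sup>2" by (simp add: L2_norm_sq)
    then show "L2_norm M (\<lambda>x. f n x - g x) \<le> e" using e(2) by (rule power2_le_imp_le)
  qed
  have mono: "strict_mono N" using Nmono by (simp add: strict_mono_Suc_iff)
  have "L2_norm M (\<lambda>x. f (N 0) x - f (N k) x) \<le> 1" if "k \<ge> 0" for k
    using N[of 0 "N 0" "N k"] strict_mono_less_eq[OF mono] by (simp add: less_imp_le)
  then have "(\<lambda>x. f (N 0) x - g x) \<in> L2 M" using dL[of 0 "N 0" 1] by simp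
  from L2_diff[OF f[of "N 0"] this] have gL: "g \<in> L2 M" by simp
  moreover have "(\<lambda>n. L2_norm M (\<lambda>x. f n x - g x)) \<longlonglongrightarrow> 0"
  proof (rule LIMSEQ_I)
    fix r :: real assume r: "r > 0"
    obtain N' where N': "\<forall>m\<ge>N'. \<forall>n\<ge>N'. L2_norm M (\<lambda>x. f m x - f n x) < r/2" using Cauchy[of "r/2"] r by auto
    have "L2_norm M (\<lambda>x. f n x - g x) \<le> r/2" if n: "n \<ge> N'" for n
    proof (rule conjunct2[OF dL])
      fix k assume "N' \<le> k"
      then have "N' \<le> N k" using seq_suble[OF mono, of k] by simp
      then show "L2_norm M (\<lambda>x. f n x - f (N k) x) \<le> r/2" using N' n by (simp add: less_imp_le)
    qed (use r in simp)
    then have "norm (L2_norm M (\<lambda>x. f n x - g x) - 0) < r" if "n \<ge> N'" for n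
      using that r L2_norm_nonneg[of M "\<lambda>x. f n x - g x"] by fastforce
    then show "\<exists>no. \<forall>n\<ge>no. norm (L2_norm M (\<lambda>x. f n x - g x) - 0) < r" by blast
  qed
  ultimately show ?thesis by (rule that)
qed

section \<open>Expansion of the characteristic function of the log-likelihood\<close>

text \<open>The remainder has derivative z^2 / (1 + z), which is at most 2 x^2 between -|x| and |x|
  because 1 + z is at least 1/2; the mean value inequality does the rest.\<close>

lemma ln_1_plus_cubic:
  assumes "\<bar>x::real\<bar> \<le> 1/2"
  shows "\<bar>ln (1 + x) - (x - x\<^sup>2 / 2)\<bar> \<le> 2 * \<bar>x\<bar>^3"
proof -
  let ?f = "\<lambda>x::real. ln (1 + x) - (x - x\<^sup>2 / 2)"
  have "norm (?f x - ?f 0) \<le> 2 * x\<^sup>2 * norm (x - 0)"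
  proof (rule field_differentiable_bound[where S = "{-\<bar>x\<bar>..\<bar>x\<bar>}" and f' = "\<lambda>z. 1 / (1 + z) - (1 - z)"])
    fix z assume z: "z \<in> {-\<bar>x\<bar>..\<bar>x\<bar>}"
    then have z1: "1/2 \<le> 1 + z" "\<bar>z\<bar> \<le> \<bar>x\<bar>" using assms by auto
    then show "(?f has_field_derivative 1 / (1 + z) - (1 - z)) (at z within {-\<bar>x\<bar>..\<bar>x\<bar>})"
      by (auto intro!: derivative_eq_intros)
    have "1 / (1 + z) - (1 - z) = z\<^sup>2 / (1 + z)" using z1 by (simp add: field_simps power2_eq_square)
    also have "\<dots> \<le> z\<^sup>2 / (1/2)" using z1 by (intro divide_left_mono) auto
    also have "\<dots> \<le> 2 * x\<^sup>2" using z1(2) by (simp add: abs_le_square_iff)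
    finally show "norm (1 / (1 + z) - (1 - z)) \<le> 2 * x\<^sup>2"
      using \<open>1 / (1 + z) - (1 - z) = z\<^sup>2 / (1 + z)\<close> z1 by simp
  qed auto
  then show ?thesis by (simp add: power3_eq_cube power2_eq_square abs_mult)
qed

text \<open>With \<open>v h\<close> the root density minus one, this is the integrand of the characteristic function of
  the log likelihood ratios \<open>ln (p h / p s)\<close> under the law with density \<open>p s\<close>.\<close>

definition loglik_integrand :: "'h set \<Rightarrow> 'h \<Rightarrow> ('h \<Rightarrow> real) \<Rightarrow> ('h \<Rightarrow> real) \<Rightarrow> complex" where
  "loglik_integrand Z s \<tau> v =
     (if \<forall>h\<in>insert s Z. 0 < 1 + v h
      then complex_of_real ((1 + v s)\<^sup>2) * iexp (\<Sum>h\<in>Z. \<tau> h * (2 * ln (1 + v h) - 2 * ln (1 + v s)))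
      else 0)"

text \<open>The second order Taylor polynomial, written so that its integral involves only the masses
  \<open>\<integral>(1 + v h)\<^sup>2\<close> and quadratic forms in \<open>v\<close>.\<close>

definition loglik_quadratic :: "'h set \<Rightarrow> 'h \<Rightarrow> ('h \<Rightarrow> real) \<Rightarrow> ('h \<Rightarrow> real) \<Rightarrow> complex" where
  "loglik_quadratic Z s \<tau> v =
     Complex ((1 + v s)\<^sup>2 - 2 * (\<Sum>h\<in>Z. \<tau> h * (v h - v s))\<^sup>2)
       (\<Sum>h\<in>Z. \<tau> h * ((1 + v h)\<^sup>2 - (1 + v s)\<^sup>2 - 2 * (v h - v s)\<^sup>2))"

lemma norm_loglik_integrand_le: "norm (loglik_integrand Z s \<tau> v) \<le> (1 + v s)\<^sup>2"
proof -
  have "norm (complex_of_real ((1 + v s)\<^sup>2) * iexp \<theta>) = (1 + v s)\<^sup>2" for \<theta>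
    unfolding norm_mult norm_of_real norm_exp_i_times by simp
  then show ?thesis unfolding loglik_integrand_def
    by (cases "\<forall>h\<in>insert s Z. 0 < 1 + v h") (simp_all only: if_P if_not_P not_False_eq_True order_refl norm_zero zero_le_power2)
qed

text \<open>For \<open>X\<close> the exponential of the exact phase \<theta>, with first and second
  order parts \<theta>1 and \<theta>2: the error splits into that of the exponential, that of the
  phase and that of its square.\<close>

lemma E_identity:
  fixes X :: complex and \<theta> \<theta>1 \<theta>2 :: real
  shows "X - (1 + \<i> * \<theta>1 + \<i> * \<theta>2 - \<theta>1\<^sup>2 / 2) =
    (X - (1 + \<i> * \<theta> - \<theta>\<^sup>2 / 2)) + \<i> * complex_of_real (\<theta> - \<theta>1 - \<theta>2) - complex_of_real ((\<theta>\<^sup>2 - \<theta>1\<^sup>2) / 2)"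
  by (simp add: algebra_simps diff_divide_distrib)

text \<open>The weight (1 + v)^2 times the expansion of \<open>X\<close>, compared with its terms of
  total order at most two; the summands on the right collect what is of order three and
  higher.\<close>

lemma remainder_identity:
  fixes X :: complex and v \<theta>1 \<theta>2 :: real
  shows "complex_of_real ((1 + v)\<^sup>2) * X - (complex_of_real ((1 + v)\<^sup>2 - \<theta>1\<^sup>2 / 2) + \<i> * (\<theta>1 + \<theta>2 + 2 * v * \<theta>1))
     = complex_of_real ((1 + v)\<^sup>2) * (X - (1 + \<i> * \<theta>1 + \<i> * \<theta>2 - \<theta>1\<^sup>2 / 2))
       + \<i> * complex_of_real (v\<^sup>2 * \<theta>1)
       + complex_of_real (2 * v + v\<^sup>2) * (\<i> * \<theta>2 - complex_of_real (\<theta>1\<^sup>2 / 2))"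
proof -
  have "complex_of_real ((1 + v)\<^sup>2) = 1 + complex_of_real (2 * v + v\<^sup>2)"
    by (simp add: power2_eq_square algebra_simps)
  then show ?thesis by (simp add: algebra_simps power2_eq_square)
qed

text \<open>For small \<open>m\<close> the remainder is cubic; for large \<open>m\<close> integrand
  and polynomial are both of order m^2. The factor min 1 m unites the cases: the bound is integrable
  for square integrable \<open>v\<close> and still becomes o(1/n). The coefficients are generously
  rounded; what matters is that they depend on \<open>T\<close> alone.\<close>

lemma loglik_taylor:
  assumes Z: "finite Z" and v: "\<And>h. h \<in> insert s Z \<Longrightarrow> \<bar>v h\<bar> \<le> m" and T: "(\<Sum>h\<in>Z. \<bar>\<tau> h\<bar>) \<le> T"
  shows "norm (loglik_integrand Z s \<tau> v - loglik_quadratic Z s \<tau> v)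
      \<le> (36 + 100 * T + 350 * T\<^sup>2 + 2200 * T^3) * (m\<^sup>2 * min 1 m)"
proof -
  have m0: "0 \<le> m" using v[of s] by auto
  have T0: "0 \<le> T" by (rule order_trans[OF _ T]) (simp add: sum_nonneg)
  have lin: "\<bar>\<Sum>h\<in>Z. \<tau> h * f h\<bar> \<le> T * B" if "\<And>h. h \<in> Z \<Longrightarrow> \<bar>f h\<bar> \<le> B" "0 \<le> B" for f B
  proof -
    have "\<bar>\<Sum>h\<in>Z. \<tau> h * f h\<bar> \<le> (\<Sum>h\<in>Z. \<bar>\<tau> h * f h\<bar>)" by (rule sum_abs)
    also have "\<dots> \<le> (\<Sum>h\<in>Z. \<bar>\<tau> h\<bar> * B)"
      using that by (intro sum_mono) (simp add: abs_mult mult_left_mono)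
    also have "\<dots> \<le> T * B" using T that(2) by (simp add: sum_distrib_right[symmetric] mult_right_mono)
    finally show ?thesis .
  qed
  \<comment> \<open>First and second order parts of the phase, from 2 ln (1 + v) = 2 v - v^2 + ...
    at \<open>v h\<close> and at \<open>v s\<close>.\<close>
  define \<theta>1 where "\<theta>1 = (\<Sum>h\<in>Z. \<tau> h * (2 * (v h - v s)))"
  define \<theta>2 where "\<theta>2 = (\<Sum>h\<in>Z. \<tau> h * (- ((v h)\<^sup>2 - (v s)\<^sup>2)))"
  have vs: "\<bar>v s\<bar> \<le> m" using v by simp
  have vh2: "(v h)\<^sup>2 \<le> m\<^sup>2" if "h \<in> insert s Z" for h
    using v[OF that] m0 by (simp add: abs_le_square_iff[symmetric])
  have b1: "\<bar>\<theta>1\<bar> \<le> T * (4 * m)"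
    unfolding \<theta>1_def
  proof (rule lin)
    fix h assume "h \<in> Z"
    then show "\<bar>2 * (v h - v s)\<bar> \<le> 4 * m" using v[of h] vs by (simp add: abs_le_iff)
  qed (use m0 in simp)
  have b2: "\<bar>\<theta>2\<bar> \<le> T * m\<^sup>2"
    unfolding \<theta>2_def
  proof (rule lin)
    fix h assume "h \<in> Z"
    then have "(v h)\<^sup>2 \<le> m\<^sup>2" "(v s)\<^sup>2 \<le> m\<^sup>2" using vh2 by auto
    then show "\<bar>- ((v h)\<^sup>2 - (v s)\<^sup>2)\<bar> \<le> m\<^sup>2"
      using zero_le_power2[of "v h"] zero_le_power2[of "v s"] by linarith
  qed simp
  have quad: "loglik_quadratic Z s \<tau> v = complex_of_real ((1 + v s)\<^sup>2 - \<theta>1\<^sup>2 / 2) + \<i> * (\<theta>1 + \<theta>2 + 2 * v s * \<theta>1)"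
  proof -
    have "(\<Sum>h\<in>Z. \<tau> h * ((1 + v h)\<^sup>2 - (1 + v s)\<^sup>2 - 2 * (v h - v s)\<^sup>2)) = \<theta>1 + \<theta>2 + 2 * v s * \<theta>1"
      unfolding \<theta>1_def \<theta>2_def sum_distrib_left sum.distrib[symmetric]
      by (intro sum.cong refl) (simp add: power2_eq_square algebra_simps)
    moreover have "2 * (\<Sum>h\<in>Z. \<tau> h * (v h - v s))\<^sup>2 = \<theta>1\<^sup>2 / 2"
    proof -
      have "\<theta>1 = 2 * (\<Sum>h\<in>Z. \<tau> h * (v h - v s))" unfolding \<theta>1_def by (simp add: sum_distrib_left mult_ac)
      then show ?thesis by (simp add: power2_eq_square)
    qed
    ultimately show ?thesis by (simp add: loglik_quadratic_def complex_eq_iff)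
  qed
  show ?thesis
  \<comment> \<open>Up to 1/2 the logarithms are expanded; beyond it every term is absorbed in m^2,
    since then 1 \<le> 4 m^2.\<close>
  proof (cases "m \<le> 1/2")
    case True
    have small: "\<bar>v h\<bar> \<le> 1/2" if "h \<in> insert s Z" for h using v[OF that] True by simp
    define \<theta> where "\<theta> = (\<Sum>h\<in>Z. \<tau> h * (2 * ln (1 + v h) - 2 * ln (1 + v s)))"
    have pos: "\<forall>h\<in>insert s Z. 0 < 1 + v h"
    proof
      fix h assume "h \<in> insert s Z"
      from small[OF this] show "0 < 1 + v h" by (simp add: abs_le_iff)
    qed
    have \<Phi>: "loglik_integrand Z s \<tau> v = complex_of_real ((1 + v s)\<^sup>2) * iexp \<theta>"
      unfolding loglik_integrand_def \<theta>_def by (rule if_P[OF pos])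
    have cub: "\<bar>ln (1 + v h) - (v h - (v h)\<^sup>2 / 2)\<bar> \<le> 2 * m^3" if "h \<in> insert s Z" for h
      using ln_1_plus_cubic[OF small[OF that]] power_mono[OF v[OF that], of 3] by simp
    have b3: "\<bar>\<theta> - \<theta>1 - \<theta>2\<bar> \<le> T * (8 * m^3)"
    proof -
      have "\<theta> - \<theta>1 - \<theta>2 = (\<Sum>h\<in>Z. \<tau> h * (2 * (ln (1 + v h) - (v h - (v h)\<^sup>2 / 2)) - 2 * (ln (1 + v s) - (v s - (v s)\<^sup>2 / 2))))"
        unfolding \<theta>_def \<theta>1_def \<theta>2_def sum_subtractf[symmetric]
        by (intro sum.cong refl) (simp add: algebra_simps)
      also have "\<bar>\<dots>\<bar> \<le> T * (8 * m^3)"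
      proof (rule lin)
        fix h assume "h \<in> Z"
        then show "\<bar>2 * (ln (1 + v h) - (v h - (v h)\<^sup>2 / 2)) - 2 * (ln (1 + v s) - (v s - (v s)\<^sup>2 / 2))\<bar> \<le> 8 * m^3"
          using cub[of h] cub[of s] unfolding abs_le_iff by simp
      qed (use m0 in simp)
      finally show ?thesis .
    qed
    have m2: "m\<^sup>2 \<le> m / 2" "m^3 \<le> m / 4" "m^3 \<le> m\<^sup>2 / 2"
    proof -
      show a: "m\<^sup>2 \<le> m / 2" using mult_left_mono[OF True m0] by (simp add: power2_eq_square)
      show b: "m^3 \<le> m\<^sup>2 / 2" using mult_left_mono[OF True, of "m\<^sup>2"] by (simp add: power3_eq_cube power2_eq_square)
      show "m^3 \<le> m / 4" using a b by simp
    qed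
    have b\<theta>: "\<bar>\<theta>\<bar> \<le> T * (8 * m)"
    proof -
      have "T * m\<^sup>2 \<le> T * (m / 2)" "T * m^3 \<le> T * (m / 4)"
        by (rule mult_left_mono[OF m2(1) T0]) (rule mult_left_mono[OF m2(2) T0])
      then show ?thesis using b1 b2 b3 by (simp add: abs_le_iff algebra_simps)
    qed
    have bd: "\<bar>\<theta> - \<theta>1\<bar> \<le> T * (6 * m\<^sup>2)"
    proof -
      have "T * m^3 \<le> T * (m\<^sup>2 / 2)" by (rule mult_left_mono[OF m2(3) T0])
      moreover have "0 \<le> T * m\<^sup>2" using T0 by simp
      ultimately show ?thesis using b2 b3 by (simp add: abs_le_iff algebra_simps)
    qed
    have bs: "\<bar>\<theta> + \<theta>1\<bar> \<le> T * (12 * m)" using b\<theta> b1 by (simp add: abs_le_iff algebra_simps)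
    have sq: "\<bar>\<theta>\<^sup>2 - \<theta>1\<^sup>2\<bar> \<le> 72 * T\<^sup>2 * m^3"
    proof -
      have "\<bar>\<theta>\<^sup>2 - \<theta>1\<^sup>2\<bar> = \<bar>\<theta> - \<theta>1\<bar> * \<bar>\<theta> + \<theta>1\<bar>" by (simp add: abs_mult[symmetric] power2_eq_square algebra_simps)
      also have "\<dots> \<le> (T * (6 * m\<^sup>2)) * (T * (12 * m))" using bd bs T0 m0 by (intro mult_mono) auto
      finally show ?thesis by (simp add: power2_eq_square power3_eq_cube mult_ac)
    qed
    have ex: "norm (iexp \<theta> - (1 + \<i> * \<theta> - \<theta>\<^sup>2 / 2)) \<le> 512 * T^3 * m^3"
    proof -
      have "norm (iexp \<theta> - (\<Sum>k\<le>2. (\<i> * \<theta>)^k / fact k)) \<le> \<bar>\<theta>\<bar>^Suc 2 / fact (Suc 2)" by (rule iexp_approx1)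
      also have "(\<Sum>k\<le>2. (\<i> * \<theta>)^k / fact k) = 1 + \<i> * \<theta> - \<theta>\<^sup>2 / 2"
        by (simp add: eval_nat_numeral power_mult_distrib)
      also have "\<bar>\<theta>\<bar>^Suc 2 / fact (Suc 2) \<le> \<bar>\<theta>\<bar>^Suc 2 / 1" by (intro divide_left_mono fact_ge_1) auto
      also have "\<dots> = \<bar>\<theta>\<bar>^3" by simp
      also have "\<dots> \<le> (T * (8 * m))^3" using b\<theta> by (intro power_mono) auto
      finally show ?thesis by (simp add: power_mult_distrib)
    qed
    define E where "E = iexp \<theta> - (1 + \<i> * \<theta>1 + \<i> * \<theta>2 - \<theta>1\<^sup>2 / 2)"
    have bE: "norm E \<le> (512 * T^3 + 8 * T + 36 * T\<^sup>2) * m^3"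
    proof -
      have "E = (iexp \<theta> - (1 + \<i> * \<theta> - \<theta>\<^sup>2 / 2)) + \<i> * complex_of_real (\<theta> - \<theta>1 - \<theta>2) - complex_of_real ((\<theta>\<^sup>2 - \<theta>1\<^sup>2) / 2)"
        unfolding E_def by (rule E_identity)
      also have "norm \<dots> \<le> norm (iexp \<theta> - (1 + \<i> * \<theta> - \<theta>\<^sup>2 / 2)) + norm (\<i> * complex_of_real (\<theta> - \<theta>1 - \<theta>2))
          + norm (complex_of_real ((\<theta>\<^sup>2 - \<theta>1\<^sup>2) / 2))"
        by (rule order_trans[OF norm_triangle_ineq4 add_right_mono[OF norm_triangle_ineq]])
      also have "\<dots> \<le> 512 * T^3 * m^3 + T * (8 * m^3) + 72 * T\<^sup>2 * m^3 / 2"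
        using ex b3 sq by (intro add_mono) (simp_all add: norm_mult del: of_real_diff of_real_divide)
      finally show ?thesis by (simp add: algebra_simps)
    qed
    have vs1: "(1 + v s)\<^sup>2 \<le> 4" "\<bar>2 * v s + (v s)\<^sup>2\<bar> \<le> 3 * m" "(v s)\<^sup>2 \<le> m\<^sup>2"
    proof -
      have "(1 + v s)\<^sup>2 \<le> 2\<^sup>2" using small[of s] by (intro power_mono) (auto simp: abs_le_iff)
      then show "(1 + v s)\<^sup>2 \<le> 4" by simp
      show a: "(v s)\<^sup>2 \<le> m\<^sup>2" using vh2 by simp
      have "\<bar>2 * v s + (v s)\<^sup>2\<bar> \<le> 2 * \<bar>v s\<bar> + (v s)\<^sup>2"
        using abs_triangle_ineq[of "2 * v s" "(v s)\<^sup>2"] by (simp add: abs_mult)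
      then show "\<bar>2 * v s + (v s)\<^sup>2\<bar> \<le> 3 * m" using a m2(1) vs by linarith
    qed
    have "loglik_integrand Z s \<tau> v - loglik_quadratic Z s \<tau> v
       = complex_of_real ((1 + v s)\<^sup>2) * E + \<i> * complex_of_real ((v s)\<^sup>2 * \<theta>1)
         + complex_of_real (2 * v s + (v s)\<^sup>2) * (\<i> * \<theta>2 - complex_of_real (\<theta>1\<^sup>2 / 2))"
      unfolding \<Phi> quad E_def by (rule remainder_identity)
    also have "norm \<dots> \<le> norm (complex_of_real ((1 + v s)\<^sup>2) * E) + norm (\<i> * complex_of_real ((v s)\<^sup>2 * \<theta>1))
         + norm (complex_of_real (2 * v s + (v s)\<^sup>2) * (\<i> * \<theta>2 - complex_of_real (\<theta>1\<^sup>2 / 2)))"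
      by (rule order_trans[OF norm_triangle_ineq add_right_mono[OF norm_triangle_ineq]])
    also have "\<dots> \<le> 4 * ((512 * T^3 + 8 * T + 36 * T\<^sup>2) * m^3) + m\<^sup>2 * (T * (4 * m)) + 3 * m * (T * m\<^sup>2 + 8 * T\<^sup>2 * m\<^sup>2)"
    proof (intro add_mono)
      show "norm (complex_of_real ((1 + v s)\<^sup>2) * E) \<le> 4 * ((512 * T^3 + 8 * T + 36 * T\<^sup>2) * m^3)"
        unfolding norm_mult using vs1 bE by (intro mult_mono) (auto simp del: of_real_power)
      have "norm (\<i> * complex_of_real ((v s)\<^sup>2 * \<theta>1)) = (v s)\<^sup>2 * \<bar>\<theta>1\<bar>"
        unfolding norm_mult norm_of_real abs_mult by simp
      also have "\<dots> \<le> m\<^sup>2 * (T * (4 * m))" using vs1 b1 by (intro mult_mono) auto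
      finally show "norm (\<i> * complex_of_real ((v s)\<^sup>2 * \<theta>1)) \<le> m\<^sup>2 * (T * (4 * m))" .
      show "norm (complex_of_real (2 * v s + (v s)\<^sup>2) * (\<i> * \<theta>2 - complex_of_real (\<theta>1\<^sup>2 / 2))) \<le> 3 * m * (T * m\<^sup>2 + 8 * T\<^sup>2 * m\<^sup>2)"
        unfolding norm_mult
      proof (rule mult_mono)
        show "norm (complex_of_real (2 * v s + (v s)\<^sup>2)) \<le> 3 * m" using vs1 unfolding norm_of_real by simp
        have "\<theta>1\<^sup>2 \<le> (T * (4 * m))\<^sup>2" using b1 by (metis abs_ge_zero power2_abs power_mono)
        then have "\<bar>\<theta>1\<^sup>2 / 2\<bar> \<le> 8 * T\<^sup>2 * m\<^sup>2" by (simp add: power_mult_distrib)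
        moreover have "norm (\<i> * complex_of_real \<theta>2) \<le> T * m\<^sup>2" using b2 by (simp add: norm_mult)
        ultimately show "norm (\<i> * \<theta>2 - complex_of_real (\<theta>1\<^sup>2 / 2)) \<le> T * m\<^sup>2 + 8 * T\<^sup>2 * m\<^sup>2"
          by (intro norm_triangle_le_diff add_mono) (auto simp del: of_real_power of_real_divide)
      qed (use m0 T0 in auto)
    qed
    also have "\<dots> = (2048 * T^3 + 39 * T + 168 * T\<^sup>2) * m^3"
      by (simp add: algebra_simps power2_eq_square power3_eq_cube)
    also have "\<dots> \<le> (36 + 100 * T + 350 * T\<^sup>2 + 2200 * T^3) * m^3"
      using T0 m0 by (intro mult_right_mono) auto
    also have "m^3 = m\<^sup>2 * min 1 m" using True by (simp add: power2_eq_square power3_eq_cube min_def)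
    finally show ?thesis .
  next
    case False
    then have m1: "1 \<le> 4 * m\<^sup>2" using power_mono[of "1/2" m 2] by (simp add: power2_eq_square)
    have sq: "(1 + v h)\<^sup>2 \<le> 9 * m\<^sup>2" if "h \<in> insert s Z" for h
    proof -
      have "\<bar>1 + v h\<bar> \<le> \<bar>3 * m\<bar>" using v[OF that] False by (simp add: abs_le_iff)
      then have "(1 + v h)\<^sup>2 \<le> (3 * m)\<^sup>2" by (simp only: abs_le_square_iff)
      then show ?thesis by (simp add: power_mult_distrib)
    qed
    have sqd: "(v h - v s)\<^sup>2 \<le> 4 * m\<^sup>2" if "h \<in> Z" for h
    proof -
      have "\<bar>v h - v s\<bar> \<le> \<bar>2 * m\<bar>" using v[of h] vs that m0 by (simp add: abs_le_iff)
      then have "(v h - v s)\<^sup>2 \<le> (2 * m)\<^sup>2" by (simp only: abs_le_square_iff)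
      then show ?thesis by (simp add: power_mult_distrib)
    qed
    have "\<theta>1\<^sup>2 \<le> (T * (4 * m))\<^sup>2" using b1 by (metis abs_ge_zero power2_abs power_mono)
    then have t: "\<theta>1\<^sup>2 / 2 \<le> 8 * T\<^sup>2 * m\<^sup>2" by (simp add: power_mult_distrib)
    have im: "\<bar>\<Sum>h\<in>Z. \<tau> h * ((1 + v h)\<^sup>2 - (1 + v s)\<^sup>2 - 2 * (v h - v s)\<^sup>2)\<bar> \<le> T * (17 * m\<^sup>2)"
    proof (rule lin)
      fix h assume h: "h \<in> Z"
      show "\<bar>(1 + v h)\<^sup>2 - (1 + v s)\<^sup>2 - 2 * (v h - v s)\<^sup>2\<bar> \<le> 17 * m\<^sup>2"
        using sq[of h] sq[of s] sqd[OF h] h zero_le_power2[of "1 + v h"] zero_le_power2[of "1 + v s"]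
          zero_le_power2[of "v h - v s"] unfolding abs_le_iff by (simp, linarith)
    qed simp
    have "norm (loglik_quadratic Z s \<tau> v) \<le> \<bar>(1 + v s)\<^sup>2 - \<theta>1\<^sup>2 / 2\<bar> + \<bar>\<theta>1 + \<theta>2 + 2 * v s * \<theta>1\<bar>"
      unfolding quad by (rule order_trans[OF norm_triangle_ineq], simp only: norm_mult norm_of_real) simp
    also have "\<bar>(1 + v s)\<^sup>2 - \<theta>1\<^sup>2 / 2\<bar> \<le> 9 * m\<^sup>2 + 8 * T\<^sup>2 * m\<^sup>2"
      using sq[of s, OF insertI1] t zero_le_power2[of "1 + v s"] zero_le_power2[of \<theta>1] zero_le_power2[of m]
        zero_le_power2[of "T * m"] unfolding power_mult_distrib by linarith
    also have "\<theta>1 + \<theta>2 + 2 * v s * \<theta>1 = (\<Sum>h\<in>Z. \<tau> h * ((1 + v h)\<^sup>2 - (1 + v s)\<^sup>2 - 2 * (v h - v s)\<^sup>2))"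
      using arg_cong[OF quad, of Im] by (simp add: loglik_quadratic_def)
    also note im
    finally have "norm (loglik_quadratic Z s \<tau> v) \<le> 9 * m\<^sup>2 + 8 * T\<^sup>2 * m\<^sup>2 + T * (17 * m\<^sup>2)" by simp
    then have "norm (loglik_integrand Z s \<tau> v - loglik_quadratic Z s \<tau> v) \<le> 9 * m\<^sup>2 + (9 * m\<^sup>2 + 8 * T\<^sup>2 * m\<^sup>2 + T * (17 * m\<^sup>2))"
      using norm_loglik_integrand_le[of Z s \<tau> v] sq[of s] by (intro norm_triangle_le_diff) simp
    \<comment> \<open>Doubled coefficients pay for the factor 1/2, which is a lower bound of min 1 m
      in this case.\<close>
    also have "\<dots> = (36 + 34 * T + 16 * T\<^sup>2) * (m\<^sup>2 * (1/2))" by (simp add: algebra_simps)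
    also have "\<dots> \<le> (36 + 100 * T + 350 * T\<^sup>2 + 2200 * T^3) * (m\<^sup>2 * min 1 m)"
    proof (rule mult_mono)
      have "0 \<le> T\<^sup>2" "0 \<le> T^3" using T0 by auto
      then show "36 + 34 * T + 16 * T\<^sup>2 \<le> 36 + 100 * T + 350 * T\<^sup>2 + 2200 * T^3"
        "0 \<le> 36 + 100 * T + 350 * T\<^sup>2 + 2200 * T^3" using T0 by linarith+
      show "m\<^sup>2 * (1/2) \<le> m\<^sup>2 * min 1 m" using False by (intro mult_left_mono) auto
    qed simp
    finally show ?thesis .
  qed
qed

section \<open>Integrals along a sequence with a tangent\<close>

text \<open>\<open>w n\<close> stands for a root density minus 1 at the parameter 1 / sqrt n; the
  tangent is halved because it is the derivative of twice the root density.\<close>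

definition tangent_seq :: "'a measure \<Rightarrow> (nat \<Rightarrow> 'a \<Rightarrow> real) \<Rightarrow> ('a \<Rightarrow> real) \<Rightarrow> bool" where
  "tangent_seq M w \<gamma> \<longleftrightarrow> (\<forall>n. w n \<in> L2 M) \<and> \<gamma> \<in> L2 M \<and>
     (\<lambda>n. L2_norm M (\<lambda>x. sqrt (real n) * w n x - \<gamma> x / 2)) \<longlonglongrightarrow> 0"

lemma tangent_seq_lincomb:
  assumes "finite J" "\<And>h. h \<in> J \<Longrightarrow> tangent_seq M (\<lambda>n. w n h) (\<gamma> h)"
  shows "tangent_seq M (\<lambda>n x. \<Sum>h\<in>J. c h * w n h x) (\<lambda>x. \<Sum>h\<in>J. c h * \<gamma> h x)"
  unfolding tangent_seq_def
proof (intro conjI allI)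
  have L: "\<And>h n. h \<in> J \<Longrightarrow> w n h \<in> L2 M" "\<And>h. h \<in> J \<Longrightarrow> \<gamma> h \<in> L2 M"
    and lim: "\<And>h. h \<in> J \<Longrightarrow> (\<lambda>n. L2_norm M (\<lambda>x. sqrt (real n) * w n h x - \<gamma> h x / 2)) \<longlonglongrightarrow> 0"
    using assms(2) by (auto simp: tangent_seq_def)
  show "(\<lambda>x. \<Sum>h\<in>J. c h * w n h x) \<in> L2 M" for n using L by (intro L2_sum L2_scale)
  show "(\<lambda>x. \<Sum>h\<in>J. c h * \<gamma> h x) \<in> L2 M" using L by (intro L2_sum L2_scale)
  show "(\<lambda>n. L2_norm M (\<lambda>x. sqrt (real n) * (\<Sum>h\<in>J. c h * w n h x) - (\<Sum>h\<in>J. c h * \<gamma> h x) / 2)) \<longlonglongrightarrow> 0"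
  proof (rule Lim_null_comparison)
    show "(\<lambda>n. \<Sum>h\<in>J. \<bar>c h\<bar> * L2_norm M (\<lambda>x. sqrt (real n) * w n h x - \<gamma> h x / 2)) \<longlonglongrightarrow> 0"
      using lim by (intro tendsto_null_sum tendsto_mult_right_zero)
    show "\<forall>\<^sub>F n in sequentially. norm (L2_norm M (\<lambda>x. sqrt (real n) * (\<Sum>h\<in>J. c h * w n h x) - (\<Sum>h\<in>J. c h * \<gamma> h x) / 2))
      \<le> (\<Sum>h\<in>J. \<bar>c h\<bar> * L2_norm M (\<lambda>x. sqrt (real n) * w n h x - \<gamma> h x / 2))"
    proof (intro always_eventually allI)
      fix n
      have L': "(\<lambda>x. sqrt (real n) * w n h x - \<gamma> h x / 2) \<in> L2 M" if "h \<in> J" for h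
        using L2_diff[OF L2_scale[OF L(1)[OF that]] L2_scale[OF L(2)[OF that], of "1/2"]] by simp
      have eq: "(\<lambda>x. sqrt (real n) * (\<Sum>h\<in>J. c h * w n h x) - (\<Sum>h\<in>J. c h * \<gamma> h x) / 2)
        = (\<lambda>x. \<Sum>h\<in>J. c h * (sqrt (real n) * w n h x - \<gamma> h x / 2))"
        by (simp add: fun_eq_iff sum_distrib_left sum_divide_distrib sum_subtractf[symmetric] algebra_simps)
      have "L2_norm M (\<lambda>x. \<Sum>h\<in>J. c h * (sqrt (real n) * w n h x - \<gamma> h x / 2)) \<le> (\<Sum>h\<in>J. L2_norm M (\<lambda>x. c h * (sqrt (real n) * w n h x - \<gamma> h x / 2)))"
        using L' by (intro L2_norm_sum L2_scale)
      then show "norm (L2_norm M (\<lambda>x. sqrt (real n) * (\<Sum>h\<in>J. c h * w n h x) - (\<Sum>h\<in>J. c h * \<gamma> h x) / 2))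
        \<le> (\<Sum>h\<in>J. \<bar>c h\<bar> * L2_norm M (\<lambda>x. sqrt (real n) * w n h x - \<gamma> h x / 2))"
        unfolding eq by (simp add: L2_norm_scale L2_norm_nonneg)
    qed
  qed
qed

lemma tangent_seq_diff:
  assumes "tangent_seq M v \<beta>" "tangent_seq M w \<gamma>"
  shows "tangent_seq M (\<lambda>n x. v n x - w n x) (\<lambda>x. \<beta> x - \<gamma> x)"
  using tangent_seq_lincomb[of UNIV M "\<lambda>n b. if b then v n else w n" "\<lambda>b. if b then \<beta> else \<gamma>" "\<lambda>b. if b then 1 else -1"] assms
  by (simp add: UNIV_bool)

lemma tangent_seq_quadratic:
  assumes "tangent_seq M w \<gamma>"
  shows "(\<lambda>n. real n * (\<integral>x. (w n x)\<^sup>2 \<partial>M)) \<longlonglongrightarrow> (\<integral>x. (\<gamma> x)\<^sup>2 \<partial>M) / 4"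
proof -
  have L: "\<And>n. (\<lambda>x. sqrt (real n) * w n x) \<in> L2 M" "(\<lambda>x. \<gamma> x / 2) \<in> L2 M"
    using assms L2_scale[of _ M] L2_scale[of \<gamma> M "1/2"] by (auto simp: tangent_seq_def)
  have "(\<lambda>n. (L2_norm M (\<lambda>x. sqrt (real n) * w n x))\<^sup>2) \<longlonglongrightarrow> (L2_norm M (\<lambda>x. \<gamma> x / 2))\<^sup>2"
    using assms by (intro tendsto_power L2_norm_tendsto L) (simp add: tangent_seq_def)
  then show ?thesis by (simp add: L2_norm_sq power_mult_distrib power_divide)
qed

lemma borel_measurable_loglik_integrand:
  assumes Z: "finite Z" and v: "\<And>h. h \<in> insert s Z \<Longrightarrow> (\<lambda>x. v x h) \<in> borel_measurable M"
  shows "(\<lambda>x. loglik_integrand Z s \<tau> (v x)) \<in> borel_measurable M"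
proof -
  have [measurable]: "(\<lambda>x. v x s) \<in> borel_measurable M" "\<And>h. h \<in> Z \<Longrightarrow> (\<lambda>x. v x h) \<in> borel_measurable M"
    using v by auto
  have "{x \<in> space M. \<forall>h\<in>insert s Z. 0 < 1 + v x h} \<in> sets M"
    using Z v by (intro sets.sets_Collect_finite_All) auto
  then show ?thesis unfolding loglik_integrand_def by (intro measurable_If) (auto intro!: borel_measurable_complex_iff[THEN iffD2])
qed

text \<open>Multiplied by n, the Taylor remainder vanishes, and the integral of the polynomial
  consists of masses, which contribute 0 in the limit, and of quadratic forms, which converge with
  the tangents. The limit is the logarithm of the characteristic function of jointly normal
  variables whose means are minus half their variances.\<close>

lemma loglik_integral_expansion:
  fixes v :: "nat \<Rightarrow> 'h \<Rightarrow> 'a \<Rightarrow> real"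
  assumes M: "prob_space M" and Z: "finite Z"
    and t: "\<And>h. h \<in> insert s Z \<Longrightarrow> tangent_seq M (\<lambda>n. v n h) (\<gamma> h)"
    and mass: "\<And>h. h \<in> insert s Z \<Longrightarrow> (\<lambda>n. real n * ((\<integral>x. (1 + v n h x)\<^sup>2 \<partial>M) - 1)) \<longlonglongrightarrow> 0"
  shows "(\<lambda>n. of_nat n * ((\<integral>x. loglik_integrand Z s \<tau> (\<lambda>h. v n h x) \<partial>M) - 1)) \<longlonglongrightarrow>
     Complex (- (\<integral>x. (\<Sum>h\<in>Z. \<tau> h * (\<gamma> h x - \<gamma> s x))\<^sup>2 \<partial>M) / 2)
       (- (\<Sum>h\<in>Z. \<tau> h * (\<integral>x. (\<gamma> h x - \<gamma> s x)\<^sup>2 \<partial>M)) / 2)"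
proof -
  interpret prob_space M by fact
  let ?J = "insert s Z"
  have J: "finite ?J" using Z by simp
  have vL: "v n h \<in> L2 M" "\<gamma> h \<in> L2 M" if "h \<in> ?J" for n h using t[OF that] by (auto simp: tangent_seq_def)
  note vm = L2_measurable[OF vL(1)] L2_measurable[OF vL(2)]
  \<comment> \<open>\<open>m\<close> dominates all \<open>v n h\<close>. Times sqrt n it is at most
    \<Gamma>/2 + \<rho>, where \<Gamma> is a fixed square integrable function and \<rho> tends to 0
    in L2.\<close>
  define m where "m n x = (\<Sum>h\<in>?J. \<bar>v n h x\<bar>)" for n x
  define \<Gamma> where "\<Gamma> x = (\<Sum>h\<in>?J. \<bar>\<gamma> h x\<bar>)" for x
  define \<rho> where "\<rho> n x = (\<Sum>h\<in>?J. \<bar>sqrt (real n) * v n h x - \<gamma> h x / 2\<bar>)" for n x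
  have mL: "m n \<in> L2 M" for n unfolding m_def by (intro L2_sum L2_abs vL)
  have \<Gamma>L: "\<Gamma> \<in> L2 M" unfolding \<Gamma>_def by (intro L2_sum L2_abs vL)
  have dL: "(\<lambda>x. sqrt (real n) * v n h x - \<gamma> h x / 2) \<in> L2 M" if "h \<in> ?J" for n h
    using L2_diff[OF L2_scale[OF vL(1)[OF that]] L2_scale[OF vL(2)[OF that], of "1/2"]] by simp
  have \<rho>L: "\<rho> n \<in> L2 M" for n unfolding \<rho>_def by (intro L2_sum L2_abs dL)
  note [measurable] = L2_measurable[OF mL] L2_measurable[OF \<Gamma>L] L2_measurable[OF \<rho>L]
  have nonneg: "0 \<le> m n x" "0 \<le> \<Gamma> x" "0 \<le> \<rho> n x" for n x by (auto simp: m_def \<Gamma>_def \<rho>_def intro!: sum_nonneg)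
  define rem where "rem n x = (m n x)\<^sup>2 * min 1 (m n x)" for n x
  have rem_i: "integrable M (rem n)" for n
    unfolding rem_def
    by (rule Bochner_Integration.integrable_bound[OF L2_integrable_sq[OF mL]])
      (use nonneg in \<open>auto simp: abs_mult min_def mult_left_le\<close>)
  define maj where "maj n x = (\<Gamma> x)\<^sup>2 * min 1 (\<Gamma> x / sqrt (real n))" for n x
  have maj_i: "integrable M (maj n)" for n
    unfolding maj_def
    by (rule Bochner_Integration.integrable_bound[OF L2_integrable_sq[OF \<Gamma>L]])
      (use nonneg in \<open>auto simp: abs_mult min_def mult_left_le\<close>)
  have rem_le: "real n * rem n x \<le> maj n x + 4 * (\<rho> n x)\<^sup>2" if n: "n \<ge> 1" for n x
  proof -
    define r where "r = sqrt (real n)"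
    have r: "r > 0" "r\<^sup>2 = real n" using n by (auto simp: r_def)
    have "r * m n x \<le> \<Gamma> x / 2 + \<rho> n x"
      unfolding m_def \<Gamma>_def \<rho>_def sum_distrib_left sum_divide_distrib sum.distrib[symmetric] r_def[symmetric]
    proof (rule sum_mono)
      fix h
      have "r * \<bar>v n h x\<bar> = \<bar>\<gamma> h x / 2 + (r * v n h x - \<gamma> h x / 2)\<bar>" using r by (simp add: abs_mult)
      also have "\<dots> \<le> \<bar>\<gamma> h x / 2\<bar> + \<bar>r * v n h x - \<gamma> h x / 2\<bar>" by (rule abs_triangle_ineq)
      finally show "r * \<bar>v n h x\<bar> \<le> \<bar>\<gamma> h x\<bar> / 2 + \<bar>r * v n h x - \<gamma> h x / 2\<bar>" by simp
    qed
    \<comment> \<open>The larger of the two summands decides: the first case is paid for by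
      \<open>maj\<close>, the second by 4 \<rho>^2.\<close>
    then consider "r * m n x \<le> \<Gamma> x" | "r * m n x \<le> 2 * \<rho> n x" by linarith
    then show ?thesis
    proof cases
      case 1
      have "m n x \<le> \<Gamma> x / r" using 1 r by (simp add: field_simps)
      then have a: "min 1 (m n x) \<le> min 1 (\<Gamma> x / r)" by auto
      have b: "(r * m n x)\<^sup>2 \<le> (\<Gamma> x)\<^sup>2" using 1 r nonneg by (intro power_mono) auto
      have "real n * rem n x = (r * m n x)\<^sup>2 * min 1 (m n x)" by (simp add: rem_def power_mult_distrib r(2))
      also have "\<dots> \<le> (\<Gamma> x)\<^sup>2 * min 1 (\<Gamma> x / r)" using a b nonneg r by (intro mult_mono) auto
      also have "\<dots> \<le> maj n x + 4 * (\<rho> n x)\<^sup>2" by (simp add: maj_def r_def)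
      finally show ?thesis .
    next
      case 2
      have b: "(r * m n x)\<^sup>2 \<le> (2 * \<rho> n x)\<^sup>2" using 2 r nonneg by (intro power_mono) auto
      have "real n * rem n x = (r * m n x)\<^sup>2 * min 1 (m n x)" by (simp add: rem_def power_mult_distrib r(2))
      also have "\<dots> \<le> (2 * \<rho> n x)\<^sup>2 * 1" using b nonneg by (intro mult_mono) auto
      also have "\<dots> \<le> maj n x + 4 * (\<rho> n x)\<^sup>2" using nonneg by (simp add: maj_def power_mult_distrib)
      finally show ?thesis .
    qed
  qed
  have \<rho>0: "(\<lambda>n. \<integral>x. (\<rho> n x)\<^sup>2 \<partial>M) \<longlonglongrightarrow> 0"
  proof -
    have "(\<lambda>n. L2_norm M (\<rho> n)) \<longlonglongrightarrow> 0"
    proof (rule Lim_null_comparison)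
      show "(\<lambda>n. \<Sum>h\<in>?J. L2_norm M (\<lambda>x. sqrt (real n) * v n h x - \<gamma> h x / 2)) \<longlonglongrightarrow> 0"
        using t by (intro tendsto_null_sum) (simp add: tangent_seq_def)
      have "L2_norm M (\<rho> n) \<le> (\<Sum>h\<in>?J. L2_norm M (\<lambda>x. \<bar>sqrt (real n) * v n h x - \<gamma> h x / 2\<bar>))" for n
        unfolding \<rho>_def by (intro L2_norm_sum L2_abs dL)
      then show "\<forall>\<^sub>F n in sequentially. norm (L2_norm M (\<rho> n)) \<le> (\<Sum>h\<in>?J. L2_norm M (\<lambda>x. sqrt (real n) * v n h x - \<gamma> h x / 2))"
        by (intro always_eventually) (simp add: L2_norm_nonneg L2_norm_def)
    qed
    from tendsto_power[OF this, of 2] show ?thesis by (simp add: L2_norm_sq)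
  qed
  \<comment> \<open>\<Gamma>^2 dominates, and the factor min 1 (\<Gamma> / sqrt n) tends to 0
    pointwise; second moments suffice.\<close>
  have maj0: "(\<lambda>n. \<integral>x. maj n x \<partial>M) \<longlonglongrightarrow> (\<integral>x. 0 \<partial>M)"
  proof (rule integral_dominated_convergence[where w = "\<lambda>x. (\<Gamma> x)\<^sup>2"])
    show "integrable M (\<lambda>x. (\<Gamma> x)\<^sup>2)" by (rule L2_integrable_sq[OF \<Gamma>L])
    show "AE x in M. norm (maj n x) \<le> (\<Gamma> x)\<^sup>2" for n
      using nonneg by (intro AE_I2) (auto simp: maj_def abs_mult min_def mult_left_le)
    show "AE x in M. (\<lambda>n. maj n x) \<longlonglongrightarrow> 0"
    proof (rule AE_I2)
      fix x
      have "filterlim (\<lambda>n. sqrt (real n)) at_top sequentially"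
        by (intro filterlim_compose[OF sqrt_at_top filterlim_real_sequentially])
      then have "(\<lambda>n. \<Gamma> x / sqrt (real n)) \<longlonglongrightarrow> 0"
        by (rule tendsto_divide_0[OF tendsto_const filterlim_at_top_imp_at_infinity])
      then have "(\<lambda>n. (\<Gamma> x)\<^sup>2 * min 1 (\<Gamma> x / sqrt (real n))) \<longlonglongrightarrow> (\<Gamma> x)\<^sup>2 * min 1 0"
        by (intro tendsto_intros)
      then show "(\<lambda>n. maj n x) \<longlonglongrightarrow> 0" by (simp add: maj_def)
    qed
  qed (auto simp: maj_def)
  have rem0: "(\<lambda>n. real n * (\<integral>x. rem n x \<partial>M)) \<longlonglongrightarrow> 0"
  proof (rule Lim_null_comparison)
    show "(\<lambda>n. (\<integral>x. maj n x \<partial>M) + 4 * (\<integral>x. (\<rho> n x)\<^sup>2 \<partial>M)) \<longlonglongrightarrow> 0"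
      using tendsto_add[OF maj0 tendsto_mult_left[OF \<rho>0, of 4]] by simp
    show "\<forall>\<^sub>F n in sequentially. norm (real n * (\<integral>x. rem n x \<partial>M)) \<le> (\<integral>x. maj n x \<partial>M) + 4 * (\<integral>x. (\<rho> n x)\<^sup>2 \<partial>M)"
      using eventually_ge_at_top[of 1]
    proof eventually_elim
      case (elim n)
      have "real n * (\<integral>x. rem n x \<partial>M) = (\<integral>x. real n * rem n x \<partial>M)" by simp
      also have "\<dots> \<le> (\<integral>x. maj n x + 4 * (\<rho> n x)\<^sup>2 \<partial>M)"
        using rem_le[OF elim] rem_i maj_i L2_integrable_sq[OF \<rho>L] by (intro integral_mono) auto
      also have "\<dots> = (\<integral>x. maj n x \<partial>M) + 4 * (\<integral>x. (\<rho> n x)\<^sup>2 \<partial>M)"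
        using maj_i L2_integrable_sq[OF \<rho>L] by simp
      finally have "real n * (\<integral>x. rem n x \<partial>M) \<le> (\<integral>x. maj n x \<partial>M) + 4 * (\<integral>x. (\<rho> n x)\<^sup>2 \<partial>M)" .
      moreover have "0 \<le> (\<integral>x. rem n x \<partial>M)" using nonneg by (intro integral_nonneg_AE AE_I2) (auto simp: rem_def)
      ultimately show ?case by simp
    qed
  qed
  define T where "T = (\<Sum>h\<in>Z. \<bar>\<tau> h\<bar>)"
  define K where "K = 36 + 100 * T + 350 * T\<^sup>2 + 2200 * T^3"
  define \<Phi> where "\<Phi> n x = loglik_integrand Z s \<tau> (\<lambda>h. v n h x)" for n x
  define q where "q n x = loglik_quadratic Z s \<tau> (\<lambda>h. v n h x)" for n x
  have \<Phi>q: "norm (\<Phi> n x - q n x) \<le> K * rem n x" for n x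
    unfolding \<Phi>_def q_def K_def rem_def
  proof (rule loglik_taylor[OF Z])
    fix h assume "h \<in> ?J"
    then show "\<bar>v n h x\<bar> \<le> m n x" unfolding m_def using J by (intro member_le_sum) auto
  qed (simp add: T_def)
  have \<Phi>m: "\<Phi> n \<in> borel_measurable M" for n
    unfolding \<Phi>_def by (rule borel_measurable_loglik_integrand[OF Z vm(1)])
  have sqL: "(\<lambda>x. 1 + v n h x) \<in> L2 M" "(\<lambda>x. v n h x - v n s x) \<in> L2 M" if "h \<in> ?J" for n h
    using that by (auto intro!: L2_add L2_const L2_diff vL)
  define A where "A n x = (1 + v n s x)\<^sup>2 - 2 * (\<Sum>h\<in>Z. \<tau> h * (v n h x - v n s x))\<^sup>2" for n x
  define B where "B n x = (\<Sum>h\<in>Z. \<tau> h * ((1 + v n h x)\<^sup>2 - (1 + v n s x)\<^sup>2 - 2 * (v n h x - v n s x)\<^sup>2))" for n x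
  have sL: "(\<lambda>x. \<Sum>h\<in>Z. \<tau> h * (v n h x - v n s x)) \<in> L2 M" for n
    by (intro L2_sum L2_scale sqL) auto
  have Ai: "integrable M (A n)" for n unfolding A_def
    using L2_integrable_sq[OF sL] L2_integrable_sq[OF sqL(1)] by auto
  have Bi: "integrable M (B n)" for n unfolding B_def
    using L2_integrable_sq[OF sqL(1)] L2_integrable_sq[OF sqL(2)] by auto
  have qAB: "q n = (\<lambda>x. complex_of_real (A n x) + \<i> * complex_of_real (B n x))" for n
    by (simp add: fun_eq_iff q_def loglik_quadratic_def A_def B_def complex_eq_iff)
  have qi: "integrable M (q n)" for n unfolding qAB using Ai Bi by auto
  have \<Phi>i: "integrable M (\<Phi> n)" for n
  proof (rule Bochner_Integration.integrable_bound)
    show "integrable M (\<lambda>x. (1 + v n s x)\<^sup>2)" using L2_integrable_sq[OF sqL(1)] by auto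
    show "AE x in M. norm (\<Phi> n x) \<le> norm ((1 + v n s x)\<^sup>2)"
      using norm_loglik_integrand_le by (intro AE_I2) (simp add: \<Phi>_def)
  qed (rule \<Phi>m)
  have Iq: "(\<integral>x. q n x \<partial>M) = Complex (\<integral>x. A n x \<partial>M) (\<integral>x. B n x \<partial>M)" for n
    unfolding qAB using Ai Bi by (simp add: complex_eq_iff)
  have limA: "(\<lambda>n. real n * ((\<integral>x. A n x \<partial>M) - 1)) \<longlonglongrightarrow> - (\<integral>x. (\<Sum>h\<in>Z. \<tau> h * (\<gamma> h x - \<gamma> s x))\<^sup>2 \<partial>M) / 2"
  proof -
    have "tangent_seq M (\<lambda>n x. \<Sum>h\<in>Z. \<tau> h * (v n h x - v n s x)) (\<lambda>x. \<Sum>h\<in>Z. \<tau> h * (\<gamma> h x - \<gamma> s x))"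
      using tangent_seq_lincomb[OF Z, of M "\<lambda>n h x. v n h x - v n s x" "\<lambda>h x. \<gamma> h x - \<gamma> s x" \<tau>] tangent_seq_diff[OF t t] by simp
    from tendsto_diff[OF mass[of s] tendsto_mult_left[OF tangent_seq_quadratic[OF this], of 2]]
    show ?thesis
      using L2_integrable_sq[OF sL] L2_integrable_sq[OF sqL(1)] by (simp add: A_def algebra_simps)
  qed
  have limB: "(\<lambda>n. real n * (\<integral>x. B n x \<partial>M)) \<longlonglongrightarrow> - (\<Sum>h\<in>Z. \<tau> h * (\<integral>x. (\<gamma> h x - \<gamma> s x)\<^sup>2 \<partial>M)) / 2"
  proof -
    have "(\<lambda>n. \<Sum>h\<in>Z. \<tau> h * (real n * ((\<integral>x. (1 + v n h x)\<^sup>2 \<partial>M) - 1) - real n * ((\<integral>x. (1 + v n s x)\<^sup>2 \<partial>M) - 1)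
        - 2 * (real n * (\<integral>x. (v n h x - v n s x)\<^sup>2 \<partial>M))))
      \<longlonglongrightarrow> (\<Sum>h\<in>Z. \<tau> h * (0 - 0 - 2 * ((\<integral>x. (\<gamma> h x - \<gamma> s x)\<^sup>2 \<partial>M) / 4)))"
      using t by (intro tendsto_intros mass tangent_seq_quadratic tangent_seq_diff) auto
    also have "(\<Sum>h\<in>Z. \<tau> h * (0 - 0 - 2 * ((\<integral>x. (\<gamma> h x - \<gamma> s x)\<^sup>2 \<partial>M) / 4)))
       = - (\<Sum>h\<in>Z. \<tau> h * (\<integral>x. (\<gamma> h x - \<gamma> s x)\<^sup>2 \<partial>M)) / 2"
      by (simp add: sum_divide_distrib sum_negf)
    also have "(\<lambda>n. \<Sum>h\<in>Z. \<tau> h * (real n * ((\<integral>x. (1 + v n h x)\<^sup>2 \<partial>M) - 1) - real n * ((\<integral>x. (1 + v n s x)\<^sup>2 \<partial>M) - 1)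
        - 2 * (real n * (\<integral>x. (v n h x - v n s x)\<^sup>2 \<partial>M)))) = (\<lambda>n. real n * (\<integral>x. B n x \<partial>M))"
    proof (rule ext)
      fix n
      have "(\<integral>x. B n x \<partial>M) = (\<Sum>h\<in>Z. \<tau> h * ((\<integral>x. (1 + v n h x)\<^sup>2 \<partial>M) - (\<integral>x. (1 + v n s x)\<^sup>2 \<partial>M) - 2 * (\<integral>x. (v n h x - v n s x)\<^sup>2 \<partial>M)))"
        unfolding B_def using L2_integrable_sq[OF sqL(1)] L2_integrable_sq[OF sqL(2)]
        by (subst Bochner_Integration.integral_sum) (auto intro!: sum.cong)
      then show "(\<Sum>h\<in>Z. \<tau> h * (real n * ((\<integral>x. (1 + v n h x)\<^sup>2 \<partial>M) - 1) - real n * ((\<integral>x. (1 + v n s x)\<^sup>2 \<partial>M) - 1)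
        - 2 * (real n * (\<integral>x. (v n h x - v n s x)\<^sup>2 \<partial>M)))) = real n * (\<integral>x. B n x \<partial>M)"
        by (simp add: sum_distrib_left algebra_simps)
    qed
    finally show ?thesis .
  qed
  have "(\<lambda>n. Complex (real n * ((\<integral>x. A n x \<partial>M) - 1)) (real n * (\<integral>x. B n x \<partial>M))) \<longlonglongrightarrow>
     Complex (- (\<integral>x. (\<Sum>h\<in>Z. \<tau> h * (\<gamma> h x - \<gamma> s x))\<^sup>2 \<partial>M) / 2)
       (- (\<Sum>h\<in>Z. \<tau> h * (\<integral>x. (\<gamma> h x - \<gamma> s x)\<^sup>2 \<partial>M)) / 2)"
    by (intro tendsto_Complex limA limB)
  also have "(\<lambda>n. Complex (real n * ((\<integral>x. A n x \<partial>M) - 1)) (real n * (\<integral>x. B n x \<partial>M))) = (\<lambda>n. of_nat n * ((\<integral>x. q n x \<partial>M) - 1))"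
    by (simp add: fun_eq_iff Iq complex_eq_iff)
  finally have limq: "(\<lambda>n. of_nat n * ((\<integral>x. q n x \<partial>M) - 1)) \<longlonglongrightarrow>
     Complex (- (\<integral>x. (\<Sum>h\<in>Z. \<tau> h * (\<gamma> h x - \<gamma> s x))\<^sup>2 \<partial>M) / 2)
       (- (\<Sum>h\<in>Z. \<tau> h * (\<integral>x. (\<gamma> h x - \<gamma> s x)\<^sup>2 \<partial>M)) / 2)" .
  have diff: "(\<lambda>n. of_nat n * ((\<integral>x. \<Phi> n x \<partial>M) - (\<integral>x. q n x \<partial>M))) \<longlonglongrightarrow> 0"
  proof (rule Lim_null_comparison)
    show "(\<lambda>n. K * (real n * (\<integral>x. rem n x \<partial>M))) \<longlonglongrightarrow> 0" using tendsto_mult_left[OF rem0, of K] by simp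
    show "\<forall>\<^sub>F n in sequentially. norm (of_nat n * ((\<integral>x. \<Phi> n x \<partial>M) - (\<integral>x. q n x \<partial>M))) \<le> K * (real n * (\<integral>x. rem n x \<partial>M))"
    proof (intro always_eventually allI)
      fix n
      have "norm ((\<integral>x. \<Phi> n x \<partial>M) - (\<integral>x. q n x \<partial>M)) = norm (\<integral>x. \<Phi> n x - q n x \<partial>M)" using \<Phi>i qi by simp
      also have "\<dots> \<le> (\<integral>x. norm (\<Phi> n x - q n x) \<partial>M)" by (rule integral_norm_bound)
      also have "\<dots> \<le> (\<integral>x. K * rem n x \<partial>M)" using \<Phi>q \<Phi>i qi rem_i by (intro integral_mono) auto
      also have "\<dots> = K * (\<integral>x. rem n x \<partial>M)" by simp
      finally have "real n * norm ((\<integral>x. \<Phi> n x \<partial>M) - (\<integral>x. q n x \<partial>M)) \<le> real n * (K * (\<integral>x. rem n x \<partial>M))"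
        by (rule mult_left_mono) simp
      then show "norm (of_nat n * ((\<integral>x. \<Phi> n x \<partial>M) - (\<integral>x. q n x \<partial>M))) \<le> K * (real n * (\<integral>x. rem n x \<partial>M))"
        by (simp add: norm_mult mult_ac)
    qed
  qed
  from tendsto_add[OF limq diff] show ?thesis by (simp add: \<Phi>_def algebra_simps)
qed

text \<open>Comparison with w n = exp (c/n) avoids complex logarithms: numbers of norm at most 1
  satisfy |z^k - w^k| \<le> k |z - w|, and n (z n - w n) tends to 0. The sign of Re c keeps w n in
  the unit disc.\<close>

lemma tendsto_power_exp:
  fixes z :: "nat \<Rightarrow> complex"
  assumes z: "\<And>n. norm (z n) \<le> 1" and c: "(\<lambda>n. of_nat n * (z n - 1)) \<longlonglongrightarrow> c" and Re: "Re c \<le> 0"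
    and k: "\<forall>\<^sub>F n in sequentially. k n \<le> n" and \<kappa>: "(\<lambda>n. real (k n) / real n) \<longlonglongrightarrow> \<kappa>"
  shows "(\<lambda>n. z n ^ k n) \<longlonglongrightarrow> exp (of_real \<kappa> * c)"
proof -
  define w where "w n = exp (c / of_nat n)" for n
  have w: "norm (w n) \<le> 1" for n using Re by (simp add: w_def divide_nonpos_nonneg)
  have "(\<lambda>n. of_nat n * (w n - 1)) \<longlonglongrightarrow> c"
  proof (cases "c = 0")
    case False
    have "(\<lambda>n. c / of_nat n) \<longlonglongrightarrow> 0" by (rule lim_const_over_n)
    then have "filterlim (\<lambda>n. c / of_nat n) (at 0) sequentially"
      using False eventually_gt_at_top[of 0] by (auto simp: filterlim_at elim: eventually_mono)
    moreover have "((\<lambda>h. (exp h - 1) / h) \<longlongrightarrow> 1) (at (0::complex))"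
      using DERIV_exp[of "0::complex"] by (simp add: DERIV_def)
    ultimately have "(\<lambda>n. (exp (c / of_nat n) - 1) / (c / of_nat n)) \<longlonglongrightarrow> 1" by (rule filterlim_compose[rotated])
    from tendsto_mult_left[OF this, of c] show ?thesis using False by (simp add: w_def mult_ac)
  qed (simp add: w_def)
  from tendsto_diff[OF c this] have d: "(\<lambda>n. of_nat n * (z n - w n)) \<longlonglongrightarrow> 0"
    by (simp add: algebra_simps)
  have "(\<lambda>n. z n ^ k n - w n ^ k n) \<longlonglongrightarrow> 0"
  proof (rule Lim_null_comparison)
    show "(\<lambda>n. norm (of_nat n * (z n - w n))) \<longlonglongrightarrow> 0" using tendsto_norm[OF d] by simp
    show "\<forall>\<^sub>F n in sequentially. norm (z n ^ k n - w n ^ k n) \<le> norm (of_nat n * (z n - w n))"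
      using k
    proof eventually_elim
      case (elim n)
      have "norm (z n ^ k n - w n ^ k n) \<le> k n * norm (z n - w n)" by (rule norm_power_diff[OF z w])
      also have "\<dots> \<le> n * norm (z n - w n)" using elim by (intro mult_right_mono) auto
      finally show ?case by (simp add: norm_mult)
    qed
  qed
  moreover have "(\<lambda>n. w n ^ k n) \<longlonglongrightarrow> exp (of_real \<kappa> * c)"
  proof -
    have "w n ^ k n = exp (of_real (real (k n) / real n) * c)" for n
      by (simp add: w_def exp_of_nat_mult[symmetric])
    then show ?thesis by (simp only:) (intro tendsto_intros \<kappa>)
  qed
  ultimately show ?thesis using tendsto_add by fastforce
qed

section \<open>Differentiable curves of product measures\<close>

lemma (in pair_sigma_finite) integral_product:
  fixes u v :: "_ \<Rightarrow> 'c::{real_normed_field, banach, second_countable_topology}"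
  assumes u: "integrable M1 u" and v: "integrable M2 v"
  shows "integrable (M1 \<Otimes>\<^sub>M M2) (\<lambda>z. u (fst z) * v (snd z))"
    and "(\<integral>z. u (fst z) * v (snd z) \<partial>(M1 \<Otimes>\<^sub>M M2)) = (\<integral>x. u x \<partial>M1) * (\<integral>y. v y \<partial>M2)"
proof -
  have [measurable]: "u \<in> borel_measurable M1" "v \<in> borel_measurable M2" using u v by auto
  show i: "integrable (M1 \<Otimes>\<^sub>M M2) (\<lambda>z. u (fst z) * v (snd z))"
  proof (rule Fubini_integrable)
    show "integrable M1 (\<lambda>x. \<integral>y. norm (u (fst (x, y)) * v (snd (x, y))) \<partial>M2)"
      using u by (simp add: norm_mult)
    show "AE x in M1. integrable M2 (\<lambda>y. u (fst (x, y)) * v (snd (x, y)))" using v by simp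
  qed measurable
  show "(\<integral>z. u (fst z) * v (snd z) \<partial>(M1 \<Otimes>\<^sub>M M2)) = (\<integral>x. u x \<partial>M1) * (\<integral>y. v y \<partial>M2)"
    using integral_fst'[OF i] by simp
qed

section \<open>Integrating out one coordinate\<close>

text \<open>The conditional expectation given the first coordinate under a product measure. On a sum
  of two components of which the second has mean zero it returns the first.\<close>

definition partial_integral :: "'b measure \<Rightarrow> ('a \<times> 'b \<Rightarrow> real) \<Rightarrow> 'a \<Rightarrow> real" where
  "partial_integral Q g x = (\<integral>y. g (x, y) \<partial>Q)"

abbreviation swap_args :: "('a \<times> 'b \<Rightarrow> real) \<Rightarrow> 'b \<times> 'a \<Rightarrow> real" where
  "swap_args g \<equiv> \<lambda>z. g (snd z, fst z)"

lemma partial_integral_scale: "partial_integral Q (\<lambda>z. c * g z) x = c * partial_integral Q g x"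
  by (simp add: partial_integral_def)

context pair_prob_space
begin

lemma integral_fst_component:
  fixes f :: "'a \<Rightarrow> real"
  assumes f: "f \<in> borel_measurable M1"
  shows "(\<integral>z. f (fst z) \<partial>(M1 \<Otimes>\<^sub>M M2)) = (\<integral>x. f x \<partial>M1)"
    "integrable (M1 \<Otimes>\<^sub>M M2) (\<lambda>z. f (fst z)) \<longleftrightarrow> integrable M1 f"
  using integral_distr[OF measurable_fst f, of M2] integrable_distr_eq[OF measurable_fst f, of M2]
  by (simp_all add: M2.distr_pair_fst)

lemma L2_fst:
  assumes f: "f \<in> L2 M1"
  shows "(\<lambda>z. f (fst z)) \<in> L2 (M1 \<Otimes>\<^sub>M M2)" "L2_norm (M1 \<Otimes>\<^sub>M M2) (\<lambda>z. f (fst z)) = L2_norm M1 f"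
proof -
  have m: "f \<in> borel_measurable M1" "(\<lambda>x. (f x)\<^sup>2) \<in> borel_measurable M1" using f by (auto simp: L2_def)
  show "(\<lambda>z. f (fst z)) \<in> L2 (M1 \<Otimes>\<^sub>M M2)"
    using f m integral_fst_component(2)[OF m(2)] by (auto simp: L2_def)
  show "L2_norm (M1 \<Otimes>\<^sub>M M2) (\<lambda>z. f (fst z)) = L2_norm M1 f"
    using integral_fst_component(1)[OF m(2)] by (simp add: L2_norm_def)
qed

lemma integral_swap_args:
  fixes g :: "'a \<times> 'b \<Rightarrow> real"
  assumes g: "g \<in> borel_measurable (M1 \<Otimes>\<^sub>M M2)"
  shows "(\<integral>z. swap_args g z \<partial>(M2 \<Otimes>\<^sub>M M1)) = (\<integral>z. g z \<partial>(M1 \<Otimes>\<^sub>M M2))"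
    "integrable (M2 \<Otimes>\<^sub>M M1) (swap_args g) \<longleftrightarrow> integrable (M1 \<Otimes>\<^sub>M M2) g"
    "swap_args g \<in> borel_measurable (M2 \<Otimes>\<^sub>M M1)"
  using integral_product_swap[OF g] integrable_product_swap_iff[of g] g
  by (simp_all add: case_prod_unfold)

lemma L2_swap_args:
  assumes g: "g \<in> L2 (M1 \<Otimes>\<^sub>M M2)"
  shows "swap_args g \<in> L2 (M2 \<Otimes>\<^sub>M M1)" "L2_norm (M2 \<Otimes>\<^sub>M M1) (swap_args g) = L2_norm (M1 \<Otimes>\<^sub>M M2) g"
proof -
  have m: "g \<in> borel_measurable (M1 \<Otimes>\<^sub>M M2)" "(\<lambda>x. (g x)\<^sup>2) \<in> borel_measurable (M1 \<Otimes>\<^sub>M M2)"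
    using g by (auto simp: L2_def)
  show "swap_args g \<in> L2 (M2 \<Otimes>\<^sub>M M1)"
    using integral_swap_args(2)[OF m(2)] integral_swap_args(3)[OF m(1)] g by (simp add: L2_def)
  show "L2_norm (M2 \<Otimes>\<^sub>M M1) (swap_args g) = L2_norm (M1 \<Otimes>\<^sub>M M2) g"
    using integral_swap_args(1)[OF m(2)] by (simp add: L2_norm_def)
qed

lemma AE_swap_args:
  assumes "{z \<in> space (M1 \<Otimes>\<^sub>M M2). P z} \<in> sets (M1 \<Otimes>\<^sub>M M2)" "AE z in M1 \<Otimes>\<^sub>M M2. P z"
  shows "AE z in M2 \<Otimes>\<^sub>M M1. P (snd z, fst z)"
proof -
  have "AE z in distr (M2 \<Otimes>\<^sub>M M1) (M1 \<Otimes>\<^sub>M M2) (\<lambda>(x, y). (y, x)). P z"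
    by (subst distr_pair_swap[symmetric]) (rule assms(2))
  then show ?thesis using assms(1) by (subst (asm) AE_distr_iff) (auto simp: case_prod_unfold)
qed

lemma L2_product:
  assumes f: "f \<in> L2 M1" and h: "h \<in> L2 M2"
  shows "(\<lambda>z. f (fst z) * h (snd z)) \<in> L2 (M1 \<Otimes>\<^sub>M M2)"
    "(\<integral>z. (f (fst z) * h (snd z))\<^sup>2 \<partial>(M1 \<Otimes>\<^sub>M M2)) = (\<integral>x. (f x)\<^sup>2 \<partial>M1) * (\<integral>y. (h y)\<^sup>2 \<partial>M2)"
    "(\<integral>z. f (fst z) * h (snd z) \<partial>(M1 \<Otimes>\<^sub>M M2)) = (\<integral>x. f x \<partial>M1) * (\<integral>y. h y \<partial>M2)"
proof -
  have [measurable]: "f \<in> borel_measurable M1" "h \<in> borel_measurable M2"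
    using f h by (auto simp: L2_def)
  have sq: "integrable M1 (\<lambda>x. (f x)\<^sup>2)" "integrable M2 (\<lambda>x. (h x)\<^sup>2)" using f h by (auto simp: L2_def)
  show "(\<lambda>z. f (fst z) * h (snd z)) \<in> L2 (M1 \<Otimes>\<^sub>M M2)"
    using integral_product[OF sq] by (intro L2_I) (auto simp: power_mult_distrib)
  show "(\<integral>z. (f (fst z) * h (snd z))\<^sup>2 \<partial>(M1 \<Otimes>\<^sub>M M2)) = (\<integral>x. (f x)\<^sup>2 \<partial>M1) * (\<integral>y. (h y)\<^sup>2 \<partial>M2)"
    using integral_product[OF sq] by (simp add: power_mult_distrib)
  show "(\<integral>z. f (fst z) * h (snd z) \<partial>(M1 \<Otimes>\<^sub>M M2)) = (\<integral>x. f x \<partial>M1) * (\<integral>y. h y \<partial>M2)"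
    using integral_product[OF M1.L2_integrable[OF f] M2.L2_integrable[OF h]] by simp
qed

lemma pair_L2_integrable: "g \<in> L2 (M1 \<Otimes>\<^sub>M M2) \<Longrightarrow> integrable (M1 \<Otimes>\<^sub>M M2) g"
  by (rule P.L2_integrable)

text \<open>Fibrewise the square of the mean is at most the mean of the square; integration over the
  first coordinate gives the contraction.\<close>

lemma partial_integral_L2:
  assumes g: "g \<in> L2 (M1 \<Otimes>\<^sub>M M2)"
  shows "partial_integral M2 g \<in> L2 M1" "L2_norm M1 (partial_integral M2 g) \<le> L2_norm (M1 \<Otimes>\<^sub>M M2) g"
    "(\<integral>x. partial_integral M2 g x \<partial>M1) = (\<integral>z. g z \<partial>(M1 \<Otimes>\<^sub>M M2))"
proof -
  have [measurable]: "g \<in> borel_measurable (M1 \<Otimes>\<^sub>M M2)" using g by (simp add: L2_def)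
  have sq: "integrable (M1 \<Otimes>\<^sub>M M2) (\<lambda>z. (g z)\<^sup>2)" using g by (simp add: L2_def)
  have m[measurable]: "partial_integral M2 g \<in> borel_measurable M1"
    unfolding partial_integral_def[abs_def] by measurable
  have ae: "AE x in M1. (partial_integral M2 g x)\<^sup>2 \<le> (\<integral>y. (g (x, y))\<^sup>2 \<partial>M2)"
    using AE_integrable_fst'[OF sq] AE_space
  proof eventually_elim
    case (elim x)
    have "(\<lambda>y. g (x, y)) \<in> L2 M2" using elim by (intro L2_I) auto
    from M2.L2_norm_ge_integral[OF this]
    have "\<bar>partial_integral M2 g x\<bar> \<le> L2_norm M2 (\<lambda>y. g (x, y))" by (simp add: partial_integral_def)
    then have "(partial_integral M2 g x)\<^sup>2 \<le> (L2_norm M2 (\<lambda>y. g (x, y)))\<^sup>2"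
      by (metis abs_ge_zero power2_abs power_mono)
    then show ?case by (simp add: L2_norm_sq)
  qed
  have i: "integrable M1 (\<lambda>x. (partial_integral M2 g x)\<^sup>2)"
    by (rule Bochner_Integration.integrable_bound[OF integrable_fst'[OF sq]]) (use ae in auto)
  then show "partial_integral M2 g \<in> L2 M1" by (intro L2_I m)
  have "(\<integral>x. (partial_integral M2 g x)\<^sup>2 \<partial>M1) \<le> (\<integral>x. \<integral>y. (g (x, y))\<^sup>2 \<partial>M2 \<partial>M1)"
    by (intro integral_mono_AE i integrable_fst'[OF sq] ae)
  also have "\<dots> = (\<integral>z. (g z)\<^sup>2 \<partial>(M1 \<Otimes>\<^sub>M M2))" by (rule integral_fst'[OF sq])
  finally show "L2_norm M1 (partial_integral M2 g) \<le> L2_norm (M1 \<Otimes>\<^sub>M M2) g"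
    unfolding L2_norm_def by (rule real_sqrt_le_mono)
  show "(\<integral>x. partial_integral M2 g x \<partial>M1) = (\<integral>z. g z \<partial>(M1 \<Otimes>\<^sub>M M2))"
    unfolding partial_integral_def by (rule integral_fst'[OF pair_L2_integrable[OF g]])
qed

lemma partial_integral_add_AE:
  assumes f: "f \<in> L2 (M1 \<Otimes>\<^sub>M M2)" and g: "g \<in> L2 (M1 \<Otimes>\<^sub>M M2)"
  shows "AE x in M1. partial_integral M2 (\<lambda>z. f z + g z) x = partial_integral M2 f x + partial_integral M2 g x"
  using AE_integrable_fst'[OF pair_L2_integrable[OF f]] AE_integrable_fst'[OF pair_L2_integrable[OF g]]
  by eventually_elim (simp add: partial_integral_def)

lemma partial_integral_diff_AE:
  assumes f: "f \<in> L2 (M1 \<Otimes>\<^sub>M M2)" and g: "g \<in> L2 (M1 \<Otimes>\<^sub>M M2)"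
  shows "AE x in M1. partial_integral M2 (\<lambda>z. f z - g z) x = partial_integral M2 f x - partial_integral M2 g x"
  using AE_integrable_fst'[OF pair_L2_integrable[OF f]] AE_integrable_fst'[OF pair_L2_integrable[OF g]]
  by eventually_elim (simp add: partial_integral_def)

lemma partial_integral_cong_AE:
  assumes f: "f \<in> borel_measurable (M1 \<Otimes>\<^sub>M M2)" and g: "g \<in> borel_measurable (M1 \<Otimes>\<^sub>M M2)"
    and ae: "AE z in M1 \<Otimes>\<^sub>M M2. f z = g z"
  shows "AE x in M1. partial_integral M2 f x = partial_integral M2 g x"
proof -
  have "AE x in M1. AE y in M2. f (x, y) = g (x, y)" using AE_pair[OF ae] by simp
  with AE_space show ?thesis
  proof eventually_elim
    case (elim x)
    then show ?case unfolding partial_integral_def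
      using f g by (intro integral_cong_AE) auto
  qed
qed

end

section \<open>Root densities of product curves\<close>

lemma pair_prob_spaceI: "prob_space P \<Longrightarrow> prob_space Q \<Longrightarrow> pair_prob_space P Q"
  by (simp add: pair_prob_space_def pair_sigma_finite_def prob_space_imp_sigma_finite)

text \<open>Differentiability in quadratic mean of a curve of root densities \<open>a\<close>; the last clause bounds the
  mass of the singular parts.\<close>

definition root_differentiable :: "'a measure \<Rightarrow> (real \<Rightarrow> 'a \<Rightarrow> real) \<Rightarrow> ('a \<Rightarrow> real) \<Rightarrow> bool" where
  "root_differentiable M a g \<longleftrightarrow> g \<in> L2 M \<and>
     (\<forall>t. a t \<in> L2 M \<and> (\<forall>x. 0 \<le> a t x) \<and> (\<integral>x. (a t x)\<^sup>2 \<partial>M) \<le> 1) \<and>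
     ((\<lambda>t. L2_norm M (\<lambda>x. a t x - 1 - t / 2 * g x) / \<bar>t\<bar>) \<longlongrightarrow> 0) (at 0) \<and>
     ((\<lambda>t. (1 - (\<integral>x. (a t x)\<^sup>2 \<partial>M)) / t\<^sup>2) \<longlongrightarrow> 0) (at 0)"

lemma root_differentiable_cong_AE:
  assumes d: "root_differentiable M a g" and M: "prob_space M"
    and b: "\<And>t. b t \<in> borel_measurable M" "\<And>t x. 0 \<le> b t x" and ab: "\<And>t. AE x in M. b t x = a t x"
  shows "root_differentiable M b g"
proof -
  interpret prob_space M by fact
  have L: "g \<in> L2 M" "\<And>t. a t \<in> L2 M" using d by (auto simp: root_differentiable_def)
  have m: "g \<in> borel_measurable M" "\<And>t. a t \<in> borel_measurable M" using L by (auto simp: L2_def)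
  have bL: "b t \<in> L2 M" for t using L2_cong_AE[OF L(2) b(1) ab] .
  have i: "(\<integral>x. (b t x)\<^sup>2 \<partial>M) = (\<integral>x. (a t x)\<^sup>2 \<partial>M)" for t
    using ab[of t] m b by (intro integral_cong_AE) (auto elim: eventually_mono)
  have n: "L2_norm M (\<lambda>x. b t x - 1 - t / 2 * g x) = L2_norm M (\<lambda>x. a t x - 1 - t / 2 * g x)" for t
    using ab[of t] m b by (intro L2_norm_cong_AE) (auto elim: eventually_mono)
  show ?thesis using d bL b unfolding root_differentiable_def i n by blast
qed

text \<open>From a^2 = 1 + 2 (a - 1) + (a - 1)^2 and the mass 1 - o(t^2), the integral of a - 1 is
  O(t^2), whereas to first order it is t/2 times the mean of \<open>g\<close>.\<close>

lemma root_differentiable_mean_zero: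
  assumes d: "root_differentiable M a g" and M: "prob_space M"
  shows "(\<integral>x. g x \<partial>M) = 0"
proof -
  interpret prob_space M by fact
  have gL: "g \<in> L2 M" and aL: "\<And>t. a t \<in> L2 M" and le: "\<And>t. (\<integral>x. (a t x)\<^sup>2 \<partial>M) \<le> 1"
    and l1: "((\<lambda>t. L2_norm M (\<lambda>x. a t x - 1 - t / 2 * g x) / \<bar>t\<bar>) \<longlongrightarrow> 0) (at 0)"
    and l2: "((\<lambda>t. (1 - (\<integral>x. (a t x)\<^sup>2 \<partial>M)) / t\<^sup>2) \<longlongrightarrow> 0) (at 0)"
    using d by (auto simp: root_differentiable_def)
  define N where "N t = L2_norm M (\<lambda>x. a t x - 1 - t / 2 * g x) / \<bar>t\<bar>" for t
  define S where "S t = (1 - (\<integral>x. (a t x)\<^sup>2 \<partial>M)) / t\<^sup>2" for t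
  define \<Gamma> where "\<Gamma> = (\<integral>x. g x \<partial>M)"
  have bound: "\<bar>\<Gamma>\<bar> \<le> \<bar>t\<bar> * S t + \<bar>t\<bar> * (L2_norm M g / 2 + N t)\<^sup>2 + 2 * N t" if t: "t \<noteq> 0" for t
  proof -
    have uL: "(\<lambda>x. a t x - 1) \<in> L2 M" by (rule L2_diff[OF aL L2_const])
    have tL: "(\<lambda>x. t / 2 * g x) \<in> L2 M" by (rule L2_scale[OF gL])
    have rL: "(\<lambda>x. a t x - 1 - t / 2 * g x) \<in> L2 M" by (rule L2_diff[OF uL tL])
    have i: "integrable M (a t)" "integrable M g" using L2_integrable aL gL by auto
    have sq: "(\<integral>x. (a t x)\<^sup>2 \<partial>M) = 1 + 2 * (\<integral>x. a t x - 1 \<partial>M) + (\<integral>x. (a t x - 1)\<^sup>2 \<partial>M)"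
    proof -
      have "(\<lambda>x. (a t x)\<^sup>2) = (\<lambda>x. 1 + 2 * (a t x - 1) + (a t x - 1)\<^sup>2)"
        by (simp add: fun_eq_iff power2_eq_square algebra_simps)
      then show ?thesis using i L2_integrable_sq[OF uL] by (simp add: prob_space)
    qed
    have r1: "\<bar>\<integral>x. a t x - 1 - t / 2 * g x \<partial>M\<bar> \<le> N t * \<bar>t\<bar>"
      using L2_norm_ge_integral[OF rL] t by (simp add: N_def)
    have r2: "(\<integral>x. a t x - 1 - t / 2 * g x \<partial>M) = (\<integral>x. a t x - 1 \<partial>M) - t / 2 * \<Gamma>"
      using i by (simp add: \<Gamma>_def)
    have "L2_norm M (\<lambda>x. a t x - 1) \<le> L2_norm M (\<lambda>x. a t x - 1 - t / 2 * g x) + L2_norm M (\<lambda>x. t / 2 * g x)"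
      using L2_norm_triangle[OF rL tL] by (simp only: diff_add_cancel)
    also have "\<dots> = \<bar>t\<bar> * (L2_norm M g / 2 + N t)"
    proof -
      have "A + \<bar>t / 2\<bar> * B = \<bar>t\<bar> * (B / 2 + A / \<bar>t\<bar>)" for A B using t by (simp add: field_simps)
      then show ?thesis unfolding L2_norm_scale N_def .
    qed
    finally have "(L2_norm M (\<lambda>x. a t x - 1))\<^sup>2 \<le> (\<bar>t\<bar> * (L2_norm M g / 2 + N t))\<^sup>2"
      by (intro power_mono L2_norm_nonneg)
    then have u2: "(\<integral>x. (a t x - 1)\<^sup>2 \<partial>M) \<le> t\<^sup>2 * (L2_norm M g / 2 + N t)\<^sup>2"
      by (simp add: L2_norm_sq power_mult_distrib)
    \<comment> \<open>The mass identity solved for the mean of \<open>g\<close>; after division by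
      |t| every term on the right tends to 0.\<close>
    have "t * \<Gamma> = - (S t * t\<^sup>2) - (\<integral>x. (a t x - 1)\<^sup>2 \<partial>M) - 2 * (\<integral>x. a t x - 1 - t / 2 * g x \<partial>M)"
      using t unfolding r2 S_def sq by (simp add: field_simps)
    then have "\<bar>t\<bar> * \<bar>\<Gamma>\<bar> \<le> \<bar>S t * t\<^sup>2\<bar> + \<bar>\<integral>x. (a t x - 1)\<^sup>2 \<partial>M\<bar> + 2 * \<bar>\<integral>x. a t x - 1 - t / 2 * g x \<partial>M\<bar>"
      unfolding abs_mult[symmetric] by linarith
    also have "\<dots> \<le> S t * t\<^sup>2 + t\<^sup>2 * (L2_norm M g / 2 + N t)\<^sup>2 + 2 * (N t * \<bar>t\<bar>)"
    proof -
      have "0 \<le> S t" using le by (simp add: S_def)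
      then show ?thesis using u2 r1 by (intro add_mono) auto
    qed
    also have "\<dots> = \<bar>t\<bar> * (\<bar>t\<bar> * S t + \<bar>t\<bar> * (L2_norm M g / 2 + N t)\<^sup>2 + 2 * N t)"
      by (simp add: power2_eq_square algebra_simps)
    finally show ?thesis using t by (simp add: mult_le_cancel_left)
  qed
  have "((\<lambda>t. \<bar>t\<bar> * S t + \<bar>t\<bar> * (L2_norm M g / 2 + N t)\<^sup>2 + 2 * N t) \<longlongrightarrow> \<bar>0\<bar> * 0 + \<bar>0\<bar> * (L2_norm M g / 2 + 0)\<^sup>2 + 2 * 0) (at 0)"
    using l1 l2 by (intro tendsto_intros) (simp_all add: N_def S_def)
  then have "((\<lambda>t. \<bar>t\<bar> * S t + \<bar>t\<bar> * (L2_norm M g / 2 + N t)\<^sup>2 + 2 * N t) \<longlongrightarrow> 0) (at 0)" by simp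
  moreover have "\<forall>\<^sub>F t in at 0. \<bar>\<Gamma>\<bar> \<le> \<bar>t\<bar> * S t + \<bar>t\<bar> * (L2_norm M g / 2 + N t)\<^sup>2 + 2 * N t"
    using bound by (auto simp: eventually_at_filter)
  ultimately have "\<bar>\<Gamma>\<bar> \<le> 0" by (rule tendsto_lowerbound) simp
  then show ?thesis by (simp add: \<Gamma>_def)
qed

text \<open>Integrating out the second coordinate of the remainder leaves \<open>k t * a t\<close>
  in place of \<open>a t\<close>, where \<open>k t\<close> is the mean of \<open>b t\<close>. As
  \<open>g\<close> has mean zero, the remainder has mean m k - 1; since m \<le> 1, the defect 1 - k
  is at most the norm of the remainder and is absorbed. The mass missing from the first factor is at
  most that missing from the product.\<close>

lemma root_differentiable_product_fst:
  assumes P: "prob_space P" and Q: "prob_space Q"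
    and d: "root_differentiable (P \<Otimes>\<^sub>M Q) (\<lambda>t z. a t (fst z) * b t (snd z)) g"
    and a: "\<And>t. a t \<in> L2 P" "\<And>t x. 0 \<le> a t x" "\<And>t. (\<integral>x. (a t x)\<^sup>2 \<partial>P) \<le> 1"
    and b: "\<And>t. b t \<in> L2 Q" "\<And>t x. 0 \<le> b t x" "\<And>t. (\<integral>x. (b t x)\<^sup>2 \<partial>Q) \<le> 1"
  shows "root_differentiable P a (partial_integral Q g)"
proof -
  interpret pair_prob_space P Q using P Q by (rule pair_prob_spaceI)
  have gL: "g \<in> L2 (P \<Otimes>\<^sub>M Q)"
    and l1: "((\<lambda>t. L2_norm (P \<Otimes>\<^sub>M Q) (\<lambda>z. a t (fst z) * b t (snd z) - 1 - t / 2 * g z) / \<bar>t\<bar>) \<longlongrightarrow> 0) (at 0)"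
    and l2: "((\<lambda>t. (1 - (\<integral>z. (a t (fst z) * b t (snd z))\<^sup>2 \<partial>(P \<Otimes>\<^sub>M Q))) / t\<^sup>2) \<longlongrightarrow> 0) (at 0)"
    using d by (auto simp: root_differentiable_def)
  define r where "r t z = a t (fst z) * b t (snd z) - 1 - t / 2 * g z" for t z
  define G where "G = partial_integral Q g"
  have GL: "G \<in> L2 P" unfolding G_def by (rule partial_integral_L2(1)[OF gL])
  define k where "k t = (\<integral>y. b t y \<partial>Q)" for t
  define m where "m t = (\<integral>x. a t x \<partial>P)" for t
  have abL: "(\<lambda>z. a t (fst z) * b t (snd z)) \<in> L2 (P \<Otimes>\<^sub>M Q)" for t by (rule L2_product[OF a(1) b(1)])
  have ab1: "(\<lambda>z. a t (fst z) * b t (snd z) - 1) \<in> L2 (P \<Otimes>\<^sub>M Q)" for t by (intro L2_diff abL P.L2_const)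
  have tL: "(\<lambda>z. t / 2 * g z) \<in> L2 (P \<Otimes>\<^sub>M Q)" for t by (intro L2_scale gL)
  have rL: "r t \<in> L2 (P \<Otimes>\<^sub>M Q)" for t unfolding r_def[abs_def] by (intro L2_diff ab1 tL)
  have norm1: "L2_norm P (a t) \<le> 1" "L2_norm Q (b t) \<le> 1" for t
    using a(3)[of t] b(3)[of t] by (simp_all add: L2_norm_def)
  have km: "0 \<le> k t" "0 \<le> m t" "k t \<le> 1" "m t \<le> 1" for t
    using M1.L2_norm_ge_integral[OF a(1), of t] M2.L2_norm_ge_integral[OF b(1), of t] norm1[of t] a(2) b(2)
    by (auto simp: k_def m_def intro: integral_nonneg)
  have ir: "(\<integral>z. r t z \<partial>(P \<Otimes>\<^sub>M Q)) = m t * k t - 1" for t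
  proof -
    have "(\<integral>z. r t z \<partial>(P \<Otimes>\<^sub>M Q)) = (\<integral>z. a t (fst z) * b t (snd z) - 1 \<partial>(P \<Otimes>\<^sub>M Q)) - t / 2 * (\<integral>z. g z \<partial>(P \<Otimes>\<^sub>M Q))"
      unfolding r_def using P.L2_integrable[OF ab1] P.L2_integrable[OF gL] by simp
    also have "\<dots> = m t * k t - 1"
      using P.L2_integrable[OF abL] L2_product(3)[OF a(1) b(1)] root_differentiable_mean_zero[OF d P.prob_space_axioms]
      by (simp add: m_def k_def P.prob_space)
    finally show ?thesis .
  qed
  have k1: "1 - k t \<le> L2_norm (P \<Otimes>\<^sub>M Q) (r t)" for t
  proof -
    have "m t * k t \<le> 1 * k t" using km[of t] by (intro mult_right_mono) auto
    then show ?thesis using P.L2_norm_ge_integral[OF rL, of t] unfolding ir by linarith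
  qed
  have ae: "AE x in P. a t x - 1 - t / 2 * G x = (1 - k t) * a t x + partial_integral Q (r t) x" for t
  proof -
    have "AE x in P. partial_integral Q (r t) x = partial_integral Q (\<lambda>z. a t (fst z) * b t (snd z) - 1) x - t / 2 * G x"
      using partial_integral_diff_AE[OF ab1 tL] unfolding partial_integral_scale G_def r_def[abs_def] .
    moreover have "AE x in P. partial_integral Q (\<lambda>z. a t (fst z) * b t (snd z) - 1) x
        = partial_integral Q (\<lambda>z. a t (fst z) * b t (snd z)) x - partial_integral Q (\<lambda>z. 1) x"
      by (rule partial_integral_diff_AE[OF abL P.L2_const])
    ultimately show ?thesis
    proof eventually_elim
      case (elim x)
      have "partial_integral Q (\<lambda>z. a t (fst z) * b t (snd z)) x = a t x * k t" "partial_integral Q (\<lambda>z. 1) x = 1"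
        by (simp_all add: partial_integral_def k_def M2.prob_space)
      then show ?case using elim by (simp add: algebra_simps)
    qed
  qed
  have nb: "L2_norm P (\<lambda>x. a t x - 1 - t / 2 * G x) \<le> 2 * L2_norm (P \<Otimes>\<^sub>M Q) (r t)" for t
  proof -
    note pr = partial_integral_L2[OF rL, of t]
    note [measurable] = L2_measurable[OF a(1)] L2_measurable[OF GL] L2_measurable[OF pr(1)]
    have "L2_norm P (\<lambda>x. a t x - 1 - t / 2 * G x) = L2_norm P (\<lambda>x. (1 - k t) * a t x + partial_integral Q (r t) x)"
      by (rule L2_norm_cong_AE[OF ae]) measurable
    also have "\<dots> \<le> L2_norm P (\<lambda>x. (1 - k t) * a t x) + L2_norm P (partial_integral Q (r t))"
      by (intro L2_norm_triangle L2_scale a pr)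
    also have "L2_norm P (\<lambda>x. (1 - k t) * a t x) \<le> L2_norm (P \<Otimes>\<^sub>M Q) (r t) * 1"
      unfolding L2_norm_scale using k1[of t] km[of t] norm1[of t] L2_norm_nonneg by (intro mult_mono) auto
    finally show ?thesis using pr(2) by simp
  qed
  show ?thesis
    unfolding root_differentiable_def G_def[symmetric]
  proof (intro conjI allI)
    show "((\<lambda>t. L2_norm P (\<lambda>x. a t x - 1 - t / 2 * G x) / \<bar>t\<bar>) \<longlongrightarrow> 0) (at 0)"
    proof (rule Lim_null_comparison)
      show "((\<lambda>t. 2 * (L2_norm (P \<Otimes>\<^sub>M Q) (r t) / \<bar>t\<bar>)) \<longlongrightarrow> 0) (at 0)"
        using tendsto_mult_left[OF l1, of 2] unfolding r_def by (simp only: mult_zero_right)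
      show "\<forall>\<^sub>F t in at 0. norm (L2_norm P (\<lambda>x. a t x - 1 - t / 2 * G x) / \<bar>t\<bar>) \<le> 2 * (L2_norm (P \<Otimes>\<^sub>M Q) (r t) / \<bar>t\<bar>)"
        unfolding real_norm_def abs_divide abs_idempotent abs_of_nonneg[OF L2_norm_nonneg] times_divide_eq_right
        by (intro always_eventually allI divide_right_mono nb abs_ge_zero)
    qed
    show "((\<lambda>t. (1 - (\<integral>x. (a t x)\<^sup>2 \<partial>P)) / t\<^sup>2) \<longlongrightarrow> 0) (at 0)"
    proof (rule Lim_null_comparison[OF _ l2], intro always_eventually allI)
      fix t
      have "(\<integral>x. (a t x)\<^sup>2 \<partial>P) * (\<integral>y. (b t y)\<^sup>2 \<partial>Q) \<le> (\<integral>x. (a t x)\<^sup>2 \<partial>P) * 1"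
        using b(3)[of t] by (intro mult_left_mono) auto
      then show "norm ((1 - (\<integral>x. (a t x)\<^sup>2 \<partial>P)) / t\<^sup>2) \<le> (1 - (\<integral>z. (a t (fst z) * b t (snd z))\<^sup>2 \<partial>(P \<Otimes>\<^sub>M Q))) / t\<^sup>2"
        unfolding L2_product(2)[OF a(1) b(1)] using a(3)[of t] by (simp add: divide_right_mono)
    qed
  qed (use GL a in auto)
qed

lemma root_differentiable_swap:
  assumes P: "prob_space P" and Q: "prob_space Q"
    and d: "root_differentiable (P \<Otimes>\<^sub>M Q) c g"
  shows "root_differentiable (Q \<Otimes>\<^sub>M P) (\<lambda>t. swap_args (c t)) (swap_args g)"
proof -
  interpret pair_prob_space P Q using P Q by (rule pair_prob_spaceI)
  have gL: "g \<in> L2 (P \<Otimes>\<^sub>M Q)" and cL: "\<And>t. c t \<in> L2 (P \<Otimes>\<^sub>M Q)" using d by (auto simp: root_differentiable_def)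
  have sq: "(\<lambda>z. (c t z)\<^sup>2) \<in> borel_measurable (P \<Otimes>\<^sub>M Q)" for t using cL[of t] by (auto simp: L2_def)
  have "(\<lambda>z. c t z - 1 - t / 2 * g z) \<in> L2 (P \<Otimes>\<^sub>M Q)" for t
    by (intro L2_diff L2_scale P.L2_const cL gL)
  note n = L2_swap_args(2)[OF this]
  show ?thesis
    using d L2_swap_args(1)[OF gL] L2_swap_args(1)[OF cL]
    unfolding root_differentiable_def integral_swap_args(1)[OF sq] n by simp
qed

text \<open>The norm of the mixed term (a - 1)(b - 1) factorises and so is O(t^2). To first order
  the product root density is therefore additive in its factors, and its tangent is the sum of the
  two marginal tangents.\<close>

lemma root_differentiable_product:
  assumes P: "prob_space P" and Q: "prob_space Q"
    and d: "root_differentiable (P \<Otimes>\<^sub>M Q) (\<lambda>t z. a t (fst z) * b t (snd z)) g"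
    and a: "\<And>t. a t \<in> L2 P" "\<And>t x. 0 \<le> a t x" "\<And>t. (\<integral>x. (a t x)\<^sup>2 \<partial>P) \<le> 1"
    and b: "\<And>t. b t \<in> L2 Q" "\<And>t x. 0 \<le> b t x" "\<And>t. (\<integral>x. (b t x)\<^sup>2 \<partial>Q) \<le> 1"
  shows "root_differentiable P a (partial_integral Q g)"
    "root_differentiable Q b (partial_integral P (swap_args g))"
    "AE z in P \<Otimes>\<^sub>M Q. g z = partial_integral Q g (fst z) + partial_integral P (swap_args g) (snd z)"
proof -
  interpret pair_prob_space P Q using P Q by (rule pair_prob_spaceI)
  interpret S: pair_prob_space Q P using Q P by (rule pair_prob_spaceI)
  show A: "root_differentiable P a (partial_integral Q g)"
    by (rule root_differentiable_product_fst[OF P Q d a b])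
  have "root_differentiable (Q \<Otimes>\<^sub>M P) (\<lambda>t z. b t (fst z) * a t (snd z)) (swap_args g)"
    using root_differentiable_swap[OF P Q d] by (simp add: mult.commute)
  from root_differentiable_product_fst[OF Q P this b a]
  show B: "root_differentiable Q b (partial_integral P (swap_args g))" .
  define ga gb where "ga = partial_integral Q g" and "gb = partial_integral P (swap_args g)"
  have gL: "g \<in> L2 (P \<Otimes>\<^sub>M Q)" using d by (auto simp: root_differentiable_def)
  have gaL: "ga \<in> L2 P" and gbL: "gb \<in> L2 Q" using A B by (auto simp: root_differentiable_def ga_def gb_def)
  define na where "na t = L2_norm P (\<lambda>x. a t x - 1 - t / 2 * ga x) / \<bar>t\<bar>" for t
  define nb where "nb t = L2_norm Q (\<lambda>x. b t x - 1 - t / 2 * gb x) / \<bar>t\<bar>" for t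
  define nr where "nr t = L2_norm (P \<Otimes>\<^sub>M Q) (\<lambda>z. a t (fst z) * b t (snd z) - 1 - t / 2 * g z) / \<bar>t\<bar>" for t
  have lim: "(na \<longlongrightarrow> 0) (at 0)" "(nb \<longlongrightarrow> 0) (at 0)" "(nr \<longlongrightarrow> 0) (at 0)"
    using A B d by (auto simp: root_differentiable_def ga_def gb_def na_def[abs_def] nb_def[abs_def] nr_def[abs_def])
  define w where "w z = g z - (ga (fst z) + gb (snd z))" for z
  have L2snd: "(\<lambda>z. f (snd z)) \<in> L2 (P \<Otimes>\<^sub>M Q) \<and> L2_norm (P \<Otimes>\<^sub>M Q) (\<lambda>z. f (snd z)) = L2_norm Q f" if "f \<in> L2 Q" for f
    using S.L2_swap_args[OF S.L2_fst(1)[OF that]] S.L2_fst(2)[OF that] by simp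
  have wL: "w \<in> L2 (P \<Otimes>\<^sub>M Q)" unfolding w_def[abs_def]
    using L2snd[OF gbL] by (intro L2_diff L2_add gL L2_fst gaL) auto
  define W where "W = L2_norm (P \<Otimes>\<^sub>M Q) w"
  have aux: "(\<lambda>x. f x - 1) \<in> L2 M \<and> (\<lambda>x. f x - 1 - t / 2 * h x) \<in> L2 M
      \<and> L2_norm M (\<lambda>x. f x - 1) \<le> \<bar>t\<bar> * (L2_norm M h / 2 + L2_norm M (\<lambda>x. f x - 1 - t / 2 * h x) / \<bar>t\<bar>)"
    if "prob_space M" "f \<in> L2 M" "h \<in> L2 M" "t \<noteq> 0" for M :: "'u measure" and f h t
  proof -
    interpret M: prob_space M by fact
    have 1: "(\<lambda>x. f x - 1) \<in> L2 M" by (intro L2_diff that M.L2_const)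
    have 2: "(\<lambda>x. f x - 1 - t / 2 * h x) \<in> L2 M" by (intro L2_diff L2_scale 1 that)
    have 3: "(\<lambda>x. t / 2 * h x) \<in> L2 M" by (intro L2_scale that)
    have "A + \<bar>t / 2\<bar> * B = \<bar>t\<bar> * (B / 2 + A / \<bar>t\<bar>)" for A B using that(4) by (simp add: field_simps)
    then have "L2_norm M (\<lambda>x. f x - 1) \<le> \<bar>t\<bar> * (L2_norm M h / 2 + L2_norm M (\<lambda>x. f x - 1 - t / 2 * h x) / \<bar>t\<bar>)"
      using L2_norm_triangle[OF 2 3] unfolding L2_norm_scale by (simp only: diff_add_cancel)
    then show ?thesis using 1 2 by blast
  qed
  have bound: "W \<le> 2 * (\<bar>t\<bar> * ((L2_norm P ga / 2 + na t) * (L2_norm Q gb / 2 + nb t)) + nr t + na t + nb t)"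
    if t: "t \<noteq> 0" for t
  proof -
    note xa = aux[OF P a(1) gaL t, of t] and xb = aux[OF Q b(1) gbL t, of t]
    have rL: "(\<lambda>z. a t (fst z) * b t (snd z) - 1 - t / 2 * g z) \<in> L2 (P \<Otimes>\<^sub>M Q)"
      by (intro L2_diff L2_scale gL P.L2_const L2_product a b)
    have pL: "(\<lambda>z. (a t (fst z) - 1) * (b t (snd z) - 1)) \<in> L2 (P \<Otimes>\<^sub>M Q)"
      using L2_product(1)[of "\<lambda>x. a t x - 1" "\<lambda>x. b t x - 1"] xa xb by simp
    have pn: "L2_norm (P \<Otimes>\<^sub>M Q) (\<lambda>z. (a t (fst z) - 1) * (b t (snd z) - 1)) = L2_norm P (\<lambda>x. a t x - 1) * L2_norm Q (\<lambda>x. b t x - 1)"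
      using L2_product(2)[of "\<lambda>x. a t x - 1" "\<lambda>x. b t x - 1"] xa xb by (simp add: L2_norm_def real_sqrt_mult)
    have raL: "(\<lambda>z. a t (fst z) - 1 - t / 2 * ga (fst z)) \<in> L2 (P \<Otimes>\<^sub>M Q)"
      "L2_norm (P \<Otimes>\<^sub>M Q) (\<lambda>z. a t (fst z) - 1 - t / 2 * ga (fst z)) = L2_norm P (\<lambda>x. a t x - 1 - t / 2 * ga x)"
      using L2_fst[of "\<lambda>x. a t x - 1 - t / 2 * ga x"] xa by auto
    have rbL: "(\<lambda>z. b t (snd z) - 1 - t / 2 * gb (snd z)) \<in> L2 (P \<Otimes>\<^sub>M Q)"
      "L2_norm (P \<Otimes>\<^sub>M Q) (\<lambda>z. b t (snd z) - 1 - t / 2 * gb (snd z)) = L2_norm Q (\<lambda>x. b t x - 1 - t / 2 * gb x)"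
      using L2snd[of "\<lambda>x. b t x - 1 - t / 2 * gb x"] xb by auto
    \<comment> \<open>The defect \<open>w\<close>, scaled by t/2, is the mixed term minus the
      remainder of the product plus the two marginal remainders.\<close>
    have eq: "(\<lambda>z. t / 2 * w z) = (\<lambda>z. ((a t (fst z) - 1) * (b t (snd z) - 1) - (a t (fst z) * b t (snd z) - 1 - t / 2 * g z))
        + ((a t (fst z) - 1 - t / 2 * ga (fst z)) + (b t (snd z) - 1 - t / 2 * gb (snd z))))"
      by (simp add: fun_eq_iff w_def algebra_simps)
    have nrt: "nr t * \<bar>t\<bar> = L2_norm (P \<Otimes>\<^sub>M Q) (\<lambda>z. a t (fst z) * b t (snd z) - 1 - t / 2 * g z)"
      using t by (simp add: nr_def)
    have "\<bar>t\<bar> / 2 * W = L2_norm (P \<Otimes>\<^sub>M Q) (\<lambda>z. t / 2 * w z)" unfolding L2_norm_scale W_def by simp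
    also have "\<dots> \<le> L2_norm (P \<Otimes>\<^sub>M Q) (\<lambda>z. (a t (fst z) - 1) * (b t (snd z) - 1) - (a t (fst z) * b t (snd z) - 1 - t / 2 * g z))
        + L2_norm (P \<Otimes>\<^sub>M Q) (\<lambda>z. (a t (fst z) - 1 - t / 2 * ga (fst z)) + (b t (snd z) - 1 - t / 2 * gb (snd z)))"
      unfolding eq by (intro L2_norm_triangle L2_diff[OF pL rL] L2_add raL rbL)
    also have "L2_norm (P \<Otimes>\<^sub>M Q) (\<lambda>z. (a t (fst z) - 1) * (b t (snd z) - 1) - (a t (fst z) * b t (snd z) - 1 - t / 2 * g z))
       \<le> L2_norm P (\<lambda>x. a t x - 1) * L2_norm Q (\<lambda>x. b t x - 1) + nr t * \<bar>t\<bar>"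
      using L2_norm_triangle_minus[OF pL rL] by (simp only: pn nrt)
    also have "L2_norm (P \<Otimes>\<^sub>M Q) (\<lambda>z. (a t (fst z) - 1 - t / 2 * ga (fst z)) + (b t (snd z) - 1 - t / 2 * gb (snd z)))
       \<le> na t * \<bar>t\<bar> + nb t * \<bar>t\<bar>"
      using L2_norm_triangle[OF raL(1) rbL(1)] t raL(2) rbL(2) by (simp add: na_def nb_def)
    also have "L2_norm P (\<lambda>x. a t x - 1) * L2_norm Q (\<lambda>x. b t x - 1)
       \<le> (\<bar>t\<bar> * (L2_norm P ga / 2 + na t)) * (\<bar>t\<bar> * (L2_norm Q gb / 2 + nb t))"
      using xa xb L2_norm_nonneg[of P] L2_norm_nonneg[of Q] by (intro mult_mono) (auto simp: na_def nb_def)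
    finally have "\<bar>t\<bar> * (W / 2) \<le> \<bar>t\<bar> * (\<bar>t\<bar> * ((L2_norm P ga / 2 + na t) * (L2_norm Q gb / 2 + nb t)) + nr t + na t + nb t)"
      by (simp add: algebra_simps)
    then show ?thesis using t by (simp add: mult_le_cancel_left)
  qed
  have "((\<lambda>t. 2 * (\<bar>t\<bar> * ((L2_norm P ga / 2 + na t) * (L2_norm Q gb / 2 + nb t)) + nr t + na t + nb t)) \<longlongrightarrow>
      2 * (\<bar>0\<bar> * ((L2_norm P ga / 2 + 0) * (L2_norm Q gb / 2 + 0)) + 0 + 0 + 0)) (at 0)"
    by (intro tendsto_intros lim)
  then have "((\<lambda>t. 2 * (\<bar>t\<bar> * ((L2_norm P ga / 2 + na t) * (L2_norm Q gb / 2 + nb t)) + nr t + na t + nb t)) \<longlongrightarrow> 0) (at 0)"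
    by simp
  moreover have "\<forall>\<^sub>F t in at 0. W \<le> 2 * (\<bar>t\<bar> * ((L2_norm P ga / 2 + na t) * (L2_norm Q gb / 2 + nb t)) + nr t + na t + nb t)"
    using bound by (auto simp: eventually_at_filter)
  ultimately have "W \<le> 0" by (rule tendsto_lowerbound) simp
  then have "W = 0" using L2_norm_nonneg[of "P \<Otimes>\<^sub>M Q" w] by (simp add: W_def)
  then have "AE z in P \<Otimes>\<^sub>M Q. w z = 0" unfolding W_def by (rule L2_norm_eq_0_AE[OF wL])
  then show "AE z in P \<Otimes>\<^sub>M Q. g z = partial_integral Q g (fst z) + partial_integral P (swap_args g) (snd z)"
    by eventually_elim (simp add: w_def ga_def gb_def)
qed

section \<open>From root densities to curves of measures\<close>

definition prob_curve :: "(real \<Rightarrow> 'a measure) \<Rightarrow> bool" where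
  "prob_curve \<rho> \<longleftrightarrow> (\<forall>t. prob_space (\<rho> t) \<and> sets (\<rho> t) = sets (\<rho> 0))"

lemma prob_curveD:
  assumes "prob_curve \<rho>"
  shows "prob_space (\<rho> t)" "sets (\<rho> t) = sets (\<rho> 0)"
  using assms by (auto simp: prob_curve_def)

context pair_prob_space
begin

lemma AE_fst:
  assumes "AE x in M1. R x"
  shows "AE z in M1 \<Otimes>\<^sub>M M2. R (fst z)"
proof (rule AE_distrD[OF measurable_fst])
  show "AE x in distr (M1 \<Otimes>\<^sub>M M2) M1 fst. R x" unfolding M2.distr_pair_fst by (rule assms)
qed

lemma AE_snd:
  assumes "AE y in M2. R y"
  shows "AE z in M1 \<Otimes>\<^sub>M M2. R (snd z)"
proof (rule AE_distrD[OF measurable_snd])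
  have d: "distr (M1 \<Otimes>\<^sub>M M2) M2 snd = M2"
  proof (rule measure_eqI)
    fix A assume "A \<in> sets (distr (M1 \<Otimes>\<^sub>M M2) M2 snd)"
    then have A: "A \<in> sets M2" by simp
    have "snd -` A \<inter> space (M1 \<Otimes>\<^sub>M M2) = space M1 \<times> A"
      using sets.sets_into_space[OF A] by (auto simp: space_pair_measure)
    then show "emeasure (distr (M1 \<Otimes>\<^sub>M M2) M2 snd) A = emeasure M2 A"
      using A by (simp add: emeasure_distr M2.emeasure_pair_measure_Times M1.emeasure_space_1)
  qed simp
  show "AE y in distr (M1 \<Otimes>\<^sub>M M2) M2 snd. R y" unfolding d by (rule assms)
qed

end

definition root_density :: "(real \<Rightarrow> 'a measure) \<Rightarrow> real \<Rightarrow> 'a \<Rightarrow> real" where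
  "root_density \<rho> t x = sqrt (enn2real (density_quotient (\<rho> t) (\<rho> 0) x))"

lemma root_density_on:
  assumes \<rho>: "prob_curve \<rho>"
  shows "density_on (\<rho> t) (\<rho> 0) (\<lambda>x. (root_density \<rho> t x)\<^sup>2) {x \<in> space (\<rho> 0). density_quotient (\<rho> t) (\<rho> 0) x < \<infinity>}"
  using density_on_density_quotient(1)[OF prob_curveD(1)[OF \<rho>] prob_curveD(1)[OF \<rho>] prob_curveD(2)[OF \<rho>]]
  by (simp add: root_density_def)

lemma root_density:
  assumes \<rho>: "prob_curve \<rho>"
  shows "root_density \<rho> t \<in> L2 (\<rho> 0)" "0 \<le> root_density \<rho> t x" "(\<integral>x. (root_density \<rho> t x)\<^sup>2 \<partial>\<rho> 0) \<le> 1"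
    "1 - (\<integral>x. (root_density \<rho> t x)\<^sup>2 \<partial>\<rho> 0) = measure (\<rho> t) {x \<in> space (\<rho> 0). density_quotient (\<rho> t) (\<rho> 0) x = \<infinity>}"
proof -
  interpret prob_space "\<rho> t" by (rule prob_curveD(1)[OF \<rho>])
  let ?L = "density_quotient (\<rho> t) (\<rho> 0)"
  note d = root_density_on[OF \<rho>, where t = t]
  note i = density_on_integrable[OF d prob_curveD(1)[OF \<rho>]]
  have m: "(\<lambda>x. enn2real (?L x)) \<in> borel_measurable (\<rho> 0)"
    using density_on_density_quotient(1)[OF prob_curveD(1)[OF \<rho>] prob_curveD(1)[OF \<rho>] prob_curveD(2)[OF \<rho>]]
    by (simp add: density_on_def)
  then have "root_density \<rho> t \<in> borel_measurable (\<rho> 0)" unfolding root_density_def[abs_def] by measurable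
  then show "root_density \<rho> t \<in> L2 (\<rho> 0)" using i(1) by (rule L2_I)
  show "0 \<le> root_density \<rho> t x" by (simp add: root_density_def)
  show "(\<integral>x. (root_density \<rho> t x)\<^sup>2 \<partial>\<rho> 0) \<le> 1" by (rule i(3))
  let ?S = "{x \<in> space (\<rho> 0). ?L x < \<infinity>}"
  have sp: "space (\<rho> 0) = space (\<rho> t)" using prob_curveD(2)[OF \<rho>] by (metis sets_eq_imp_space_eq)
  have S: "?S \<in> sets (\<rho> t)" using d prob_curveD(2)[OF \<rho>, of t] by (simp add: density_on_def)
  have "1 - measure (\<rho> t) ?S = measure (\<rho> t) (space (\<rho> t) - ?S)" using prob_compl[OF S] by simp
  also have "space (\<rho> t) - ?S = {x \<in> space (\<rho> 0). ?L x = \<infinity>}" using sp by (auto simp: less_top[symmetric])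
  finally show "1 - (\<integral>x. (root_density \<rho> t x)\<^sup>2 \<partial>\<rho> 0) = measure (\<rho> t) {x \<in> space (\<rho> 0). ?L x = \<infinity>}"
    unfolding i(2) .
qed

text \<open>The expansion in the definition is twice that of the root density, and the singular mass
  is 1 minus the integral of its square; what remains is to write Landau symbols as limits of
  quotients.\<close>

lemma L2_differentiable_iff_root_differentiable:
  assumes \<rho>: "prob_curve \<rho>"
  shows "L2_differentiable \<rho> g \<longleftrightarrow> root_differentiable (\<rho> 0) (root_density \<rho>) g"
proof -
  let ?A = "\<lambda>t. L2_norm (\<rho> 0) (\<lambda>x. 2 * (root_density \<rho> t x - 1) - t * g x)"
  let ?B = "\<lambda>t. 1 - (\<integral>x. (root_density \<rho> t x)\<^sup>2 \<partial>\<rho> 0)"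
  have small: "f \<in> o[at 0](h) \<longleftrightarrow> ((\<lambda>t. f t / h t) \<longlongrightarrow> 0) (at 0)" if "\<And>t. t \<noteq> 0 \<Longrightarrow> h t \<noteq> 0" for f h :: "real \<Rightarrow> real"
  proof
    show "f \<in> o[at 0](h)" if "((\<lambda>t. f t / h t) \<longlongrightarrow> 0) (at 0)"
      by (rule smalloI_tendsto[OF that]) (use \<open>\<And>t. t \<noteq> 0 \<Longrightarrow> h t \<noteq> 0\<close> in \<open>auto simp: eventually_at_filter\<close>)
  qed (rule smalloD_tendsto)
  have A: "?A t = 2 * L2_norm (\<rho> 0) (\<lambda>x. root_density \<rho> t x - 1 - t / 2 * g x)" for t
  proof -
    have "(\<lambda>x. 2 * (root_density \<rho> t x - 1) - t * g x) = (\<lambda>x. 2 * (root_density \<rho> t x - 1 - t / 2 * g x))"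
      by (simp add: fun_eq_iff algebra_simps)
    then show ?thesis by (simp only: L2_norm_scale abs_numeral)
  qed
  have A': "((\<lambda>t. ?A t / \<bar>t\<bar>) \<longlongrightarrow> 0) (at 0) \<longleftrightarrow> ((\<lambda>t. L2_norm (\<rho> 0) (\<lambda>x. root_density \<rho> t x - 1 - t / 2 * g x) / \<bar>t\<bar>) \<longlongrightarrow> 0) (at 0)"
    (is "_ \<longleftrightarrow> (?N \<longlongrightarrow> 0) (at 0)")
  proof -
    have "(\<lambda>t. ?A t / \<bar>t\<bar>) = (\<lambda>t. 2 * ?N t)" unfolding A by (simp only: times_divide_eq_right)
    moreover have "((\<lambda>t. 2 * ?N t) \<longlongrightarrow> 0) (at 0) \<longleftrightarrow> (?N \<longlongrightarrow> 0) (at 0)"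
      using tendsto_mult_left[of "\<lambda>t. 2 * ?N t" 0 "at 0" "1/2"] tendsto_mult_left[of ?N 0 "at 0" 2] by (auto simp only: mult.assoc[symmetric]) simp_all
    ultimately show ?thesis by (simp only:)
  qed
  have "L2_differentiable \<rho> g \<longleftrightarrow> g \<in> L2 (\<rho> 0) \<and> ?A \<in> o[at 0](\<lambda>t. \<bar>t\<bar>) \<and> ?B \<in> o[at 0](\<lambda>t. t\<^sup>2)"
    unfolding L2_differentiable_def root_density(4)[OF \<rho>] by (simp only: root_density_def)
  also have "\<dots> \<longleftrightarrow> g \<in> L2 (\<rho> 0) \<and> ((\<lambda>t. ?A t / \<bar>t\<bar>) \<longlongrightarrow> 0) (at 0) \<and> ((\<lambda>t. ?B t / t\<^sup>2) \<longlongrightarrow> 0) (at 0)"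
    by (subst (1 2) small) auto
  also have "\<dots> \<longleftrightarrow> root_differentiable (\<rho> 0) (root_density \<rho>) g"
    unfolding A' root_differentiable_def using root_density[OF \<rho>] by blast
  finally show ?thesis .
qed

text \<open>By uniqueness of densities the product of the marginal root densities is a version of
  the root density of the product, so the statement on root densities applies.\<close>

theorem L2_differentiable_product:
  assumes P: "prob_curve P" and Q: "prob_curve Q"
    and d: "L2_differentiable (\<lambda>t. P t \<Otimes>\<^sub>M Q t) g"
  shows "L2_differentiable P (partial_integral (Q 0) g)"
    "L2_differentiable Q (partial_integral (P 0) (swap_args g))"
    "AE z in P 0 \<Otimes>\<^sub>M Q 0. g z = partial_integral (Q 0) g (fst z) + partial_integral (P 0) (swap_args g) (snd z)"
proof -
  note P1 = prob_curveD(1)[OF P] and Q1 = prob_curveD(1)[OF Q]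
  interpret pair_prob_space "P 0" "Q 0" by (rule pair_prob_spaceI[OF P1 Q1])
  let ?\<rho> = "\<lambda>t. P t \<Otimes>\<^sub>M Q t"
  have \<rho>: "prob_curve ?\<rho>"
    unfolding prob_curve_def
  proof (intro allI conjI)
    fix t
    interpret t: pair_prob_space "P t" "Q t" by (rule pair_prob_spaceI[OF P1 Q1])
    show "prob_space (?\<rho> t)" by (rule t.P.prob_space_axioms)
    show "sets (?\<rho> t) = sets (?\<rho> 0)" by (rule sets_pair_measure_cong[OF prob_curveD(2)[OF P] prob_curveD(2)[OF Q]])
  qed
  note \<rho>1 = prob_curveD(1)[OF \<rho>]
  have d': "root_differentiable (?\<rho> 0) (root_density ?\<rho>) g"
    using d L2_differentiable_iff_root_differentiable[OF \<rho>] by simp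
  have ae: "AE z in ?\<rho> 0. root_density P t (fst z) * root_density Q t (snd z) = root_density ?\<rho> t z" for t
  proof -
    have "AE z in ?\<rho> 0. (root_density P t (fst z))\<^sup>2 * (root_density Q t (snd z))\<^sup>2 = (root_density ?\<rho> t z)\<^sup>2"
      by (rule density_on_unique[OF \<rho>1 density_on_pair[OF P1 Q1 P1 Q1 root_density_on[OF P] root_density_on[OF Q]] root_density_on[OF \<rho>]])
    then show ?thesis
    proof eventually_elim
      case (elim z)
      then have "(root_density P t (fst z) * root_density Q t (snd z))\<^sup>2 = (root_density ?\<rho> t z)\<^sup>2"
        by (simp only: power_mult_distrib)
      then show ?case
        using root_density(2)[OF P] root_density(2)[OF Q] root_density(2)[OF \<rho>] by (simp add: power2_eq_iff_nonneg)
    qed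
  qed
  have "root_differentiable (P 0 \<Otimes>\<^sub>M Q 0) (\<lambda>t z. root_density P t (fst z) * root_density Q t (snd z)) g"
  proof (rule root_differentiable_cong_AE[OF d' \<rho>1 _ _ ae])
    show "(\<lambda>z. root_density P t (fst z) * root_density Q t (snd z)) \<in> borel_measurable (?\<rho> 0)" for t
      by (rule L2_measurable[OF L2_product(1)[OF root_density(1)[OF P] root_density(1)[OF Q]]])
    show "0 \<le> root_density P t (fst z) * root_density Q t (snd z)" for t z
      using root_density(2)[OF P] root_density(2)[OF Q] by simp
  qed
  note r = root_differentiable_product[OF P1 Q1 this root_density(1-3)[OF P] root_density(1-3)[OF Q]]
  show "L2_differentiable P (partial_integral (Q 0) g)" "L2_differentiable Q (partial_integral (P 0) (swap_args g))"
    using r(1,2) L2_differentiable_iff_root_differentiable[OF P] L2_differentiable_iff_root_differentiable[OF Q] by auto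
  show "AE z in P 0 \<Otimes>\<^sub>M Q 0. g z = partial_integral (Q 0) g (fst z) + partial_integral (P 0) (swap_args g) (snd z)"
    by (rule r(3))
qed

text \<open>Only the germ at 0 matters. A curve that lies in the family near 0 can thus be exchanged
  for one that consists of probability measures for all t.\<close>

lemma L2_differentiable_cong:
  assumes d: "L2_differentiable \<rho> g" and e: "\<forall>\<^sub>F t in nhds 0. \<rho> t = \<rho>' t"
  shows "L2_differentiable \<rho>' g"
proof -
  have 0: "\<rho>' 0 = \<rho> 0" using eventually_nhds_x_imp_x[OF e] by simp
  have e': "\<forall>\<^sub>F t in at 0. \<rho> t = \<rho>' t" using e by (auto simp: eventually_at_filter elim: eventually_mono)
  have "(\<lambda>t. L2_norm (\<rho> 0) (\<lambda>x. 2 * (sqrt (enn2real (density_quotient (\<rho>' t) (\<rho> 0) x)) - 1) - t * g x)) \<in> o[at 0](\<lambda>t. \<bar>t\<bar>) \<longleftrightarrow>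
    (\<lambda>t. L2_norm (\<rho> 0) (\<lambda>x. 2 * (sqrt (enn2real (density_quotient (\<rho> t) (\<rho> 0) x)) - 1) - t * g x)) \<in> o[at 0](\<lambda>t. \<bar>t\<bar>)"
    by (rule landau_o.small.in_cong, use e' in eventually_elim) simp
  moreover have "(\<lambda>t. measure (\<rho>' t) {x \<in> space (\<rho> 0). density_quotient (\<rho>' t) (\<rho> 0) x = \<infinity>}) \<in> o[at 0](\<lambda>t. t\<^sup>2) \<longleftrightarrow>
    (\<lambda>t. measure (\<rho> t) {x \<in> space (\<rho> 0). density_quotient (\<rho> t) (\<rho> 0) x = \<infinity>}) \<in> o[at 0](\<lambda>t. t\<^sup>2)"
    by (rule landau_o.small.in_cong, use e' in eventually_elim) simp
  ultimately show ?thesis using d unfolding L2_differentiable_def 0 by simp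
qed

text \<open>The factors are the marginals. This yields the starting points of the factor curves from
  that of the product curve.\<close>

lemma pair_measure_eq_imp_eq:
  assumes P: "prob_space P" "prob_space P'" and Q: "prob_space Q" "prob_space Q'"
    and s: "sets P = sets P'" "sets Q = sets Q'" and eq: "P \<Otimes>\<^sub>M Q = P' \<Otimes>\<^sub>M Q'"
  shows "P = P'" "Q = Q'"
proof -
  interpret A': pair_prob_space Q P by (rule pair_prob_spaceI[OF Q(1) P(1)])
  interpret B': pair_prob_space Q' P' by (rule pair_prob_spaceI[OF Q(2) P(2)])
  have "P = distr (P \<Otimes>\<^sub>M Q) P fst" by (simp add: prob_space.distr_pair_fst[OF Q(1)])
  also have "\<dots> = distr (P' \<Otimes>\<^sub>M Q') P' fst" using s eq by (intro distr_cong) auto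
  also have "\<dots> = P'" by (simp add: prob_space.distr_pair_fst[OF Q(2)])
  finally show "P = P'" .
  have "Q \<Otimes>\<^sub>M P = distr (P \<Otimes>\<^sub>M Q) (Q \<Otimes>\<^sub>M P) (\<lambda>(x, y). (y, x))" by (rule A'.distr_pair_swap)
  also have "\<dots> = distr (P' \<Otimes>\<^sub>M Q') (Q' \<Otimes>\<^sub>M P') (\<lambda>(x, y). (y, x))"
    using s eq by (intro distr_cong sets_pair_measure_cong) auto
  also have "\<dots> = Q' \<Otimes>\<^sub>M P'" by (rule B'.distr_pair_swap[symmetric])
  finally have eq': "Q \<Otimes>\<^sub>M P = Q' \<Otimes>\<^sub>M P'" .
  have "Q = distr (Q \<Otimes>\<^sub>M P) Q fst" by (simp add: prob_space.distr_pair_fst[OF P(1)])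
  also have "\<dots> = distr (Q' \<Otimes>\<^sub>M P') Q' fst" using s eq' by (intro distr_cong) auto
  also have "\<dots> = Q'" by (simp add: prob_space.distr_pair_fst[OF P(2)])
  finally show "Q = Q'" .
qed

section \<open>Tangent cones and tangent spaces of product families\<close>

lemma tangent_cone_product:
  assumes \<P>: "\<P> \<subseteq> space (prob_algebra M1)" and \<Q>: "\<Q> \<subseteq> space (prob_algebra M2)"
    and P0: "P0 \<in> space (prob_algebra M1)" and Q0: "Q0 \<in> space (prob_algebra M2)"
    and g: "g \<in> tangent_cone (P0 \<Otimes>\<^sub>M Q0) (prod_family \<P> \<Q>)"
  shows "partial_integral Q0 g \<in> tangent_cone P0 \<P>" "partial_integral P0 (swap_args g) \<in> tangent_cone Q0 \<Q>"
    "AE z in P0 \<Otimes>\<^sub>M Q0. g z = partial_integral Q0 g (fst z) + partial_integral P0 (swap_args g) (snd z)"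
    "g \<in> L2 (P0 \<Otimes>\<^sub>M Q0)"
proof -
  obtain \<rho> where \<rho>: "\<rho> 0 = P0 \<Otimes>\<^sub>M Q0" "\<forall>\<^sub>F t in nhds 0. \<rho> t \<in> prod_family \<P> \<Q>" "L2_differentiable \<rho> g"
    using g by (auto simp: tangent_cone_def)
  have pP: "prob_space P \<and> sets P = sets P0" if "P \<in> \<P>" for P using that \<P> P0 by (auto simp: space_prob_algebra)
  have pQ: "prob_space Q \<and> sets Q = sets Q0" if "Q \<in> \<Q>" for Q using that \<Q> Q0 by (auto simp: space_prob_algebra)
  have p0: "prob_space P0" "prob_space Q0" using P0 Q0 by (auto simp: space_prob_algebra)
  \<comment> \<open>Factors are chosen where the curve lies in the family; elsewhere (P0, Q0) is the
    default, so both factor curves consist of probability measures for all t.\<close>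
  have "\<forall>t. \<exists>PQ. if \<rho> t \<in> prod_family \<P> \<Q> then fst PQ \<in> \<P> \<and> snd PQ \<in> \<Q> \<and> \<rho> t = fst PQ \<Otimes>\<^sub>M snd PQ else PQ = (P0, Q0)"
  proof
    fix t
    show "\<exists>PQ. if \<rho> t \<in> prod_family \<P> \<Q> then fst PQ \<in> \<P> \<and> snd PQ \<in> \<Q> \<and> \<rho> t = fst PQ \<Otimes>\<^sub>M snd PQ else PQ = (P0, Q0)"
    proof (cases "\<rho> t \<in> prod_family \<P> \<Q>")
      case True
      then obtain P Q where "\<rho> t = P \<Otimes>\<^sub>M Q" "P \<in> \<P>" "Q \<in> \<Q>" by (auto simp: prod_family_def)
      then show ?thesis using True by (intro exI[of _ "(P, Q)"]) simp
    qed simp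
  qed
  then obtain PQ where PQ: "\<And>t. if \<rho> t \<in> prod_family \<P> \<Q> then fst (PQ t) \<in> \<P> \<and> snd (PQ t) \<in> \<Q> \<and> \<rho> t = fst (PQ t) \<Otimes>\<^sub>M snd (PQ t) else PQ t = (P0, Q0)"
    by metis
  define P Q where "P t = fst (PQ t)" and "Q t = snd (PQ t)" for t
  have in_f: "\<rho> t \<in> prod_family \<P> \<Q> \<Longrightarrow> P t \<in> \<P> \<and> Q t \<in> \<Q> \<and> \<rho> t = P t \<Otimes>\<^sub>M Q t" for t
    using PQ[of t] by (simp add: P_def Q_def)
  have all: "prob_space (P t) \<and> sets (P t) = sets P0 \<and> prob_space (Q t) \<and> sets (Q t) = sets Q0" for t
  proof (cases "\<rho> t \<in> prod_family \<P> \<Q>")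
    case True
    then show ?thesis using in_f pP pQ by blast
  next
    case False
    then show ?thesis using PQ[of t] p0 by (simp add: P_def Q_def)
  qed
  \<comment> \<open>A property eventual in \<open>nhds 0\<close> holds at 0 itself, so the factors
    at 0 were chosen from the family and their product is the base measure.\<close>
  have "\<rho> 0 \<in> prod_family \<P> \<Q>" using eventually_nhds_x_imp_x[OF \<rho>(2)] .
  from in_f[OF this] have eq0: "P 0 \<Otimes>\<^sub>M Q 0 = P0 \<Otimes>\<^sub>M Q0" using \<rho>(1) by simp
  have 0: "P 0 = P0" "Q 0 = Q0"
    using pair_measure_eq_imp_eq[OF _ p0(1) _ p0(2) _ _ eq0] all by blast+
  have "L2_differentiable (\<lambda>t. P t \<Otimes>\<^sub>M Q t) g"
    by (rule L2_differentiable_cong[OF \<rho>(3)], use \<rho>(2) in eventually_elim) (use in_f in blast)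
  moreover have "prob_curve P" "prob_curve Q" unfolding prob_curve_def using all by auto
  ultimately have d: "L2_differentiable P (partial_integral Q0 g)" "L2_differentiable Q (partial_integral P0 (swap_args g))"
    "AE z in P0 \<Otimes>\<^sub>M Q0. g z = partial_integral Q0 g (fst z) + partial_integral P0 (swap_args g) (snd z)"
    using L2_differentiable_product[of P Q g] unfolding 0 by blast+
  have ev: "\<forall>\<^sub>F t in nhds 0. P t \<in> \<P>" "\<forall>\<^sub>F t in nhds 0. Q t \<in> \<Q>"
    using \<rho>(2) in_f by (auto elim: eventually_mono)
  show "partial_integral Q0 g \<in> tangent_cone P0 \<P>" "partial_integral P0 (swap_args g) \<in> tangent_cone Q0 \<Q>"
    unfolding tangent_cone_def using ev 0 d(1,2) by blast+
  show "AE z in P0 \<Otimes>\<^sub>M Q0. g z = partial_integral Q0 g (fst z) + partial_integral P0 (swap_args g) (snd z)"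
    by (rule d(3))
  show "g \<in> L2 (P0 \<Otimes>\<^sub>M Q0)" using \<rho>(1,3) by (simp add: L2_differentiable_def)
qed

lemma tangent_cone_mean_zero:
  assumes \<P>: "\<P> \<subseteq> space (prob_algebra M)" and P0: "P0 \<in> space (prob_algebra M)" and g: "g \<in> tangent_cone P0 \<P>"
  shows "g \<in> L2 P0" "(\<integral>x. g x \<partial>P0) = 0"
proof -
  obtain \<rho> where \<rho>: "\<rho> 0 = P0" "\<forall>\<^sub>F t in nhds 0. \<rho> t \<in> \<P>" "L2_differentiable \<rho> g"
    using g by (auto simp: tangent_cone_def)
  \<comment> \<open>Values outside the family, possible away from 0, are replaced by
    \<open>P0\<close>; the germ at 0 is unchanged.\<close>
  define \<rho>' where "\<rho>' t = (if \<rho> t \<in> \<P> then \<rho> t else P0)" for t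
  have d: "L2_differentiable \<rho>' g"
    by (rule L2_differentiable_cong[OF \<rho>(3)], use \<rho>(2) in eventually_elim) (simp add: \<rho>'_def)
  have p: "prob_curve \<rho>'"
    using \<P> P0 \<rho>(1) by (auto simp: prob_curve_def \<rho>'_def space_prob_algebra subset_iff)
  have 0: "\<rho>' 0 = P0" using \<rho>(1) by (simp add: \<rho>'_def)
  have rd: "root_differentiable (\<rho>' 0) (root_density \<rho>') g"
    using L2_differentiable_iff_root_differentiable[OF p] d by blast
  show "g \<in> L2 P0" "(\<integral>x. g x \<partial>P0) = 0"
    using root_differentiable_mean_zero[OF rd prob_curveD(1)[OF p]] rd unfolding 0 by (auto simp: root_differentiable_def)
qed

lemma linear_span_iff:
  "f \<in> linear_span K \<longleftrightarrow> (\<exists>F c. f = (\<lambda>x. \<Sum>u\<in>F. c u * u x) \<and> finite F \<and> F \<subseteq> K)"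
  by (auto simp: linear_span_def)

lemma linear_span_add:
  assumes "f \<in> linear_span K" "g \<in> linear_span K"
  shows "(\<lambda>x. f x + g x) \<in> linear_span K"
proof -
  obtain F c where F: "f = (\<lambda>x. \<Sum>u\<in>F. c u * u x)" "finite F" "F \<subseteq> K" using assms(1) by (auto simp: linear_span_def)
  obtain G d where G: "g = (\<lambda>x. \<Sum>u\<in>G. d u * u x)" "finite G" "G \<subseteq> K" using assms(2) by (auto simp: linear_span_def)
  let ?c = "\<lambda>u. (if u \<in> F then c u else 0) + (if u \<in> G then d u else 0)"
  have "(\<lambda>x. f x + g x) = (\<lambda>x. \<Sum>u\<in>F \<union> G. ?c u * u x)"
  proof (rule ext)
    fix x
    have "(\<Sum>u\<in>F \<union> G. ?c u * u x) = (\<Sum>u\<in>F \<union> G. if u \<in> F then c u * u x else 0) + (\<Sum>u\<in>F \<union> G. if u \<in> G then d u * u x else 0)"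
      unfolding sum.distrib[symmetric] by (intro sum.cong refl) (simp add: distrib_right)
    also have "(\<Sum>u\<in>F \<union> G. if u \<in> F then c u * u x else 0) = f x"
      using F G by (simp add: sum.inter_restrict[symmetric] Int_absorb1)
    also have "(\<Sum>u\<in>F \<union> G. if u \<in> G then d u * u x else 0) = g x"
      using F G by (simp add: sum.inter_restrict[symmetric] Int_absorb1)
    finally show "f x + g x = (\<Sum>u\<in>F \<union> G. ?c u * u x)" by simp
  qed
  then show ?thesis unfolding linear_span_iff using F(2,3) G(2,3)
    by (intro exI[of _ "F \<union> G"] exI[of _ ?c]) auto
qed

lemma linear_span_scale:
  assumes "f \<in> linear_span K"
  shows "(\<lambda>x. a * f x) \<in> linear_span K"
proof -
  obtain F c where F: "f = (\<lambda>x. \<Sum>u\<in>F. c u * u x)" "finite F" "F \<subseteq> K" using assms by (auto simp: linear_span_def)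
  then have "(\<lambda>x. a * f x) = (\<lambda>x. \<Sum>u\<in>F. (a * c u) * u x)" by (simp add: sum_distrib_left mult.assoc)
  then show ?thesis unfolding linear_span_iff using F(2,3)
    by (intro exI[of _ F] exI[of _ "\<lambda>u. a * c u"]) auto
qed

lemma linear_span_zero: "(\<lambda>x. 0) \<in> linear_span K"
  unfolding linear_span_def by (rule CollectI, rule exI[of _ "{}"]) simp

lemma linear_span_superset: "g \<in> K \<Longrightarrow> g \<in> linear_span K"
  unfolding linear_span_def by (rule CollectI, rule exI[of _ "{g}"], rule exI[of _ "\<lambda>_. 1"]) simp

text \<open>Adds one generator at a time and keeps the membership of the partial sum at hand, from
  which its square integrability is read off.\<close>

lemma linear_span_induct [consumes 1, case_names zero step]:
  assumes "f \<in> linear_span K"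
    and "P (\<lambda>x. 0)" and "\<And>c u h. u \<in> K \<Longrightarrow> h \<in> linear_span K \<Longrightarrow> P h \<Longrightarrow> P (\<lambda>x. c * u x + h x)"
  shows "P f"
proof -
  obtain F c where F: "f = (\<lambda>x. \<Sum>u\<in>F. c u * u x)" "finite F" "F \<subseteq> K" using assms(1) by (auto simp: linear_span_def)
  from F(2,3) have "P (\<lambda>x. \<Sum>u\<in>F. c u * u x) \<and> (\<lambda>x. \<Sum>u\<in>F. c u * u x) \<in> linear_span K"
  proof (induction F)
    case empty
    then show ?case using assms(2) linear_span_zero by simp
  next
    case (insert u F)
    then show ?case
      using assms(3)[of u "\<lambda>x. \<Sum>u\<in>F. c u * u x" "c u"]
        linear_span_add[OF linear_span_scale[OF linear_span_superset[of u K], of "c u"], of "\<lambda>x. \<Sum>u\<in>F. c u * u x"] by simp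
  qed
  then show ?thesis using F(1) by simp
qed

lemma linear_span_L2: "f \<in> linear_span K \<Longrightarrow> K \<subseteq> L2 M \<Longrightarrow> f \<in> L2 M"
proof (induction rule: linear_span_induct)
  case (step c u h)
  then have "u \<in> L2 M" "h \<in> L2 M" by auto
  then show ?case by (intro L2_add L2_scale)
qed (rule L2_zero)

lemma tangent_space_L2: "g \<in> tangent_space R \<R> \<Longrightarrow> g \<in> L2 R"
  by (simp add: tangent_space_def)

lemma tangent_cone_L2: "tangent_cone R \<R> \<subseteq> L2 R"
  by (auto simp: tangent_cone_def L2_differentiable_def)

lemma tangent_spaceD:
  assumes "g \<in> tangent_space R \<R>" "\<epsilon> > 0"
  obtains h where "h \<in> linear_span (tangent_cone R \<R>)" "h \<in> L2 R" "L2_norm R (\<lambda>x. g x - h x) < \<epsilon>"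
proof -
  obtain h where "h \<in> linear_span (tangent_cone R \<R>)" "L2_norm R (\<lambda>x. g x - h x) < \<epsilon>"
    using assms unfolding tangent_space_def by blast
  then show thesis using linear_span_L2[OF _ tangent_cone_L2] that by blast
qed

lemma tangent_space_zero: "(\<lambda>x. 0) \<in> tangent_space R \<R>"
  unfolding tangent_space_def using L2_zero[of R] linear_span_zero[of "tangent_cone R \<R>"]
  by (auto intro!: bexI[of _ "\<lambda>x. 0"] simp: L2_norm_zero)

lemma tangent_space_add:
  assumes f: "f \<in> tangent_space R \<R>" and g: "g \<in> tangent_space R \<R>"
  shows "(\<lambda>x. f x + g x) \<in> tangent_space R \<R>"
  unfolding tangent_space_def
proof (rule CollectI, intro conjI allI impI)
  show "(\<lambda>x. f x + g x) \<in> L2 R" using f g by (intro L2_add tangent_space_L2)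
  fix \<epsilon> :: real assume e: "\<epsilon> > 0"
  obtain u where u: "u \<in> linear_span (tangent_cone R \<R>)" "u \<in> L2 R" "L2_norm R (\<lambda>x. f x - u x) < \<epsilon>/2"
    using tangent_spaceD[OF f, of "\<epsilon>/2"] e by auto
  obtain v where v: "v \<in> linear_span (tangent_cone R \<R>)" "v \<in> L2 R" "L2_norm R (\<lambda>x. g x - v x) < \<epsilon>/2"
    using tangent_spaceD[OF g, of "\<epsilon>/2"] e by auto
  have "L2_norm R (\<lambda>x. (f x - u x) + (g x - v x)) \<le> L2_norm R (\<lambda>x. f x - u x) + L2_norm R (\<lambda>x. g x - v x)"
    by (intro L2_norm_triangle L2_diff tangent_space_L2[OF f] tangent_space_L2[OF g] u v)
  then have "L2_norm R (\<lambda>x. f x + g x - (u x + v x)) < \<epsilon>" using u(3) v(3) by (simp add: algebra_simps)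
  then show "\<exists>h\<in>linear_span (tangent_cone R \<R>). L2_norm R (\<lambda>x. f x + g x - h x) < \<epsilon>"
    using linear_span_add[OF u(1) v(1)] by (intro bexI)
qed

lemma tangent_space_scale:
  assumes f: "f \<in> tangent_space R \<R>"
  shows "(\<lambda>x. a * f x) \<in> tangent_space R \<R>"
  unfolding tangent_space_def
proof (rule CollectI, intro conjI allI impI)
  show "(\<lambda>x. a * f x) \<in> L2 R" using f by (intro L2_scale tangent_space_L2)
  fix \<epsilon> :: real assume e: "\<epsilon> > 0"
  obtain u where u: "u \<in> linear_span (tangent_cone R \<R>)" "L2_norm R (\<lambda>x. f x - u x) < \<epsilon> / (1 + \<bar>a\<bar>)"
    using tangent_spaceD[OF f, of "\<epsilon> / (1 + \<bar>a\<bar>)"] e by auto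
  have "L2_norm R (\<lambda>x. a * f x - a * u x) = \<bar>a\<bar> * L2_norm R (\<lambda>x. f x - u x)"
    unfolding right_diff_distrib[symmetric] L2_norm_scale ..
  also have "\<dots> \<le> (1 + \<bar>a\<bar>) * L2_norm R (\<lambda>x. f x - u x)" by (intro mult_right_mono L2_norm_nonneg) simp
  also have "\<dots> < \<epsilon>" using u(2) by (simp add: field_simps pos_less_divide_eq)
  finally show "\<exists>h\<in>linear_span (tangent_cone R \<R>). L2_norm R (\<lambda>x. a * f x - h x) < \<epsilon>"
    using linear_span_scale[OF u(1)] by (intro bexI)
qed

lemma tangent_space_closed:
  assumes f: "\<And>n::nat. f n \<in> tangent_space R \<R>" and g: "g \<in> L2 R"
    and lim: "(\<lambda>n. L2_norm R (\<lambda>x. f n x - g x)) \<longlonglongrightarrow> 0"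
  shows "g \<in> tangent_space R \<R>"
  unfolding tangent_space_def
proof (rule CollectI, intro conjI allI impI)
  fix \<epsilon> :: real assume e: "\<epsilon> > 0"
  obtain n where n: "L2_norm R (\<lambda>x. f n x - g x) < \<epsilon>/2"
    using order_tendstoD(2)[OF lim, of "\<epsilon>/2"] e by (auto simp: eventually_sequentially)
  obtain u where u: "u \<in> linear_span (tangent_cone R \<R>)" "u \<in> L2 R" "L2_norm R (\<lambda>x. f n x - u x) < \<epsilon>/2"
    using tangent_spaceD[OF f, of "\<epsilon>/2"] e by auto
  have "L2_norm R (\<lambda>x. g x - u x) \<le> L2_norm R (\<lambda>x. g x - f n x) + L2_norm R (\<lambda>x. f n x - u x)"
    by (rule L2_norm_triangle_diff[OF g tangent_space_L2[OF f] u(2)])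
  also have "\<dots> < \<epsilon>" using n u(3) L2_norm_diff_commute[of R g "f n"] by simp
  finally show "\<exists>h\<in>linear_span (tangent_cone R \<R>). L2_norm R (\<lambda>x. g x - h x) < \<epsilon>"
    using u(1) by (intro bexI)
qed fact

text \<open>The mean vanishes on the cone, hence on its span, and it is continuous in L2.\<close>

lemma tangent_space_mean_zero:
  assumes \<P>: "\<P> \<subseteq> space (prob_algebra M)" and P0: "P0 \<in> space (prob_algebra M)" and g: "g \<in> tangent_space P0 \<P>"
  shows "(\<integral>x. g x \<partial>P0) = 0"
proof -
  interpret prob_space P0 using P0 by (simp add: space_prob_algebra)
  have span: "(\<integral>x. h x \<partial>P0) = 0" if "h \<in> linear_span (tangent_cone P0 \<P>)" for h
    using that
  proof (induction rule: linear_span_induct)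
    case (step c u h)
    have "integrable P0 u" "integrable P0 h"
      using L2_integrable tangent_cone_mean_zero(1)[OF \<P> P0 step(1)] linear_span_L2[OF step(2) tangent_cone_L2] by auto
    then show ?case using step(3) tangent_cone_mean_zero(2)[OF \<P> P0 step(1)] by simp
  qed simp
  have "\<bar>\<integral>x. g x \<partial>P0\<bar> \<le> \<epsilon>" if "\<epsilon> > 0" for \<epsilon>
  proof -
    obtain h where h: "h \<in> linear_span (tangent_cone P0 \<P>)" "h \<in> L2 P0" "L2_norm P0 (\<lambda>x. g x - h x) < \<epsilon>"
      using tangent_spaceD[OF g \<open>\<epsilon> > 0\<close>] .
    have "(\<integral>x. g x - h x \<partial>P0) = (\<integral>x. g x \<partial>P0)"
      using span[OF h(1)] L2_integrable[OF h(2)] L2_integrable[OF tangent_space_L2[OF g]] by simp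
    then show ?thesis
      using L2_norm_ge_integral[OF L2_diff[OF tangent_space_L2[OF g] h(2)]] h(3) by simp
  qed
  then show ?thesis by (metis abs_le_zero_iff dense_ge)
qed

text \<open>Both partial integrations are linear and contractive, so the decomposition passes from
  the cone to its span and from there to the closure.\<close>

theorem tangent_space_product:
  assumes \<P>: "\<P> \<subseteq> space (prob_algebra M1)" and \<Q>: "\<Q> \<subseteq> space (prob_algebra M2)"
    and P0: "P0 \<in> space (prob_algebra M1)" and Q0: "Q0 \<in> space (prob_algebra M2)"
    and g: "g \<in> tangent_space (P0 \<Otimes>\<^sub>M Q0) (prod_family \<P> \<Q>)"
  shows "partial_integral Q0 g \<in> tangent_space P0 \<P>" "partial_integral P0 (swap_args g) \<in> tangent_space Q0 \<Q>"
    "AE z in P0 \<Otimes>\<^sub>M Q0. g z = partial_integral Q0 g (fst z) + partial_integral P0 (swap_args g) (snd z)"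
proof -
  have p0: "prob_space P0" "prob_space Q0" using P0 Q0 by (auto simp: space_prob_algebra)
  interpret pair_prob_space P0 Q0 by (rule pair_prob_spaceI[OF p0])
  interpret S: pair_prob_space Q0 P0 by (rule pair_prob_spaceI[OF p0(2,1)])
  let ?R = "P0 \<Otimes>\<^sub>M Q0" and ?K = "tangent_cone (P0 \<Otimes>\<^sub>M Q0) (prod_family \<P> \<Q>)"
  let ?E1 = "partial_integral Q0" and ?E2 = "\<lambda>g. partial_integral P0 (swap_args g)"
  note tc = tangent_cone_product[OF \<P> \<Q> P0 Q0]
  have L2snd: "(\<lambda>z. f (snd z)) \<in> L2 ?R \<and> L2_norm ?R (\<lambda>z. f (snd z)) = L2_norm Q0 f" if "f \<in> L2 Q0" for f
    using S.L2_swap_args[OF S.L2_fst(1)[OF that]] S.L2_fst(2)[OF that] by simp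
  have E2L: "?E2 f \<in> L2 Q0" "L2_norm Q0 (?E2 f) \<le> L2_norm ?R f" if "f \<in> L2 ?R" for f
    using S.partial_integral_L2(1,2)[OF L2_swap_args(1)[OF that]] L2_swap_args(2)[OF that] by auto
  note E1L = partial_integral_L2(1,2)
  have E2diff: "AE y in Q0. ?E2 (\<lambda>z. f z - h z) y = ?E2 f y - ?E2 h y" if "f \<in> L2 ?R" "h \<in> L2 ?R" for f h
    by (rule S.partial_integral_diff_AE[OF L2_swap_args(1)[OF that(1)] L2_swap_args(1)[OF that(2)]])
  \<comment> \<open>Partial integrals are additive only almost everywhere, where both fibres are
    integrable; hence members \<open>k\<close> of the span that agree almost surely, in place of
    equality.\<close>
  have span: "(\<exists>k\<in>linear_span (tangent_cone P0 \<P>). AE x in P0. ?E1 h x = k x) \<and>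
      (\<exists>k\<in>linear_span (tangent_cone Q0 \<Q>). AE x in Q0. ?E2 h x = k x) \<and>
      (AE z in ?R. h z = ?E1 h (fst z) + ?E2 h (snd z))"
    if "h \<in> linear_span ?K" for h
    using that
  proof (induction rule: linear_span_induct)
    case zero
    show ?case by (intro conjI bexI[of _ "\<lambda>x. 0"]) (simp_all add: linear_span_zero partial_integral_def)
  next
    case (step c u h)
    have uL: "(\<lambda>z. c * u z) \<in> L2 ?R" and hL: "h \<in> L2 ?R"
      using L2_scale[OF tc(4)[OF step(1)]] linear_span_L2[OF step(2) tangent_cone_L2] by auto
    have a1: "AE x in P0. ?E1 (\<lambda>z. c * u z + h z) x = c * ?E1 u x + ?E1 h x"
      using partial_integral_add_AE[OF uL hL] unfolding partial_integral_scale .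
    have a2: "AE x in Q0. ?E2 (\<lambda>z. c * u z + h z) x = c * ?E2 u x + ?E2 h x"
      using S.partial_integral_add_AE[OF L2_swap_args(1)[OF uL] L2_swap_args(1)[OF hL]] unfolding partial_integral_scale .
    obtain k1 where k1: "k1 \<in> linear_span (tangent_cone P0 \<P>)" "AE x in P0. ?E1 h x = k1 x" using step(3) by blast
    obtain k2 where k2: "k2 \<in> linear_span (tangent_cone Q0 \<Q>)" "AE x in Q0. ?E2 h x = k2 x" using step(3) by blast
    have b1: "AE x in P0. ?E1 (\<lambda>z. c * u z + h z) x = c * ?E1 u x + k1 x" using a1 k1(2) by eventually_elim simp
    have b2: "AE x in Q0. ?E2 (\<lambda>z. c * u z + h z) x = c * ?E2 u x + k2 x" using a2 k2(2) by eventually_elim simp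
    have m1: "(\<lambda>x. c * ?E1 u x + k1 x) \<in> linear_span (tangent_cone P0 \<P>)"
      by (intro linear_span_add linear_span_scale linear_span_superset k1 tc(1)[OF step(1)])
    have m2: "(\<lambda>x. c * ?E2 u x + k2 x) \<in> linear_span (tangent_cone Q0 \<Q>)"
      by (intro linear_span_add linear_span_scale linear_span_superset k2 tc(2)[OF step(1)])
    have dec: "AE z in ?R. c * u z + h z = ?E1 (\<lambda>z. c * u z + h z) (fst z) + ?E2 (\<lambda>z. c * u z + h z) (snd z)"
    proof -
      have "AE z in ?R. ?E1 (\<lambda>z. c * u z + h z) (fst z) = c * ?E1 u (fst z) + ?E1 h (fst z)"
        by (rule AE_fst[OF a1])
      moreover have "AE z in ?R. ?E2 (\<lambda>z. c * u z + h z) (snd z) = c * ?E2 u (snd z) + ?E2 h (snd z)"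
        by (rule AE_snd[OF a2])
      moreover have "AE z in ?R. h z = ?E1 h (fst z) + ?E2 h (snd z)" using step(3) by blast
      ultimately show ?thesis using tc(3)[OF step(1)] by eventually_elim (simp add: algebra_simps)
    qed
    show ?case
    proof (intro conjI dec)
      show "\<exists>k\<in>linear_span (tangent_cone P0 \<P>). AE x in P0. ?E1 (\<lambda>z. c * u z + h z) x = k x"
        by (rule bexI[where x = "\<lambda>x. c * ?E1 u x + k1 x"], rule b1, rule m1)
      show "\<exists>k\<in>linear_span (tangent_cone Q0 \<Q>). AE x in Q0. ?E2 (\<lambda>z. c * u z + h z) x = k x"
        by (rule bexI[where x = "\<lambda>x. c * ?E2 u x + k2 x"], rule b2, rule m2)
    qed
  qed
  have gL: "g \<in> L2 ?R" by (rule tangent_space_L2[OF g])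
  show "?E1 g \<in> tangent_space P0 \<P>"
    unfolding tangent_space_def
  proof (rule CollectI, intro conjI allI impI)
    fix \<epsilon> :: real assume e: "\<epsilon> > 0"
    obtain h where h: "h \<in> linear_span ?K" "h \<in> L2 ?R" "L2_norm ?R (\<lambda>x. g x - h x) < \<epsilon>" using tangent_spaceD[OF g e] .
    obtain k where k: "k \<in> linear_span (tangent_cone P0 \<P>)" "AE x in P0. ?E1 h x = k x" using span[OF h(1)] by blast
    have kL: "k \<in> L2 P0" using linear_span_L2[OF k(1) tangent_cone_L2] .
    have ghL: "(\<lambda>z. g z - h z) \<in> L2 ?R" by (rule L2_diff[OF gL h(2)])
    have "L2_norm P0 (\<lambda>x. ?E1 g x - k x) = L2_norm P0 (?E1 (\<lambda>z. g z - h z))"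
    proof (rule L2_norm_cong_AE)
      show "AE x in P0. ?E1 g x - k x = ?E1 (\<lambda>z. g z - h z) x"
        using partial_integral_diff_AE[OF gL h(2)] k(2) by eventually_elim simp
    qed (intro L2_measurable L2_diff E1L kL gL ghL)+
    also have "\<dots> < \<epsilon>" using E1L(2)[OF ghL] h(3) by simp
    finally show "\<exists>k\<in>linear_span (tangent_cone P0 \<P>). L2_norm P0 (\<lambda>x. ?E1 g x - k x) < \<epsilon>" using k(1) by (intro bexI)
  qed (rule E1L(1)[OF gL])
  show "?E2 g \<in> tangent_space Q0 \<Q>"
    unfolding tangent_space_def
  proof (rule CollectI, intro conjI allI impI)
    fix \<epsilon> :: real assume e: "\<epsilon> > 0"
    obtain h where h: "h \<in> linear_span ?K" "h \<in> L2 ?R" "L2_norm ?R (\<lambda>x. g x - h x) < \<epsilon>" using tangent_spaceD[OF g e] .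
    obtain k where k: "k \<in> linear_span (tangent_cone Q0 \<Q>)" "AE x in Q0. ?E2 h x = k x" using span[OF h(1)] by blast
    have kL: "k \<in> L2 Q0" using linear_span_L2[OF k(1) tangent_cone_L2] .
    have ghL: "(\<lambda>z. g z - h z) \<in> L2 ?R" by (rule L2_diff[OF gL h(2)])
    have "L2_norm Q0 (\<lambda>x. ?E2 g x - k x) = L2_norm Q0 (?E2 (\<lambda>z. g z - h z))"
    proof (rule L2_norm_cong_AE)
      show "AE x in Q0. ?E2 g x - k x = ?E2 (\<lambda>z. g z - h z) x"
        using E2diff[OF gL h(2)] k(2) by eventually_elim simp
      show "(\<lambda>x. ?E2 g x - k x) \<in> borel_measurable Q0" by (rule L2_measurable[OF L2_diff[OF E2L(1)[OF gL] kL]])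
      show "?E2 (\<lambda>z. g z - h z) \<in> borel_measurable Q0" by (rule L2_measurable[OF E2L(1)[OF ghL]])
    qed
    also have "\<dots> < \<epsilon>" using E2L(2)[OF ghL] h(3) by simp
    finally show "\<exists>k\<in>linear_span (tangent_cone Q0 \<Q>). L2_norm Q0 (\<lambda>x. ?E2 g x - k x) < \<epsilon>" using k(1) by (intro bexI)
  qed (rule E2L(1)[OF gL])
  \<comment> \<open>The defect of the decomposition. Up to null sets it is linear in
    \<open>f\<close>, it has norm at most 3 and vanishes on the span; hence the tolerance
    \<epsilon>/3.\<close>
  define w where "w f z = f z - (?E1 f (fst z) + ?E2 f (snd z))" for f z
  have wL: "w f \<in> L2 ?R" if "f \<in> L2 ?R" for f
    unfolding w_def[abs_def] using L2snd[OF E2L(1)[OF that]] by (intro L2_diff L2_add L2_fst E1L that) auto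
  have "L2_norm ?R (w g) \<le> \<epsilon>" if e: "\<epsilon> > 0" for \<epsilon>
  proof -
    obtain h where h: "h \<in> linear_span ?K" "h \<in> L2 ?R" "L2_norm ?R (\<lambda>x. g x - h x) < \<epsilon>/3"
      using tangent_spaceD[OF g, of "\<epsilon>/3"] e by auto
    define f where "f z = g z - h z" for z
    have fL: "f \<in> L2 ?R" unfolding f_def[abs_def] by (rule L2_diff[OF gL h(2)])
    have ae: "AE z in ?R. w g z = w f z"
    proof -
      have "AE z in ?R. ?E1 f (fst z) = ?E1 g (fst z) - ?E1 h (fst z)"
        unfolding f_def[abs_def] by (rule AE_fst[OF partial_integral_diff_AE[OF gL h(2)]])
      moreover have "AE z in ?R. ?E2 f (snd z) = ?E2 g (snd z) - ?E2 h (snd z)"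
        unfolding f_def[abs_def] by (rule AE_snd[OF E2diff[OF gL h(2)]])
      moreover have "AE z in ?R. h z = ?E1 h (fst z) + ?E2 h (snd z)" using span[OF h(1)] by blast
      ultimately show ?thesis by eventually_elim (simp add: w_def f_def)
    qed
    have "L2_norm ?R (w g) = L2_norm ?R (w f)"
      by (rule L2_norm_cong_AE[OF ae L2_measurable[OF wL[OF gL]] L2_measurable[OF wL[OF fL]]])
    also have "\<dots> \<le> L2_norm ?R f + L2_norm ?R (\<lambda>z. ?E1 f (fst z) + ?E2 f (snd z))"
      unfolding w_def[abs_def] using L2snd[OF E2L(1)[OF fL]] by (intro L2_norm_triangle_minus L2_add L2_fst E1L fL) auto
    also have "L2_norm ?R (\<lambda>z. ?E1 f (fst z) + ?E2 f (snd z)) \<le> L2_norm ?R (\<lambda>z. ?E1 f (fst z)) + L2_norm ?R (\<lambda>z. ?E2 f (snd z))"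
      using L2snd[OF E2L(1)[OF fL]] by (intro L2_norm_triangle L2_fst E1L fL) auto
    also have "\<dots> \<le> L2_norm ?R f + L2_norm ?R f"
      using L2snd[OF E2L(1)[OF fL]] L2_fst(2)[OF E1L(1)[OF fL]] E1L(2)[OF fL] E2L(2)[OF fL] by simp
    finally show ?thesis using h(3) by (simp add: f_def[abs_def])
  qed
  then have "L2_norm ?R (w g) \<le> 0" by (rule dense_ge)
  then have "L2_norm ?R (w g) = 0" using L2_norm_nonneg[of ?R "w g"] by simp
  from L2_norm_eq_0_AE[OF wL[OF gL] this]
  show "AE z in ?R. g z = ?E1 g (fst z) + ?E2 g (snd z)" by eventually_elim (simp add: w_def)
qed

section \<open>Existence of the Gaussian shift\<close>

context hilbert_space
begin

lemma hinner_zero: "y \<in> hcarrier H \<Longrightarrow> hinner H (hzero H) y = 0"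
  using inner_add_left[OF zero_closed scale_closed[OF zero_closed, of "-1"], of y]
    inner_scale_left[OF zero_closed, of y "-1"] add_inverse[OF zero_closed] by simp

text \<open>A finite linear combination is described through its inner products with the carrier,
  which is all that the quadratic form of the kernel involves.\<close>

lemma hinner_lincomb:
  assumes "finite J" "J \<subseteq> hcarrier H"
  shows "\<exists>x\<in>hcarrier H. \<forall>y\<in>hcarrier H. hinner H x y = (\<Sum>h\<in>J. c h * hinner H h y)"
  using assms
proof (induction J)
  case empty
  then show ?case using zero_closed hinner_zero by auto
next
  case (insert h J)
  then obtain x where x: "x \<in> hcarrier H" "\<And>y. y \<in> hcarrier H \<Longrightarrow> hinner H x y = (\<Sum>h\<in>J. c h * hinner H h y)" by auto
  have h: "h \<in> hcarrier H" using insert.prems by auto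
  show ?case
  proof (intro bexI ballI)
    show "hadd H (hscale H (c h) h) x \<in> hcarrier H" by (intro add_closed scale_closed h x)
    fix y assume y: "y \<in> hcarrier H"
    show "hinner H (hadd H (hscale H (c h) h) x) y = (\<Sum>h\<in>insert h J. c h * hinner H h y)"
      using insert.hyps inner_add_left[OF scale_closed[OF h, of "c h"] x(1) y] inner_scale_left[OF h y] x(2)[OF y] by simp
  qed
qed

lemma hinner_psd_kernel: "psd_kernel (hcarrier H) (hinner H)"
  unfolding psd_kernel_def
proof (intro conjI ballI allI impI)
  fix x y assume "x \<in> hcarrier H" "y \<in> hcarrier H"
  then show "hinner H x y = hinner H y x" by (rule inner_commute)
next
  fix J and c :: "_ \<Rightarrow> real" assume J: "finite J" "J \<subseteq> hcarrier H"
  obtain x where x: "x \<in> hcarrier H" "\<And>y. y \<in> hcarrier H \<Longrightarrow> hinner H x y = (\<Sum>h\<in>J. c h * hinner H h y)"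
    using hinner_lincomb[OF J, of c] by auto
  have "0 \<le> hinner H x x" by (rule inner_ge_zero[OF x(1)])
  also have "\<dots> = (\<Sum>h\<in>J. c h * hinner H h x)" by (rule x(2)[OF x(1)])
  also have "\<dots> = (\<Sum>h\<in>J. c h * (\<Sum>k\<in>J. c k * hinner H k h))"
    using J x inner_commute[of _ x] by (intro sum.cong refl) (auto simp: subset_iff)
  also have "\<dots> = (\<Sum>h\<in>J. \<Sum>k\<in>J. c h * c k * hinner H h k)"
    using J inner_commute by (auto simp: sum_distrib_left mult.assoc subset_iff intro!: sum.cong)
  finally show "0 \<le> (\<Sum>h\<in>J. \<Sum>k\<in>J. c h * c k * hinner H h k)" .
qed

lemma hnorm_sq: "h \<in> hcarrier H \<Longrightarrow> (hnorm H h)\<^sup>2 = hinner H h h"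
  by (simp add: hnorm_def inner_ge_zero)

end

lemma centred_normal_char:
  assumes "0 \<le> \<sigma>"
  shows "real_distribution (centred_normal \<sigma>)" "char (centred_normal \<sigma>) t = complex_of_real (exp (- (t\<^sup>2 * \<sigma>\<^sup>2) / 2))"
proof -
  have "real_distribution (centred_normal \<sigma>) \<and> char (centred_normal \<sigma>) t = complex_of_real (exp (- (t\<^sup>2 * \<sigma>\<^sup>2) / 2))"
  proof (cases "\<sigma> = 0")
    case True
    then show ?thesis
      by (auto simp: centred_normal_def char_def real_distribution_def real_distribution_axioms_def integral_return
        intro: prob_space_return)
  next
    case False
    then have \<sigma>: "\<sigma> > 0" using assms by simp
    have "prob_space (density lborel (\<lambda>x. ennreal (normal_density 0 \<sigma> x)))" by (rule prob_space_normal_density[OF \<sigma>])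
    then have 1: "real_distribution (centred_normal \<sigma>)"
      using False by (auto simp: centred_normal_def real_distribution_def real_distribution_axioms_def)
    have sc: "\<sigma> * normal_density 0 \<sigma> (0 + \<sigma> * x) = std_normal_density x" for x
      using \<sigma> by (simp add: normal_density_def power_mult_distrib real_sqrt_mult field_simps)
    have "char (centred_normal \<sigma>) t = (\<integral>x. normal_density 0 \<sigma> x *\<^sub>R iexp (t * x) \<partial>lborel)"
      using False by (simp add: centred_normal_def char_def integral_density)
    also have "\<dots> = \<sigma> *\<^sub>R (\<integral>x. normal_density 0 \<sigma> (0 + \<sigma> * x) *\<^sub>R iexp (t * (0 + \<sigma> * x)) \<partial>lborel)"
      using \<sigma> lborel_integral_real_affine[of \<sigma> "\<lambda>x. normal_density 0 \<sigma> x *\<^sub>R iexp (t * x)" 0] by simp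
    also have "\<dots> = (\<integral>x. (\<sigma> * normal_density 0 \<sigma> (0 + \<sigma> * x)) *\<^sub>R iexp ((t * \<sigma>) * x) \<partial>lborel)"
      unfolding integral_scaleR_right[symmetric] by (intro Bochner_Integration.integral_cong refl) (simp add: mult.assoc)
    also have "\<dots> = char std_normal_distribution (t * \<sigma>)"
      unfolding sc by (simp add: char_def integral_density)
    finally show ?thesis using 1 by (simp add: char_std_normal_distribution power_mult_distrib)
  qed
  then show "real_distribution (centred_normal \<sigma>)" "char (centred_normal \<sigma>) t = complex_of_real (exp (- (t\<^sup>2 * \<sigma>\<^sup>2) / 2))" by auto
qed

text \<open>The integrand exp X + exp (-X) - 2 is a square with integral 0. This converts zero
  variance into an almost sure identity by exponential moments alone.\<close>

lemma AE_zero_if_exp_moments: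
  fixes X :: "'a \<Rightarrow> real"
  assumes M: "prob_space M" and i: "integrable M (\<lambda>x. exp (X x))" "integrable M (\<lambda>x. exp (- X x))"
    and e: "(\<integral>x. exp (X x) \<partial>M) = 1" "(\<integral>x. exp (- X x) \<partial>M) = 1"
  shows "AE x in M. X x = 0"
proof -
  interpret prob_space M by fact
  have eq: "exp y + exp (- y) - 2 = (exp (y/2) - exp (- (y/2)))\<^sup>2" for y :: real
  proof -
    have "exp y = exp (y/2) * exp (y/2)" "exp (- y) = exp (- (y/2)) * exp (- (y/2))" "exp (y/2) * exp (- (y/2)) = 1"
      unfolding exp_add[symmetric] by simp_all
    then show ?thesis by (simp add: power2_eq_square algebra_simps)
  qed
  have "(\<integral>x. exp (X x) + exp (- X x) - 2 \<partial>M) = 0" using i e by (simp add: prob_space)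
  moreover have "integrable M (\<lambda>x. exp (X x) + exp (- X x) - 2)" using i by simp
  ultimately have "AE x in M. exp (X x) + exp (- X x) - 2 = 0"
    by (subst (asm) integral_nonneg_eq_0_iff_AE) (auto simp: eq)
  then show ?thesis
  proof eventually_elim
    case (elim x)
    then have "exp (X x / 2) = exp (- (X x / 2))" unfolding eq by simp
    then show ?case by simp
  qed
qed

lemma density_on_density:
  assumes Q: "prob_space Q" and p: "p \<in> borel_measurable Q" "\<And>x. 0 \<le> p x" and P: "P = density Q (\<lambda>x. ennreal (p x))"
  shows "density_on P Q p (space Q)"
proof -
  have "density P (indicator (space Q)) = density P (\<lambda>x. 1)"
    using P by (intro density_cong) auto
  also have "\<dots> = P" by (rule density_1)
  finally show ?thesis using p P by (auto simp: density_on_def)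
qed

lemma density_quotient_density:
  assumes P: "prob_space P" and Q: "prob_space Q" and d: "density_on P Q p S"
  shows "AE x in Q. density_quotient P Q x = ennreal (p x)"
proof -
  have s: "sets P = sets Q" using d by (simp add: density_on_def)
  note q = density_on_density_quotient[OF P Q s]
  have "AE x in Q. enn2real (density_quotient P Q x) = p x" by (rule density_on_unique[OF Q q(1) d])
  with q(2) show ?thesis
  proof eventually_elim
    case (elim x)
    then show ?case using ennreal_enn2real[of "density_quotient P Q x"] by simp
  qed
qed

text \<open>The coordinates of a Gaussian process on path space serve as \<open>L\<close>, and
  \<open>P h\<close> is the exponential tilt of \<open>W\<close>. Besides the Gaussian shift, the
  likelihood ratios between any two parameters and the joint characteristic function of their
  logarithms are exported, for comparison with the limit of the samples.\<close>

theorem (in hilbert_space) gaussian_shift_exists: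
  obtains W :: "('h \<Rightarrow> real) measure" and P where
    "gaussian_shift H W P"
    "\<And>s. s \<in> hcarrier H \<Longrightarrow> prob_space (P s)"
    "\<And>h s. h \<in> hcarrier H \<Longrightarrow> s \<in> hcarrier H \<Longrightarrow> (\<lambda>\<omega>. \<omega> h) \<in> borel_measurable (P s)"
    "\<And>h s. h \<in> hcarrier H \<Longrightarrow> s \<in> hcarrier H \<Longrightarrow> AE \<omega> in P s. density_quotient (P h) (P s) \<omega> =
        ennreal (exp (\<omega> h - \<omega> s - (hinner H h h - hinner H s s) / 2))"
    "\<And>Z s \<tau>. finite Z \<Longrightarrow> Z \<subseteq> hcarrier H \<Longrightarrow> s \<in> hcarrier H \<Longrightarrow>
        (\<integral>\<omega>. iexp (\<Sum>h\<in>Z. \<tau> h * (\<omega> h - \<omega> s - (hinner H h h - hinner H s s) / 2)) \<partial>P s) =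
        exp (Complex
          (- ((\<Sum>h\<in>Z. \<Sum>k\<in>Z. \<tau> h * \<tau> k * hinner H h k) - 2 * (\<Sum>h\<in>Z. \<tau> h) * (\<Sum>h\<in>Z. \<tau> h * hinner H h s)
             + (\<Sum>h\<in>Z. \<tau> h)\<^sup>2 * hinner H s s) / 2)
          (- ((\<Sum>h\<in>Z. \<tau> h * hinner H h h) - 2 * (\<Sum>h\<in>Z. \<tau> h * hinner H h s) + (\<Sum>h\<in>Z. \<tau> h) * hinner H s s) / 2))"
proof -
  let ?C = "hcarrier H" and ?K = "hinner H"
  \<comment> \<open>In the index type \<open>'h + nat\<close> left elements name the members of
    \<open>Z\<close> and right ones further coordinates, so \<open>s\<close> can be added even if it
    lies in \<open>Z\<close>.\<close>
  obtain W :: "('h \<Rightarrow> real) measure" where W: "prob_space W" "sets W = sets (\<Pi>\<^sub>M i\<in>?C. borel)"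
    and Wi: "\<And>A f z. finite (A :: ('h + nat) set) \<Longrightarrow> f ` A \<subseteq> ?C \<Longrightarrow> integrable W (\<lambda>x. exp (\<Sum>a\<in>A. z a * complex_of_real (x (f a))))"
    and WE: "\<And>A f z. finite (A :: ('h + nat) set) \<Longrightarrow> f ` A \<subseteq> ?C \<Longrightarrow> (\<integral>x. exp (\<Sum>a\<in>A. z a * complex_of_real (x (f a))) \<partial>W)
       = exp ((\<Sum>a\<in>A. \<Sum>b\<in>A. z a * z b * complex_of_real (?K (f a) (f b))) / 2)"
    by (rule gaussian_process_exists[OF hinner_psd_kernel]) (rule that)
  interpret W: prob_space W by fact
  have Wm: "(\<lambda>\<omega>. \<omega> h) \<in> borel_measurable W" if "h \<in> ?C" for h
    using that W(2) by (simp cong: measurable_cong_sets)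
  have real: "integrable W (\<lambda>x. exp (\<Sum>a\<in>A. z a * x (f a)))"
    "(\<integral>x. exp (\<Sum>a\<in>A. z a * x (f a)) \<partial>W) = exp ((\<Sum>a\<in>A. \<Sum>b\<in>A. z a * z b * ?K (f a) (f b)) / 2)"
    if A: "finite (A :: ('h + nat) set)" "f ` A \<subseteq> ?C" for A f and z :: "'h + nat \<Rightarrow> real"
  proof -
    have e: "exp (\<Sum>a\<in>A. complex_of_real (z a) * complex_of_real (x (f a))) = complex_of_real (exp (\<Sum>a\<in>A. z a * x (f a)))" for x :: "'h \<Rightarrow> real"
      unfolding exp_of_real[symmetric] by simp
    have i: "integrable W (\<lambda>x. complex_of_real (exp (\<Sum>a\<in>A. z a * x (f a))))"
      using Wi[OF A, of "\<lambda>a. complex_of_real (z a)"] unfolding e .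
    show "integrable W (\<lambda>x. exp (\<Sum>a\<in>A. z a * x (f a)))"
      using i by (simp only: complex_of_real_integrable_eq)
    have "complex_of_real (\<integral>x. exp (\<Sum>a\<in>A. z a * x (f a)) \<partial>W) = exp (complex_of_real ((\<Sum>a\<in>A. \<Sum>b\<in>A. z a * z b * ?K (f a) (f b)) / 2))"
      using WE[OF A, of "\<lambda>a. complex_of_real (z a)"] unfolding e integral_complex_of_real by simp
    then show "(\<integral>x. exp (\<Sum>a\<in>A. z a * x (f a)) \<partial>W) = exp ((\<Sum>a\<in>A. \<Sum>b\<in>A. z a * z b * ?K (f a) (f b)) / 2)"
      unfolding exp_of_real of_real_eq_iff .
  qed
  have single: "integrable W (\<lambda>x. exp (c * x h))" "(\<integral>x. exp (c * x h) \<partial>W) = exp (c\<^sup>2 * ?K h h / 2)" if "h \<in> ?C" for h c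
    using real[of "{Inr 0}" "\<lambda>_. h" "\<lambda>_. c"] that by (simp_all add: power2_eq_square)
  \<comment> \<open>A combination of coordinates with variance 0 vanishes almost surely. Three terms
    suffice: additivity uses all of them, homogeneity two and the zero vector one.\<close>
  have null: "AE \<omega> in W. c0 * \<omega> h0 + c1 * \<omega> h1 + c2 * \<omega> h2 = 0"
    if C: "h0 \<in> ?C" "h1 \<in> ?C" "h2 \<in> ?C"
      and v: "c0\<^sup>2 * ?K h0 h0 + c1\<^sup>2 * ?K h1 h1 + c2\<^sup>2 * ?K h2 h2 + 2 * (c0 * c1 * ?K h0 h1 + c0 * c2 * ?K h0 h2 + c1 * c2 * ?K h1 h2) = 0"
    for c0 c1 c2 h0 h1 h2
  proof -
    let ?A = "{Inr 0, Inr (Suc 0), Inr 2} :: ('h + nat) set"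
    define f where "f a = (case a of Inr n \<Rightarrow> if n = 0 then h0 else if n = Suc 0 then h1 else h2 | Inl h \<Rightarrow> h)" for a :: "'h + nat"
    define z where "z a = (case a of Inr n \<Rightarrow> if n = 0 then c0 else if n = Suc 0 then c1 else c2 | Inl h \<Rightarrow> 0)" for a :: "'h + nat"
    have A: "finite ?A" "f ` ?A \<subseteq> ?C" using C by (auto simp: f_def)
    have q: "(\<Sum>a\<in>?A. \<Sum>b\<in>?A. z a * z b * ?K (f a) (f b)) = 0"
      using v inner_commute[OF C(1) C(2)] inner_commute[OF C(1) C(3)] inner_commute[OF C(2) C(3)]
      by (simp add: f_def z_def power2_eq_square algebra_simps)
    have s: "(\<Sum>a\<in>?A. z a * x (f a)) = c0 * x h0 + c1 * x h1 + c2 * x h2" for x :: "'h \<Rightarrow> real"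
      by (simp add: f_def z_def)
    have s': "(\<Sum>a\<in>?A. - z a * x (f a)) = - (c0 * x h0 + c1 * x h1 + c2 * x h2)" for x :: "'h \<Rightarrow> real"
      by (simp add: f_def z_def)
    have q': "(\<Sum>a\<in>?A. \<Sum>b\<in>?A. - z a * - z b * ?K (f a) (f b)) = 0" using q by (simp only: minus_mult_minus)
    show ?thesis
      using real[OF A, of z] real[OF A, of "\<lambda>a. - z a"] unfolding s s' q q'
      by (intro AE_zero_if_exp_moments[OF W(1)]) simp_all
  qed
  define P where "P h = density W (\<lambda>\<omega>. ennreal (exp (\<omega> h - ?K h h / 2)))" for h
  have Pm: "(\<lambda>\<omega>. exp (\<omega> h - ?K h h / 2)) \<in> borel_measurable W" if "h \<in> ?C" for h
    using Wm[OF that] by measurable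
  have sP: "sets (P h) = sets W" "space (P h) = space W" for h by (simp_all add: P_def)
  have PP: "prob_space (P h)" if h: "h \<in> ?C" for h
  proof
    have eqf: "exp (\<omega> h - ?K h h / 2) = exp (1 * \<omega> h) * exp (- ?K h h / 2)" for \<omega> :: "'h \<Rightarrow> real"
      unfolding exp_add[symmetric] by simp
    have i: "integrable W (\<lambda>\<omega>. exp (\<omega> h - ?K h h / 2))"
      unfolding eqf by (rule integrable_mult_left) (rule single(1)[OF h])
    have "(\<integral>\<omega>. exp (\<omega> h - ?K h h / 2) \<partial>W) = exp (1\<^sup>2 * ?K h h / 2) * exp (- ?K h h / 2)"
      unfolding eqf by (simp only: integral_mult_left_zero single(2)[OF h])
    also have "\<dots> = 1" unfolding exp_add[symmetric] by simp
    finally have e: "(\<integral>\<omega>. exp (\<omega> h - ?K h h / 2) \<partial>W) = 1" .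
    have "emeasure (P h) (space (P h)) = (\<integral>\<^sup>+\<omega>. ennreal (exp (\<omega> h - ?K h h / 2)) * indicator (space W) \<omega> \<partial>W)"
      unfolding P_def using Pm[OF h] by (simp add: emeasure_density)
    also have "\<dots> = (\<integral>\<^sup>+\<omega>. ennreal (exp (\<omega> h - ?K h h / 2)) \<partial>W)" by (intro nn_integral_cong) auto
    also have "\<dots> = 1" using nn_integral_eq_integral[OF i] e by simp
    finally show "emeasure (P h) (space (P h)) = 1" .
  qed
  \<comment> \<open>The coordinate at the zero vector has variance 0, so the tilt there is trivial
    and \<open>W\<close> is the centre of the shift.\<close>
  have P0: "P (hzero H) = W"
  proof -
    have K0: "?K (hzero H) (hzero H) = 0" by (rule hinner_zero[OF zero_closed])
    have "AE \<omega> in W. 1 * \<omega> (hzero H) + 0 * \<omega> (hzero H) + 0 * \<omega> (hzero H) = 0"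
      by (rule null) (use zero_closed K0 in auto)
    then have "AE \<omega> in W. ennreal (exp (\<omega> (hzero H) - ?K (hzero H) (hzero H) / 2)) = 1"
      by eventually_elim (simp add: K0)
    then have "P (hzero H) = density W (\<lambda>_. 1)" unfolding P_def using Pm[OF zero_closed] by (intro density_cong) auto
    then show ?thesis by (simp add: density_1)
  qed
  have don: "density_on (P h) (P s) (\<lambda>\<omega>. exp (\<omega> h - \<omega> s - (?K h h - ?K s s) / 2)) (space (P s))" if h: "h \<in> ?C" and s: "s \<in> ?C" for h s
  proof (rule density_on_density[OF PP[OF s]])
    have m: "(\<lambda>\<omega>. exp (\<omega> h - \<omega> s - (?K h h - ?K s s) / 2)) \<in> borel_measurable W" using Wm[OF h] Wm[OF s] by measurable
    then show "(\<lambda>\<omega>. exp (\<omega> h - \<omega> s - (?K h h - ?K s s) / 2)) \<in> borel_measurable (P s)"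
      using sP(1) by (simp cong: measurable_cong_sets)
    have "density (P s) (\<lambda>\<omega>. ennreal (exp (\<omega> h - \<omega> s - (?K h h - ?K s s) / 2)))
      = density W (\<lambda>\<omega>. ennreal (exp (\<omega> s - ?K s s / 2)) * ennreal (exp (\<omega> h - \<omega> s - (?K h h - ?K s s) / 2)))"
      unfolding P_def using m Pm[OF s] by (intro density_density_eq) auto
    also have "\<dots> = P h" unfolding P_def
      by (intro arg_cong2[where f = density] refl ext) (simp add: ennreal_mult[symmetric] exp_add[symmetric] field_simps)
    finally show "P h = density (P s) (\<lambda>\<omega>. ennreal (exp (\<omega> h - \<omega> s - (?K h h - ?K s s) / 2)))" ..
  qed simp
  have hn: "0 \<le> hnorm H h" "(hnorm H h)\<^sup>2 = ?K h h" if "h \<in> ?C" for h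
    using hnorm_sq[OF that] inner_ge_zero[OF that] by (auto simp: hnorm_def)
  have GS: "gaussian_shift H W P"
    unfolding gaussian_shift_def
  proof (intro conjI exI[of _ "\<lambda>h \<omega>. \<omega> h"] ballI)
    show "hilbert_space H" by (rule hilbert_space_axioms)
    show "is_experiment W ?C P" unfolding is_experiment_def using PP sP by (auto simp: space_prob_algebra)
    show "standard_gaussian_process H (P (hzero H)) (\<lambda>h \<omega>. \<omega> h)"
      unfolding standard_gaussian_process_def P0
    proof (intro conjI ballI allI W(1))
      fix h assume h: "h \<in> ?C"
      show "(\<lambda>\<omega>. \<omega> h) \<in> L2 W"
        unfolding L2_def
      proof (rule CollectI, intro conjI Wm[OF h])
        show "integrable W (\<lambda>\<omega>. (\<omega> h)\<^sup>2)"
        proof (rule Bochner_Integration.integrable_bound)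
          show "integrable W (\<lambda>\<omega>. 2 * (exp (1 * \<omega> h) + exp (-1 * \<omega> h)))"
            by (intro integrable_mult_right Bochner_Integration.integrable_add single(1)[OF h])
          show "AE \<omega> in W. norm ((\<omega> h)\<^sup>2) \<le> norm (2 * (exp (1 * \<omega> h) + exp (-1 * \<omega> h)))"
          proof (rule AE_I2)
            fix \<omega> :: "'h \<Rightarrow> real"
            have "(\<omega> h)\<^sup>2 / 2 \<le> exp \<bar>\<omega> h\<bar>" using exp_lower_Taylor_quadratic[of "\<bar>\<omega> h\<bar>"] by simp
            also have "\<dots> \<le> exp (\<omega> h) + exp (- \<omega> h)" by (cases "0 \<le> \<omega> h") auto
            finally show "norm ((\<omega> h)\<^sup>2) \<le> norm (2 * (exp (1 * \<omega> h) + exp (-1 * \<omega> h)))" by simp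
          qed
        qed (use Wm[OF h] in measurable)
      qed
      show "distr W borel (\<lambda>\<omega>. \<omega> h) = centred_normal (hnorm H h)"
      proof (rule Levy_uniqueness[OF W.real_distribution_distr[OF Wm[OF h]] centred_normal_char(1)[OF hn(1)[OF h]]], rule ext)
        fix t
        have "char (distr W borel (\<lambda>\<omega>. \<omega> h)) t = (\<integral>\<omega>. exp (\<Sum>a\<in>{Inr 0 :: 'h + nat}. (\<i> * complex_of_real t) * complex_of_real (\<omega> h)) \<partial>W)"
          unfolding char_def by (subst integral_distr[OF Wm[OF h]]) (auto simp: mult.assoc)
        also have "\<dots> = exp (complex_of_real (- (t\<^sup>2 * ?K h h) / 2))"
          using WE[of "{Inr 0}" "\<lambda>_. h" "\<lambda>_. \<i> * complex_of_real t"] h by (simp add: power2_eq_square algebra_simps)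
        finally show "char (distr W borel (\<lambda>\<omega>. \<omega> h)) t = char (centred_normal (hnorm H h)) t"
          unfolding centred_normal_char(2)[OF hn(1)[OF h]] hn(2)[OF h] exp_of_real .
      qed
      fix k assume k: "k \<in> ?C"
      have hk: "hadd H h k \<in> ?C" by (rule add_closed[OF h k])
      have "AE \<omega> in W. 1 * \<omega> (hadd H h k) + (-1) * \<omega> h + (-1) * \<omega> k = 0"
      proof (rule null[OF hk h k])
        have "?K (hadd H h k) (hadd H h k) = ?K h (hadd H h k) + ?K k (hadd H h k)" by (rule inner_add_left[OF h k hk])
        moreover have "?K h (hadd H h k) = ?K h h + ?K k h" "?K k (hadd H h k) = ?K h k + ?K k k"
          using inner_commute[OF h hk] inner_commute[OF k hk] inner_add_left[OF h k h] inner_add_left[OF h k k] by auto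
        moreover have "?K (hadd H h k) h = ?K h h + ?K k h" "?K (hadd H h k) k = ?K h k + ?K k k"
          by (rule inner_add_left[OF h k h]) (rule inner_add_left[OF h k k])
        moreover have "?K h k = ?K k h" by (rule inner_commute[OF h k])
        ultimately show "1\<^sup>2 * ?K (hadd H h k) (hadd H h k) + (-1)\<^sup>2 * ?K h h + (-1)\<^sup>2 * ?K k k +
          2 * (1 * (-1) * ?K (hadd H h k) h + 1 * (-1) * ?K (hadd H h k) k + (-1) * (-1) * ?K h k) = 0" by simp
      qed
      then show "AE \<omega> in W. \<omega> (hadd H h k) = \<omega> h + \<omega> k" by eventually_elim simp
    next
      fix a h assume h: "h \<in> ?C"
      have ah: "hscale H a h \<in> ?C" by (rule scale_closed[OF h])
      have "AE \<omega> in W. 1 * \<omega> (hscale H a h) + (- a) * \<omega> h + 0 * \<omega> h = 0"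
      proof (rule null[OF ah h h])
        have "?K (hscale H a h) (hscale H a h) = a * ?K h (hscale H a h)" by (rule inner_scale_left[OF h ah])
        moreover have "?K h (hscale H a h) = a * ?K h h" using inner_commute[OF h ah] inner_scale_left[OF h h] by simp
        moreover have "?K (hscale H a h) h = a * ?K h h" by (rule inner_scale_left[OF h h])
        ultimately show "1\<^sup>2 * ?K (hscale H a h) (hscale H a h) + (- a)\<^sup>2 * ?K h h + 0\<^sup>2 * ?K h h +
          2 * (1 * (- a) * ?K (hscale H a h) h + 1 * 0 * ?K (hscale H a h) h + (- a) * 0 * ?K h h) = 0"
          by (simp add: power2_eq_square)
      qed
      then show "AE \<omega> in W. \<omega> (hscale H a h) = a * \<omega> h" by eventually_elim simp
    qed
    fix h assume h: "h \<in> ?C"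
    show "is_density_quotient (P h) (P (hzero H)) (\<lambda>\<omega>. ennreal (exp (\<omega> h - (hnorm H h)\<^sup>2 / 2)))"
      unfolding is_density_quotient_def P0 hn(2)[OF h]
    proof (intro conjI ballI)
      show "(\<lambda>\<omega>. ennreal (exp (\<omega> h - ?K h h / 2))) \<in> borel_measurable W" using Pm[OF h] by measurable
      fix A assume "A \<in> sets W"
      then show "emeasure (P h) A = (\<integral>\<^sup>+\<omega>. ennreal (exp (\<omega> h - ?K h h / 2)) * indicator A \<omega> \<partial>W)
          + emeasure (P h) (A \<inter> {\<omega> \<in> space W. ennreal (exp (\<omega> h - ?K h h / 2)) = \<infinity>})"
        unfolding P_def using Pm[OF h] by (simp add: emeasure_density)
    qed (simp add: W.emeasure_space_1)
  qed
  have ch: "(\<integral>\<omega>. iexp (\<Sum>h\<in>Z. \<tau> h * (\<omega> h - \<omega> s - (?K h h - ?K s s) / 2)) \<partial>P s) =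
        exp (Complex
          (- ((\<Sum>h\<in>Z. \<Sum>k\<in>Z. \<tau> h * \<tau> k * ?K h k) - 2 * (\<Sum>h\<in>Z. \<tau> h) * (\<Sum>h\<in>Z. \<tau> h * ?K h s)
             + (\<Sum>h\<in>Z. \<tau> h)\<^sup>2 * ?K s s) / 2)
          (- ((\<Sum>h\<in>Z. \<tau> h * ?K h h) - 2 * (\<Sum>h\<in>Z. \<tau> h * ?K h s) + (\<Sum>h\<in>Z. \<tau> h) * ?K s s) / 2))"
    if Z: "finite Z" "Z \<subseteq> ?C" and s: "s \<in> ?C" for Z s \<tau>
  proof -
    let ?A = "insert (Inr 0) (Inl ` Z) :: ('h + nat) set"
    define S B C where "S = (\<Sum>h\<in>Z. \<tau> h)" and "B = (\<Sum>h\<in>Z. \<tau> h * ?K h s)" and "C = (\<Sum>h\<in>Z. \<tau> h * ?K h h)"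
    define A2 where "A2 = (\<Sum>h\<in>Z. \<Sum>k\<in>Z. \<tau> h * \<tau> k * ?K h k)"
    define f where "f a = (case a of Inl h \<Rightarrow> h | Inr _ \<Rightarrow> s)" for a :: "'h + nat"
    \<comment> \<open>The tilt to \<open>P s\<close> contributes the exponent 1 at \<open>s\<close>,
      and the terms -\<omega> s of all the ratios together contribute -i S; both go into the extra
      index.\<close>
    define z where "z a = (case a of Inl h \<Rightarrow> \<i> * complex_of_real (\<tau> h) | Inr _ \<Rightarrow> 1 - \<i> * complex_of_real S)" for a :: "'h + nat"
    have A: "finite ?A" "f ` ?A \<subseteq> ?C" using Z s by (auto simp: f_def)
    have inj: "inj_on Inl Z" by simp
    have nin: "(Inr 0 :: 'h + nat) \<notin> Inl ` Z" by auto
    have sumA: "(\<Sum>a\<in>?A. g a) = g (Inr 0) + (\<Sum>h\<in>Z. g (Inl h))" for g :: "'h + nat \<Rightarrow> complex"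
      using Z nin by (simp add: sum.reindex[OF inj] o_def)
    have zs: "(\<Sum>a\<in>?A. z a * complex_of_real (\<omega> (f a))) =
        complex_of_real (\<omega> s) + \<i> * complex_of_real ((\<Sum>h\<in>Z. \<tau> h * \<omega> h) - S * \<omega> s)" for \<omega>
      unfolding sumA by (simp add: z_def f_def sum_distrib_left algebra_simps)
    have quad: "(\<Sum>a\<in>?A. \<Sum>b\<in>?A. z a * z b * complex_of_real (?K (f a) (f b)))
      = (1 - \<i> * complex_of_real S)\<^sup>2 * complex_of_real (?K s s) + 2 * (1 - \<i> * complex_of_real S) * \<i> * complex_of_real B - complex_of_real A2"
    proof -
      have c: "?K s h = ?K h s" if "h \<in> Z" for h using inner_commute[OF s] Z(2) that by blast
      have B': "(\<Sum>h\<in>Z. (1 - \<i> * complex_of_real S) * (\<i> * complex_of_real (\<tau> h)) * complex_of_real (?K s h)) = (1 - \<i> * complex_of_real S) * \<i> * complex_of_real B"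
        unfolding B_def of_real_sum sum_distrib_left using c by (intro sum.cong refl) simp
      have B'': "(\<Sum>h\<in>Z. \<i> * complex_of_real (\<tau> h) * (1 - \<i> * complex_of_real S) * complex_of_real (?K h s)) = (1 - \<i> * complex_of_real S) * \<i> * complex_of_real B"
        unfolding B_def of_real_sum sum_distrib_left by (intro sum.cong refl) (simp add: mult_ac)
      have A': "(\<Sum>h\<in>Z. \<Sum>k\<in>Z. \<i> * complex_of_real (\<tau> h) * (\<i> * complex_of_real (\<tau> k)) * complex_of_real (?K h k)) = - complex_of_real A2"
        unfolding A2_def of_real_sum sum_negf[symmetric] by (intro sum.cong refl) (simp add: mult_ac)
      have "(\<Sum>a\<in>?A. \<Sum>b\<in>?A. z a * z b * complex_of_real (?K (f a) (f b)))
         = (1 - \<i> * complex_of_real S) * (1 - \<i> * complex_of_real S) * complex_of_real (?K s s)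
           + (\<Sum>h\<in>Z. (1 - \<i> * complex_of_real S) * (\<i> * complex_of_real (\<tau> h)) * complex_of_real (?K s h))
           + ((\<Sum>h\<in>Z. \<i> * complex_of_real (\<tau> h) * (1 - \<i> * complex_of_real S) * complex_of_real (?K h s))
           + (\<Sum>h\<in>Z. \<Sum>k\<in>Z. \<i> * complex_of_real (\<tau> h) * (\<i> * complex_of_real (\<tau> k)) * complex_of_real (?K h k)))"
        unfolding sumA sum.distrib by (simp add: z_def f_def)
      then show ?thesis unfolding B' B'' A' by (simp add: power2_eq_square)
    qed
    \<comment> \<open>The deterministic part of the exponent: the normalisation of the tilt and the
      centring of the log-likelihood ratios.\<close>
    define c where "c = Complex (- ?K s s / 2) (- (C - S * ?K s s) / 2)"
    have "(\<integral>\<omega>. iexp (\<Sum>h\<in>Z. \<tau> h * (\<omega> h - \<omega> s - (?K h h - ?K s s) / 2)) \<partial>P s)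
      = (\<integral>\<omega>. exp (\<omega> s - ?K s s / 2) *\<^sub>R iexp (\<Sum>h\<in>Z. \<tau> h * (\<omega> h - \<omega> s - (?K h h - ?K s s) / 2)) \<partial>W)"
      unfolding P_def
    proof (rule integral_density)
      show "(\<lambda>\<omega>. iexp (\<Sum>h\<in>Z. \<tau> h * (\<omega> h - \<omega> s - (?K h h - ?K s s) / 2))) \<in> borel_measurable W"
      proof -
        have r: "(\<lambda>\<omega>. \<Sum>h\<in>Z. \<tau> h * (\<omega> h - \<omega> s - (?K h h - ?K s s) / 2)) \<in> borel_measurable W"
          using Wm[OF s] Wm Z by (intro borel_measurable_sum borel_measurable_times borel_measurable_diff borel_measurable_const) auto
        show ?thesis by (rule measurable_compose[OF r]) measurable
      qed
    qed (use Pm[OF s] in auto)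
    also have "\<dots> = (\<integral>\<omega>. exp c * exp (\<Sum>a\<in>?A. z a * complex_of_real (\<omega> (f a))) \<partial>W)"
    proof (intro Bochner_Integration.integral_cong refl)
      fix \<omega>
      have t: "(\<Sum>h\<in>Z. \<tau> h * (\<omega> h - \<omega> s - (?K h h - ?K s s) / 2)) = (\<Sum>h\<in>Z. \<tau> h * \<omega> h) - S * \<omega> s - (C - S * ?K s s) / 2"
      proof -
        have "(\<Sum>h\<in>Z. \<tau> h * (\<omega> h - \<omega> s - (?K h h - ?K s s) / 2))
          = (\<Sum>h\<in>Z. \<tau> h * \<omega> h - \<tau> h * \<omega> s - (\<tau> h * ?K h h - \<tau> h * ?K s s) / 2)"
          by (intro sum.cong refl) (simp add: algebra_simps diff_divide_distrib)
        also have "\<dots> = (\<Sum>h\<in>Z. \<tau> h * \<omega> h) - S * \<omega> s - (C - S * ?K s s) / 2"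
          unfolding S_def C_def by (simp add: sum_subtractf sum_divide_distrib[symmetric] sum_distrib_right[symmetric])
        finally show ?thesis .
      qed
      have "exp (\<omega> s - ?K s s / 2) *\<^sub>R iexp ((\<Sum>h\<in>Z. \<tau> h * \<omega> h) - S * \<omega> s - (C - S * ?K s s) / 2)
        = exp (complex_of_real (\<omega> s - ?K s s / 2) + \<i> * complex_of_real ((\<Sum>h\<in>Z. \<tau> h * \<omega> h) - S * \<omega> s - (C - S * ?K s s) / 2))"
        by (simp only: scaleR_conv_of_real exp_add exp_of_real)
      also have "complex_of_real (\<omega> s - ?K s s / 2) + \<i> * complex_of_real ((\<Sum>h\<in>Z. \<tau> h * \<omega> h) - S * \<omega> s - (C - S * ?K s s) / 2)
        = c + (complex_of_real (\<omega> s) + \<i> * complex_of_real ((\<Sum>h\<in>Z. \<tau> h * \<omega> h) - S * \<omega> s))"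
        by (simp only: c_def complex_eq_iff plus_complex.sel times_complex.sel complex.sel Re_complex_of_real Im_complex_of_real imaginary_unit.sel)
           (simp add: field_simps)
      finally show "exp (\<omega> s - ?K s s / 2) *\<^sub>R iexp (\<Sum>h\<in>Z. \<tau> h * (\<omega> h - \<omega> s - (?K h h - ?K s s) / 2))
        = exp c * exp (\<Sum>a\<in>?A. z a * complex_of_real (\<omega> (f a)))"
        unfolding t zs exp_add[symmetric] .
    qed
    also have "\<dots> = exp c * exp ((\<Sum>a\<in>?A. \<Sum>b\<in>?A. z a * z b * complex_of_real (?K (f a) (f b))) / 2)"
      unfolding integral_mult_right_zero WE[OF A] ..
    also have "\<dots> = exp (Complex (- (A2 - 2 * S * B + S\<^sup>2 * ?K s s) / 2) (- (C - 2 * B + S * ?K s s) / 2))"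
      unfolding exp_add[symmetric] quad
      by (rule arg_cong[where f = exp]) (simp add: c_def complex_eq_iff power2_eq_square field_simps)
    finally show ?thesis unfolding A2_def B_def C_def S_def .
  qed
  show thesis
  proof (rule that[OF GS PP _ _ ch])
    show "(\<lambda>\<omega>. \<omega> h) \<in> borel_measurable (P s)" if "h \<in> ?C" "s \<in> ?C" for h s
      using Wm[OF that(1)] sP(1) by (simp cong: measurable_cong_sets)
    show "AE \<omega> in P s. density_quotient (P h) (P s) \<omega> = ennreal (exp (\<omega> h - \<omega> s - (?K h h - ?K s s) / 2))"
      if "h \<in> ?C" "s \<in> ?C" for h s
      by (rule density_quotient_density[OF PP[OF that(1)] PP[OF that(2)] don[OF that]])
  qed
qed

section \<open>The weighted tangent space\<close>

locale product_tangents =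
  fixes M1 :: "'a measure" and M2 :: "'b measure" and \<P> :: "'a measure set" and \<Q> :: "'b measure set"
    and P0 :: "'a measure" and Q0 :: "'b measure" and d :: real
  assumes \<P>: "\<P> \<subseteq> space (prob_algebra M1)" and \<Q>: "\<Q> \<subseteq> space (prob_algebra M2)"
    and P0: "P0 \<in> space (prob_algebra M1)" and Q0: "Q0 \<in> space (prob_algebra M2)"
    and d: "0 < d" "d < 1"
begin

abbreviation "R0 \<equiv> P0 \<Otimes>\<^sub>M Q0"
abbreviation "T \<equiv> tangent_space R0 (prod_family \<P> \<Q>)"
abbreviation "H \<equiv> weighted_tangent_space P0 Q0 \<P> \<Q> d"
abbreviation "E1 \<equiv> partial_integral Q0"
abbreviation "E2 g \<equiv> partial_integral P0 (swap_args g)"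
abbreviation "cls \<equiv> L2_class R0"

text \<open>The scalar product on representatives, with the components made explicit as partial
  integrals; the Hilbert space laws are proved for it and then carried to classes.\<close>

definition ip :: "('a \<times> 'b \<Rightarrow> real) \<Rightarrow> ('a \<times> 'b \<Rightarrow> real) \<Rightarrow> real" where
  "ip g h = (1 - d) * (\<integral>x. E1 g x * E1 h x \<partial>P0) + d * (\<integral>y. E2 g y * E2 h y \<partial>Q0)"

lemma prob_P0: "prob_space P0" and prob_Q0: "prob_space Q0"
  using P0 Q0 by (auto simp: space_prob_algebra)

end

sublocale product_tangents \<subseteq> pair_prob_space P0 Q0
  by (rule pair_prob_spaceI[OF prob_P0 prob_Q0])

sublocale product_tangents \<subseteq> S: pair_prob_space Q0 P0
  by (rule pair_prob_spaceI[OF prob_Q0 prob_P0])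

context product_tangents
begin

lemma E1_L2: "g \<in> L2 R0 \<Longrightarrow> E1 g \<in> L2 P0" and E1_norm: "g \<in> L2 R0 \<Longrightarrow> L2_norm P0 (E1 g) \<le> L2_norm R0 g"
  by (rule partial_integral_L2; assumption)+

lemma E2_L2: "g \<in> L2 R0 \<Longrightarrow> E2 g \<in> L2 Q0" and E2_norm: "g \<in> L2 R0 \<Longrightarrow> L2_norm Q0 (E2 g) \<le> L2_norm R0 g"
  using S.partial_integral_L2(1,2)[OF L2_swap_args(1)] L2_swap_args(2) by auto

lemma T_L2: "g \<in> T \<Longrightarrow> g \<in> L2 R0" by (rule tangent_space_L2)

lemma L2_snd: "f \<in> L2 Q0 \<Longrightarrow> (\<lambda>z. f (snd z)) \<in> L2 R0"
  "f \<in> L2 Q0 \<Longrightarrow> L2_norm R0 (\<lambda>z. f (snd z)) = L2_norm Q0 f"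
  using S.L2_swap_args[OF S.L2_fst(1)] S.L2_fst(2) by auto

lemma E1_cong: "f \<in> L2 R0 \<Longrightarrow> g \<in> L2 R0 \<Longrightarrow> AE z in R0. f z = g z \<Longrightarrow> AE x in P0. E1 f x = E1 g x"
  by (rule partial_integral_cong_AE[OF L2_measurable L2_measurable])

lemma E2_cong:
  assumes "f \<in> L2 R0" "g \<in> L2 R0" "AE z in R0. f z = g z"
  shows "AE y in Q0. E2 f y = E2 g y"
proof (rule S.partial_integral_cong_AE)
  have [measurable]: "f \<in> borel_measurable R0" "g \<in> borel_measurable R0" using assms L2_measurable by auto
  have "{z \<in> space R0. f z = g z} \<in> sets R0" by measurable
  from AE_swap_args[OF this assms(3)] show "AE z in Q0 \<Otimes>\<^sub>M P0. f (snd z, fst z) = g (snd z, fst z)" by simp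
qed (use L2_measurable[OF L2_swap_args(1)] assms in auto)

lemma E1_sum:
  assumes "g1 \<in> L2 P0" "g2 \<in> L2 Q0" "(\<integral>y. g2 y \<partial>Q0) = 0"
  shows "E1 (\<lambda>z. g1 (fst z) + g2 (snd z)) = g1"
proof
  fix x
  show "E1 (\<lambda>z. g1 (fst z) + g2 (snd z)) x = g1 x"
    using M2.L2_integrable[OF assms(2)] assms(3) by (simp add: partial_integral_def M2.prob_space)
qed

lemma E2_sum:
  assumes "g1 \<in> L2 P0" "g2 \<in> L2 Q0" "(\<integral>x. g1 x \<partial>P0) = 0"
  shows "E2 (\<lambda>z. g1 (fst z) + g2 (snd z)) = g2"
proof
  fix y
  show "E2 (\<lambda>z. g1 (fst z) + g2 (snd z)) y = g2 y"
    using M1.L2_integrable[OF assms(1)] assms(3) by (simp add: partial_integral_def M1.prob_space)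
qed

lemma ip_cong:
  assumes "f \<in> L2 R0" "g \<in> L2 R0" "h \<in> L2 R0" "k \<in> L2 R0" "AE z in R0. f z = g z" "AE z in R0. h z = k z"
  shows "ip f h = ip g k"
proof -
  have "(\<integral>x. E1 f x * E1 h x \<partial>P0) = (\<integral>x. E1 g x * E1 k x \<partial>P0)"
    using E1_cong[OF assms(1,2,5)] E1_cong[OF assms(3,4,6)] L2_measurable[OF E1_L2] assms(1-4)
    by (intro integral_cong_AE) auto
  moreover have "(\<integral>x. E2 f x * E2 h x \<partial>Q0) = (\<integral>x. E2 g x * E2 k x \<partial>Q0)"
    using E2_cong[OF assms(1,2,5)] E2_cong[OF assms(3,4,6)] L2_measurable[OF E2_L2] assms(1-4)
    by (intro integral_cong_AE) auto
  ultimately show ?thesis by (simp add: ip_def)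
qed

lemma ip_commute: "ip g h = ip h g"
  by (simp add: ip_def mult.commute)

lemma ip_scale: "ip (\<lambda>z. a * g z) h = a * ip g h"
  by (simp add: ip_def partial_integral_scale mult.assoc distrib_left)

lemma ip_add:
  assumes "f \<in> L2 R0" "g \<in> L2 R0" "h \<in> L2 R0"
  shows "ip (\<lambda>z. f z + g z) h = ip f h + ip g h"
proof -
  note i1 = L2_mult_integrable[OF E1_L2[OF assms(1)] E1_L2[OF assms(3)]] L2_mult_integrable[OF E1_L2[OF assms(2)] E1_L2[OF assms(3)]]
  note i2 = L2_mult_integrable[OF E2_L2[OF assms(1)] E2_L2[OF assms(3)]] L2_mult_integrable[OF E2_L2[OF assms(2)] E2_L2[OF assms(3)]]
  have fg: "(\<lambda>z. f z + g z) \<in> L2 R0" by (intro L2_add assms)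
  note [measurable] = L2_measurable[OF E1_L2[OF assms(1)]] L2_measurable[OF E1_L2[OF assms(2)]] L2_measurable[OF E1_L2[OF assms(3)]]
    L2_measurable[OF E2_L2[OF assms(1)]] L2_measurable[OF E2_L2[OF assms(2)]] L2_measurable[OF E2_L2[OF assms(3)]]
    L2_measurable[OF E1_L2[OF fg]] L2_measurable[OF E2_L2[OF fg]]
  have "(\<integral>x. E1 (\<lambda>z. f z + g z) x * E1 h x \<partial>P0) = (\<integral>x. E1 f x * E1 h x + E1 g x * E1 h x \<partial>P0)"
    using partial_integral_add_AE[OF assms(1,2)]
    by (intro integral_cong_AE) (auto elim!: eventually_mono simp: distrib_right)
  moreover have "(\<integral>x. E2 (\<lambda>z. f z + g z) x * E2 h x \<partial>Q0) = (\<integral>x. E2 f x * E2 h x + E2 g x * E2 h x \<partial>Q0)"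
    using S.partial_integral_add_AE[OF L2_swap_args(1)[OF assms(1)] L2_swap_args(1)[OF assms(2)]]
    by (intro integral_cong_AE) (auto elim!: eventually_mono simp: distrib_right)
  ultimately show ?thesis using i1 i2 by (simp add: ip_def distrib_left)
qed

lemma ip_self: "ip g g = (1 - d) * (L2_norm P0 (E1 g))\<^sup>2 + d * (L2_norm Q0 (E2 g))\<^sup>2"
  unfolding ip_def L2_norm_sq by (simp add: power2_eq_square)

lemma ip_self_le: "g \<in> L2 R0 \<Longrightarrow> ip g g \<le> (L2_norm R0 g)\<^sup>2"
proof -
  assume g: "g \<in> L2 R0"
  have "(L2_norm P0 (E1 g))\<^sup>2 \<le> (L2_norm R0 g)\<^sup>2" "(L2_norm Q0 (E2 g))\<^sup>2 \<le> (L2_norm R0 g)\<^sup>2"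
    using E1_norm[OF g] E2_norm[OF g] L2_norm_nonneg by (auto intro: power_mono)
  then have "ip g g \<le> (1 - d) * (L2_norm R0 g)\<^sup>2 + d * (L2_norm R0 g)\<^sup>2"
    unfolding ip_self using d by (intro add_mono mult_left_mono) auto
  then show ?thesis by (simp add: algebra_simps)
qed

lemma T_decomposition: "g \<in> T \<Longrightarrow> AE z in R0. g z = E1 g (fst z) + E2 g (snd z)"
  and T_E1: "g \<in> T \<Longrightarrow> E1 g \<in> tangent_space P0 \<P>" and T_E2: "g \<in> T \<Longrightarrow> E2 g \<in> tangent_space Q0 \<Q>"
  using tangent_space_product[OF \<P> \<Q> P0 Q0] by auto

text \<open>By the decomposition the norm of \<open>g\<close> is at most the sum of those of its
  components; squaring a sum costs a factor 2, and both weights are at least min d (1 - d) > 0.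
  Definiteness and completeness of the weighted product rest on this inequality.\<close>

lemma norm_le_ip:
  assumes "g \<in> T"
  shows "(L2_norm R0 g)\<^sup>2 \<le> 2 / min d (1 - d) * ip g g"
proof -
  let ?m = "min d (1 - d)" and ?a = "L2_norm P0 (E1 g)" and ?b = "L2_norm Q0 (E2 g)"
  have m: "?m > 0" using d by simp
  have gL: "g \<in> L2 R0" using assms by (rule T_L2)
  have L: "(\<lambda>z. E1 g (fst z)) \<in> L2 R0" "(\<lambda>z. E2 g (snd z)) \<in> L2 R0"
    by (rule L2_fst(1)[OF E1_L2[OF gL]], rule L2_snd(1)[OF E2_L2[OF gL]])
  have "L2_norm R0 g = L2_norm R0 (\<lambda>z. E1 g (fst z) + E2 g (snd z))"
    by (rule L2_norm_cong_AE[OF T_decomposition[OF assms] L2_measurable[OF gL] L2_measurable[OF L2_add[OF L]]])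
  also have "\<dots> \<le> ?a + ?b"
    using L2_norm_triangle[OF L] L2_fst(2)[OF E1_L2[OF gL]] L2_snd(2)[OF E2_L2[OF gL]] by simp
  finally have "(L2_norm R0 g)\<^sup>2 \<le> (?a + ?b)\<^sup>2" by (intro power_mono L2_norm_nonneg)
  also have "\<dots> \<le> 2 * (?a\<^sup>2 + ?b\<^sup>2)"
  proof -
    have "0 \<le> (?a - ?b)\<^sup>2" by simp
    then show ?thesis by (simp add: power2_sum power2_diff)
  qed
  also have "\<dots> = 2 / ?m * (?m * ?a\<^sup>2 + ?m * ?b\<^sup>2)"
  proof -
    have "2 * (x + y) = 2 / m * (m * x + m * y)" if "0 < m" for x y m :: real
      using that by (simp add: field_simps)
    from this[OF m] show ?thesis .
  qed
  also have "\<dots> \<le> 2 / ?m * ip g g"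
    unfolding ip_self using m by (intro mult_left_mono add_mono mult_right_mono) auto
  finally show ?thesis .
qed

lemma ip_eq_0:
  assumes "g \<in> T" "ip g g = 0"
  shows "AE z in R0. g z = 0"
proof -
  have "(L2_norm R0 g)\<^sup>2 \<le> 0" using norm_le_ip[OF assms(1)] assms(2) by simp
  then show ?thesis using L2_norm_eq_0_AE[OF T_L2[OF assms(1)]] by simp
qed

lemma cls_iff: "h \<in> cls g \<longleftrightarrow> h \<in> L2 R0 \<and> (AE z in R0. h z = g z)"
  by (simp add: L2_class_def)

lemma cls_self: "g \<in> L2 R0 \<Longrightarrow> g \<in> cls g"
  by (simp add: cls_iff)

lemma cls_eqI: "AE z in R0. g z = h z \<Longrightarrow> cls g = cls h"
proof -
  assume ae: "AE z in R0. g z = h z"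
  show "cls g = cls h"
  proof (intro set_eqI iffI)
    fix f assume "f \<in> cls g"
    then have "f \<in> L2 R0" "AE z in R0. f z = g z" by (auto simp: cls_iff)
    from this(2) ae have "AE z in R0. f z = h z" by eventually_elim simp
    then show "f \<in> cls h" using \<open>f \<in> L2 R0\<close> by (simp add: cls_iff)
  next
    fix f assume "f \<in> cls h"
    then have "f \<in> L2 R0" "AE z in R0. f z = h z" by (auto simp: cls_iff)
    from this(2) ae have "AE z in R0. f z = g z" by eventually_elim simp
    then show "f \<in> cls g" using \<open>f \<in> L2 R0\<close> by (simp add: cls_iff)
  qed
qed

lemma H_carrier: "hcarrier H = cls ` T" and H_zero: "hzero H = cls (\<lambda>z. 0)"
  by (simp_all add: weighted_tangent_space_def Let_def)

lemma H_add: "g \<in> L2 R0 \<Longrightarrow> h \<in> L2 R0 \<Longrightarrow> hadd H (cls g) (cls h) = cls (\<lambda>z. g z + h z)"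
proof -
  assume g: "g \<in> L2 R0" and h: "h \<in> L2 R0"
  have "cls (\<lambda>z. g' z + h' z) = cls (\<lambda>z. g z + h z)" if "g' \<in> cls g" "h' \<in> cls h" for g' h'
  proof (rule cls_eqI)
    have "AE z in R0. g' z = g z" "AE z in R0. h' z = h z" using that by (auto simp: cls_iff)
    then show "AE z in R0. g' z + h' z = g z + h z" by eventually_elim simp
  qed
  then have "(\<Union>g'\<in>cls g. \<Union>h'\<in>cls h. cls (\<lambda>z. g' z + h' z)) = cls (\<lambda>z. g z + h z)"
    using cls_self[OF g] cls_self[OF h] by blast
  then show ?thesis by (simp add: weighted_tangent_space_def Let_def)
qed

lemma H_scale: "g \<in> L2 R0 \<Longrightarrow> hscale H a (cls g) = cls (\<lambda>z. a * g z)"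
proof -
  assume g: "g \<in> L2 R0"
  have "cls (\<lambda>z. a * g' z) = cls (\<lambda>z. a * g z)" if "g' \<in> cls g" for g'
  proof (rule cls_eqI)
    have "AE z in R0. g' z = g z" using that by (auto simp: cls_iff)
    then show "AE z in R0. a * g' z = a * g z" by eventually_elim simp
  qed
  then have "(\<Union>g'\<in>cls g. cls (\<lambda>z. a * g' z)) = cls (\<lambda>z. a * g z)" using cls_self[OF g] by blast
  then show ?thesis by (simp add: weighted_tangent_space_def Let_def)
qed

text \<open>The partial integrals provide admissible components. For uniqueness, any admissible
  components are tangents and so have mean zero; partial integration recovers them from their sum,
  and up to null sets it does not depend on the representative.\<close>

lemma H_inner: "g \<in> T \<Longrightarrow> h \<in> T \<Longrightarrow> hinner H (cls g) (cls h) = ip g h"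
proof -
  assume g: "g \<in> T" and h: "h \<in> T"
  have gL: "g \<in> L2 R0" "h \<in> L2 R0" using g h T_L2 by auto
  have mem: "(\<lambda>z. E1 f (fst z) + E2 f (snd z)) \<in> cls f" if "f \<in> T" for f
  proof -
    have fL: "f \<in> L2 R0" by (rule T_L2[OF that])
    have "(\<lambda>z. E1 f (fst z) + E2 f (snd z)) \<in> L2 R0"
      by (intro L2_add L2_fst(1) L2_snd(1) E1_L2 E2_L2 fL)
    then show ?thesis using T_decomposition[OF that] by (simp add: cls_iff eq_commute)
  qed
  have "(THE r. \<exists>g1 \<in> tangent_space P0 \<P>. \<exists>h1 \<in> tangent_space P0 \<P>.
          \<exists>g2 \<in> tangent_space Q0 \<Q>. \<exists>h2 \<in> tangent_space Q0 \<Q>.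
            (\<lambda>x. g1 (fst x) + g2 (snd x)) \<in> cls g \<and>
            (\<lambda>x. h1 (fst x) + h2 (snd x)) \<in> cls h \<and>
            r = (1 - d) * (\<integral>x. g1 x * h1 x \<partial>P0) + d * (\<integral>y. g2 y * h2 y \<partial>Q0)) = ip g h"
  proof (rule the_equality)
    show "\<exists>g1 \<in> tangent_space P0 \<P>. \<exists>h1 \<in> tangent_space P0 \<P>.
          \<exists>g2 \<in> tangent_space Q0 \<Q>. \<exists>h2 \<in> tangent_space Q0 \<Q>.
            (\<lambda>x. g1 (fst x) + g2 (snd x)) \<in> cls g \<and>
            (\<lambda>x. h1 (fst x) + h2 (snd x)) \<in> cls h \<and>
            ip g h = (1 - d) * (\<integral>x. g1 x * h1 x \<partial>P0) + d * (\<integral>y. g2 y * h2 y \<partial>Q0)"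
      by (intro bexI[of _ "E1 g"] bexI[of _ "E1 h"] bexI[of _ "E2 g"] bexI[of _ "E2 h"] conjI mem g h T_E1 T_E2 ip_def)
  next
    fix r assume "\<exists>g1 \<in> tangent_space P0 \<P>. \<exists>h1 \<in> tangent_space P0 \<P>.
          \<exists>g2 \<in> tangent_space Q0 \<Q>. \<exists>h2 \<in> tangent_space Q0 \<Q>.
            (\<lambda>x. g1 (fst x) + g2 (snd x)) \<in> cls g \<and>
            (\<lambda>x. h1 (fst x) + h2 (snd x)) \<in> cls h \<and>
            r = (1 - d) * (\<integral>x. g1 x * h1 x \<partial>P0) + d * (\<integral>y. g2 y * h2 y \<partial>Q0)"
    then obtain g1 h1 g2 h2 where t: "g1 \<in> tangent_space P0 \<P>" "h1 \<in> tangent_space P0 \<P>"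
      "g2 \<in> tangent_space Q0 \<Q>" "h2 \<in> tangent_space Q0 \<Q>"
      and m: "(\<lambda>x. g1 (fst x) + g2 (snd x)) \<in> cls g" "(\<lambda>x. h1 (fst x) + h2 (snd x)) \<in> cls h"
      and r: "r = (1 - d) * (\<integral>x. g1 x * h1 x \<partial>P0) + d * (\<integral>y. g2 y * h2 y \<partial>Q0)" by blast
    have L: "g1 \<in> L2 P0" "h1 \<in> L2 P0" "g2 \<in> L2 Q0" "h2 \<in> L2 Q0" using t tangent_space_L2 by auto
    have z: "(\<integral>x. g1 x \<partial>P0) = 0" "(\<integral>x. h1 x \<partial>P0) = 0" "(\<integral>x. g2 x \<partial>Q0) = 0" "(\<integral>x. h2 x \<partial>Q0) = 0"
      using tangent_space_mean_zero[OF \<P> P0] tangent_space_mean_zero[OF \<Q> Q0] t by auto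
    have "r = ip (\<lambda>x. g1 (fst x) + g2 (snd x)) (\<lambda>x. h1 (fst x) + h2 (snd x))"
      unfolding r ip_def E1_sum[OF L(1,3) z(3)] E1_sum[OF L(2,4) z(4)] E2_sum[OF L(1,3) z(1)] E2_sum[OF L(2,4) z(2)] ..
    also have "\<dots> = ip g h" using m gL by (intro ip_cong) (auto simp: cls_iff)
    finally show "r = ip g h" .
  qed
  then show ?thesis by (simp add: weighted_tangent_space_def Let_def)
qed

lemma hnorm_cls: "g \<in> T \<Longrightarrow> hnorm H (cls g) = sqrt (ip g g)"
  by (simp add: hnorm_def H_inner)

lemma hdist_cls:
  assumes "g \<in> T" "h \<in> T"
  shows "hdist H (cls g) (cls h) = sqrt (ip (\<lambda>z. g z - h z) (\<lambda>z. g z - h z))" "(\<lambda>z. g z - h z) \<in> T"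
proof -
  show gh: "(\<lambda>z. g z - h z) \<in> T"
    using tangent_space_add[OF assms(1) tangent_space_scale[OF assms(2), of "-1"]] by simp
  have "hadd H (cls g) (hscale H (-1) (cls h)) = cls (\<lambda>z. g z + - 1 * h z)"
    unfolding H_scale[OF T_L2[OF assms(2)]] by (rule H_add[OF T_L2[OF assms(1)] L2_scale[OF T_L2[OF assms(2)]]])
  then show "hdist H (cls g) (cls h) = sqrt (ip (\<lambda>z. g z - h z) (\<lambda>z. g z - h z))"
    using hnorm_cls[OF gh] by (simp add: hdist_def)
qed

text \<open>The algebraic laws are checked on representatives. For completeness, the weighted norm
  is equivalent to the L2 norm on tangents, and the tangent space is closed in L2.\<close>

theorem hilbert_space_H: "hilbert_space H"
proof
  note add = H_add[OF T_L2 T_L2] and scale = H_scale[OF T_L2]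
  note closed = tangent_space_add tangent_space_scale tangent_space_zero
  show "hzero H \<in> hcarrier H" unfolding H_zero H_carrier by (intro imageI closed)
  show "hadd H x y \<in> hcarrier H" if xy: "x \<in> hcarrier H" "y \<in> hcarrier H" for x y
  proof -
    obtain f g where fg: "f \<in> T" "x = cls f" "g \<in> T" "y = cls g" using xy unfolding H_carrier by blast
    show ?thesis unfolding fg add[OF fg(1,3)] H_carrier by (intro imageI closed fg)
  qed
  show "hscale H a x \<in> hcarrier H" if x: "x \<in> hcarrier H" for a x
  proof -
    obtain f where f: "f \<in> T" "x = cls f" using x unfolding H_carrier by blast
    show ?thesis unfolding f scale[OF f(1)] H_carrier by (intro imageI closed f)
  qed
  show "hadd H (hadd H x y) z = hadd H x (hadd H y z)"
    if xy: "x \<in> hcarrier H" "y \<in> hcarrier H" "z \<in> hcarrier H" for x y z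
  proof -
    obtain f g h where fg: "f \<in> T" "x = cls f" "g \<in> T" "y = cls g" "h \<in> T" "z = cls h" using xy unfolding H_carrier by blast
    show ?thesis
      unfolding fg add[OF fg(1,3)] add[OF fg(3,5)] add[OF closed(1)[OF fg(1,3)] fg(5)] add[OF fg(1) closed(1)[OF fg(3,5)]]
      by (simp add: add.assoc)
  qed
  show "hadd H x y = hadd H y x" if xy: "x \<in> hcarrier H" "y \<in> hcarrier H" for x y
  proof -
    obtain f g where fg: "f \<in> T" "x = cls f" "g \<in> T" "y = cls g" using xy unfolding H_carrier by blast
    show ?thesis unfolding fg add[OF fg(1,3)] add[OF fg(3,1)] by (simp add: add.commute)
  qed
  show "hadd H x (hzero H) = x" if x: "x \<in> hcarrier H" for x
  proof -
    obtain f where f: "f \<in> T" "x = cls f" using x unfolding H_carrier by blast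
    show ?thesis unfolding f H_zero add[OF f(1) closed(3)] by simp
  qed
  show "hadd H x (hscale H (- 1) x) = hzero H" if x: "x \<in> hcarrier H" for x
  proof -
    obtain f where f: "f \<in> T" "x = cls f" using x unfolding H_carrier by blast
    show ?thesis unfolding f scale[OF f(1)] add[OF f(1) closed(2)[OF f(1)]] H_zero by simp
  qed
  show "hscale H a (hadd H x y) = hadd H (hscale H a x) (hscale H a y)"
    if xy: "x \<in> hcarrier H" "y \<in> hcarrier H" for a x y
  proof -
    obtain f g where fg: "f \<in> T" "x = cls f" "g \<in> T" "y = cls g" using xy unfolding H_carrier by blast
    show ?thesis
      unfolding fg add[OF fg(1,3)] scale[OF fg(1)] scale[OF fg(3)] scale[OF closed(1)[OF fg(1,3)]]
        add[OF closed(2)[OF fg(1)] closed(2)[OF fg(3)]] by (simp add: distrib_left)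
  qed
  show "hscale H (a + b) x = hadd H (hscale H a x) (hscale H b x)" if x: "x \<in> hcarrier H" for a b x
  proof -
    obtain f where f: "f \<in> T" "x = cls f" using x unfolding H_carrier by blast
    show ?thesis unfolding f scale[OF f(1)] add[OF closed(2)[OF f(1)] closed(2)[OF f(1)]] by (simp add: distrib_right)
  qed
  show "hscale H a (hscale H b x) = hscale H (a * b) x" if x: "x \<in> hcarrier H" for a b x
  proof -
    obtain f where f: "f \<in> T" "x = cls f" using x unfolding H_carrier by blast
    show ?thesis unfolding f scale[OF f(1)] scale[OF closed(2)[OF f(1)]] by (simp add: mult.assoc)
  qed
  show "hscale H 1 x = x" if x: "x \<in> hcarrier H" for x
  proof -
    obtain f where f: "f \<in> T" "x = cls f" using x unfolding H_carrier by blast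
    show ?thesis unfolding f scale[OF f(1)] by simp
  qed
  show "hinner H x y = hinner H y x" if xy: "x \<in> hcarrier H" "y \<in> hcarrier H" for x y
  proof -
    obtain f g where fg: "f \<in> T" "x = cls f" "g \<in> T" "y = cls g" using xy unfolding H_carrier by blast
    show ?thesis unfolding fg H_inner[OF fg(1,3)] H_inner[OF fg(3,1)] by (rule ip_commute)
  qed
  show "hinner H (hadd H x y) z = hinner H x z + hinner H y z"
    if xy: "x \<in> hcarrier H" "y \<in> hcarrier H" "z \<in> hcarrier H" for x y z
  proof -
    obtain f g h where fg: "f \<in> T" "x = cls f" "g \<in> T" "y = cls g" "h \<in> T" "z = cls h" using xy unfolding H_carrier by blast
    show ?thesis
      unfolding fg add[OF fg(1,3)] H_inner[OF closed(1)[OF fg(1,3)] fg(5)] H_inner[OF fg(1,5)] H_inner[OF fg(3,5)]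
      by (rule ip_add[OF T_L2[OF fg(1)] T_L2[OF fg(3)] T_L2[OF fg(5)]])
  qed
  show "hinner H (hscale H a x) y = a * hinner H x y" if xy: "x \<in> hcarrier H" "y \<in> hcarrier H" for a x y
  proof -
    obtain f g where fg: "f \<in> T" "x = cls f" "g \<in> T" "y = cls g" using xy unfolding H_carrier by blast
    show ?thesis unfolding fg scale[OF fg(1)] H_inner[OF closed(2)[OF fg(1)] fg(3)] H_inner[OF fg(1,3)] by (rule ip_scale)
  qed
  show "0 \<le> hinner H x x" if x: "x \<in> hcarrier H" for x
  proof -
    obtain f where f: "f \<in> T" "x = cls f" using x unfolding H_carrier by blast
    show ?thesis unfolding f H_inner[OF f(1) f(1)] ip_self using d by simp
  qed
  show "x = hzero H" if x: "x \<in> hcarrier H" "hinner H x x = 0" for x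
  proof -
    obtain f where f: "f \<in> T" "x = cls f" using x unfolding H_carrier by blast
    have "ip f f = 0" using x(2) unfolding f H_inner[OF f(1) f(1)] .
    from ip_eq_0[OF f(1) this] show ?thesis unfolding f H_zero by (rule cls_eqI)
  qed
  fix X :: "nat \<Rightarrow> _"
  assume X: "\<And>n. X n \<in> hcarrier H"
    and C: "\<And>\<epsilon>. \<epsilon> > 0 \<Longrightarrow> \<exists>N. \<forall>m\<ge>N. \<forall>n\<ge>N. hdist H (X m) (X n) < \<epsilon>"
  have "\<exists>g. g \<in> T \<and> X n = cls g" for n using X[of n] unfolding H_carrier by blast
  then obtain g where g: "\<And>n. g n \<in> T" "\<And>n. X n = cls (g n)" by metis
  \<comment> \<open>The comparison constant of the two norms: a sequence that is Cauchy in the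
    weighted norm is Cauchy in L2.\<close>
  define c where "c = sqrt (2 / min d (1 - d))"
  have c: "c > 0" using d by (simp add: c_def)
  have nle: "L2_norm R0 (\<lambda>z. g m z - g n z) \<le> c * hdist H (X m) (X n)" for m n
  proof -
    have "L2_norm R0 (\<lambda>z. g m z - g n z) = sqrt ((L2_norm R0 (\<lambda>z. g m z - g n z))\<^sup>2)" by (simp add: L2_norm_nonneg)
    also have "\<dots> \<le> sqrt (2 / min d (1 - d) * ip (\<lambda>z. g m z - g n z) (\<lambda>z. g m z - g n z))"
      by (rule real_sqrt_le_mono[OF norm_le_ip[OF hdist_cls(2)[OF g(1) g(1)]]])
    also have "\<dots> = c * hdist H (X m) (X n)" unfolding g(2) hdist_cls(1)[OF g(1) g(1)] c_def real_sqrt_mult ..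
    finally show ?thesis .
  qed
  have "\<exists>N. \<forall>m\<ge>N. \<forall>n\<ge>N. L2_norm R0 (\<lambda>z. g m z - g n z) < e" if e: "e > 0" for e
  proof -
    obtain N where N: "\<And>m n. m \<ge> N \<Longrightarrow> n \<ge> N \<Longrightarrow> hdist H (X m) (X n) < e / c" using C[of "e / c"] e c by auto
    have "L2_norm R0 (\<lambda>z. g m z - g n z) < e" if "m \<ge> N" "n \<ge> N" for m n
    proof -
      have "c * hdist H (X m) (X n) < e" using N[OF that] c by (simp add: field_simps)
      with nle[of m n] show ?thesis by simp
    qed
    then show ?thesis by blast
  qed
  from P.L2_complete[OF T_L2[OF g(1)] this] obtain f where f: "f \<in> L2 R0" "(\<lambda>n. L2_norm R0 (\<lambda>z. g n z - f z)) \<longlonglongrightarrow> 0" .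
  have fT: "f \<in> T" by (rule tangent_space_closed[OF g(1) f])
  show "\<exists>x\<in>hcarrier H. (\<lambda>n. hdist H (X n) x) \<longlonglongrightarrow> 0"
  proof (rule bexI)
    show "cls f \<in> hcarrier H" unfolding H_carrier by (rule imageI[OF fT])
    show "(\<lambda>n. hdist H (X n) (cls f)) \<longlonglongrightarrow> 0"
    proof (rule Lim_null_comparison[OF _ f(2)], intro always_eventually allI)
      fix n
      have "hdist H (X n) (cls f) \<le> sqrt ((L2_norm R0 (\<lambda>z. g n z - f z))\<^sup>2)"
        unfolding g(2) hdist_cls(1)[OF g(1) fT] by (rule real_sqrt_le_mono[OF ip_self_le[OF T_L2[OF hdist_cls(2)[OF g(1) fT]]]])
      moreover have "0 \<le> hdist H (X n) (cls f)"
        unfolding g(2) hdist_cls(1)[OF g(1) fT] ip_self using d by simp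
      ultimately show "norm (hdist H (X n) (cls f)) \<le> L2_norm R0 (\<lambda>z. g n z - f z)" by (simp add: L2_norm_nonneg)
    qed
  qed
qed

end

section \<open>Log-likelihoods of two independent samples\<close>

text \<open>Substitutes t = 1 / sqrt n into the two limits at 0. For n = 0 division by zero gives t
  = 0, so the identities are used for positive n only.\<close>

lemma root_differentiable_tangent_seq:
  assumes M: "prob_space M" and r: "root_differentiable M a g"
  shows "tangent_seq M (\<lambda>n x. a (1 / sqrt (real n)) x - 1) g"
    and "(\<lambda>n. real n * ((\<integral>x. (1 + (a (1 / sqrt (real n)) x - 1))\<^sup>2 \<partial>M) - 1)) \<longlonglongrightarrow> 0"
proof -
  interpret prob_space M by fact
  define t where "t n = 1 / sqrt (real n)" for n
  have t: "filterlim t (at 0) sequentially"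
  proof (rule filterlim_atI)
    show "t \<longlonglongrightarrow> 0" unfolding t_def by real_asymp
    show "\<forall>\<^sub>F n in sequentially. t n \<noteq> 0"
      using eventually_gt_at_top[of 0] by eventually_elim (simp add: t_def)
  qed
  have L: "g \<in> L2 M" "\<And>t. a t \<in> L2 M" using r by (auto simp: root_differentiable_def)
  have 1: "(\<lambda>n. L2_norm M (\<lambda>x. a (t n) x - 1 - t n / 2 * g x) / \<bar>t n\<bar>) \<longlonglongrightarrow> 0"
    by (rule filterlim_compose[OF _ t]) (use r in \<open>auto simp: root_differentiable_def\<close>)
  have 2: "(\<lambda>n. (1 - (\<integral>x. (a (t n) x)\<^sup>2 \<partial>M)) / (t n)\<^sup>2) \<longlonglongrightarrow> 0"
    by (rule filterlim_compose[OF _ t]) (use r in \<open>auto simp: root_differentiable_def\<close>)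
  have "(\<lambda>n. L2_norm M (\<lambda>x. sqrt (real n) * (a (t n) x - 1) - g x / 2)) \<longlonglongrightarrow> 0"
  proof (rule Lim_transform_eventually[OF 1])
    show "\<forall>\<^sub>F n in sequentially. L2_norm M (\<lambda>x. a (t n) x - 1 - t n / 2 * g x) / \<bar>t n\<bar>
        = L2_norm M (\<lambda>x. sqrt (real n) * (a (t n) x - 1) - g x / 2)"
      using eventually_gt_at_top[of 0]
    proof eventually_elim
      case (elim n)
      then have "(\<lambda>x. sqrt (real n) * (a (t n) x - 1) - g x / 2) = (\<lambda>x. sqrt (real n) * (a (t n) x - 1 - t n / 2 * g x))"
        by (simp add: t_def fun_eq_iff field_simps)
      then show ?case using elim by (simp add: L2_norm_scale) (simp add: t_def)
    qed
  qed
  then show "tangent_seq M (\<lambda>n x. a (1 / sqrt (real n)) x - 1) g"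
    using L L2_diff[OF L(2) L2_const[of 1]] by (simp add: tangent_seq_def t_def)
  show "(\<lambda>n. real n * ((\<integral>x. (1 + (a (1 / sqrt (real n)) x - 1))\<^sup>2 \<partial>M) - 1)) \<longlonglongrightarrow> 0"
  proof (rule Lim_transform_eventually)
    show "(\<lambda>n. - ((1 - (\<integral>x. (a (t n) x)\<^sup>2 \<partial>M)) / (t n)\<^sup>2)) \<longlonglongrightarrow> 0" using tendsto_minus[OF 2] by simp
    show "\<forall>\<^sub>F n in sequentially. - ((1 - (\<integral>x. (a (t n) x)\<^sup>2 \<partial>M)) / (t n)\<^sup>2)
        = real n * ((\<integral>x. (1 + (a (1 / sqrt (real n)) x - 1))\<^sup>2 \<partial>M) - 1)"
      using eventually_gt_at_top[of 0] by eventually_elim (simp add: t_def power_divide field_simps)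
  qed
qed

lemma two_sample_prob:
  assumes "prob_space P" "prob_space Q"
  shows "prob_space (two_sample P Q k m)"
proof -
  interpret P: product_prob_space "\<lambda>_. P" "{..<k}" by (rule product_prob_spaceI) (rule assms)
  interpret Q: product_prob_space "\<lambda>_. Q" "{..<m}" by (rule product_prob_spaceI) (rule assms)
  interpret pair_prob_space "\<Pi>\<^sub>M i\<in>{..<k}. P" "\<Pi>\<^sub>M j\<in>{..<m}. Q" by (rule pair_prob_spaceI) unfold_locales
  show ?thesis unfolding two_sample_def by (rule P.prob_space_axioms)
qed

lemma two_sample_sets:
  assumes "sets P = sets P'" "sets Q = sets Q'"
  shows "sets (two_sample P Q k m) = sets (two_sample P' Q' k m)"
  unfolding two_sample_def using assms by (intro sets_pair_measure_cong sets_PiM_cong) auto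

lemma two_sample_prob_algebra:
  assumes "P \<in> space (prob_algebra M1)" "Q \<in> space (prob_algebra M2)"
  shows "two_sample P Q k m \<in> space (prob_algebra (two_sample M1 M2 k m))"
  using assms two_sample_prob[of P Q k m] two_sample_sets[of P M1 Q M2 k m] by (simp add: space_prob_algebra)

lemma two_sample_integral_prod:
  fixes u :: "'a \<Rightarrow> 'c::{real_normed_field, banach, second_countable_topology}"
  assumes "prob_space P" "prob_space Q" "integrable P u" "integrable Q v"
  shows "(\<integral>z. (\<Prod>i<k. u (fst z i)) * (\<Prod>j<m. v (snd z j)) \<partial>two_sample P Q k m) = (\<integral>x. u x \<partial>P) ^ k * (\<integral>y. v y \<partial>Q) ^ m"
proof -
  interpret P: product_prob_space "\<lambda>_. P" "{..<k}" by (rule product_prob_spaceI) (rule assms)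
  interpret Q: product_prob_space "\<lambda>_. Q" "{..<m}" by (rule product_prob_spaceI) (rule assms)
  interpret pair_prob_space "\<Pi>\<^sub>M i\<in>{..<k}. P" "\<Pi>\<^sub>M j\<in>{..<m}. Q" by (rule pair_prob_spaceI) unfold_locales
  show ?thesis
    unfolding two_sample_def
    using integral_product(2)[OF P.product_integrable_prod[of "{..<k}" "\<lambda>_. u"] Q.product_integrable_prod[of "{..<m}" "\<lambda>_. v"]]
      P.product_integral_prod[of "{..<k}" "\<lambda>_. u"] Q.product_integral_prod[of "{..<m}" "\<lambda>_. v"] assms
    by simp
qed

section \<open>Likelihood ratios for fixed sample sizes\<close>

text \<open>All laws are described relative to the product of the base measures, which need not
  dominate them: \<open>a\<close> and \<open>b\<close> are root densities, and the singular parts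
  live off \<open>S\<close> and \<open>U\<close>.\<close>

locale two_sample_likelihood =
  fixes P0 :: "'a measure" and Q0 :: "'b measure" and p :: "'h \<Rightarrow> 'a measure" and q :: "'h \<Rightarrow> 'b measure"
    and a :: "'h \<Rightarrow> 'a \<Rightarrow> real" and b :: "'h \<Rightarrow> 'b \<Rightarrow> real" and S :: "'h \<Rightarrow> 'a set" and U :: "'h \<Rightarrow> 'b set"
    and k m :: nat and Z :: "'h set" and s :: 'h
  assumes base: "prob_space P0" "prob_space Q0" and Z: "finite Z"
    and prob: "\<And>h. h \<in> insert s Z \<Longrightarrow> prob_space (p h)" "\<And>h. h \<in> insert s Z \<Longrightarrow> prob_space (q h)"
    and p: "\<And>h. h \<in> insert s Z \<Longrightarrow> density_on (p h) P0 (\<lambda>x. (a h x)\<^sup>2) (S h)"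
    and q: "\<And>h. h \<in> insert s Z \<Longrightarrow> density_on (q h) Q0 (\<lambda>y. (b h y)\<^sup>2) (U h)"
    and a: "\<And>h. h \<in> insert s Z \<Longrightarrow> a h \<in> borel_measurable P0" "\<And>h x. 0 \<le> a h x"
    and b: "\<And>h. h \<in> insert s Z \<Longrightarrow> b h \<in> borel_measurable Q0" "\<And>h y. 0 \<le> b h y"
begin

abbreviation "E h \<equiv> two_sample (p h) (q h) k m"
abbreviation "R \<equiv> two_sample P0 Q0 k m"

definition lik :: "'h \<Rightarrow> (nat \<Rightarrow> 'a) \<times> (nat \<Rightarrow> 'b) \<Rightarrow> real" where
  "lik h z = (\<Prod>i<k. (a h (fst z i))\<^sup>2) * (\<Prod>j<m. (b h (snd z j))\<^sup>2)"

definition regular :: "'h \<Rightarrow> ((nat \<Rightarrow> 'a) \<times> (nat \<Rightarrow> 'b)) set" where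
  "regular h = PiE {..<k} (\<lambda>_. S h) \<times> PiE {..<m} (\<lambda>_. U h)"

definition pos :: "((nat \<Rightarrow> 'a) \<times> (nat \<Rightarrow> 'b)) set" where
  "pos = {z \<in> space R. \<forall>h\<in>insert s Z. 0 < lik h z}"

text \<open>On \<open>good\<close> all likelihood ratios are positive and finite; elsewhere \<open>loglik\<close> has the junk value 0.\<close>

definition good :: "((nat \<Rightarrow> 'a) \<times> (nat \<Rightarrow> 'b)) set" where
  "good = regular s \<inter> pos"

definition loglik :: "(nat \<Rightarrow> 'a) \<times> (nat \<Rightarrow> 'b) \<Rightarrow> 'h \<Rightarrow> real" where
  "loglik z h = indicator good z * ln (lik h z / lik s z)"

lemma prob_E: "h \<in> insert s Z \<Longrightarrow> prob_space (E h)"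
  by (intro two_sample_prob prob)

lemma sets_E: "h \<in> insert s Z \<Longrightarrow> sets (E h) = sets R"
  using p[of h] q[of h] by (intro two_sample_sets) (auto simp: density_on_def)

lemma density_E: "h \<in> insert s Z \<Longrightarrow> density_on (E h) R (lik h) (regular h)"
proof -
  assume h: "h \<in> insert s Z"
  have "density_on (E h) R (\<lambda>z. (\<Prod>i<k. (a h (fst z i))\<^sup>2) * (\<Prod>j<m. (b h (snd z j))\<^sup>2)) (regular h)"
    unfolding two_sample_def regular_def
    by (intro density_on_pair density_on_PiM prob_space_PiM finite_lessThan base prob[OF h] p[OF h] q[OF h])
  then show ?thesis by (simp add: lik_def[abs_def])
qed

lemma lik_measurable: "h \<in> insert s Z \<Longrightarrow> lik h \<in> borel_measurable R"
  and regular_sets: "h \<in> insert s Z \<Longrightarrow> regular h \<in> sets R"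
  using density_E by (auto simp: density_on_def)

lemma pos_sets: "pos \<in> sets R"
  unfolding pos_def
proof (rule sets.sets_Collect_finite_All)
  fix h assume "h \<in> insert s Z"
  from lik_measurable[OF this] show "{z \<in> space R. 0 < lik h z} \<in> sets R" by measurable
qed (use Z in simp)

lemma good_sets: "good \<in> sets R"
  unfolding good_def by (intro sets.Int regular_sets pos_sets) simp

lemma loglik_measurable: "h \<in> insert s Z \<Longrightarrow> (\<lambda>z. loglik z h) \<in> borel_measurable R"
proof -
  assume h: "h \<in> insert s Z"
  have [measurable]: "lik h \<in> borel_measurable R" "lik s \<in> borel_measurable R" "good \<in> sets R"
    using lik_measurable[OF h] lik_measurable[of s] good_sets by auto
  show ?thesis unfolding loglik_def by measurable
qed

lemma pos_iff:
  assumes "z \<in> space R"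
  shows "z \<in> pos \<longleftrightarrow> (\<forall>h\<in>insert s Z. (\<forall>i<k. 0 < a h (fst z i)) \<and> (\<forall>j<m. 0 < b h (snd z j)))"
proof -
  have "0 < lik h z \<longleftrightarrow> (\<forall>i<k. 0 < a h (fst z i)) \<and> (\<forall>j<m. 0 < b h (snd z j))" if h: "h \<in> insert s Z" for h
  proof -
    have "0 \<le> lik h z" unfolding lik_def by (intro mult_nonneg_nonneg prod_nonneg) auto
    then have "0 < lik h z \<longleftrightarrow> lik h z \<noteq> 0" by linarith
    also have "\<dots> \<longleftrightarrow> (\<forall>i<k. a h (fst z i) \<noteq> 0) \<and> (\<forall>j<m. b h (snd z j) \<noteq> 0)"
      by (auto simp: lik_def)
    also have "\<dots> \<longleftrightarrow> (\<forall>i<k. 0 < a h (fst z i)) \<and> (\<forall>j<m. 0 < b h (snd z j))"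
      using a(2)[of h] b(2)[of h] by (metis less_le order_less_irrefl)
    finally show ?thesis .
  qed
  then show ?thesis using assms by (simp add: pos_def)
qed

text \<open>\<open>loglik_integrand\<close> is 0 as soon as one of the densities vanishes, so the
  product over the observations produces the indicator of \<open>pos\<close> by itself; on
  \<open>pos\<close> logarithms turn products into sums.\<close>

lemma prod_loglik_integrand:
  assumes z: "z \<in> space R"
  shows "(\<Prod>i<k. loglik_integrand Z s \<tau> (\<lambda>h. a h (fst z i) - 1)) * (\<Prod>j<m. loglik_integrand Z s \<tau> (\<lambda>h. b h (snd z j) - 1))
    = lik s z *\<^sub>R (indicator pos z *\<^sub>R iexp (\<Sum>h\<in>Z. \<tau> h * ln (lik h z / lik s z)))"
proof (cases "z \<in> pos")
  case True
  then have ap: "\<And>h i. h \<in> insert s Z \<Longrightarrow> i < k \<Longrightarrow> 0 < a h (fst z i)" and bp: "\<And>h j. h \<in> insert s Z \<Longrightarrow> j < m \<Longrightarrow> 0 < b h (snd z j)"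
    using pos_iff[OF z] by auto
  define \<alpha> where "\<alpha> i = (\<Sum>h\<in>Z. \<tau> h * (2 * ln (a h (fst z i)) - 2 * ln (a s (fst z i))))" for i
  define \<beta> where "\<beta> j = (\<Sum>h\<in>Z. \<tau> h * (2 * ln (b h (snd z j)) - 2 * ln (b s (snd z j))))" for j
  have lnl: "ln (lik h z) = (\<Sum>i<k. 2 * ln (a h (fst z i))) + (\<Sum>j<m. 2 * ln (b h (snd z j)))" if h: "h \<in> insert s Z" for h
  proof -
    have "ln (\<Prod>i<k. (a h (fst z i))\<^sup>2) = (\<Sum>i<k. ln ((a h (fst z i))\<^sup>2))"
      by (rule ln_prod; use ap[OF h] in force)
    also have "\<dots> = (\<Sum>i<k. 2 * ln (a h (fst z i)))" using ap[OF h] by (intro sum.cong) (auto simp: ln_realpow)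
    finally have 1: "ln (\<Prod>i<k. (a h (fst z i))\<^sup>2) = (\<Sum>i<k. 2 * ln (a h (fst z i)))" .
    have "ln (\<Prod>j<m. (b h (snd z j))\<^sup>2) = (\<Sum>j<m. ln ((b h (snd z j))\<^sup>2))"
      by (rule ln_prod; use bp[OF h] in force)
    also have "\<dots> = (\<Sum>j<m. 2 * ln (b h (snd z j)))" using bp[OF h] by (intro sum.cong) (auto simp: ln_realpow)
    finally have 2: "ln (\<Prod>j<m. (b h (snd z j))\<^sup>2) = (\<Sum>j<m. 2 * ln (b h (snd z j)))" .
    have "ln (lik h z) = ln (\<Prod>i<k. (a h (fst z i))\<^sup>2) + ln (\<Prod>j<m. (b h (snd z j))\<^sup>2)"
      unfolding lik_def by (rule ln_mult_pos) (intro prod_pos; use ap[OF h] bp[OF h] in force)+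
    then show ?thesis using 1 2 by simp
  qed
  have likp: "0 < lik h z" if "h \<in> insert s Z" for h using True that by (auto simp: pos_def)
  have "(\<Sum>h\<in>Z. \<tau> h * ln (lik h z / lik s z)) = (\<Sum>h\<in>Z. (\<Sum>i<k. \<tau> h * (2 * ln (a h (fst z i)) - 2 * ln (a s (fst z i))))
     + (\<Sum>j<m. \<tau> h * (2 * ln (b h (snd z j)) - 2 * ln (b s (snd z j)))))"
  proof (rule sum.cong[OF refl])
    fix h assume "h \<in> Z"
    then have h: "h \<in> insert s Z" by simp
    have dl: "ln (lik h z / lik s z) = ln (lik h z) - ln (lik s z)" using likp[OF h] likp[of s] by (simp add: ln_div)
    show "\<tau> h * ln (lik h z / lik s z) = (\<Sum>i<k. \<tau> h * (2 * ln (a h (fst z i)) - 2 * ln (a s (fst z i))))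
     + (\<Sum>j<m. \<tau> h * (2 * ln (b h (snd z j)) - 2 * ln (b s (snd z j))))"
      unfolding dl lnl[OF h] lnl[of s, simplified] sum_distrib_left[symmetric] sum_subtractf by (simp add: algebra_simps)
  qed
  also have "\<dots> = (\<Sum>i<k. \<alpha> i) + (\<Sum>j<m. \<beta> j)"
    unfolding \<alpha>_def \<beta>_def sum.distrib by (simp only: sum.swap[of _ Z])
  finally have sum: "(\<Sum>h\<in>Z. \<tau> h * ln (lik h z / lik s z)) = (\<Sum>i<k. \<alpha> i) + (\<Sum>j<m. \<beta> j)" .
  have A: "(\<Prod>i<k. loglik_integrand Z s \<tau> (\<lambda>h. a h (fst z i) - 1)) = (\<Prod>i<k. complex_of_real ((a s (fst z i))\<^sup>2) * iexp (\<alpha> i))"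
    using ap by (intro prod.cong) (auto simp: loglik_integrand_def \<alpha>_def)
  have B: "(\<Prod>j<m. loglik_integrand Z s \<tau> (\<lambda>h. b h (snd z j) - 1)) = (\<Prod>j<m. complex_of_real ((b s (snd z j))\<^sup>2) * iexp (\<beta> j))"
    using bp by (intro prod.cong) (auto simp: loglik_integrand_def \<beta>_def)
  have e: "iexp (\<Sum>h\<in>Z. \<tau> h * ln (lik h z / lik s z)) = (\<Prod>i<k. iexp (\<alpha> i)) * (\<Prod>j<m. iexp (\<beta> j))"
    unfolding sum of_real_add distrib_left exp_add of_real_sum sum_distrib_left by (simp add: exp_sum)
  show ?thesis unfolding A B e prod.distrib using True by (simp add: lik_def scaleR_conv_of_real)
next
  case False
  then consider h i where "h \<in> insert s Z" "i < k" "\<not> 0 < a h (fst z i)" | h j where "h \<in> insert s Z" "j < m" "\<not> 0 < b h (snd z j)"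
    using pos_iff[OF z] by blast
  then have "(\<Prod>i<k. loglik_integrand Z s \<tau> (\<lambda>h. a h (fst z i) - 1)) * (\<Prod>j<m. loglik_integrand Z s \<tau> (\<lambda>h. b h (snd z j) - 1)) = 0"
  proof cases
    case (1 h i)
    then have "loglik_integrand Z s \<tau> (\<lambda>h. a h (fst z i) - 1) = 0" by (auto simp: loglik_integrand_def)
    then have "(\<Prod>i<k. loglik_integrand Z s \<tau> (\<lambda>h. a h (fst z i) - 1)) = 0" using 1 by (intro prod_zero) auto
    then show ?thesis by simp
  next
    case (2 h j)
    then have "loglik_integrand Z s \<tau> (\<lambda>h. b h (snd z j) - 1) = 0" by (auto simp: loglik_integrand_def)
    then have "(\<Prod>j<m. loglik_integrand Z s \<tau> (\<lambda>h. b h (snd z j) - 1)) = 0" using 2 by (intro prod_zero) auto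
    then show ?thesis by simp
  qed
  then show ?thesis using False by simp
qed

text \<open>The squared root density at \<open>s\<close> dominates, and its mass is at most 1. The
  resulting bound by 1 is what the limit of powers asks for.\<close>

lemma loglik_integrand_integrable:
  "integrable P0 (\<lambda>x. loglik_integrand Z s \<tau> (\<lambda>h. a h x - 1))"
  "integrable Q0 (\<lambda>y. loglik_integrand Z s \<tau> (\<lambda>h. b h y - 1))"
  "norm (\<integral>x. loglik_integrand Z s \<tau> (\<lambda>h. a h x - 1) \<partial>P0) \<le> 1"
  "norm (\<integral>y. loglik_integrand Z s \<tau> (\<lambda>h. b h y - 1) \<partial>Q0) \<le> 1"
proof -
  have ia: "integrable P0 (\<lambda>x. (a s x)\<^sup>2)" "(\<integral>x. (a s x)\<^sup>2 \<partial>P0) \<le> 1"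
    and ib: "integrable Q0 (\<lambda>y. (b s y)\<^sup>2)" "(\<integral>y. (b s y)\<^sup>2 \<partial>Q0) \<le> 1"
    using density_on_integrable[OF p[of s] prob(1)] density_on_integrable[OF q[of s] prob(2)] by auto
  have na: "norm (loglik_integrand Z s \<tau> (\<lambda>h. a h x - 1)) \<le> (a s x)\<^sup>2" for x
    using norm_loglik_integrand_le[of Z s \<tau> "\<lambda>h. a h x - 1"] by simp
  have nb: "norm (loglik_integrand Z s \<tau> (\<lambda>h. b h y - 1)) \<le> (b s y)\<^sup>2" for y
    using norm_loglik_integrand_le[of Z s \<tau> "\<lambda>h. b h y - 1"] by simp
  show i1: "integrable P0 (\<lambda>x. loglik_integrand Z s \<tau> (\<lambda>h. a h x - 1))"
    by (rule Bochner_Integration.integrable_bound[OF ia(1)], rule borel_measurable_loglik_integrand[OF Z])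
      (use na a(1) in auto)
  show i2: "integrable Q0 (\<lambda>y. loglik_integrand Z s \<tau> (\<lambda>h. b h y - 1))"
    by (rule Bochner_Integration.integrable_bound[OF ib(1)], rule borel_measurable_loglik_integrand[OF Z])
      (use nb b(1) in auto)
  have "norm (\<integral>x. loglik_integrand Z s \<tau> (\<lambda>h. a h x - 1) \<partial>P0) \<le> (\<integral>x. (a s x)\<^sup>2 \<partial>P0)"
    by (rule order_trans[OF integral_norm_bound integral_mono[OF integrable_norm[OF i1] ia(1) na]])
  with ia(2) show "norm (\<integral>x. loglik_integrand Z s \<tau> (\<lambda>h. a h x - 1) \<partial>P0) \<le> 1" by simp
  have "norm (\<integral>y. loglik_integrand Z s \<tau> (\<lambda>h. b h y - 1) \<partial>Q0) \<le> (\<integral>y. (b s y)\<^sup>2 \<partial>Q0)"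
    by (rule order_trans[OF integral_norm_bound integral_mono[OF integrable_norm[OF i2] ib(1) nb]])
  with ib(2) show "norm (\<integral>y. loglik_integrand Z s \<tau> (\<lambda>h. b h y - 1) \<partial>Q0) \<le> 1" by simp
qed

text \<open>On its regular part the law at \<open>s\<close> has density \<open>lik s\<close> with
  respect to the base product, and there independence splits the integral into powers.\<close>

lemma integral_good_iexp:
  "(\<integral>z. indicator good z *\<^sub>R iexp (\<Sum>h\<in>Z. \<tau> h * loglik z h) \<partial>E s) =
    (\<integral>x. loglik_integrand Z s \<tau> (\<lambda>h. a h x - 1) \<partial>P0) ^ k * (\<integral>y. loglik_integrand Z s \<tau> (\<lambda>h. b h y - 1) \<partial>Q0) ^ m"
proof -
  let ?G = "\<lambda>z. indicator pos z *\<^sub>R iexp (\<Sum>h\<in>Z. \<tau> h * ln (lik h z / lik s z))"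
  have [measurable]: "pos \<in> sets R" by (rule pos_sets)
  have [measurable]: "(\<lambda>z. \<Sum>h\<in>Z. \<tau> h * ln (lik h z / lik s z)) \<in> borel_measurable R"
    using lik_measurable by (intro borel_measurable_sum borel_measurable_times borel_measurable_ln borel_measurable_divide) auto
  have "(\<integral>z. indicator good z *\<^sub>R iexp (\<Sum>h\<in>Z. \<tau> h * loglik z h) \<partial>E s) = (\<integral>z. indicator (regular s) z *\<^sub>R ?G z \<partial>E s)"
    by (intro Bochner_Integration.integral_cong) (auto simp: loglik_def good_def indicator_def)
  also have "\<dots> = (\<integral>z. lik s z *\<^sub>R ?G z \<partial>R)"
  proof (rule density_on_integral[OF density_E])
    show "?G \<in> borel_measurable R" by (intro borel_measurable_scaleR borel_measurable_indicator) measurable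
  qed simp
  also have "\<dots> = (\<integral>z. (\<Prod>i<k. loglik_integrand Z s \<tau> (\<lambda>h. a h (fst z i) - 1)) * (\<Prod>j<m. loglik_integrand Z s \<tau> (\<lambda>h. b h (snd z j) - 1)) \<partial>R)"
    by (intro Bochner_Integration.integral_cong prod_loglik_integrand[symmetric] refl)
  also have "\<dots> = (\<integral>x. loglik_integrand Z s \<tau> (\<lambda>h. a h x - 1) \<partial>P0) ^ k * (\<integral>y. loglik_integrand Z s \<tau> (\<lambda>h. b h y - 1) \<partial>Q0) ^ m"
    by (rule two_sample_integral_prod[OF base loglik_integrand_integrable(1,2)])
  finally show ?thesis .
qed

text \<open>The chain rule through the base product applies on \<open>regular s\<close>; on
  \<open>good\<close> all densities are positive as well, so the exponential undoes the
  logarithm.\<close>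

lemma density_quotient_good:
  "AE z in E s. z \<in> good \<longrightarrow> (\<forall>h\<in>Z. density_quotient (E h) (E s) z = ennreal (exp (loglik z h)))"
proof -
  have "AE z in E s. \<forall>h\<in>Z. z \<in> regular s \<longrightarrow> z \<in> regular h \<and> lik s z > 0 \<and> density_quotient (E h) (E s) z = ennreal (lik h z / lik s z)"
    using Z by (intro AE_finite_allI density_quotient_chain[where R = R] prob_E two_sample_prob base density_E) auto
  then show ?thesis
    by eventually_elim (auto simp: good_def loglik_def pos_def)
qed

text \<open>The true quotients and the exponentials of \<open>loglik\<close> agree almost surely on
  \<open>good\<close>; elsewhere, where quotients may be infinite, the test function changes by at
  most 2 C.\<close>

lemma likelihood_law_integral:
  assumes f: "continuous_map (product_topology (\<lambda>_. euclidean) Z) euclideanreal f"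
    and C: "\<And>x. x \<in> extensional Z \<Longrightarrow> \<bar>f x\<bar> \<le> C"
  shows "\<bar>(\<integral>x. f x \<partial>likelihood_law E Z s) - (\<integral>z. f (\<lambda>h\<in>Z. ennreal (exp (loglik z h))) \<partial>E s)\<bar>
    \<le> 2 * C * (1 - measure (E s) good)"
proof -
  interpret Es: prob_space "E s" by (rule prob_E) simp
  have fm[measurable]: "f \<in> borel_measurable (\<Pi>\<^sub>M h\<in>Z. borel)" by (rule borel_measurable_PiM_continuous_map[OF Z f])
  have sE: "sets (E h) = sets (E s)" if "h \<in> Z" for h using sets_E[of h] sets_E[of s] that by simp
  have dq: "(\<lambda>z. density_quotient (E h) (E s) z) \<in> borel_measurable (E s)" if "h \<in> Z" for h
    using density_quotient[OF prob_E prob_E sE[OF that]] that by (simp add: is_density_quotient_def)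
  have ll: "(\<lambda>z. loglik z h) \<in> borel_measurable (E s)" if "h \<in> Z" for h
    using loglik_measurable[of h] that unfolding measurable_cong_sets[OF sets_E[of s, simplified] refl] by simp
  have g[measurable]: "good \<in> sets (E s)" using good_sets sets_E[of s] by simp
  have mq[measurable]: "(\<lambda>z. \<lambda>h\<in>Z. density_quotient (E h) (E s) z) \<in> measurable (E s) (\<Pi>\<^sub>M h\<in>Z. borel)"
    by (intro measurable_restrict dq)
  have me[measurable]: "(\<lambda>z. \<lambda>h\<in>Z. ennreal (exp (loglik z h))) \<in> measurable (E s) (\<Pi>\<^sub>M h\<in>Z. borel)"
  proof (rule measurable_restrict)
    fix h assume "h \<in> Z"
    from ll[OF this] show "(\<lambda>z. ennreal (exp (loglik z h))) \<in> borel_measurable (E s)" by measurable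
  qed
  let ?f = "\<lambda>z. f (\<lambda>h\<in>Z. density_quotient (E h) (E s) z)" and ?g = "\<lambda>z. f (\<lambda>h\<in>Z. ennreal (exp (loglik z h)))"
  let ?f' = "\<lambda>z. if z \<in> good then ?g z else ?f z"
  have "(\<integral>x. f x \<partial>likelihood_law E Z s) = (\<integral>z. ?f z \<partial>E s)"
    unfolding likelihood_law_def by (rule integral_distr) measurable
  also have "\<dots> = (\<integral>z. ?f' z \<partial>E s)"
  proof (rule integral_cong_AE)
    show "AE z in E s. ?f z = ?f' z"
      using density_quotient_good by eventually_elim (auto intro!: arg_cong[where f = f] restrict_ext)
  qed measurable
  finally have "\<bar>(\<integral>x. f x \<partial>likelihood_law E Z s) - (\<integral>z. ?g z \<partial>E s)\<bar> = \<bar>(\<integral>z. ?f' z \<partial>E s) - (\<integral>z. ?g z \<partial>E s)\<bar>" by simp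
  also have "\<dots> \<le> 0 + (C + C) * measure (E s) (space (E s) - good)"
  proof (rule integral_diff_off_event[OF Es.prob_space_axioms])
    show "?f' \<in> borel_measurable (E s)" by measurable
    show "?g \<in> borel_measurable (E s)" by measurable
    show "\<bar>?f' z\<bar> \<le> C" "\<bar>?g z\<bar> \<le> C" for z using C by auto
  qed auto
  also have "\<dots> = 2 * C * (1 - measure (E s) good)"
    using Es.prob_compl[OF g] by simp
  finally show ?thesis .
qed

lemma norm_integral_iexp_diff:
  "norm ((\<integral>z. iexp (\<Sum>h\<in>Z. \<tau> h * loglik z h) \<partial>E s) - (\<integral>z. indicator good z *\<^sub>R iexp (\<Sum>h\<in>Z. \<tau> h * loglik z h) \<partial>E s))
    \<le> 1 - measure (E s) good"
proof -
  interpret Es: prob_space "E s" by (rule prob_E) simp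
  have g[measurable]: "good \<in> sets (E s)" using good_sets sets_E[of s] by simp
  have [measurable]: "(\<lambda>z. \<Sum>h\<in>Z. \<tau> h * loglik z h) \<in> borel_measurable (E s)"
    using loglik_measurable unfolding measurable_cong_sets[OF sets_E[of s, simplified] refl]
    by (intro borel_measurable_sum borel_measurable_times) auto
  let ?e = "\<lambda>z. iexp (\<Sum>h\<in>Z. \<tau> h * loglik z h)"
  have "?e \<in> borel_measurable (E s)" by measurable
  then have i: "integrable (E s) ?e"
    by (intro Es.integrable_const_bound[where B = 1]) (simp_all del: of_real_sum)
  have i': "integrable (E s) (\<lambda>z. indicator good z *\<^sub>R ?e z)" by (rule integrable_mult_indicator[OF g i])
  have "norm ((\<integral>z. ?e z \<partial>E s) - (\<integral>z. indicator good z *\<^sub>R ?e z \<partial>E s)) = norm (\<integral>z. ?e z - indicator good z *\<^sub>R ?e z \<partial>E s)"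
    using i i' by simp
  also have "\<dots> \<le> (\<integral>z. norm (?e z - indicator good z *\<^sub>R ?e z) \<partial>E s)" by (rule integral_norm_bound)
  also have "\<dots> = (\<integral>z. indicator (space (E s) - good) z \<partial>E s)"
    by (intro Bochner_Integration.integral_cong) (auto simp: indicator_def)
  also have "\<dots> = 1 - measure (E s) good"
    using Es.prob_compl[OF g] by simp
  finally show ?thesis .
qed

text \<open>The integral over \<open>good\<close> at \<tau> = 0 is its probability, so the
  convergence of that probability becomes an instance of the convergence of these integrals.\<close>

lemma measure_good: "complex_of_real (measure (E s) good) = (\<integral>z. indicator good z *\<^sub>R iexp (\<Sum>h\<in>Z. 0 * loglik z h) \<partial>E s)"
proof -
  interpret Es: prob_space "E s" by (rule prob_E) simp
  have g[measurable]: "good \<in> sets (E s)" using good_sets sets_E[of s] by simp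
  show ?thesis by (simp add: scaleR_conv_of_real)
qed

end

section \<open>Passage to the limit\<close>

text \<open>The integrals over \<open>good\<close> converge by the expansions and the limit of
  powers. At \<tau> = 0 this makes the complement of \<open>good\<close> negligible, so both the
  characteristic functions of \<open>loglik\<close> and the laws of the true likelihood ratios are
  governed by what happens on \<open>good\<close>.\<close>

lemma two_sample_likelihood_limit:
  fixes p :: "nat \<Rightarrow> 'h \<Rightarrow> 'a measure" and q :: "nat \<Rightarrow> 'h \<Rightarrow> 'b measure" and N :: "'v measure"
  assumes L: "\<And>n. two_sample_likelihood P0 Q0 (p n) (q n) (a n) (b n) (S n) (U n) Z s"
    and ta: "\<And>h. h \<in> insert s Z \<Longrightarrow> tangent_seq P0 (\<lambda>n x. a n h x - 1) (\<gamma> h)"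
    and ma: "\<And>h. h \<in> insert s Z \<Longrightarrow> (\<lambda>n. real n * ((\<integral>x. (1 + (a n h x - 1))\<^sup>2 \<partial>P0) - 1)) \<longlonglongrightarrow> 0"
    and tb: "\<And>h. h \<in> insert s Z \<Longrightarrow> tangent_seq Q0 (\<lambda>n y. b n h y - 1) (\<delta> h)"
    and mb: "\<And>h. h \<in> insert s Z \<Longrightarrow> (\<lambda>n. real n * ((\<integral>y. (1 + (b n h y - 1))\<^sup>2 \<partial>Q0) - 1)) \<longlonglongrightarrow> 0"
    and k: "\<forall>\<^sub>F n in sequentially. k n \<le> n" "(\<lambda>n. real (k n) / real n) \<longlonglongrightarrow> \<kappa>"
    and m: "\<forall>\<^sub>F n in sequentially. m n \<le> n" "(\<lambda>n. real (m n) / real n) \<longlonglongrightarrow> \<mu>"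
    and N: "prob_space N" and Y: "\<And>h. h \<in> Z \<Longrightarrow> (\<lambda>w. Y w h) \<in> borel_measurable N"
    and char: "\<And>\<tau>. (\<integral>w. iexp (\<Sum>h\<in>Z. \<tau> h * Y w h) \<partial>N) = exp (
        of_real \<kappa> * Complex (- (\<integral>x. (\<Sum>h\<in>Z. \<tau> h * (\<gamma> h x - \<gamma> s x))\<^sup>2 \<partial>P0) / 2)
           (- (\<Sum>h\<in>Z. \<tau> h * (\<integral>x. (\<gamma> h x - \<gamma> s x)\<^sup>2 \<partial>P0)) / 2)
      + of_real \<mu> * Complex (- (\<integral>x. (\<Sum>h\<in>Z. \<tau> h * (\<delta> h x - \<delta> s x))\<^sup>2 \<partial>Q0) / 2)
           (- (\<Sum>h\<in>Z. \<tau> h * (\<integral>x. (\<delta> h x - \<delta> s x)\<^sup>2 \<partial>Q0)) / 2))"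
    and f: "continuous_map (product_topology (\<lambda>_. euclidean) Z) euclideanreal f"
    and C: "\<And>x. x \<in> extensional Z \<Longrightarrow> \<bar>f x\<bar> \<le> C"
  shows "(\<lambda>n. \<integral>x. f x \<partial>likelihood_law (\<lambda>h. two_sample (p n h) (q n h) (k n) (m n)) Z s)
    \<longlonglongrightarrow> (\<integral>w. f (\<lambda>h\<in>Z. ennreal (exp (Y w h))) \<partial>N)"
proof -
  interpret L: two_sample_likelihood P0 Q0 "p n" "q n" "a n" "b n" "S n" "U n" "k n" "m n" Z s for n by (rule L)
  have good: "(\<lambda>n. \<integral>z. indicator (L.good n) z *\<^sub>R iexp (\<Sum>h\<in>Z. \<tau> h * L.loglik n z h) \<partial>L.E n s)
      \<longlonglongrightarrow> (\<integral>w. iexp (\<Sum>h\<in>Z. \<tau> h * Y w h) \<partial>N)" for \<tau>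
    unfolding L.integral_good_iexp char exp_add
    by (intro tendsto_mult tendsto_power_exp L.loglik_integrand_integrable k m
          loglik_integral_expansion L.base L.Z ta ma tb mb) (auto intro!: integral_nonneg)
  \<comment> \<open>Contiguity enters here: the limit at \<tau> = 0 is the total mass of
    \<open>N\<close>, which is 1, so asymptotically no mass sits on vanishing densities or singular
    parts.\<close>
  have "(\<lambda>n. complex_of_real (measure (L.E n s) (L.good n))) \<longlonglongrightarrow> complex_of_real 1"
    using good[of "\<lambda>_. 0"] prob_space.prob_space[OF N] unfolding L.measure_good by simp
  then have mg: "(\<lambda>n. measure (L.E n s) (L.good n)) \<longlonglongrightarrow> 1" by (simp only: tendsto_of_real_iff)
  have rest: "(\<lambda>n. 1 - measure (L.E n s) (L.good n)) \<longlonglongrightarrow> 0"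
    using tendsto_diff[OF tendsto_const mg, of 1] by simp
  have chi: "(\<lambda>n. \<integral>z. iexp (\<Sum>h\<in>Z. \<tau> h * L.loglik n z h) \<partial>L.E n s) \<longlonglongrightarrow> (\<integral>w. iexp (\<Sum>h\<in>Z. \<tau> h * Y w h) \<partial>N)" for \<tau>
  proof -
    have "(\<lambda>n. (\<integral>z. iexp (\<Sum>h\<in>Z. \<tau> h * L.loglik n z h) \<partial>L.E n s)
        - (\<integral>z. indicator (L.good n) z *\<^sub>R iexp (\<Sum>h\<in>Z. \<tau> h * L.loglik n z h) \<partial>L.E n s)) \<longlonglongrightarrow> 0"
      by (rule Lim_null_comparison[OF always_eventually[OF allI[OF L.norm_integral_iexp_diff]] rest])
    from tendsto_add[OF this good[of \<tau>]] show ?thesis by simp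
  qed
  \<comment> \<open>The exponential maps the reals continuously into \<open>ennreal\<close>, so a
    continuous function of the ratios is a continuous function of real logarithms, to which the Levy
    theorem applies.\<close>
  let ?F = "\<lambda>x :: 'h \<Rightarrow> real. f (\<lambda>h\<in>Z. ennreal (exp (x h)))"
  have "continuous_map (product_topology (\<lambda>_. euclideanreal) Z) (product_topology (\<lambda>_. euclidean) Z)
      (\<lambda>x. \<lambda>h\<in>Z. ennreal (exp (x h)))"
    unfolding continuous_map_componentwise
  proof (intro conjI ballI)
    show "(\<lambda>x. \<lambda>h\<in>Z. ennreal (exp (x h))) ` topspace (product_topology (\<lambda>_. euclideanreal) Z) \<subseteq> extensional Z" by auto
    fix h assume h: "h \<in> Z"
    have "continuous_map euclideanreal euclidean (\<lambda>y. ennreal (exp y))"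
      by (auto intro!: continuous_on_ennreal continuous_intros)
    from continuous_map_compose[OF continuous_map_product_projection[OF h] this]
    show "continuous_map (product_topology (\<lambda>_. euclideanreal) Z) euclidean (\<lambda>x. (\<lambda>h\<in>Z. ennreal (exp (x h))) h)"
      using h by (simp add: comp_def)
  qed
  from continuous_map_compose[OF this f]
  have F: "continuous_map (product_topology (\<lambda>_. euclideanreal) Z) euclideanreal ?F" by (simp add: comp_def)
  have ll: "(\<lambda>z. L.loglik n z h) \<in> borel_measurable (L.E n s)" if "h \<in> Z" for n h
    using L.loglik_measurable[of h n] that unfolding measurable_cong_sets[OF L.sets_E[of s n, simplified] refl] by simp
  have res: "?F (restrict y Z) = ?F y" for y by (rule arg_cong[where f = f]) auto
  have lim: "(\<lambda>n. \<integral>z. ?F (L.loglik n z) \<partial>L.E n s) \<longlonglongrightarrow> (\<integral>w. ?F (Y w) \<partial>N)"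
    using multivariate_levy_continuity[OF L.Z L.prob_E[of s, simplified] N ll Y chi F, of C, unfolded res] C by simp
  have "(\<lambda>n. (\<integral>x. f x \<partial>likelihood_law (L.E n) Z s) - (\<integral>z. ?F (L.loglik n z) \<partial>L.E n s)) \<longlonglongrightarrow> 0"
  proof (rule Lim_null_comparison)
    show "(\<lambda>n. 2 * C * (1 - measure (L.E n s) (L.good n))) \<longlonglongrightarrow> 0" by (rule tendsto_mult_right_zero[OF rest])
    show "\<forall>\<^sub>F n in sequentially. norm ((\<integral>x. f x \<partial>likelihood_law (L.E n) Z s) - (\<integral>z. ?F (L.loglik n z) \<partial>L.E n s))
        \<le> 2 * C * (1 - measure (L.E n s) (L.good n))"
      using L.likelihood_law_integral[OF f C] by simp
  qed
  from tendsto_add[OF this lim] show ?thesis by simp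
qed

text \<open>Expands forms in the differences into Gram matrix entries, the shape in which the
  Gaussian shift states its characteristic function.\<close>

lemma L2_lincomb_diff:
  assumes \<gamma>: "\<forall>h\<in>insert s Z. \<gamma> h \<in> L2 M"
  defines "I \<equiv> \<lambda>h k. \<integral>x. \<gamma> h x * \<gamma> k x \<partial>M"
  shows "(\<integral>x. (\<Sum>h\<in>Z. \<tau> h * (\<gamma> h x - \<gamma> s x))\<^sup>2 \<partial>M) =
      (\<Sum>h\<in>Z. \<Sum>k\<in>Z. \<tau> h * \<tau> k * I h k) - 2 * (\<Sum>h\<in>Z. \<tau> h) * (\<Sum>h\<in>Z. \<tau> h * I h s) + (\<Sum>h\<in>Z. \<tau> h)\<^sup>2 * I s s"
    and "(\<Sum>h\<in>Z. \<tau> h * (\<integral>x. (\<gamma> h x - \<gamma> s x)\<^sup>2 \<partial>M)) =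
      (\<Sum>h\<in>Z. \<tau> h * I h h) - 2 * (\<Sum>h\<in>Z. \<tau> h * I h s) + (\<Sum>h\<in>Z. \<tau> h) * I s s"
proof -
  have i: "integrable M (\<lambda>x. \<gamma> h x * \<gamma> k x)" if "h \<in> insert s Z" "k \<in> insert s Z" for h k
    by (rule L2_mult_integrable[OF bspec[OF \<gamma> that(1)] bspec[OF \<gamma> that(2)]])
  have "(\<Sum>h\<in>Z. \<tau> h * (\<gamma> h x - \<gamma> s x))\<^sup>2 = (\<Sum>h\<in>Z. \<Sum>k\<in>Z. \<tau> h * \<tau> k * (\<gamma> h x * \<gamma> k x))
      - 2 * (\<Sum>h\<in>Z. \<tau> h) * (\<Sum>h\<in>Z. \<tau> h * (\<gamma> h x * \<gamma> s x)) + (\<Sum>h\<in>Z. \<tau> h)\<^sup>2 * (\<gamma> s x * \<gamma> s x)" for x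
  proof -
    have u: "(\<Sum>h\<in>Z. \<tau> h * (\<gamma> h x - \<gamma> s x)) = (\<Sum>h\<in>Z. \<tau> h * \<gamma> h x) - (\<Sum>h\<in>Z. \<tau> h) * \<gamma> s x"
      by (simp add: right_diff_distrib sum_subtractf sum_distrib_right)
    have uu: "(\<Sum>h\<in>Z. \<tau> h * \<gamma> h x) * (\<Sum>h\<in>Z. \<tau> h * \<gamma> h x) = (\<Sum>h\<in>Z. \<Sum>k\<in>Z. \<tau> h * \<tau> k * (\<gamma> h x * \<gamma> k x))"
      by (simp add: sum_product mult_ac)
    have us: "(\<Sum>h\<in>Z. \<tau> h * (\<gamma> h x * \<gamma> s x)) = (\<Sum>h\<in>Z. \<tau> h * \<gamma> h x) * \<gamma> s x"
      by (simp add: sum_distrib_right mult.assoc)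
    have "(y - \<sigma> * c)\<^sup>2 = y * y - 2 * \<sigma> * (y * c) + \<sigma>\<^sup>2 * (c * c)" for y \<sigma> c :: real
      by (simp add: power2_eq_square algebra_simps)
    then show ?thesis unfolding u us uu[symmetric] .
  qed
  then show "(\<integral>x. (\<Sum>h\<in>Z. \<tau> h * (\<gamma> h x - \<gamma> s x))\<^sup>2 \<partial>M) =
      (\<Sum>h\<in>Z. \<Sum>k\<in>Z. \<tau> h * \<tau> k * I h k) - 2 * (\<Sum>h\<in>Z. \<tau> h) * (\<Sum>h\<in>Z. \<tau> h * I h s) + (\<Sum>h\<in>Z. \<tau> h)\<^sup>2 * I s s"
    using i by (simp add: I_def)
  have "(\<integral>x. (\<gamma> h x - \<gamma> s x)\<^sup>2 \<partial>M) = I h h - 2 * I h s + I s s" if "h \<in> Z" for h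
  proof -
    have "(\<gamma> h x - \<gamma> s x)\<^sup>2 = \<gamma> h x * \<gamma> h x - 2 * (\<gamma> h x * \<gamma> s x) + \<gamma> s x * \<gamma> s x" for x
      by (simp add: power2_eq_square algebra_simps)
    then show ?thesis using i that by (simp add: I_def)
  qed
  then have "(\<Sum>h\<in>Z. \<tau> h * (\<integral>x. (\<gamma> h x - \<gamma> s x)\<^sup>2 \<partial>M)) = (\<Sum>h\<in>Z. \<tau> h * (I h h - 2 * I h s + I s s))"
    by (intro sum.cong) auto
  also have "\<dots> = (\<Sum>h\<in>Z. \<tau> h * I h h) - 2 * (\<Sum>h\<in>Z. \<tau> h * I h s) + (\<Sum>h\<in>Z. \<tau> h) * I s s"
    by (simp add: algebra_simps sum.distrib sum_subtractf sum_distrib_left sum_distrib_right)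
  finally show "(\<Sum>h\<in>Z. \<tau> h * (\<integral>x. (\<gamma> h x - \<gamma> s x)\<^sup>2 \<partial>M)) =
      (\<Sum>h\<in>Z. \<tau> h * I h h) - 2 * (\<Sum>h\<in>Z. \<tau> h * I h s) + (\<Sum>h\<in>Z. \<tau> h) * I s s" .
qed

context product_tangents
begin

text \<open>The Gaussian shift depends only on the Hilbert space, so one choice serves all
  \<open>Z\<close> and \<open>s\<close>. It remains to match two characteristic functions: the
  weights 1 - d and d arise for the samples as limits of n1/n and n2/n, and for the Gaussian shift
  from the scalar product.\<close>

theorem weak_convergence:
  fixes Pc :: "('a \<times> 'b \<Rightarrow> real) set \<Rightarrow> real \<Rightarrow> 'a measure"
    and Qc :: "('a \<times> 'b \<Rightarrow> real) set \<Rightarrow> real \<Rightarrow> 'b measure"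
    and n1 n2 :: "nat \<Rightarrow> nat"
  defines "E \<equiv> \<lambda>n G. two_sample (Pc G (1 / sqrt (real n))) (Qc G (1 / sqrt (real n))) (n1 n) (n2 n)"
  assumes n: "\<And>n. n \<ge> 1 \<Longrightarrow> n1 n + n2 n = n" and n2: "(\<lambda>n. real (n2 n) / real n) \<longlonglongrightarrow> d"
    and curves: "\<And>G t. G \<in> hcarrier H \<Longrightarrow> Pc G t \<in> space (prob_algebra M1) \<and> Qc G t \<in> space (prob_algebra M2)"
    and start: "\<And>G. G \<in> hcarrier H \<Longrightarrow> Pc G 0 \<Otimes>\<^sub>M Qc G 0 = R0"
    and diff: "\<And>G g. G \<in> hcarrier H \<Longrightarrow> g \<in> G \<Longrightarrow> L2_differentiable (\<lambda>t. Pc G t \<Otimes>\<^sub>M Qc G t) g"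
  obtains W :: "(('a \<times> 'b \<Rightarrow> real) set \<Rightarrow> real) measure" and P
  where "gaussian_shift H W P" "experiments_converge_weakly (hcarrier H) E P"
proof -
  let ?C = "hcarrier H"
  \<comment> \<open>Each class is represented by one tangent; its curve is differentiable with every
    member of the class as tangent, so the choice is immaterial.\<close>
  have "\<forall>G\<in>?C. \<exists>g. g \<in> T \<and> cls g = G" unfolding H_carrier by blast
  from bchoice[OF this] obtain rep where rep: "\<And>G. G \<in> ?C \<Longrightarrow> rep G \<in> T" "\<And>G. G \<in> ?C \<Longrightarrow> cls (rep G) = G" by blast
  have repL: "rep G \<in> L2 R0" if "G \<in> ?C" for G using rep(1)[OF that] by (rule T_L2)
  have prob: "prob_space (Pc G t)" "prob_space (Qc G t)" "sets (Pc G t) = sets M1" "sets (Qc G t) = sets M2"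
    if "G \<in> ?C" for G t using curves[OF that, of t] by (auto simp: space_prob_algebra)
  have sets0: "sets P0 = sets M1" "sets Q0 = sets M2" using P0 Q0 by (auto simp: space_prob_algebra)
  \<comment> \<open>Only the product is given to start at the base measure; its marginals determine
    the factors.\<close>
  have start': "Pc G 0 = P0" "Qc G 0 = Q0" if G: "G \<in> ?C" for G
    using pair_measure_eq_imp_eq[OF prob(1)[OF G] prob_P0 prob(2)[OF G] prob_Q0 _ _ start[OF G]]
    by (simp_all add: prob[OF G] sets0)
  have curve: "prob_curve (Pc G)" "prob_curve (Qc G)" if "G \<in> ?C" for G
    using prob[OF that] by (auto simp: prob_curve_def)
  have root: "root_differentiable P0 (root_density (Pc G)) (E1 (rep G))" "root_differentiable Q0 (root_density (Qc G)) (E2 (rep G))"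
    if G: "G \<in> ?C" for G
  proof -
    have "rep G \<in> G" using cls_self[OF repL[OF G]] rep(2)[OF G] by simp
    note * = L2_differentiable_product(1,2)[OF curve[OF G] diff[OF G this]]
    show "root_differentiable P0 (root_density (Pc G)) (E1 (rep G))" "root_differentiable Q0 (root_density (Qc G)) (E2 (rep G))"
      using *[unfolded start'[OF G]] L2_differentiable_iff_root_differentiable[OF curve(1)[OF G]]
        L2_differentiable_iff_root_differentiable[OF curve(2)[OF G]] start'[OF G] by auto
  qed
  have density: "density_on (Pc G t) P0 (\<lambda>x. (root_density (Pc G) t x)\<^sup>2) {x \<in> space P0. density_quotient (Pc G t) P0 x < \<infinity>}"
    "density_on (Qc G t) Q0 (\<lambda>x. (root_density (Qc G) t x)\<^sup>2) {x \<in> space Q0. density_quotient (Qc G t) Q0 x < \<infinity>}"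
    if G: "G \<in> ?C" for G t
    using root_density_on[OF curve(1)[OF G], of t] root_density_on[OF curve(2)[OF G], of t] start'[OF G] by auto
  have n1: "(\<lambda>n. real (n1 n) / real n) \<longlonglongrightarrow> 1 - d"
  proof (rule Lim_transform_eventually[OF tendsto_diff[OF tendsto_const n2]])
    show "\<forall>\<^sub>F k in sequentially. 1 - real (n2 k) / real k = real (n1 k) / real k"
      using eventually_ge_at_top[of 1]
    proof eventually_elim
      case (elim k)
      then have "real (n1 k) + real (n2 k) = real k" using n[OF elim] by linarith
      then show ?case using elim by (simp add: field_simps)
    qed
  qed
  have le: "\<forall>\<^sub>F k in sequentially. n1 k \<le> k" "\<forall>\<^sub>F k in sequentially. n2 k \<le> k"
    using n by (auto intro!: eventually_sequentiallyI[of 1]) (metis le_add1 le_add2)+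
  interpret hilbert_space H by (rule hilbert_space_H)
  obtain W :: "(('a \<times> 'b \<Rightarrow> real) set \<Rightarrow> real) measure" and P where
    shift: "gaussian_shift H W P"
    and probP: "\<And>s. s \<in> ?C \<Longrightarrow> prob_space (P s)"
    and coord: "\<And>h s. h \<in> ?C \<Longrightarrow> s \<in> ?C \<Longrightarrow> (\<lambda>\<omega>. \<omega> h) \<in> borel_measurable (P s)"
    and dqP: "\<And>h s. h \<in> ?C \<Longrightarrow> s \<in> ?C \<Longrightarrow> AE \<omega> in P s. density_quotient (P h) (P s) \<omega> =
        ennreal (exp (\<omega> h - \<omega> s - (hinner H h h - hinner H s s) / 2))"
    and charP: "\<And>Z s \<tau>. finite Z \<Longrightarrow> Z \<subseteq> ?C \<Longrightarrow> s \<in> ?C \<Longrightarrow>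
        (\<integral>\<omega>. iexp (\<Sum>h\<in>Z. \<tau> h * (\<omega> h - \<omega> s - (hinner H h h - hinner H s s) / 2)) \<partial>P s) =
        exp (Complex
          (- ((\<Sum>h\<in>Z. \<Sum>k\<in>Z. \<tau> h * \<tau> k * hinner H h k) - 2 * (\<Sum>h\<in>Z. \<tau> h) * (\<Sum>h\<in>Z. \<tau> h * hinner H h s)
             + (\<Sum>h\<in>Z. \<tau> h)\<^sup>2 * hinner H s s) / 2)
          (- ((\<Sum>h\<in>Z. \<tau> h * hinner H h h) - 2 * (\<Sum>h\<in>Z. \<tau> h * hinner H h s) + (\<Sum>h\<in>Z. \<tau> h) * hinner H s s) / 2))"
    using gaussian_shift_exists by blast
  have K: "hinner H h k = (1 - d) * (\<integral>x. E1 (rep h) x * E1 (rep k) x \<partial>P0) + d * (\<integral>y. E2 (rep h) y * E2 (rep k) y \<partial>Q0)"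
    if "h \<in> ?C" "k \<in> ?C" for h k
    using H_inner[OF rep(1)[OF that(1)] rep(1)[OF that(2)]] rep(2)[OF that(1)] rep(2)[OF that(2)] by (simp add: ip_def)
  have "(\<lambda>n. \<integral>x. f x \<partial>likelihood_law (E n) Z s) \<longlonglongrightarrow> (\<integral>x. f x \<partial>likelihood_law P Z s)"
    if Z: "finite Z" "Z \<subseteq> ?C" "s \<in> ?C"
      and f: "continuous_map (product_topology (\<lambda>_. euclidean) Z) euclideanreal f"
      and bf: "bounded (f ` topspace (product_topology (\<lambda>_. euclidean) Z))" for Z s f
  proof -
    have ZC: "h \<in> ?C" if "h \<in> insert s Z" for h using that Z by auto
    define Y where "Y \<omega> h = \<omega> h - \<omega> s - (hinner H h h - hinner H s s) / 2" for \<omega> :: "('a \<times> 'b \<Rightarrow> real) set \<Rightarrow> real" and h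
    obtain C where C: "\<And>x. x \<in> extensional Z \<Longrightarrow> \<bar>f x\<bar> \<le> C"
      using bf by (auto simp: bounded_iff PiE_UNIV_domain extensional_def PiE_def)
    have Ym: "(\<lambda>\<omega>. Y \<omega> h) \<in> borel_measurable (P s)" if "h \<in> Z" for h
      unfolding Y_def using coord Z that by auto
    have "(\<lambda>n. \<integral>x. f x \<partial>likelihood_law (E n) Z s) \<longlonglongrightarrow> (\<integral>w. f (\<lambda>h\<in>Z. ennreal (exp (Y w h))) \<partial>P s)"
      unfolding E_def
    proof (rule two_sample_likelihood_limit[where \<gamma> = "\<lambda>h. E1 (rep h)" and \<delta> = "\<lambda>h. E2 (rep h)" and \<kappa> = "1 - d" and \<mu> = d
          and a = "\<lambda>n h. root_density (Pc h) (1 / sqrt (real n))" and b = "\<lambda>n h. root_density (Qc h) (1 / sqrt (real n))"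
          and S = "\<lambda>n h. {x \<in> space P0. density_quotient (Pc h (1 / sqrt (real n))) P0 x < \<infinity>}"
          and U = "\<lambda>n h. {x \<in> space Q0. density_quotient (Qc h (1 / sqrt (real n))) Q0 x < \<infinity>}", OF _ _ _ _ _ le(1) n1 le(2) n2 probP[OF Z(3)] Ym _ f C])
      show "two_sample_likelihood P0 Q0 (\<lambda>h. Pc h (1 / sqrt (real n))) (\<lambda>h. Qc h (1 / sqrt (real n)))
          (\<lambda>h. root_density (Pc h) (1 / sqrt (real n))) (\<lambda>h. root_density (Qc h) (1 / sqrt (real n)))
          (\<lambda>h. {x \<in> space P0. density_quotient (Pc h (1 / sqrt (real n))) P0 x < \<infinity>})
          (\<lambda>h. {x \<in> space Q0. density_quotient (Qc h (1 / sqrt (real n))) Q0 x < \<infinity>}) Z s" for n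
      proof (rule two_sample_likelihood.intro)
        fix h assume "h \<in> insert s Z"
        note h = ZC[OF this]
        show "root_density (Pc h) (1 / sqrt (real n)) \<in> borel_measurable P0" "root_density (Qc h) (1 / sqrt (real n)) \<in> borel_measurable Q0"
          using root[OF h] by (auto simp: root_differentiable_def intro!: L2_measurable)
        show "prob_space (Pc h (1 / sqrt (real n)))" "prob_space (Qc h (1 / sqrt (real n)))" by (rule prob[OF h])+
        show "density_on (Pc h (1 / sqrt (real n))) P0 (\<lambda>x. (root_density (Pc h) (1 / sqrt (real n)) x)\<^sup>2)
            {x \<in> space P0. density_quotient (Pc h (1 / sqrt (real n))) P0 x < \<infinity>}" by (rule density(1)[OF h])
        show "density_on (Qc h (1 / sqrt (real n))) Q0 (\<lambda>x. (root_density (Qc h) (1 / sqrt (real n)) x)\<^sup>2)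
            {x \<in> space Q0. density_quotient (Qc h (1 / sqrt (real n))) Q0 x < \<infinity>}" by (rule density(2)[OF h])
      qed (rule prob_P0 prob_Q0 Z(1) | simp add: root_density_def)+
      show "(\<integral>w. iexp (\<Sum>h\<in>Z. \<tau> h * Y w h) \<partial>P s) = exp (
          of_real (1 - d) * Complex (- (\<integral>x. (\<Sum>h\<in>Z. \<tau> h * (E1 (rep h) x - E1 (rep s) x))\<^sup>2 \<partial>P0) / 2)
             (- (\<Sum>h\<in>Z. \<tau> h * (\<integral>x. (E1 (rep h) x - E1 (rep s) x)\<^sup>2 \<partial>P0)) / 2)
        + of_real d * Complex (- (\<integral>x. (\<Sum>h\<in>Z. \<tau> h * (E2 (rep h) x - E2 (rep s) x))\<^sup>2 \<partial>Q0) / 2)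
             (- (\<Sum>h\<in>Z. \<tau> h * (\<integral>x. (E2 (rep h) x - E2 (rep s) x)\<^sup>2 \<partial>Q0)) / 2))" for \<tau>
      proof -
        let ?I1 = "\<lambda>h k. \<integral>x. E1 (rep h) x * E1 (rep k) x \<partial>P0" and ?I2 = "\<lambda>h k. \<integral>y. E2 (rep h) y * E2 (rep k) y \<partial>Q0"
        have L1: "\<forall>h\<in>insert s Z. E1 (rep h) \<in> L2 P0" and L2: "\<forall>h\<in>insert s Z. E2 (rep h) \<in> L2 Q0"
          using E1_L2 E2_L2 repL[OF ZC] by auto
        \<comment> \<open>With the weighted scalar product inserted, each Gram sum of the Gaussian
          side splits into a first-sample and a second-sample part.\<close>
        have K1: "(\<Sum>h\<in>Z. \<Sum>k\<in>Z. \<tau> h * \<tau> k * hinner H h k) =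
            (1 - d) * (\<Sum>h\<in>Z. \<Sum>k\<in>Z. \<tau> h * \<tau> k * ?I1 h k) + d * (\<Sum>h\<in>Z. \<Sum>k\<in>Z. \<tau> h * \<tau> k * ?I2 h k)"
          unfolding sum_distrib_left sum.distrib[symmetric]
          by (intro sum.cong refl) (simp add: K ZC distrib_left mult_ac)
        have K2: "(\<Sum>h\<in>Z. \<tau> h * hinner H h s) = (1 - d) * (\<Sum>h\<in>Z. \<tau> h * ?I1 h s) + d * (\<Sum>h\<in>Z. \<tau> h * ?I2 h s)"
          unfolding sum_distrib_left sum.distrib[symmetric]
          by (intro sum.cong refl) (simp add: K ZC distrib_left mult_ac)
        have K3: "(\<Sum>h\<in>Z. \<tau> h * hinner H h h) = (1 - d) * (\<Sum>h\<in>Z. \<tau> h * ?I1 h h) + d * (\<Sum>h\<in>Z. \<tau> h * ?I2 h h)"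
          unfolding sum_distrib_left sum.distrib[symmetric]
          by (intro sum.cong refl) (simp add: K ZC distrib_left mult_ac)
        have C1: "of_real r * Complex (- x / 2) (- y / 2) + of_real r' * Complex (- x' / 2) (- y' / 2)
            = Complex (- (r * x + r' * x') / 2) (- (r * y + r' * y') / 2)" for r r' x x' y y'
          by (simp add: complex_eq_iff field_simps)
        show ?thesis
          unfolding Y_def charP[OF Z] L2_lincomb_diff[where \<gamma> = "\<lambda>h. E1 (rep h)", OF L1] L2_lincomb_diff[where \<gamma> = "\<lambda>h. E2 (rep h)", OF L2]
          unfolding C1 K1 K2 K3 K[OF Z(3) Z(3)]
          by (intro arg_cong[where f = exp] arg_cong2[where f = Complex]) (simp_all add: algebra_simps)
      qed
    qed (use root_differentiable_tangent_seq[OF prob_P0 root(1)[OF ZC]] root_differentiable_tangent_seq[OF prob_Q0 root(2)[OF ZC]] in auto)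
    \<comment> \<open>Under the Gaussian laws the density quotients are almost surely finite
      exponentials, so the return to the likelihood law costs only a null set.\<close>
    also have "(\<integral>w. f (\<lambda>h\<in>Z. ennreal (exp (Y w h))) \<partial>P s) = (\<integral>x. f x \<partial>likelihood_law P Z s)"
    proof -
      have [measurable]: "f \<in> borel_measurable (\<Pi>\<^sub>M h\<in>Z. borel)" by (rule borel_measurable_PiM_continuous_map[OF Z(1) f])
      have setsP: "sets (P h) = sets (P s)" if "h \<in> Z" for h
        using shift ZC[of h] Z(3) that by (auto simp: gaussian_shift_def is_experiment_def space_prob_algebra)
      have dm: "density_quotient (P h) (P s) \<in> borel_measurable (P s)" if "h \<in> Z" for h
        using density_quotient[OF probP probP setsP[OF that]] ZC[of h] Z(3) that by (simp add: is_density_quotient_def)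
      have [measurable]: "(\<lambda>w. \<lambda>h\<in>Z. density_quotient (P h) (P s) w) \<in> measurable (P s) (\<Pi>\<^sub>M h\<in>Z. borel)"
        by (intro measurable_restrict dm)
      have [measurable]: "(\<lambda>w. \<lambda>h\<in>Z. ennreal (exp (Y w h))) \<in> measurable (P s) (\<Pi>\<^sub>M h\<in>Z. borel)"
      proof (rule measurable_restrict)
        fix h assume "h \<in> Z"
        from Ym[OF this] show "(\<lambda>w. ennreal (exp (Y w h))) \<in> borel_measurable (P s)" by measurable
      qed
      have "AE w in P s. \<forall>h\<in>Z. density_quotient (P h) (P s) w = ennreal (exp (Y w h))"
        unfolding Y_def using Z by (intro AE_finite_allI dqP) auto
      then have "AE w in P s. f (\<lambda>h\<in>Z. ennreal (exp (Y w h))) = f (\<lambda>h\<in>Z. density_quotient (P h) (P s) w)"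
        by eventually_elim (auto intro!: arg_cong[where f = f] restrict_ext)
      then have "(\<integral>w. f (\<lambda>h\<in>Z. ennreal (exp (Y w h))) \<partial>P s) = (\<integral>w. f (\<lambda>h\<in>Z. density_quotient (P h) (P s) w) \<partial>P s)"
        by (rule integral_cong_AE[rotated 2]) measurable
      also have "\<dots> = (\<integral>x. f x \<partial>likelihood_law P Z s)"
        unfolding likelihood_law_def by (rule integral_distr[symmetric]) measurable
      finally show ?thesis .
    qed
    finally show ?thesis .
  qed
  then have "experiments_converge_weakly ?C E P"
    by (simp add: experiments_converge_weakly_def weakly_convergent_to_def)
  with shift show ?thesis by (rule that)
qed

end

text \<open>Indexing the curves by classes fixes one curve for each point of the Hilbert space;
  whether it is differentiable with a given tangent does not depend on the version of the
  tangent.\<close>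

theorem mainTheorem11:
  fixes M1 :: "'a measure" and M2 :: "'b measure"
    and \<P> :: "'a measure set" and \<Q> :: "'b measure set"
    and P0 :: "'a measure" and Q0 :: "'b measure"
    and n1 n2 :: "nat \<Rightarrow> nat" and d :: real
    and Pc :: "('a \<times> 'b \<Rightarrow> real) set \<Rightarrow> real \<Rightarrow> 'a measure"
    and Qc :: "('a \<times> 'b \<Rightarrow> real) set \<Rightarrow> real \<Rightarrow> 'b measure"
  assumes "\<P> \<noteq> {}" and "\<P> \<subseteq> space (prob_algebra M1)"
    and "\<Q> \<noteq> {}" and "\<Q> \<subseteq> space (prob_algebra M2)"
    and "P0 \<in> space (prob_algebra M1)" and "Q0 \<in> space (prob_algebra M2)"
    and "P0 \<Otimes>\<^sub>M Q0 \<in> prod_family \<P> \<Q>"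
    and "\<And>n. n \<ge> 1 \<Longrightarrow> n1 n + n2 n = n"
    and "(\<lambda>n. real (n2 n) / real n) \<longlonglongrightarrow> d" and "0 < d" and "d < 1"
    and "\<And>G t. G \<in> hcarrier (weighted_tangent_space P0 Q0 \<P> \<Q> d) \<Longrightarrow>
           Pc G t \<in> space (prob_algebra M1) \<and> Qc G t \<in> space (prob_algebra M2)"
    and "\<And>G. G \<in> hcarrier (weighted_tangent_space P0 Q0 \<P> \<Q> d) \<Longrightarrow>
           Pc G 0 \<Otimes>\<^sub>M Qc G 0 = P0 \<Otimes>\<^sub>M Q0"
    and "\<And>G g. \<lbrakk>G \<in> hcarrier (weighted_tangent_space P0 Q0 \<P> \<Q> d); g \<in> G\<rbrakk> \<Longrightarrow>
           L2_differentiable (\<lambda>t. Pc G t \<Otimes>\<^sub>M Qc G t) g"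
  shows "let H = weighted_tangent_space P0 Q0 \<P> \<Q> d;
             E = (\<lambda>n G. two_sample (Pc G (1 / sqrt (real n))) (Qc G (1 / sqrt (real n))) (n1 n) (n2 n))
         in (\<exists>(W :: (('a \<times> 'b \<Rightarrow> real) set \<Rightarrow> real) measure) P.
               gaussian_shift H W P \<and> experiments_converge_weakly (hcarrier H) E P) \<and>
            locally_asymptotically_normal H (\<lambda>n. two_sample M1 M2 (n1 n) (n2 n)) E"
proof -
  interpret product_tangents M1 M2 \<P> \<Q> P0 Q0 d
    by (rule product_tangents.intro) (fact assms)+
  let ?H = "weighted_tangent_space P0 Q0 \<P> \<Q> d"
    and ?E = "\<lambda>n G. two_sample (Pc G (1 / sqrt (real n))) (Qc G (1 / sqrt (real n))) (n1 n) (n2 n)"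
  obtain W :: "(('a \<times> 'b \<Rightarrow> real) set \<Rightarrow> real) measure" and P
    where WP: "gaussian_shift ?H W P" "experiments_converge_weakly (hcarrier ?H) ?E P"
    by (rule weak_convergence[where Pc = Pc and Qc = Qc, OF assms(8,9,12,13,14)])
  have "is_experiment (two_sample M1 M2 (n1 n) (n2 n)) (hcarrier ?H) (?E n)" for n
    using assms(12) by (auto simp: is_experiment_def intro: two_sample_prob_algebra)
  with WP hilbert_space_H show ?thesis
    unfolding Let_def locally_asymptotically_normal_def by blast
qed

end
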